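(* Let $T$ be a nice t-minimal theory (e.g. visceral), $\mathbb{M}$ a monster model, and $K$ an infinite definable field. Let $\tau$ be the canonical topology on the additive group $(K,+)$. Then $\tau$ is st-henselian and $K$ is large.
   Context: A complete one-sorted theory $T$ is t-minimal if there is a Hausdorff topology on models $M$ of $T$ (on $M^1$) with a basis given by a definable family, such that every definable $D\subseteq M$ has non-empty interior iff $D$ is infinite. "Definable" means definable with parameters; $\mathbb{M}^n$ has the product topology. $\dim(X)$ for definable $X\subseteq\mathbb{M}^n$ is $-\infty$ if $X=\emptyset$ and otherwise the largest $k$ such that some coordinate projection of $X$ to $\mathbb{M}^k$ has non-empty interior. A $k$-correspondence $f:X\rightrightarrows Y$ assigns a $k$-element subset of $Y$ to each $x\in X$; it is continuous if locally $f(x)=\{g_1(x),\dots,g_k(x)\}$ with continuous $g_i$. $T$ is nice if every definable $k$-correspondence $f:U\rightrightarrows\mathbb{M}^m$ on a definable open $U\subseteq\mathbb{M}^n$ is continuous on a definable open $U_0\subseteq U$ with $\dim(U\setminus U_0)<n$. A cell is $\sigma(\Gamma(f))$ for $f:U\rightrightarrows\mathbb{M}^{n-i}$ a continuous definable correspondence on a definable open $U\subseteq\mathbb{M}^i$ and $\sigma$ a coordinate permutation. A definable manifold is a definable set with a topology having a definable basis, covered by finitely many definable open subsets each definably homeomorphic to an open subset of a cell. The canonical topology on a definable group $G$ is the unique definable topology making $G$ a definable manifold and a topological group. $K[X]^d_1$ denotes the monic degree-$d$ polynomials over $K$, topologized via coefficients as $K^d$. A field topology $\tau$ is st-henselian if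 whenever $Q\in K[X]^d_1$ is separable with a root $a\in K$, for every neighborhood $U$ of $a$ there is a neighborhood $V$ of $Q$ in $K[X]^d_1$ such that every $P\in V$ has a root in $U$. $K$ is large if for every $P(x,y)\in K[x,y]$ and $(a,b)\in K^2$ with $P(a,b)=0\ne\frac{\partial P}{\partial y}(a,b)$, the zero set of $P$ in $K^2$ is infinite. *)

theory Defs
  imports
    "HOL-Analysis.Function_Topology"
    "HOL-Analysis.T1_Spaces"
    "HOL-Algebra.UnivPoly"
    "HOL-Algebra.Divisibility"
    "HOL-Combinatorics.Permutations"
    "HOL-Library.Extended_Real"
begin

unbundle cardinal_syntax

section \<open>First-order logic (one-sorted)\<close>

text \<open>The symbols are the members of the two sets, so that a language may have no function
  symbols although HOL types are non-empty.\<close>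

record ('f, 'r) fo_lang =
  Funs :: "'f set"
  Rels :: "'r set"
  fun_arity :: "'f \<Rightarrow> nat"
  rel_arity :: "'r \<Rightarrow> nat"

datatype 'f fo_term = Var nat | Fn 'f "'f fo_term list"

datatype ('f, 'r) fo_form =
    Eq "'f fo_term" "'f fo_term"
  | Rel 'r "'f fo_term list"
  | Neg "('f, 'r) fo_form"
  | And "('f, 'r) fo_form" "('f, 'r) fo_form"
  | Ex nat "('f, 'r) fo_form"

primrec wf_term :: "('f, 'r) fo_lang \<Rightarrow> 'f fo_term \<Rightarrow> bool" where
  "wf_term L (Var i) \<longleftrightarrow> True"
| "wf_term L (Fn f ts) \<longleftrightarrow> f \<in> Funs L \<and> length ts = fun_arity L f \<and> list_all (wf_term L) ts"

primrec wf_form :: "('f, 'r) fo_lang \<Rightarrow> ('f, 'r) fo_form \<Rightarrow> bool" where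
  "wf_form L (Eq s t) \<longleftrightarrow> wf_term L s \<and> wf_term L t"
| "wf_form L (Rel r ts) \<longleftrightarrow> r \<in> Rels L \<and> length ts = rel_arity L r \<and> list_all (wf_term L) ts"
| "wf_form L (Neg \<phi>) \<longleftrightarrow> wf_form L \<phi>"
| "wf_form L (And \<phi> \<psi>) \<longleftrightarrow> wf_form L \<phi> \<and> wf_form L \<psi>"
| "wf_form L (Ex i \<phi>) \<longleftrightarrow> wf_form L \<phi>"

primrec vars_term :: "'f fo_term \<Rightarrow> nat set" where
  "vars_term (Var i) = {i}"
| "vars_term (Fn f ts) = \<Union> (set (map vars_term ts))"

primrec free_vars :: "('f, 'r) fo_form \<Rightarrow> nat set" where
  "free_vars (Eq s t) = vars_term s \<union> vars_term t"
| "free_vars (Rel r ts) = \<Union> (vars_term ` set ts)"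
| "free_vars (Neg \<phi>) = free_vars \<phi>"
| "free_vars (And \<phi> \<psi>) = free_vars \<phi> \<union> free_vars \<psi>"
| "free_vars (Ex i \<phi>) = free_vars \<phi> - {i}"

definition fo_sentence :: "('f, 'r) fo_lang \<Rightarrow> ('f, 'r) fo_form \<Rightarrow> bool" where
  "fo_sentence L \<sigma> \<longleftrightarrow> wf_form L \<sigma> \<and> free_vars \<sigma> = {}"

record ('a, 'f, 'r) fo_struct =
  univ :: "'a set"
  fun_int :: "'f \<Rightarrow> 'a list \<Rightarrow> 'a"
  rel_int :: "'r \<Rightarrow> 'a list \<Rightarrow> bool"

definition is_struct :: "('f, 'r) fo_lang \<Rightarrow> ('a, 'f, 'r) fo_struct \<Rightarrow> bool" where
  "is_struct L M \<longleftrightarrow> univ M \<noteq> {} \<and>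
     (\<forall>f \<in> Funs L. \<forall>xs \<in> lists (univ M). length xs = fun_arity L f \<longrightarrow> fun_int M f xs \<in> univ M)"

primrec term_val :: "('a, 'f, 'r) fo_struct \<Rightarrow> (nat \<Rightarrow> 'a) \<Rightarrow> 'f fo_term \<Rightarrow> 'a" where
  "term_val M e (Var i) = e i"
| "term_val M e (Fn f ts) = fun_int M f (map (term_val M e) ts)"

primrec sat :: "('a, 'f, 'r) fo_struct \<Rightarrow> (nat \<Rightarrow> 'a) \<Rightarrow> ('f, 'r) fo_form \<Rightarrow> bool" where
  "sat M e (Eq s t) \<longleftrightarrow> term_val M e s = term_val M e t"
| "sat M e (Rel r ts) \<longleftrightarrow> rel_int M r (map (term_val M e) ts)"
| "sat M e (Neg \<phi>) \<longleftrightarrow> \<not> sat M e \<phi>"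
| "sat M e (And \<phi> \<psi>) \<longleftrightarrow> sat M e \<phi> \<and> sat M e \<psi>"
| "sat M e (Ex i \<phi>) \<longleftrightarrow> (\<exists>a \<in> univ M. sat M (e(i := a)) \<phi>)"

definition sat_sentence :: "('a, 'f, 'r) fo_struct \<Rightarrow> ('f, 'r) fo_form \<Rightarrow> bool" where
  "sat_sentence M \<sigma> \<longleftrightarrow> (\<forall>e. range e \<subseteq> univ M \<longrightarrow> sat M e \<sigma>)"

definition is_model ::
  "('f, 'r) fo_lang \<Rightarrow> ('f, 'r) fo_form set \<Rightarrow> ('a, 'f, 'r) fo_struct \<Rightarrow> bool" where
  "is_model L T M \<longleftrightarrow> is_struct L M \<and> (\<forall>\<sigma> \<in> T. sat_sentence M \<sigma>)"

text \<open>Here and in the definition of t-minimal theories, models range over the structures whose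
  universe is a subset of the type given as first argument. In the presence of an infinite
  model in that type that is larger than the language, Loewenheim--Skolem makes this notion of
  completeness agree with the one that refers to all models.\<close>

definition complete_theory ::
  "'a itself \<Rightarrow> ('f, 'r) fo_lang \<Rightarrow> ('f, 'r) fo_form set \<Rightarrow> bool" where
  "complete_theory _ L T \<longleftrightarrow>
     (\<forall>\<sigma> \<in> T. fo_sentence L \<sigma>) \<and>
     (\<exists>M :: ('a, 'f, 'r) fo_struct. is_model L T M) \<and>
     (\<forall>\<sigma>. fo_sentence L \<sigma> \<longrightarrow>
        (\<forall>M :: ('a, 'f, 'r) fo_struct. is_model L T M \<longrightarrow> sat_sentence M \<sigma>) \<or>
        (\<forall>M :: ('a, 'f, 'r) fo_struct. is_model L T M \<longrightarrow> sat_sentence M (Neg \<sigma>)))"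

section \<open>Monster models\<close>

text \<open>A set of formulas in the variable \<open>0\<close> with parameters is a set of pairs of a formula and an
  assignment supplying the parameters for the other free variables.\<close>

definition saturated ::
  "'k rel \<Rightarrow> ('f, 'r) fo_lang \<Rightarrow> ('a, 'f, 'r) fo_struct \<Rightarrow> bool" where
  "saturated \<kappa> L M \<longleftrightarrow>
     (\<forall>A p. A \<subseteq> univ M \<and> |A| <o \<kappa> \<and>
        (\<forall>(\<phi>, e) \<in> p. wf_form L \<phi> \<and> e ` (free_vars \<phi> - {0}) \<subseteq> A) \<and>
        (\<forall>q. q \<subseteq> p \<and> finite q \<longrightarrow> (\<exists>a \<in> univ M. \<forall>(\<phi>, e) \<in> q. sat M (e(0 := a)) \<phi>))
      \<longrightarrow> (\<exists>a \<in> univ M. \<forall>(\<phi>, e) \<in> p. sat M (e(0 := a)) \<phi>))"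

definition automorphism ::
  "('f, 'r) fo_lang \<Rightarrow> ('a, 'f, 'r) fo_struct \<Rightarrow> ('a \<Rightarrow> 'a) \<Rightarrow> bool" where
  "automorphism L M s \<longleftrightarrow>
     bij_betw s (univ M) (univ M) \<and>
     (\<forall>f \<in> Funs L. \<forall>xs \<in> lists (univ M). length xs = fun_arity L f \<longrightarrow>
        s (fun_int M f xs) = fun_int M f (map s xs)) \<and>
     (\<forall>r \<in> Rels L. \<forall>xs \<in> lists (univ M). length xs = rel_arity L r \<longrightarrow>
        rel_int M r xs = rel_int M r (map s xs))"

definition partial_elementary ::
  "('f, 'r) fo_lang \<Rightarrow> ('a, 'f, 'r) fo_struct \<Rightarrow> 'a set \<Rightarrow> ('a \<Rightarrow> 'a) \<Rightarrow> bool" where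
  "partial_elementary L M A g \<longleftrightarrow>
     A \<subseteq> univ M \<and> g ` A \<subseteq> univ M \<and>
     (\<forall>\<phi> e. wf_form L \<phi> \<and> e ` free_vars \<phi> \<subseteq> A \<longrightarrow> sat M e \<phi> = sat M (g \<circ> e) \<phi>)"

definition strongly_homogeneous ::
  "'k rel \<Rightarrow> ('f, 'r) fo_lang \<Rightarrow> ('a, 'f, 'r) fo_struct \<Rightarrow> bool" where
  "strongly_homogeneous \<kappa> L M \<longleftrightarrow>
     (\<forall>A g. |A| <o \<kappa> \<and> partial_elementary L M A g
        \<longrightarrow> (\<exists>s. automorphism L M s \<and> (\<forall>a \<in> A. s a = g a)))"

definition monster_model ::
  "'k rel \<Rightarrow> ('f, 'r) fo_lang \<Rightarrow> ('f, 'r) fo_form set \<Rightarrow> ('a, 'f, 'r) fo_struct \<Rightarrow> bool" where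
  "monster_model \<kappa> L T M \<longleftrightarrow>
     Card_order \<kappa> \<and> natLeq <o \<kappa> \<and> |Funs L| <o \<kappa> \<and> |Rels L| <o \<kappa> \<and>
     is_model L T M \<and> saturated \<kappa> L M \<and> strongly_homogeneous \<kappa> L M"

section \<open>Definable sets and families\<close>

definition tuples :: "('a, 'f, 'r) fo_struct \<Rightarrow> nat \<Rightarrow> (nat \<Rightarrow> 'a) set" where
  "tuples M n = {..<n} \<rightarrow>\<^sub>E univ M"

definition tcat :: "nat \<Rightarrow> (nat \<Rightarrow> 'a) \<Rightarrow> nat \<Rightarrow> (nat \<Rightarrow> 'a) \<Rightarrow> (nat \<Rightarrow> 'a)" where
  "tcat n x m y = (\<lambda>j \<in> {..<n + m}. if j < n then x j else y (j - n))"

text \<open>Definability with parameters: the assignment \<open>e\<close> supplies the parameters.\<close>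

definition definable ::
  "('f, 'r) fo_lang \<Rightarrow> ('a, 'f, 'r) fo_struct \<Rightarrow> nat \<Rightarrow> (nat \<Rightarrow> 'a) set \<Rightarrow> bool" where
  "definable L M n X \<longleftrightarrow>
     (\<exists>\<phi> e. wf_form L \<phi> \<and> range e \<subseteq> univ M \<and>
        X = {x \<in> tuples M n. sat M (\<lambda>j. if j < n then x j else e j) \<phi>})"

definition definable_family ::
  "('f, 'r) fo_lang \<Rightarrow> ('a, 'f, 'r) fo_struct \<Rightarrow> nat \<Rightarrow> (nat \<Rightarrow> 'a) set set \<Rightarrow> bool" where
  "definable_family L M n \<F> \<longleftrightarrow>
     (\<exists>m X Y. definable L M (n + m) X \<and> definable L M m Y \<and>
        \<F> = (\<lambda>y. {x \<in> tuples M n. tcat n x m y \<in> X}) ` Y)"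

definition has_definable_basis ::
  "('f, 'r) fo_lang \<Rightarrow> ('a, 'f, 'r) fo_struct \<Rightarrow> nat \<Rightarrow> (nat \<Rightarrow> 'a) topology \<Rightarrow> bool" where
  "has_definable_basis L M n \<rho> \<longleftrightarrow>
     (\<exists>\<F>. definable_family L M n \<F> \<and> openin \<rho> = arbitrary union_of (\<lambda>B. B \<in> \<F>))"

section \<open>t-minimality, dimension, correspondences\<close>

definition power_top :: "'a topology \<Rightarrow> nat \<Rightarrow> (nat \<Rightarrow> 'a) topology" where
  "power_top \<tau> n = product_topology (\<lambda>_. \<tau>) {..<n}"

definition t_minimal_topology ::
  "('f, 'r) fo_lang \<Rightarrow> ('a, 'f, 'r) fo_struct \<Rightarrow> 'a topology \<Rightarrow> bool" where
  "t_minimal_topology L M \<tau> \<longleftrightarrow>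
     topspace \<tau> = univ M \<and> Hausdorff_space \<tau> \<and>
     has_definable_basis L M 1 (power_top \<tau> 1) \<and>
     (\<forall>D. definable L M 1 D \<longrightarrow> (power_top \<tau> 1 interior_of D \<noteq> {} \<longleftrightarrow> infinite D))"

text \<open>T-minimal topologies are not unique: the Sorgenfrey topology on a real closed field is one as
  well. So dimension, niceness and manifolds below refer to a chosen one on the monster model.
  The defining formula and the parameters of the basis may depend on the model, which is the
  weakest reading.\<close>

definition t_minimal_theory ::
  "'a itself \<Rightarrow> ('f, 'r) fo_lang \<Rightarrow> ('f, 'r) fo_form set \<Rightarrow> bool" where
  "t_minimal_theory I L T \<longleftrightarrow>
     complete_theory I L T \<and>
     (\<forall>M :: ('a, 'f, 'r) fo_struct. is_model L T M \<longrightarrow> (\<exists>\<tau>. t_minimal_topology L M \<tau>))"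

definition tdim :: "'a topology \<Rightarrow> nat \<Rightarrow> (nat \<Rightarrow> 'a) set \<Rightarrow> ereal" where
  "tdim \<tau> n X =
     (if X = {} then - \<infinity>
      else ereal (real (Max {k. \<exists>\<iota>. strict_mono_on {..<k} \<iota> \<and> \<iota> ` {..<k} \<subseteq> {..<n} \<and>
        power_top \<tau> k interior_of ((\<lambda>x. \<lambda>j \<in> {..<k}. x (\<iota> j)) ` X) \<noteq> {}})))"

definition correspondence :: "nat \<Rightarrow> 'b set \<Rightarrow> 'c set \<Rightarrow> ('b \<Rightarrow> 'c set) \<Rightarrow> bool" where
  "correspondence k X Y f \<longleftrightarrow> (\<forall>x \<in> X. f x \<subseteq> Y \<and> finite (f x) \<and> card (f x) = k)"

definition continuous_correspondence ::
  "nat \<Rightarrow> 'b topology \<Rightarrow> 'c topology \<Rightarrow> ('b \<Rightarrow> 'c set) \<Rightarrow> bool" where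
  "continuous_correspondence k A B f \<longleftrightarrow>
     (\<forall>x \<in> topspace A. \<exists>W. openin A W \<and> x \<in> W \<and>
        (\<exists>g. (\<forall>i<k. continuous_map (subtopology A W) B (g i)) \<and>
             (\<forall>z \<in> W. f z = (\<lambda>i. g i z) ` {..<k})))"

definition corr_graph ::
  "nat \<Rightarrow> (nat \<Rightarrow> 'a) set \<Rightarrow> nat \<Rightarrow> ((nat \<Rightarrow> 'a) \<Rightarrow> (nat \<Rightarrow> 'a) set) \<Rightarrow> (nat \<Rightarrow> 'a) set" where
  "corr_graph n U m f = {tcat n x m y | x y. x \<in> U \<and> y \<in> f x}"

definition nice ::
  "('f, 'r) fo_lang \<Rightarrow> ('a, 'f, 'r) fo_struct \<Rightarrow> 'a topology \<Rightarrow> bool" where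
  "nice L M \<tau> \<longleftrightarrow>
     (\<forall>n m k U f.
        definable L M n U \<and> openin (power_top \<tau> n) U \<and>
        correspondence k U (tuples M m) f \<and> definable L M (n + m) (corr_graph n U m f)
      \<longrightarrow> (\<exists>U\<^sub>0 \<subseteq> U. definable L M n U\<^sub>0 \<and> openin (power_top \<tau> n) U\<^sub>0 \<and>
            continuous_correspondence k (subtopology (power_top \<tau> n) U\<^sub>0) (power_top \<tau> m) f \<and>
            tdim \<tau> n (U - U\<^sub>0) < ereal (real n)))"

section \<open>Cells, definable manifolds, canonical topologies\<close>

definition cell ::
  "('f, 'r) fo_lang \<Rightarrow> ('a, 'f, 'r) fo_struct \<Rightarrow> 'a topology \<Rightarrow> nat \<Rightarrow> (nat \<Rightarrow> 'a) set \<Rightarrow> bool" where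
  "cell L M \<tau> n C \<longleftrightarrow>
     (\<exists>i k U f \<sigma>. i \<le> n \<and>
        definable L M i U \<and> openin (power_top \<tau> i) U \<and>
        correspondence k U (tuples M (n - i)) f \<and>
        definable L M n (corr_graph i U (n - i) f) \<and>
        continuous_correspondence k (subtopology (power_top \<tau> i) U) (power_top \<tau> (n - i)) f \<and>
        \<sigma> permutes {..<n} \<and>
        C = (\<lambda>x. x \<circ> \<sigma>) ` corr_graph i U (n - i) f)"

definition definable_manifold ::
  "('f, 'r) fo_lang \<Rightarrow> ('a, 'f, 'r) fo_struct \<Rightarrow> 'a topology \<Rightarrow>
    nat \<Rightarrow> (nat \<Rightarrow> 'a) set \<Rightarrow> (nat \<Rightarrow> 'a) topology \<Rightarrow> bool" where
  "definable_manifold L M \<tau> n X \<rho> \<longleftrightarrow>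
     definable L M n X \<and> topspace \<rho> = X \<and> has_definable_basis L M n \<rho> \<and>
     (\<exists>\<U>. finite \<U> \<and> \<Union> \<U> = X \<and>
        (\<forall>W \<in> \<U>. definable L M n W \<and> openin \<rho> W \<and>
           (\<exists>m C V h. cell L M \<tau> m C \<and> openin (subtopology (power_top \<tau> m) C) V \<and>
              homeomorphic_map (subtopology \<rho> W) (subtopology (power_top \<tau> m) V) h \<and>
              definable L M (n + m) {tcat n x m (h x) | x. x \<in> W})))"

definition topological_group :: "('b, 'c) monoid_scheme \<Rightarrow> 'b topology \<Rightarrow> bool" where
  "topological_group G \<rho> \<longleftrightarrow>
     group G \<and> topspace \<rho> = carrier G \<and>
     continuous_map (prod_topology \<rho> \<rho>) \<rho> (\<lambda>(x, y). x \<otimes>\<^bsub>G\<^esub> y) \<and>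
     continuous_map \<rho> \<rho> (\<lambda>x. inv\<^bsub>G\<^esub> x)"

definition canonical_topology ::
  "('f, 'r) fo_lang \<Rightarrow> ('a, 'f, 'r) fo_struct \<Rightarrow> 'a topology \<Rightarrow>
    nat \<Rightarrow> (nat \<Rightarrow> 'a, 'c) monoid_scheme \<Rightarrow> (nat \<Rightarrow> 'a) topology" where
  "canonical_topology L M \<tau> n G =
     (THE \<rho>. definable_manifold L M \<tau> n (carrier G) \<rho> \<and> topological_group G \<rho>)"

section \<open>Fields\<close>

definition definable_op ::
  "('f, 'r) fo_lang \<Rightarrow> ('a, 'f, 'r) fo_struct \<Rightarrow> nat \<Rightarrow> (nat \<Rightarrow> 'a) set \<Rightarrow>
    ((nat \<Rightarrow> 'a) \<Rightarrow> (nat \<Rightarrow> 'a) \<Rightarrow> (nat \<Rightarrow> 'a)) \<Rightarrow> bool" where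
  "definable_op L M n X g \<longleftrightarrow>
     definable L M (n + (n + n)) {tcat n x (n + n) (tcat n y n (g x y)) | x y. x \<in> X \<and> y \<in> X}"

definition definable_field ::
  "('f, 'r) fo_lang \<Rightarrow> ('a, 'f, 'r) fo_struct \<Rightarrow> nat \<Rightarrow> (nat \<Rightarrow> 'a, 'c) ring_scheme \<Rightarrow> bool" where
  "definable_field L M n K \<longleftrightarrow>
     Ring.field K \<and> definable L M n (carrier K) \<and>
     definable_op L M n (carrier K) (\<lambda>x y. x \<oplus>\<^bsub>K\<^esub> y) \<and>
     definable_op L M n (carrier K) (\<lambda>x y. x \<otimes>\<^bsub>K\<^esub> y)"

definition field_topology :: "('b, 'c) ring_scheme \<Rightarrow> 'b topology \<Rightarrow> bool" where
  "field_topology K \<rho> \<longleftrightarrow>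
     topspace \<rho> = carrier K \<and>
     continuous_map (prod_topology \<rho> \<rho>) \<rho> (\<lambda>(x, y). x \<oplus>\<^bsub>K\<^esub> y) \<and>
     continuous_map \<rho> \<rho> (\<lambda>x. \<ominus>\<^bsub>K\<^esub> x) \<and>
     continuous_map (prod_topology \<rho> \<rho>) \<rho> (\<lambda>(x, y). x \<otimes>\<^bsub>K\<^esub> y) \<and>
     continuous_map (subtopology \<rho> (carrier K - {\<zero>\<^bsub>K\<^esub>})) \<rho> (\<lambda>x. inv\<^bsub>K\<^esub> x)"

definition poly_at :: "('b, 'c) ring_scheme \<Rightarrow> (nat \<Rightarrow> 'b) \<Rightarrow> 'b \<Rightarrow> 'b" where
  "poly_at K p a = eval K K id a p"

definition poly_deriv :: "('b, 'c) ring_scheme \<Rightarrow> (nat \<Rightarrow> 'b) \<Rightarrow> (nat \<Rightarrow> 'b)" where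
  "poly_deriv R p = (\<lambda>i. [Suc i] \<cdot>\<^bsub>R\<^esub> coeff (UP R) p (Suc i))"

text \<open>\<open>p\<close> and its derivative are coprime in \<open>K[X]\<close>.\<close>

definition separable_poly :: "('b, 'c) ring_scheme \<Rightarrow> (nat \<Rightarrow> 'b) \<Rightarrow> bool" where
  "separable_poly K p \<longleftrightarrow>
     (\<forall>q \<in> carrier (UP K). q divides\<^bsub>UP K\<^esub> p \<and> q divides\<^bsub>UP K\<^esub> poly_deriv K p
        \<longrightarrow> q \<in> Units (UP K))"

definition monic_polys :: "('b, 'c) ring_scheme \<Rightarrow> nat \<Rightarrow> (nat \<Rightarrow> 'b) set" where
  "monic_polys K d = {p \<in> carrier (UP K). deg K p = d \<and> coeff (UP K) p d = \<one>\<^bsub>K\<^esub>}"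

definition monic_topology ::
  "('b, 'c) ring_scheme \<Rightarrow> 'b topology \<Rightarrow> nat \<Rightarrow> (nat \<Rightarrow> 'b) topology" where
  "monic_topology K \<rho> d =
     pullback_topology (monic_polys K d) (\<lambda>p. \<lambda>i \<in> {..<d}. coeff (UP K) p i) (power_top \<rho> d)"

definition neighborhood :: "'b topology \<Rightarrow> 'b \<Rightarrow> 'b set \<Rightarrow> bool" where
  "neighborhood X a U \<longleftrightarrow> U \<subseteq> topspace X \<and> (\<exists>W. openin X W \<and> a \<in> W \<and> W \<subseteq> U)"

definition st_henselian :: "('b, 'c) ring_scheme \<Rightarrow> 'b topology \<Rightarrow> bool" where
  "st_henselian K \<rho> \<longleftrightarrow>
     field_topology K \<rho> \<and>
     (\<forall>d. \<forall>Q \<in> monic_polys K d. \<forall>a \<in> carrier K.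
        separable_poly K Q \<and> poly_at K Q a = \<zero>\<^bsub>K\<^esub> \<longrightarrow>
        (\<forall>U. neighborhood \<rho> a U \<longrightarrow>
           (\<exists>V. neighborhood (monic_topology K \<rho> d) Q V \<and>
              (\<forall>P \<in> V. \<exists>b \<in> U. poly_at K P b = \<zero>\<^bsub>K\<^esub>))))"

text \<open>\<open>K[x,y]\<close> is taken as \<open>K[x][y]\<close>, so the derivative with respect to \<open>y\<close> is the formal
  derivative over the coefficient ring \<open>K[x]\<close>.\<close>

definition poly2_at :: "('b, 'c) ring_scheme \<Rightarrow> (nat \<Rightarrow> nat \<Rightarrow> 'b) \<Rightarrow> 'b \<Rightarrow> 'b \<Rightarrow> 'b" where
  "poly2_at K P a b = eval (UP K) K (\<lambda>q. poly_at K q a) b P"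

definition large_field :: "('b, 'c) ring_scheme \<Rightarrow> bool" where
  "large_field K \<longleftrightarrow>
     (\<forall>P \<in> carrier (UP (UP K)). \<forall>a \<in> carrier K. \<forall>b \<in> carrier K.
        poly2_at K P a b = \<zero>\<^bsub>K\<^esub> \<and> poly2_at K (poly_deriv (UP K) P) a b \<noteq> \<zero>\<^bsub>K\<^esub> \<longrightarrow>
        infinite {(x, y). x \<in> carrier K \<and> y \<in> carrier K \<and> poly2_at K P x y = \<zero>\<^bsub>K\<^esub>})"

end

theory Submission
 imports Defs "HOL-Algebra.Algebraic_Closure_Type" "HOL-Library.Z2" "HOL-Computational_Algebra.Field_as_Ring"
  "Jordan_Normal_Form.Determinant" "Subresultants.Subresultant_Gcd"
begin

text \<open>
 The canonical topology of \<open>(K, +)\<close> is recovered from charts, that is, definable injections of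
 open subsets of \<open>M\<^sup>d\<close> into \<open>K\<close> with `d` maximal: near generic points all of them define the
 same germ of neighbourhoods of \<open>0\<close>. As there is no definable choice, dimension theory rests on
 the two-valued case of niceness and on saturation. Niceness makes definable functions generically
 continuous, which shows that the topology is a field topology, and a definable map
 \<open>K\<^sup>m \<rightarrow> K\<^sup>m\<close> with finite fibres is open at some point.

 Let \<open>Q = (X - a) R\<close> be separable of degree \<open>m\<close>. The monic polynomial of degree \<open>m\<close> that has the
 value \<open>k \<in> K[X]/(Q)\<close> as a root depends on \<open>k\<close> by a rational map \<open>K\<^sup>m \<rightarrow> K\<^sup>m\<close> with finite fibres.
 At a point \<open>k\<close> where it is open, all polynomials near its value have a root, and a perturbation of
 \<open>Q\<close> is carried into that neighbourhood by the same formula, which gives a root near \<open>a\<close>.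
 Largeness follows by intersecting the curve with the perturbations of a curve
 \<open>y = b + c (x - a) + l (x - a)\<^sup>M\<close> for which the polynomial in \<open>x\<close> so obtained is separable.
\<close>

text \<open>Niceness speaks of maps on open subsets of powers of \<open>M\<close> and only
  generically, while \<open>K\<close> is merely a definable subset of some \<open>M^n\<close>.
  Maximality of \<open>d\<close> is the bridge: the sum of two charts has \<open>2d\<close>
  coordinates but lands in a set that is finite-to-one over \<open>M^d\<close>, so near generic
  points it is determined by a \<open>d\<close>-valued map that is open in each summand separately.

  As \<open>canonical_topology\<close> is a definite description, two things have to be shown of the
  topology found in this way: it is a manifold topology, which forces cells to be exhibited and
  finitely many translates to cover \<open>K\<close>, and no other one is.

  Openness is obtained at one point \<open>k\<close>, not at a prescribed one. So \<open>k\<close>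
  is frozen there and the modulus moves: the polynomial of \<open>k\<close> modulo \<open>P\<close>
  is continuous in \<open>P\<close>, and the expression of \<open>X\<close> in powers of
  \<open>k\<close> carries its roots back to roots of \<open>P\<close>.

  For largeness, \<open>c\<close> makes the auxiliary curve transversal at \<open>(a, b)\<close>,
  and two consecutive exponents \<open>M\<close> are tried because in positive characteristic a
  single one may fail. Polynomial arithmetic is done over a type, so \<open>K\<close> is eventually
  exchanged for a type-class field.\<close>

no_notation var (\<open>X\<index>\<close>)

section \<open>Definable sets\<close>

lemma term_val_cong:
 "(!!i. i : vars_term t ==> e i = e' i) ==> term_val M e t = term_val M e' t"
proof (induction t)
 case (Fn f ts)
 hence "map (term_val M e) ts = map (term_val M e') ts" by auto
 thus ?case by (metis term_val.simps(2))
qed auto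

lemma sat_cong:
 "(!!i. i : free_vars \<phi> ==> e i = e' i) ==> sat M e \<phi> = sat M e' \<phi>"
proof (induction \<phi> arbitrary: e e')
 case (Eq s t)
 thus ?case using term_val_cong[of s e e' M] term_val_cong[of t e e' M] by auto
next
 case (Rel r ts)
 hence "map (term_val M e) ts = map (term_val M e') ts"
  by (auto intro!: term_val_cong)
 thus ?case by (metis sat.simps(2))
next
 case (Ex i \<phi>)
 have "sat M (e(i := a)) \<phi> = sat M (e'(i := a)) \<phi>" for a
  by (rule Ex.IH) (use Ex.prems in auto)
 thus ?case by simp
next
 case (Neg \<phi>) 
 thus ?case by (metis sat.simps(3) free_vars.simps(3))
next
 case (And \<phi> \<psi>)
 show ?case using And.IH(1)[of e e'] And.IH(2)[of e e'] And.prems by auto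
qed

lemma finite_vars_term: "finite (vars_term t)"
 by (induction t) auto

lemma finite_free_vars: "finite (free_vars \<phi>)"
 by (induction \<phi>) (auto simp: finite_vars_term)

primrec rename_term :: "(nat => nat) => 'f fo_term => 'f fo_term" where
 "rename_term s (Var i) = Var (s i)"
| "rename_term s (Fn f ts) = Fn f (map (rename_term s) ts)"

lemma wf_rename_term: "wf_term L t ==> wf_term L (rename_term s t)"
 by (induction t) (auto simp: list_all_iff)

lemma term_val_rename: "term_val M e (rename_term s t) = term_val M (%i. e (s i)) t"
 by (induction t) (auto intro!: arg_cong[where f = "fun_int M _"])

text \<open>A substitution may capture bound variables, so the \<open>Ex\<close> case moves the
  quantifier to a variable outside the image of the free ones. The new formula is therefore asserted
  to exist rather than computed as in \<open>rename_term\<close>.\<close>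

lemma form_subst:
 assumes "wf_form L \<phi>"
 shows "EX \<phi>'. wf_form L \<phi>' & (ALL e. sat M e \<phi>' = sat M (%i. e (s i)) \<phi>)"
 using assms
proof (induction \<phi> arbitrary: s)
 case (Eq t u)
 thus ?case
  by (intro exI[of _ "Eq (rename_term s t) (rename_term s u)"])
   (auto simp: term_val_rename wf_rename_term)
next
 case (Rel r ts)
 thus ?case
  by (intro exI[of _ "Rel r (map (rename_term s) ts)"])
   (auto simp: term_val_rename wf_rename_term list_all_iff intro!: arg_cong[where f = "rel_int M _"])
next
 case (Neg \<phi>)
 thus ?case by (metis sat.simps(3) wf_form.simps(3))
next
 case (And \<phi> \<psi>)
 thus ?case by (metis sat.simps(4) wf_form.simps(4))
next
 case (Ex i \<phi>)
 obtain k where k: "k \<notin> s ` free_vars \<phi>"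
  using finite_free_vars[of \<phi>] by (meson ex_new_if_finite finite_imageI infinite_UNIV_nat)
 obtain \<phi>' where \<phi>': "wf_form L \<phi>'" "!!e. sat M e \<phi>' = sat M (%j. e ((s(i := k)) j)) \<phi>"
  using Ex.IH[of "s(i := k)"] Ex.prems by auto
 have "sat M e (Ex k \<phi>') = sat M (%i. e (s i)) (Ex i \<phi>)" for e
 proof -
  have "sat M (e(k := a)) \<phi>' = sat M ((%i. e (s i))(i := a)) \<phi>" for a
   unfolding \<phi>' by (rule sat_cong) (use k in auto)
  thus ?thesis by simp
 qed
 thus ?case using \<phi>' by (intro exI[of _ "Ex k \<phi>'"]) auto
qed

definition tfst :: "nat => (nat => 'a) => (nat => 'a)" where
 "tfst n z = (\<lambda>j\<in>{..<n}. z j)"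

definition tsnd :: "nat => nat => (nat => 'a) => (nat => 'a)" where
 "tsnd n m z = (\<lambda>j\<in>{..<m}. z (n + j))"

lemma tcat_in [simp, intro]: "x : tuples M n ==> y : tuples M m ==> tcat n x m y : tuples M (n + m)"
 by (auto simp: tuples_def tcat_def PiE_iff)

lemma tfst_tcat [simp]: "x : tuples M n ==> tfst n (tcat n x m y) = x"
 by (auto simp: tuples_def tcat_def tfst_def PiE_iff extensional_def fun_eq_iff)

lemma tsnd_tcat [simp]: "y : tuples M m ==> tsnd n m (tcat n x m y) = y"
 by (auto simp: tuples_def tcat_def tsnd_def PiE_iff extensional_def fun_eq_iff)

lemma tfst_in [simp, intro]: "z : tuples M (n + m) ==> tfst n z : tuples M n"
 by (auto simp: tuples_def tfst_def PiE_iff)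

lemma tsnd_in [simp, intro]: "z : tuples M (n + m) ==> tsnd n m z : tuples M m"
 by (auto simp: tuples_def tsnd_def PiE_iff)

lemma tcat_tfst_tsnd [simp]: "z : tuples M (n + m) ==> tcat n (tfst n z) m (tsnd n m z) = z"
 by (auto simp: tuples_def tcat_def tfst_def tsnd_def PiE_iff extensional_def fun_eq_iff)

lemma tcat_eq_iff:
 "[|x : tuples M n; x' : tuples M n; y : tuples M m; y' : tuples M m|] ==>
  tcat n x m y = tcat n x' m y' \<longleftrightarrow> x = x' & y = y'"
 by (metis tfst_tcat tsnd_tcat)

lemma tuples_0 [simp]: "tuples M 0 = {%_. undefined}"
 by (auto simp: tuples_def)

lemma tuples_split:
 assumes "z : tuples M (n + m)"
 obtains x y where "x : tuples M n" "y : tuples M m" "z = tcat n x m y"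
 using assms by (metis tcat_tfst_tsnd tfst_in tsnd_in)

section \<open>Predicates definable with parameters, and a calculus for proving definability\<close>

locale fo_structure =
 fixes L :: "('f, 'r) fo_lang" and M :: "('a, 'f, 'r) fo_struct"
 assumes is_struct: "is_struct L M"
begin

abbreviation "UU \<equiv> univ M"
abbreviation "TT n \<equiv> tuples M n"
abbreviation "dfb \<equiv> definable L M"

lemma UU_ne: "UU ~= {}" using is_struct by (auto simp: is_struct_def)

text \<open>A variable is either read off the environment or interpreted by a parameter.\<close>

definition vval :: "(nat => nat + 'a) => (nat => 'a) => nat => 'a" where
 "vval v e = (%j. case v j of Inl i => e i | Inr a => a)"

definition vok :: "(nat => nat + 'a) => bool" where
 "vok v \<longleftrightarrow> (ALL j a. v j = Inr a --> a : UU)"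

text \<open>Predicates of whole assignments carry no arity, so that a quantifier becomes an update
  of \<open>e\<close>; the connection with sets of tuples is made in
  \<open>definable_iff_DP\<close>.\<close>

definition DP :: "((nat => 'a) => bool) => bool" where
 "DP P \<longleftrightarrow> (EX \<phi> v. wf_form L \<phi> & vok v & (ALL e. range e <= UU --> P e = sat M (vval v e) \<phi>))"

lemma DP_I: "wf_form L \<phi> ==> vok v ==> (!!e. range e <= UU ==> P e = sat M (vval v e) \<phi>) ==> DP P"
 unfolding DP_def by blast

lemma DP_E:
 assumes "DP P"
 obtains \<phi> v where "wf_form L \<phi>" "vok v" "!!e. range e <= UU ==> P e = sat M (vval v e) \<phi>"
proof -
 from assms obtain \<phi> v where "wf_form L \<phi>" "vok v"
  and "ALL e. range e <= UU --> P e = sat M (vval v e) \<phi>" unfolding DP_def by blast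
 thus thesis by (intro that[of \<phi> v]) blast+
qed

lemma DP_cong: "DP P ==> (!!e. range e <= UU ==> P e = Q e) ==> DP Q"
 unfolding DP_def by auto

lemma DP_not: "DP P ==> DP (%e. \<not> P e)"
 by (erule DP_E, rule_tac \<phi> = "Neg \<phi>" in DP_I) auto

lemma DP_eq: "DP (%e. e i = e k)"
 by (rule DP_I[of "Eq (Var i) (Var k)" Inl]) (auto simp: vval_def vok_def)

lemma DP_conj:
 assumes "DP P" "DP Q" shows "DP (%e. P e & Q e)"
proof -
 obtain \<phi> v where p: "wf_form L \<phi>" "vok v" "!!e. range e <= UU ==> P e = sat M (vval v e) \<phi>"
  using assms(1) by (rule DP_E) blast
 obtain \<psi> w where q: "wf_form L \<psi>" "vok w" "!!e. range e <= UU ==> Q e = sat M (vval w e) \<psi>"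
  using assms(2) by (rule DP_E) blast
 \<comment> \<open>Even variables go to the first formula and odd ones to the second, so that their
   parameters cannot clash.\<close>
 obtain \<phi>' where p': "wf_form L \<phi>'" "!!e. sat M e \<phi>' = sat M (%i. e (2 * i)) \<phi>"
  using form_subst[OF p(1), of M "%i. 2 * i"] by blast
 obtain \<psi>' where q': "wf_form L \<psi>'" "!!e. sat M e \<psi>' = sat M (%i. e (2 * i + 1)) \<psi>"
  using form_subst[OF q(1), of M "%i. 2 * i + 1"] by blast
 let ?u = "%j. if even j then v (j div 2) else w (j div 2)"
 show ?thesis
  by (rule DP_I[of "And \<phi>' \<psi>'" ?u])
   (use p q p' q' in \<open>auto simp: vok_def vval_def\<close>)
qed

lemma DP_const: "DP (%_. b)"
proof -
 have "DP (%e. e 0 = e 0)" by (rule DP_eq)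
 hence 1: "DP (%_. True)" by simp
 hence "DP (%_. \<not> True)" by (rule DP_not)
 with 1 show ?thesis by (cases b) auto
qed

lemma DP_disj: "DP P ==> DP Q ==> DP (%e. P e \<or> Q e)"
 using DP_not[OF DP_conj[OF DP_not DP_not], of P Q] by simp

lemma DP_ex:
 assumes "DP P" shows "DP (%e. EX a:UU. P (e(i := a)))"
proof -
 obtain \<phi> v where p: "wf_form L \<phi>" "vok v" "!!e. range e <= UU ==> P e = sat M (vval v e) \<phi>"
  using assms(1) by (rule DP_E) blast
 \<comment> \<open>Variable \<open>0\<close> is reserved for the quantified element: it replaces
   every variable that reads position \<open>i\<close>, and all others move up by one. The entry of
   \<open>?v\<close> at \<open>0\<close> is a dummy, since the quantifier overwrites it.\<close>
 let ?s = "%j. if v j = Inl i then 0 else Suc j"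
 obtain \<phi>' where p': "wf_form L \<phi>'" "!!e. sat M e \<phi>' = sat M (%j. e (?s j)) \<phi>"
  using form_subst[OF p(1), of M ?s] by blast
 let ?v = "%j. case j of 0 => Inl i | Suc k => v k"
 have *: "P (e(i := a)) = sat M ((vval ?v e)(0 := a)) \<phi>'" if "range e <= UU" "a : UU" for e a
 proof -
  have "P (e(i := a)) = sat M (vval v (e(i := a))) \<phi>" by (rule p(3)) (use that in auto)
  also have "\<dots> = sat M (%j. ((vval ?v e)(0 := a)) (?s j)) \<phi>"
   by (rule sat_cong) (auto simp: vval_def split: sum.splits)
  finally show ?thesis unfolding p' .
 qed
 show ?thesis
  by (rule DP_I[of "Ex 0 \<phi>'" ?v]) (use p p' * in \<open>auto simp: vok_def split: nat.splits\<close>)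
qed

lemma DP_sub:
 assumes "DP P" "vok w" shows "DP (%e. P (vval w e))"
proof -
 obtain \<phi> v where p: "wf_form L \<phi>" "vok v" "!!e. range e <= UU ==> P e = sat M (vval v e) \<phi>"
  using assms(1) by (rule DP_E) blast
 let ?v = "%j. case v j of Inl i => w i | Inr a => Inr a"
 have "vval v (vval w e) = vval ?v e" for e by (auto simp: vval_def fun_eq_iff split: sum.splits)
 moreover have "range (vval w e) <= UU" if "range e <= UU" for e
  using that assms(2) by (fastforce simp: vval_def vok_def split: sum.splits)
 ultimately show ?thesis
  by (intro DP_I[of \<phi> ?v]) (use p assms in \<open>auto simp: vok_def split: sum.splits\<close>)
qed

lemma definable_iff_DP: "dfb n X \<longleftrightarrow> X <= TT n & DP (%e. restrict e {..<n} : X)"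
proof
 assume "dfb n X"
 then obtain \<phi> c where c: "wf_form L \<phi>" "range c <= UU"
  "X = {x : TT n. sat M (%j. if j < n then x j else c j) \<phi>}"
  unfolding definable_def by blast
 have "(restrict e {..<n} : X) = sat M (vval (%j. if j < n then Inl j else Inr (c j)) e) \<phi>"
  if "range e <= UU" for e
 proof -
  have "vval (%j. if j < n then Inl j else Inr (c j)) e = (%j. if j < n then (restrict e {..<n}) j else c j)"
   by (auto simp: vval_def fun_eq_iff)
  thus ?thesis using that by (auto simp: c tuples_def)
 qed
 moreover have "vok (%j. if j < n then Inl j else Inr (c j))"
  using c(2) by (auto simp: vok_def)
 ultimately have "DP (%e. restrict e {..<n} : X)" using c(1) by (intro DP_I)
 moreover have "X <= TT n" unfolding c(3) by (rule Collect_subset)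
 ultimately show "X <= TT n & DP (%e. restrict e {..<n} : X)" by (rule conjI[rotated])
next
 assume X: "X <= TT n & DP (%e. restrict e {..<n} : X)"
 obtain \<phi> v where p: "wf_form L \<phi>" "vok v"
  "!!e. range e <= UU ==> (restrict e {..<n} : X) = sat M (vval v e) \<phi>"
  using conjunct2[OF X] by (rule DP_E) blast
 obtain u where u: "u : UU" using UU_ne by auto
 \<comment> \<open>\<open>definable\<close> takes its parameters from the variables beyond
   \<open>n\<close>, so each parameter moves to \<open>n + j\<close>. A variable that reads a
   position not below \<open>n\<close> moves there too and gets the arbitrary value
   \<open>u\<close>, because the predicate sees only \<open>restrict e {..<n}\<close>.\<close>
 let ?s = "%j. case v j of Inl i => (if i < n then i else n + j) | Inr a => n + j"
 obtain \<phi>' where p': "wf_form L \<phi>'" "!!e. sat M e \<phi>' = sat M (%j. e (?s j)) \<phi>"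
  using form_subst[OF p(1), of M ?s] by blast
 let ?c = "%j. case v (j - n) of Inl i => u | Inr a => a"
 have "(x : X) = sat M (%j. if j < n then x j else ?c j) \<phi>'" if x: "x : TT n" for x
 proof -
  let ?e = "%i. if i < n then x i else u"
  have "restrict ?e {..<n} = x" using x by (auto simp: tuples_def PiE_iff extensional_def fun_eq_iff)
  moreover have "range ?e <= UU" using x u by (auto simp: tuples_def)
  ultimately have "(x : X) = sat M (vval v ?e) \<phi>" using p(3)[of ?e] by simp
  also have "vval v ?e = (%j. (%j. if j < n then x j else ?c j) (?s j))"
   by (auto simp: vval_def fun_eq_iff split: sum.splits)
  finally show ?thesis unfolding p' .
 qed
 hence "X = {x : TT n. sat M (%j. if j < n then x j else ?c j) \<phi>'}"
  using conjunct1[OF X] by (intro Set.set_eqI) (simp add: subset_iff, blast)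
 moreover have "range ?c <= UU" using p(2) u by (auto simp: vok_def split: sum.splits)
 ultimately show "dfb n X" unfolding definable_def using p'(1) by (intro exI conjI)
qed

lemma definable_subset: "dfb n X ==> X <= TT n" by (simp add: definable_iff_DP)

lemma restrict_tuple [simp]: "x : TT n ==> restrict x {..<n} = x"
 by (simp add: tuples_def PiE_restrict)

lemma definable_Collect:
 assumes "DP P" "!!e. range e <= UU ==> P e = R (restrict e {..<n})"
 shows "dfb n {x : TT n. R x}"
 unfolding definable_iff_DP
 by (auto intro!: DP_cong[OF assms(1)] simp: assms(2)) (auto simp: tuples_def)

lemma definable_tuples [simp, intro]: "dfb n (TT n)"
 using definable_Collect[OF DP_const[of True], of "%_. True"] by simp

lemma definable_empty [simp, intro]: "dfb n {}"
 using definable_Collect[OF DP_const[of False], of "%_. False"] by simp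

lemma definable_Int: "dfb n X ==> dfb n Y ==> dfb n (X \<inter> Y)"
 unfolding definable_iff_DP using DP_conj by (auto simp: Int_iff)

lemma definable_Diff: "dfb n X ==> dfb n Y ==> dfb n (X - Y)"
 unfolding definable_iff_DP using DP_conj[OF _ DP_not] by (auto simp: Diff_iff)

lemma definable_Un: "dfb n X ==> dfb n Y ==> dfb n (X \<union> Y)"
 unfolding definable_iff_DP using DP_disj by (auto simp: Un_iff)

lemma definable_UN: "finite I ==> (!!i. i : I ==> dfb n (X i)) ==> dfb n (\<Union>i\<in>I. X i)"
 by (induction I rule: finite_induct) (auto intro: definable_Un)

text \<open>Substituting coordinates and parameters.\<close>

definition tsub :: "nat => (nat => nat + 'a) => (nat => 'a) => nat => 'a" where
 "tsub n s z = (\<lambda>j\<in>{..<n}. vval s z j)"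

definition sok :: "nat => nat => (nat => nat + 'a) => bool" where
 "sok N n s \<longleftrightarrow> (ALL j<n. case s j of Inl i => i < N | Inr a => a : UU)"

lemma tsub_in: "sok N n s ==> z : TT N ==> tsub n s z : TT n"
 unfolding sok_def by (auto simp: tsub_def tuples_def vval_def PiE_iff split: sum.splits)

lemma definable_tsub:
 assumes "dfb n S" "sok N n s"
 shows "dfb N {z : TT N. tsub n s z : S}"
proof -
 let ?w = "%j. if j < n then s j else Inl 0"
 have w: "vok ?w" using assms(2) unfolding vok_def sok_def by (auto split: if_splits)
 have "DP (%e. restrict (vval ?w e) {..<n} : S)"
  using DP_sub[OF _ w] assms(1) unfolding definable_iff_DP by blast
 moreover have "restrict (vval ?w e) {..<n} = tsub n s (restrict e {..<N})" for e
  using assms(2) by (auto simp: tsub_def sok_def vval_def fun_eq_iff split: sum.splits)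
 ultimately show ?thesis by (intro definable_Collect) auto
qed

lemma DP_ex_block:
 assumes "DP P"
 shows "DP (%e. EX y:TT m. P (%j. if N \<le> j & j < N + m then y (j - N) else e j))"
proof (induction m)
 case 0
 have eq: "(%j. if N \<le> j & j < N + 0 then y (j - N) else e j) = e" for y e by (auto simp: fun_eq_iff)
 show ?case unfolding eq tuples_0 by (rule DP_cong[OF assms]) blast
next
 case (Suc m)
 let ?u = "%m y e j. if N \<le> j & j < N + m then y (j - N) else e j"
 have "(EX a:UU. EX y:TT m. P (?u m y (e(N + m := a)))) = (EX y:TT (Suc m). P (?u (Suc m) y e))" for e
 proof safe
  fix a y assume a: "a : UU" "y : TT m" "P (?u m y (e(N + m := a)))"
  have eq: "?u m y (e(N + m := a)) = ?u (Suc m) (y(m := a)) e" by (auto simp: fun_eq_iff)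
  have "y(m := a) : TT (Suc m)" using a by (auto simp: tuples_def PiE_iff extensional_def)
  with a(3) show "EX y:TT (Suc m). P (?u (Suc m) y e)" unfolding eq by (rule bexI)
 next
  fix y assume a: "y : TT (Suc m)" "P (?u (Suc m) y e)"
  have eq: "?u (Suc m) y e = ?u m (restrict y {..<m}) (e(N + m := y m))" by (auto simp: fun_eq_iff)
  have "restrict y {..<m} : TT m" "y m : UU" using a by (auto simp: tuples_def PiE_iff)
  with a(2) show "EX a:UU. EX y:TT m. P (?u m y (e(N + m := a)))"
   unfolding eq by (intro bexI)
 qed
 thus ?case using DP_ex[OF Suc.IH, of "N + m"] by simp
qed

lemma definable_proj:
 assumes "dfb (N + m) X"
 shows "dfb N {x : TT N. EX y:TT m. tcat N x m y : X}"
proof -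
 have eq: "restrict (%j. if N \<le> j & j < N + m then y (j - N) else e j) {..<N + m} = tcat N (restrict e {..<N}) m y" for y e
  by (auto simp: tcat_def fun_eq_iff)
 have "DP (%e. restrict e {..<N + m} : X)" using assms by (simp add: definable_iff_DP)
 from DP_ex_block[OF this, of m N]
 have "DP (%e. EX y:TT m. tcat N (restrict e {..<N}) m y : X)" unfolding eq .
 thus ?thesis by (rule definable_Collect) auto
qed

text \<open>A context \<open>(N, C, dec)\<close> consists of a definable set \<open>C\<close> of \<open>N\<close>-tuples, each of
 which is decoded to a value, e.g. a pair of tuples; definability of predicates on these values can
 then be proved by applying introduction rules to their syntactic form.\<close>

type_synonym ('b, 'x) ctx = "nat \<times> (nat => 'b) set \<times> ((nat => 'b) => 'x)"

definition wfc :: "('a, 'x) ctx => bool" where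
 "wfc Ga = (case Ga of (N, C, dec) => dfb N C)"

definition cset :: "('a, 'x) ctx => 'x set" where
 "cset Ga = (case Ga of (N, C, dec) => dec ` C)"

definition c0 :: "nat => (nat => 'a) set => ('a, nat => 'a) ctx" where
 "c0 n S = (n, S, %z. z)"

definition cx :: "('a, 'x) ctx => nat => (nat => 'a) set => ('a, 'x \<times> (nat => 'a)) ctx" where
 "cx Ga m S = (case Ga of (N, C, dec) =>
   (N + m, {z : TT (N + m). tfst N z : C & tsnd N m z : S}, %z. (dec (tfst N z), tsnd N m z)))"

definition D :: "('a, 'x) ctx => ('x => bool) => bool" where
 "D Ga R = (case Ga of (N, C, dec) => dfb N {z : C. R (dec z)})"

definition DT :: "('a, 'x) ctx => nat => ('x => (nat => 'a)) => bool" where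
 "DT Ga n f = (case Ga of (N, C, dec) =>
   (ALL z:C. f (dec z) : TT n) & dfb (N + n) {z : TT (N + n). tfst N z : C & tsnd N n z = f (dec (tfst N z))})"

lemma tfst_tsub: "tfst n z = tsub n Inl z" by (auto simp: tfst_def tsub_def vval_def)
lemma tsnd_tsub: "tsnd n m z = tsub m (%j. Inl (n + j)) z" by (auto simp: tsnd_def tsub_def vval_def)

lemma definable_tfst: "dfb n S ==> dfb (n + m) {z : TT (n + m). tfst n z : S}"
 unfolding tfst_tsub by (rule definable_tsub) (auto simp: sok_def)

lemma definable_tsnd: "dfb m S ==> dfb (n + m) {z : TT (n + m). tsnd n m z : S}"
 unfolding tsnd_tsub by (rule definable_tsub) (auto simp: sok_def)

lemma definable_times: "dfb n S ==> dfb m S' ==> dfb (n + m) {z : TT (n + m). tfst n z : S & tsnd n m z : S'}"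
 using definable_Int[OF definable_tfst[of n S m] definable_tsnd[of m S' n]]
 by (rule back_subst[of "dfb (n + m)"]) auto

lemma wfc_c0 [simp]: "wfc (c0 n S) = dfb n S" by (simp add: wfc_def c0_def)
lemma wfc_cx [simp, intro]: "wfc Ga ==> dfb m S ==> wfc (cx Ga m S)"
 by (auto simp: wfc_def cx_def definable_times split: prod.splits)
lemma cset_c0 [simp]: "cset (c0 n S) = S" by (simp add: cset_def c0_def)
lemma cset_cx [simp]:
 assumes "wfc Ga" "dfb m S" shows "cset (cx Ga m S) = cset Ga \<times> S"
proof -
 obtain N C dec where Ga: "Ga = (N, C, dec)" by (cases Ga)
 have "C <= TT N" "S <= TT m" using assms by (auto simp: Ga wfc_def dest: definable_subset)
 hence "(dec x, y) : (%z. (dec (tfst N z), tsnd N m z)) ` {z : TT (N + m). tfst N z : C & tsnd N m z : S}"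
  if "x : C" "y : S" for x y
  using that by (intro image_eqI[of _ _ "tcat N x m y"]) auto
 thus ?thesis by (auto simp: Ga cset_def cx_def)
qed

lemma D_c0: "D (c0 n S) R \<longleftrightarrow> dfb n {x : S. R x}" by (simp add: D_def c0_def)

lemma definableI: "X = {x : S. R x} ==> D (c0 n S) R ==> dfb n X" by (simp add: D_c0)

lemma D_not: "wfc Ga ==> D Ga P ==> D Ga (%x. \<not> P x)"
proof -
 assume a: "wfc Ga" "D Ga P"
 obtain N C dec where Ga: "Ga = (N, C, dec)" by (cases Ga)
 have "dfb N (C - {z : C. P (dec z)})" using a by (intro definable_Diff) (auto simp: Ga wfc_def D_def)
 moreover have "C - {z : C. P (dec z)} = {z : C. \<not> P (dec z)}" by auto
 ultimately show ?thesis by (simp add: D_def Ga)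
qed

lemma Collect_conj_eq2: "{z : C. P z & Q z} = {z : C. P z} \<inter> {z : C. Q z}" by auto

lemma Collect_disj_eq2: "{z : C. P z \<or> Q z} = {z : C. P z} \<union> {z : C. Q z}" by auto

lemma D_conj: "D Ga P ==> D Ga Q ==> D Ga (%x. P x & Q x)"
 unfolding D_def by (auto split: prod.splits dest: definable_Int simp: Collect_conj_eq2)

lemma D_disj: "D Ga P ==> D Ga Q ==> D Ga (%x. P x \<or> Q x)"
 unfolding D_def by (auto split: prod.splits dest: definable_Un simp: Collect_disj_eq2)

lemma D_const: "wfc Ga ==> D Ga (%_. b)"
 unfolding D_def wfc_def by (cases b) (auto split: prod.splits)

lemma D_imp: "wfc Ga ==> D Ga P ==> D Ga Q ==> D Ga (%x. P x --> Q x)"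
 unfolding imp_conv_disj by (intro D_disj D_not)

lemma D_iff: "wfc Ga ==> D Ga P ==> D Ga Q ==> D Ga (%x. P x \<longleftrightarrow> Q x)"
 unfolding iff_conv_conj_imp by (intro D_conj D_imp)

lemma D_bex:
 assumes "dfb m S" "wfc Ga" "D (cx Ga m S) (%p. R (fst p) (snd p))"
 shows "D Ga (%x. EX y:S. R x y)"
proof -
 obtain N C dec where Ga: "Ga = (N, C, dec)" by (cases Ga)
 have s: "C <= TT N" "S <= TT m" using assms by (auto simp: Ga wfc_def dest: definable_subset)
 have "{z : C. EX y:S. R (dec z) y} = {x : TT N. EX y:TT m. tcat N x m y :
  {z : {z : TT (N + m). tfst N z : C & tsnd N m z : S}. R (dec (tfst N z)) (tsnd N m z)}}"
  (is "?A = ?B")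
 proof (intro Set.set_eqI iffI)
  fix z assume "z : ?A"
  then obtain y where "z : C" "y : S" "R (dec z) y" by auto
  moreover from this have "z : TT N" "y : TT m" using s by auto
  ultimately show "z : ?B" by auto
 next
  fix z assume "z : ?B"
  thus "z : ?A" by auto
 qed
 moreover have "dfb N ?B" using assms(3) unfolding D_def Ga cx_def by (intro definable_proj) simp
 ultimately show ?thesis unfolding D_def Ga prod.case by (rule ssubst)
qed

lemma D_ball:
 assumes "dfb m S" "wfc Ga" "D (cx Ga m S) (%p. R (fst p) (snd p))"
 shows "D Ga (%x. ALL y:S. R x y)"
proof -
 have "D Ga (%x. \<not> (EX y:S. \<not> R x y))"
  by (intro D_not D_bex[OF assms(1)] assms wfc_cx[OF assms(2,1)])
 thus ?thesis by simp
qed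

lemma D_bexf: "finite I ==> wfc Ga ==> (!!i. i : I ==> D Ga (R i)) ==> D Ga (%x. EX i:I. R i x)"
 by (induction I rule: finite_induct) (auto intro: D_const D_disj)

lemma D_ballf: "finite I ==> wfc Ga ==> (!!i. i : I ==> D Ga (R i)) ==> D Ga (%x. ALL i:I. R i x)"
 by (induction I rule: finite_induct) (auto intro: D_const D_conj)

lemma D_cong: "D Ga R ==> (!!x. x : cset Ga ==> R x = R' x) ==> D Ga R'"
 unfolding D_def cset_def by (auto split: prod.splits intro: back_subst[of "dfb _"])

text \<open>A term is eliminated by quantifying over its value: the set is the projection of the
  intersection of the graph of \<open>t\<close> with the set defined by \<open>R\<close>.\<close>

lemma DT_subst:
 assumes t: "DT Ga m t" and "dfb m S" "wfc Ga" "!!x. x : cset Ga ==> t x : S"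
  and R: "D (cx Ga m S) (%p. R (fst p) (snd p))"
 shows "D Ga (%x. R x (t x))"
proof -
 obtain N C dec where Ga: "Ga = (N, C, dec)" by (cases Ga)
 have s: "C <= TT N" "S <= TT m" using assms by (auto simp: Ga wfc_def dest: definable_subset)
 have ts: "!!z. z : C ==> t (dec z) : S" using assms(4) by (auto simp: Ga cset_def)
 have "{z : C. R (dec z) (t (dec z))} = {x : TT N. EX y:TT m. tcat N x m y :
   {z : {z : TT (N + m). tfst N z : C & tsnd N m z : S}. R (dec (tfst N z)) (tsnd N m z)} \<inter>
   {z : TT (N + m). tfst N z : C & tsnd N m z = t (dec (tfst N z))}}" (is "?A = ?B")
 proof (intro Set.set_eqI iffI)
  fix z assume "z : ?A"
  thus "z : ?B" using ts s by (auto intro!: bexI[of _ "t (dec z)"] dest: subsetD)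
 next
  fix z assume "z : ?B"
  thus "z : ?A" by auto
 qed
 moreover have "dfb N ?B" using R t unfolding D_def DT_def Ga cx_def prod.case
  by (intro definable_proj definable_Int) simp_all
 ultimately show ?thesis unfolding D_def Ga prod.case by (rule ssubst)
qed

lemma DT_var0: "dfb n S ==> DT (c0 n S) n (%z. z)"
proof -
 assume S: "dfb n S"
 have "DP (%e. (ALL j:{..<n}. e j = e (n + j)) & restrict e {..<n} : S)"
 proof (intro DP_conj)
  have "DP (%e. ALL j:J. e j = e (n + j))" if "finite J" for J
   using that by (induction J) (auto intro: DP_const DP_conj DP_eq)
  thus "DP (%e. ALL j:{..<n}. e j = e (n + j))" by simp
  show "DP (%e. restrict e {..<n} : S)" using S by (simp add: definable_iff_DP)
 qed
 hence "dfb (n + n) {z : TT (n + n). tfst n z : S & tsnd n n z = tfst n z}"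
  by (rule definable_Collect) (auto simp: tfst_def tsnd_def fun_eq_iff cong: restrict_cong)
 thus ?thesis using definable_subset[OF S] unfolding DT_def c0_def by auto
qed

lemma DT_I:
 assumes "wfc Ga" "!!x. x : cset Ga ==> f x : TT n" "D (cx Ga n (TT n)) (%p. snd p = f (fst p))"
 shows "DT Ga n f"
 using assms unfolding DT_def D_def cx_def cset_def by (auto split: prod.splits intro: back_subst[of "dfb _"])

lemma DT_D: "DT Ga n f ==> D (cx Ga n (TT n)) (%p. snd p = f (fst p))"
 unfolding DT_def D_def cx_def by (auto split: prod.splits intro: back_subst[of "dfb _"])

lemma DT_in: "DT Ga n f ==> x : cset Ga ==> f x : TT n"
 unfolding DT_def cset_def by (auto split: prod.splits)

lemma DT_tsub0:
 assumes "dfb N C" "sok N n s"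
 shows "DT (c0 N C) n (tsub n s)"
proof -
 have 1: "DT (c0 n (TT n)) n (%z. z)" by (rule DT_var0) simp
 let ?s = "%j. if j < n then s j else Inl (N + (j - n))"
 have "sok (N + n) (n + n) ?s" using assms(2) by (fastforce simp: sok_def split: sum.splits)
 with 1 have "dfb (N + n) {z : TT (N + n). tsub (n + n) ?s z : {z : TT (n + n). tfst n z : TT n & tsnd n n z = tfst n z}}"
  unfolding DT_def c0_def by (intro definable_tsub) auto
 hence "dfb (N + n) ({z : TT (N + n). tsub (n + n) ?s z : {z : TT (n + n). tfst n z : TT n & tsnd n n z = tfst n z}}
   \<inter> {z : TT (N + n). tfst N z : C})"
  by (intro definable_Int definable_tfst assms)
 moreover have "tsub (n + n) ?s z : {z : TT (n + n). tfst n z : TT n & tsnd n n z = tfst n z}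
   \<longleftrightarrow> tsnd N n z = tsub n s (tfst N z)" if z: "z : TT (N + n)" for z
 proof -
  have "tsub (n + n) ?s z = tcat n (tsub n s (tfst N z)) n (tsnd N n z)"
   using assms(2) by (fastforce simp: tsub_def vval_def tcat_def tfst_def tsnd_def fun_eq_iff sok_def split: sum.splits)
  moreover have "tsub n s (tfst N z) : TT n" "tsnd N n z : TT n" using z by (auto intro: tsub_in assms)
  ultimately show ?thesis by auto
 qed
 ultimately have "dfb (N + n) {z : TT (N + n). tfst N z : C & tsnd N n z = tsub n s (tfst N z)}"
  by (auto intro: back_subst[of "dfb _"])
 thus ?thesis unfolding DT_def c0_def using definable_subset[OF assms(1)] assms by (auto intro: tsub_in)
qed

lemma DT_dec:
 assumes "wfc (N, C, dec)" shows "DT (N, C, dec) n f \<longleftrightarrow> DT (c0 N C) n (%z. f (dec z))"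
 by (simp add: DT_def c0_def)

lemma DT_snd: "wfc Ga ==> dfb m S ==> DT (cx Ga m S) m snd"
proof -
 assume a: "wfc Ga" "dfb m S"
 obtain N C dec where Ga: "Ga = (N, C, dec)" by (cases Ga)
 have "wfc (cx Ga m S)" using a by auto
 thus ?thesis using DT_tsub0[of "N + m" _ m "%j. Inl (N + j)"]
  unfolding cx_def Ga by (simp add: DT_dec tsnd_tsub[abs_def]) (simp add: wfc_def sok_def)
qed

lemma DT_fst:
 assumes a: "wfc Ga" "dfb m S" and f: "DT Ga n f"
 shows "DT (cx Ga m S) n (%p. f (fst p))"
proof -
 obtain N C dec where Ga: "Ga = (N, C, dec)" by (cases Ga)
 let ?X = "{z : TT (N + n). tfst N z : C & tsnd N n z = f (dec (tfst N z))}"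
 let ?s = "%j. if j < N then Inl j else Inl (m + j)"
 have X: "dfb (N + n) ?X" using f by (simp add: DT_def Ga)
 have "wfc (cx Ga m S)" using a by auto
 hence w: "dfb (N + m) {z : TT (N + m). tfst N z : C & tsnd N m z : S}" by (simp add: cx_def Ga wfc_def)
 have "sok (N + m + n) (N + n) ?s" by (auto simp: sok_def)
 from definable_Int[OF definable_tsub[OF X this] definable_tfst[OF w, of n]]
 have "dfb (N + m + n) ({z : TT (N + m + n). tsub (N + n) ?s z : ?X} \<inter>
  {z : TT (N + m + n). tfst (N + m) z : {z : TT (N + m). tfst N z : C & tsnd N m z : S}})" .
 moreover have "tfst N (tsub (N + n) ?s z) = tfst N (tfst (N + m) z)"
  "tsnd N n (tsub (N + n) ?s z) = tsnd (N + m) n z" for z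
  by (auto simp: tsub_def vval_def tfst_def tsnd_def fun_eq_iff add_ac)
 moreover have "z : TT (N + m + n) ==> tsub (N + n) ?s z : TT (N + n)" for z
  by (rule tsub_in) (auto simp: sok_def)
 ultimately show ?thesis using f
  unfolding DT_def Ga cx_def by (auto intro: back_subst[of "dfb _"])
qed

lemma DT_const:
 assumes "wfc Ga" "a : TT n" shows "DT Ga n (%_. a)"
proof -
 obtain N C dec where Ga: "Ga = (N, C, dec)" by (cases Ga)
 have a: "a = tsub n (%j. Inr (a j)) z" for z
  using assms(2) by (auto simp: tsub_def vval_def tuples_def fun_eq_iff PiE_iff extensional_def)
 have "sok N n (%j. Inr (a j))" using assms(2) by (auto simp: sok_def tuples_def)
 from DT_tsub0[OF _ this, of C] assms(1) a show ?thesis unfolding Ga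
  by (subst DT_dec) (auto simp: wfc_def cong: DT_def)
qed

lemma DT_app_gen:
 assumes t: "DT Ga n t" and g: "DT (c0 n S) m g" and "dfb n S" "wfc Ga" "!!x. x : cset Ga ==> t x : S"
 shows "DT Ga m (%x. g (t x))"
proof (rule DT_I)
 obtain N C dec where Ga: "Ga = (N, C, dec)" by (cases Ga)
 show "g (t x) : TT m" if "x : cset Ga" for x using DT_in[OF g] assms(5)[OF that] by simp
 have w: "wfc (cx Ga m (TT m))" using assms by auto
 show "D (cx Ga m (TT m)) (%p. snd p = g (t (fst p)))"
 proof (rule DT_subst[where t = "%p. t (fst p)" and R = "%p w. snd p = g w" and S = S and m = n])
  show "DT (cx Ga m (TT m)) n (%p. t (fst p))" by (intro DT_fst assms) simp
  show "dfb n S" "wfc (cx Ga m (TT m))" using assms w by auto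
  show "t (fst x) : S" if "x : cset (cx Ga m (TT m))" for x using that assms by auto
  let ?X = "{z : TT (n + m). tfst n z : S & tsnd n m z = g (tfst n z)}"
  let ?s = "%j. if j < n then Inl (N + m + j) else Inl (N + (j - n))"
  have X: "dfb (n + m) ?X" using g by (simp add: DT_def c0_def)
  have "sok (N + m + n) (n + m) ?s" by (auto simp: sok_def)
  moreover have w': "dfb (N + m + n) {z : TT (N + m + n). tfst (N + m) z : {z : TT (N + m). tfst N z : C & tsnd N m z : TT m} & tsnd (N + m) n z : S}"
   using wfc_cx[OF w assms(3)] by (simp add: cx_def Ga wfc_def)
  ultimately have "dfb (N + m + n) ({z : TT (N + m + n). tsub (n + m) ?s z : ?X} \<inter> {z : TT (N + m + n). tfst (N + m) z : {z : TT (N + m). tfst N z : C & tsnd N m z : TT m} & tsnd (N + m) n z : S})"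
   by (intro definable_Int definable_tsub[OF X]) auto
  moreover have "tfst n (tsub (n + m) ?s z) = tsnd (N + m) n z"
   "tsnd n m (tsub (n + m) ?s z) = tsnd N m (tfst (N + m) z)" for z
   by (auto simp: tsub_def vval_def tfst_def tsnd_def fun_eq_iff)
  moreover have "z : TT (N + m + n) ==> tsub (n + m) ?s z : TT (n + m)" for z
   by (rule tsub_in) (auto simp: sok_def)
  ultimately show "D (cx (cx Ga m (TT m)) n S) (%p. snd (fst p) = g (snd p))"
   unfolding D_def cx_def Ga by (auto intro: back_subst[of "dfb _"])
 qed
qed (use assms in auto)

lemma D_in:
 assumes "dfb n S" "DT Ga n t" "wfc Ga"
 shows "D Ga (%x. t x : S)"
proof (rule DT_subst[where t = t and S = "TT n" and R = "%x y. y : S"])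
 have "DT (cx Ga n (TT n)) n snd" using assms by (intro DT_snd) auto
 obtain N C dec where Ga: "Ga = (N, C, dec)" by (cases Ga)
 have "dfb (N + n) {z : TT (N + n). tfst N z : C & tsnd N n z : S}"
  using assms by (intro definable_times) (auto simp: wfc_def Ga)
 thus "D (cx Ga n (TT n)) (%p. snd p : S)"
  unfolding D_def cx_def Ga by (auto intro: back_subst[of "dfb _"])
qed (use assms in \<open>auto intro: DT_in\<close>)

lemma D_eq:
 assumes "DT Ga n t" "DT Ga n u" "wfc Ga"
 shows "D Ga (%x. t x = u x)"
 by (rule DT_subst[where t = t and S = "TT n" and R = "%x y. y = u x"])
  (use assms in \<open>auto intro: DT_in DT_D\<close>)

lemma DT_tcat:
 assumes "DT Ga n t" "DT Ga m u" "wfc Ga"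
 shows "DT Ga (n + m) (%x. tcat n (t x) m (u x))"
proof (rule DT_I)
 let ?\<Delta> = "cx Ga (n + m) (TT (n + m))"
 have w: "wfc ?\<Delta>" using assms by auto
 have sn: "DT ?\<Delta> (n + m) snd" by (rule DT_snd) (use assms in auto)
 have 1: "DT ?\<Delta> n (%p. tfst n (snd p))" "DT ?\<Delta> m (%p. tsnd n m (snd p))"
  unfolding tfst_tsub tsnd_tsub
  by (rule DT_app_gen[OF sn DT_tsub0[of "n + m" "TT (n + m)"]];
   use assms w in \<open>auto simp: sok_def\<close>)+
 have "D ?\<Delta> (%p. tfst n (snd p) = t (fst p) & tsnd n m (snd p) = u (fst p))"
  by (intro D_conj D_eq[OF 1(1) DT_fst[OF assms(3) definable_tuples assms(1)] w]
   D_eq[OF 1(2) DT_fst[OF assms(3) definable_tuples assms(2)] w])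
 thus "D ?\<Delta> (%p. snd p = tcat n (t (fst p)) m (u (fst p)))"
 proof (rule D_cong)
  fix x assume "x : cset ?\<Delta>"
  hence x: "snd x : TT (n + m)" "fst x : cset Ga" using assms by auto
  have "t (fst x) : TT n" "u (fst x) : TT m" using x assms by (auto intro: DT_in)
  thus "(tfst n (snd x) = t (fst x) & tsnd n m (snd x) = u (fst x)) = (snd x = tcat n (t (fst x)) m (u (fst x)))"
   using x by (metis tfst_tcat tsnd_tcat tcat_tfst_tsnd)
 qed
qed (use assms in \<open>auto intro: DT_in\<close>)

lemma DT_tsub: "DT Ga N t ==> sok N n s ==> wfc Ga ==> DT Ga n (%x. tsub n s (t x))"
 by (rule DT_app_gen[OF _ DT_tsub0[of N "TT N"]]) (auto dest: DT_in)

lemma DT_tfst: "DT Ga (n + m) t ==> wfc Ga ==> DT Ga n (%x. tfst n (t x))"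
 unfolding tfst_tsub by (rule DT_tsub) (auto simp: sok_def)

lemma DT_tsnd: "DT Ga (n + m) t ==> wfc Ga ==> DT Ga m (%x. tsnd n m (t x))"
 unfolding tsnd_tsub by (rule DT_tsub) (auto simp: sok_def)

lemma DT_sel: "DT Ga N t ==> (!!j. j < n ==> s j < N) ==> wfc Ga ==> DT Ga n (%x. \<lambda>j\<in>{..<n}. t x (s j))"
 using DT_tsub[of Ga N t n "%j. Inl (s j)"] by (simp add: sok_def tsub_def vval_def)

text \<open>Applied repeatedly, these rules follow the syntax of a predicate and leave the
  definability of the sets named in it and the well-formedness of the contexts.\<close>

lemmas dint = D_conj D_disj D_not D_imp D_iff D_bex D_ball D_bexf D_ballf D_in D_eq
 DT_var0 DT_snd DT_tcat DT_tfst DT_tsnd DT_fst DT_const D_const definable_tuples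

end

section \<open>Topology and saturation\<close>

lemma topspace_power_top [simp]: "topspace (power_top \<tau> n) = {..<n} \<rightarrow>\<^sub>E topspace \<tau>"
 by (simp add: power_top_def)

lemma continuous_map_power_top:
 "continuous_map X (power_top \<tau> n) f \<longleftrightarrow>
  f : topspace X \<rightarrow> extensional {..<n} & (ALL i<n. continuous_map X \<tau> (%x. f x i))"
 by (auto simp: power_top_def continuous_map_componentwise)

lemma continuous_map_power_top_coord: "i < n ==> continuous_map (power_top \<tau> n) \<tau> (%x. x i)"
 using continuous_map_product_projection[of i "{..<n}" "%_. \<tau>"] by (simp add: power_top_def)

lemma countable_natLeq: "countable A ==> |A| \<le>o natLeq"
 unfolding countable_def
 by (metis card_of_nat card_of_ordLeqI ordIso_iff_ordLeq ordLeq_transitive subset_UNIV card_of_ordLeq)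

lemma continuous_map_locally:
 assumes "!!x. x : topspace X ==> EX W. openin X W & x : W & continuous_map (subtopology X W) Y f"
 shows "continuous_map X Y f"
 unfolding continuous_map_def
proof (intro conjI allI impI)
 show "f : topspace X \<rightarrow> topspace Y"
 proof
  fix x assume x: "x : topspace X"
  then obtain W where W: "openin X W" "x : W" "continuous_map (subtopology X W) Y f" using assms by blast
  show "f x : topspace Y" using continuous_map_funspace[OF W(3)] x W(2) by auto
 qed
 fix V assume V: "openin Y V"
 show "openin X {x : topspace X. f x : V}"
 proof (subst openin_subopen, intro ballI)
  fix x assume x: "x : {x : topspace X. f x : V}"
  then obtain W where W: "openin X W" "x : W" "continuous_map (subtopology X W) Y f" using assms by blast
  have "openin (subtopology X W) {z : topspace (subtopology X W). f z : V}"
   using openin_continuous_map_preimage[OF W(3) V] .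
  hence "openin X {z : topspace (subtopology X W). f z : V}"
   using W(1) openin_trans_full by blast
  thus "EX T. openin X T & x : T & T <= {x : topspace X. f x : V}"
   using x W by (intro exI[of _ "{z : topspace (subtopology X W). f z : V}"]) auto
 qed
qed

text \<open>Definability speaks of single tuples, so \<open>N\<close> tuples of length
  \<open>k\<close> are stored in one tuple of length \<open>N * k\<close>; \<open>flat\<close> packs
  them and \<open>slc\<close> extracts the blocks.\<close>

definition slc :: "nat => nat => (nat => 'a) => (nat => 'a)" where
 "slc k i w = (\<lambda>j\<in>{..<k}. w (i * k + j))"

definition flat :: "nat => nat => (nat => nat => 'a) => (nat => 'a)" where
 "flat k N f = (\<lambda>j\<in>{..<N * k}. f (j div k) (j mod k))"

lemma slc_index: "i < N ==> j < k ==> i * k + j < N * (k::nat)"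
proof -
 assume "i < N" "j < k"
 hence "i * k + j < Suc i * k" by simp
 also have "\<dots> \<le> N * k" using `i < N` by (intro mult_le_mono1) simp
 finally show ?thesis .
qed

lemma flat_index: "j < N * k ==> j div k < N & j mod k < (k::nat)"
 by (metis less_mult_imp_div_less mod_less_divisor mult_is_0 not_less_zero not_gr_zero)

lemma slc_in: "i < N ==> w : tuples M (N * k) ==> slc k i w : tuples M k"
 by (auto simp: tuples_def slc_def PiE_iff slc_index)

lemma flat_in: "(!!i. i < N ==> f i : tuples M k) ==> flat k N f : tuples M (N * k)"
 by (auto simp: tuples_def flat_def PiE_iff flat_index)

lemma slc_flat: "i < N ==> f i : tuples M k ==> slc k i (flat k N f) = f i"
 by (auto simp: tuples_def flat_def slc_def PiE_iff slc_index fun_eq_iff extensional_def)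

lemma flat_slc: "w : tuples M (N * k) ==> flat k N (%i. slc k i w) = w"
 by (auto simp: tuples_def flat_def slc_def PiE_iff flat_index fun_eq_iff extensional_def)

text \<open>For each fixed \<open>N\<close> this is first-order (\<open>D_atleast\<close>), unlike
  finiteness. Infinite sets are named separately because \<open>card\<close> assigns them
  \<open>0\<close>.\<close>

definition atleast :: "nat => 'x set => bool" where
 "atleast N S \<longleftrightarrow> infinite S \<or> N \<le> card S"

lemma atleast_iff: "atleast N S \<longleftrightarrow> (EX f. inj_on f {..<N} & f ` {..<N} <= S)"
proof
 assume "atleast N S"
 then obtain T where T: "T <= S" "finite T" "card T = N"
  unfolding atleast_def by (metis infinite_arbitrarily_large obtain_subset_with_card_n)
 then obtain f where "bij_betw f {..<N} T"
  by (metis bij_betw_from_nat_into_finite)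
 thus "EX f. inj_on f {..<N} & f ` {..<N} <= S" using T unfolding bij_betw_def by blast
next
 assume "EX f. inj_on f {..<N} & f ` {..<N} <= S"
 thus "atleast N S" unfolding atleast_def by (metis card_image card_lessThan card_mono)
qed

lemma atleast_exact: "atleast N S & \<not> atleast (Suc N) S \<longleftrightarrow> finite S & card S = N"
 unfolding atleast_def by auto

context fo_structure begin

lemma DT_slc: "DT Ga (N * k) t ==> i < N ==> wfc Ga ==> DT Ga k (%x. slc k i (t x))"
 unfolding slc_def by (rule DT_sel) (auto simp: slc_index)

lemma D_atleast:
 assumes "wfc Ga" "D (cx Ga k (TT k)) (%p. R (fst p) (snd p))"
 shows "D Ga (%g. atleast N {x : TT k. R g x})"
proof -
 let ?\<Delta> = "cx Ga (N * k) (TT (N * k))"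
 have w: "wfc ?\<Delta>" using assms by auto
 have R: "D ?\<Delta> (%p. R (fst p) (slc k i (snd p)))" if "i < N" for i
 proof (rule DT_subst[where t = "%p. slc k i (snd p)" and S = "TT k" and m = k and R = "%p. R (fst p)"])
  show "DT ?\<Delta> k (%p. slc k i (snd p))" by (rule DT_slc[OF DT_snd]) (use assms that w in auto)
  show "slc k i (snd x) : TT k" if "x : cset ?\<Delta>" for x using that assms \<open>i < N\<close> by (auto intro: slc_in)
  show "D (cx ?\<Delta> k (TT k)) (%p. R (fst (fst p)) (snd p))"
  proof -
   let ?E = "cx ?\<Delta> k (TT k)"
   obtain n C dec where Ga: "Ga = (n, C, dec)" by (cases Ga)
   let ?s = "%j. if j < n then Inl j else Inl (N * k + j)"
   have a: "dfb (n + k) {z : {z : TT (n + k). tfst n z : C & tsnd n k z : TT k}. R (dec (tfst n z)) (tsnd n k z)}"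
   using assms(2) by (simp add: D_def cx_def Ga)
   have "sok (n + N * k + k) (n + k) ?s" by (auto simp: sok_def)
   from definable_tsub[OF a this]
   have b: "dfb (n + N * k + k) {z : TT (n + N * k + k). tsub (n + k) ?s z : {z : {z : TT (n + k). tfst n z : C & tsnd n k z : TT k}. R (dec (tfst n z)) (tsnd n k z)}}" .
   have "tfst n (tsub (n + k) ?s z) = tfst n (tfst (n + N * k) z)"
   "tsnd n k (tsub (n + k) ?s z) = tsnd (n + N * k) k z" for z
   by (auto simp: tsub_def vval_def tfst_def tsnd_def fun_eq_iff add_ac)
   moreover have "z : TT (n + N * k + k) ==> tsub (n + k) ?s z : TT (n + k)" for z
   by (rule tsub_in) (auto simp: sok_def)
   ultimately show ?thesis using b unfolding D_def cx_def Ga by (auto intro: back_subst[of "dfb _"])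
  qed
 qed (use assms w in auto)
 have "D Ga (%g. EX w:TT (N * k). (ALL i:{..<N}. R g (slc k i w)) &
  (ALL i:{..<N}. ALL j:{..<N}. i ~= j --> slc k i w ~= slc k j w))"
  by (rule dint DT_slc R assms(1) | (auto simp: assms(1); fail)[1])+
 moreover have "(EX w:TT (N * k). (ALL i:{..<N}. R g (slc k i w)) &
  (ALL i:{..<N}. ALL j:{..<N}. i ~= j --> slc k i w ~= slc k j w)) \<longleftrightarrow> atleast N {x : TT k. R g x}" for g
  unfolding atleast_iff
 proof
  assume "EX w:TT (N * k). (ALL i:{..<N}. R g (slc k i w)) &
   (ALL i:{..<N}. ALL j:{..<N}. i ~= j --> slc k i w ~= slc k j w)"
  then obtain w where "w : TT (N * k)" "ALL i:{..<N}. R g (slc k i w)"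
   "ALL i:{..<N}. ALL j:{..<N}. i ~= j --> slc k i w ~= slc k j w" by blast
  thus "EX f. inj_on f {..<N} & f ` {..<N} <= {x : TT k. R g x}"
   by (intro exI[of _ "%i. slc k i w"]) (auto simp: inj_on_def intro: slc_in)
 next
  assume "EX f. inj_on f {..<N} & f ` {..<N} <= {x : TT k. R g x}"
  then obtain f where f: "inj_on f {..<N}" "f ` {..<N} <= {x : TT k. R g x}" by blast
  have "slc k i (flat k N f) = f i" if "i < N" for i
   using f(2) that by (intro slc_flat) auto
  moreover have "flat k N f : TT (N * k)" using f(2) by (intro flat_in) auto
  ultimately show "EX w:TT (N * k). (ALL i:{..<N}. R g (slc k i w)) &
   (ALL i:{..<N}. ALL j:{..<N}. i ~= j --> slc k i w ~= slc k j w)"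
   using f by (intro bexI[of _ "flat k N f"]) (auto simp: inj_on_def)
 qed
 ultimately show ?thesis by simp
qed

definition dfn :: "nat => (nat => 'a) set => nat => ((nat => 'a) => (nat => 'a)) => bool" where
 "dfn n U m f \<longleftrightarrow> dfb n U & DT (c0 n U) m f"

lemma dfnD: "dfn n U m f ==> dfb n U" "dfn n U m f ==> x : U ==> f x : TT m"
 unfolding dfn_def using DT_in[of "c0 n U" m f x] by auto

lemma DT_app:
 assumes "dfn n U m f" "DT Ga n t" "wfc Ga" "!!x. x : cset Ga ==> t x : U"
 shows "DT Ga m (%x. f (t x))"
 using DT_app_gen[OF assms(2) _ _ assms(3,4), of m f] assms(1) unfolding dfn_def by blast

lemma dfn_graph: "dfn n U m f ==> dfb (n + m) {z : TT (n + m). tfst n z : U & tsnd n m z = f (tfst n z)}"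
 unfolding dfn_def DT_def c0_def by auto

lemma dfn_subset:
 assumes "dfn n U m f" "dfb n V" "V <= U" shows "dfn n V m f"
 unfolding dfn_def
proof
 show "DT (c0 n V) m f" by (rule DT_app[OF assms(1) DT_var0]) (use assms in auto)
qed (rule assms)

lemma dfn_comp:
 assumes "dfn n U m f" "dfn m V k g" "f ` U <= V" shows "dfn n U k (%x. g (f x))"
proof -
 have "DT (c0 n U) m f" "dfb n U" using assms(1) by (auto simp: dfn_def)
 thus ?thesis unfolding dfn_def using assms by (auto intro!: DT_app[OF assms(2)])
qed

lemma dfnI: "dfb n U ==> DT (c0 n U) m f ==> dfn n U m f" by (simp add: dfn_def)

lemma dfn_cong: "dfn n U m f ==> (!!x. x : U ==> f x = g x) ==> dfn n U m g"
 unfolding dfn_def DT_def c0_def by (auto intro: back_subst[of "dfb _"])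

lemma dfn_id: "dfb n U ==> dfn n U n (%x. x)" by (simp add: dfn_def DT_var0)

lemma dfb_image: "dfn n U m f ==> dfb m (f ` U)"
proof -
 assume f: "dfn n U m f"
 have "D (c0 m (TT m)) (%y. EX x:U. y = f x)"
  by (rule dint DT_app[OF f] dfnD(1)[OF f] | (auto simp: dfnD[OF f]; fail)[1])+
 thus ?thesis
  by (rule definableI[rotated]) (use dfnD(2)[OF f] in auto)
qed

lemma dfb_vimage: "dfn n U m f ==> dfb m S ==> dfb n {x : U. f x : S}"
 by (rule definableI[OF refl], rule D_in) (auto simp: dfn_def)

lemma dfn_inv:
 assumes f: "dfn n U m f" and "inj_on f U" shows "dfn m (f ` U) n (inv_into U f)"
proof (rule dfnI)
 show i: "dfb m (f ` U)" using dfb_image[OF f] .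
 have U: "U <= TT n" using dfnD(1)[OF f] definable_subset by auto
 show "DT (c0 m (f ` U)) n (inv_into U f)"
 proof (rule DT_I)
  let ?G = "cx (c0 m (f ` U)) n (TT n)"
  have w: "wfc ?G" using i by auto
  have "D ?G (%p. EX x:U. snd p = x & fst p = f x)"
   by (rule dint DT_app[OF f] dfnD(1)[OF f] i | (auto simp: dfnD[OF f] i; fail)[1])+
  thus "D ?G (%p. snd p = inv_into U f (fst p))"
   by (rule D_cong) (use i assms in \<open>auto simp: inv_into_f_f f_inv_into_f inv_into_into\<close>)
  show "inv_into U f x : TT n" if "x : cset (c0 m (f ` U))" for x
   using that by (intro subsetD[OF U] inv_into_into) simp
  show "wfc (c0 m (f ` U))" using i by simp
 qed
qed

lemma dfb_fiber:
 assumes "dfb (n + m) S" "u : TT n" shows "dfb m {x : TT m. tcat n u m x : S}"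
 by (rule definableI[OF refl], (rule dint assms | (simp add: assms; fail)[1])+)

end

section \<open>Definable bases of the power topologies, saturation, and niceness in usable
  form\<close>

locale tmin = fo_structure L M
 for L :: "('f, 'r) fo_lang" and M :: "('a, 'f, 'r) fo_struct" +
 fixes \<tau> :: "'a topology" and \<kappa> :: "'k rel"
 assumes tmt: "t_minimal_topology L M \<tau>"
  and nice: "nice L M \<tau>"
  and sat: "saturated \<kappa> L M" and kappa: "natLeq <o \<kappa>"
begin

abbreviation "PT \<equiv> power_top \<tau>"
abbreviation "opn n \<equiv> openin (PT n)"
abbreviation "sbt n \<equiv> subtopology (PT n)"
abbreviation "cont n U m \<equiv> continuous_map (sbt n U) (PT m)"

lemma topspace_tau [simp]: "topspace \<tau> = UU" using tmt by (simp add: t_minimal_topology_def)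

lemma topspace_PT: "topspace (PT n) = TT n" by (simp add: tuples_def)

lemma openin_PT_subset: "opn n W ==> W <= TT n"
 using openin_subset topspace_PT by metis

lemma openin_TT [simp]: "opn n (TT n)"
 using openin_topspace[of "PT n"] by (simp only: topspace_PT)

lemma Hausdorff_PT: "Hausdorff_space (PT n)"
 using tmt by (auto simp: t_minimal_topology_def power_top_def Hausdorff_space_product_topology)

lemma continuous_map_PT:
 "continuous_map X (PT n) f \<longleftrightarrow> f : topspace X \<rightarrow> TT n & (ALL i<n. continuous_map X \<tau> (%x. f x i))"
proof
 assume "continuous_map X (PT n) f"
 thus "f : topspace X \<rightarrow> TT n & (ALL i<n. continuous_map X \<tau> (%x. f x i))"
  using continuous_map_funspace[of X "PT n" f] unfolding topspace_PT by (auto simp: continuous_map_power_top)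
qed (auto simp: continuous_map_power_top tuples_def Pi_iff PiE_iff)

lemma continuous_map_sel:
 assumes "!!j. j < n ==> s j < m" shows "continuous_map (PT m) (PT n) (%x. \<lambda>j\<in>{..<n}. x (s j))"
 unfolding continuous_map_PT
proof (intro conjI allI impI)
 show "(%x. \<lambda>j\<in>{..<n}. x (s j)) : topspace (PT m) \<rightarrow> TT n"
  using assms by (auto simp: tuples_def)
 show "continuous_map (PT m) \<tau> (%x. (\<lambda>j\<in>{..<n}. x (s j)) i)" if "i < n" for i
  using that continuous_map_power_top_coord[OF assms[OF that]] by simp
qed

lemma continuous_map_tfst: "continuous_map (PT (n + m)) (PT n) (tfst n)"
 using continuous_map_sel[of n "%j. j" "n + m"] by (simp add: tfst_def[abs_def])

lemma continuous_map_tsnd: "continuous_map (PT (n + m)) (PT m) (tsnd n m)"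
 using continuous_map_sel[of m "%j. n + j" "n + m"] by (simp add: tsnd_def[abs_def])

lemma continuous_map_slc: "i < N ==> continuous_map (PT (N * k)) (PT k) (slc k i)"
 using continuous_map_sel[of k "%j. i * k + j" "N * k"] by (simp add: slc_def[abs_def] slc_index)

lemma continuous_map_tcat:
 assumes "continuous_map X (PT n) f" "continuous_map X (PT m) g"
 shows "continuous_map X (PT (n + m)) (%x. tcat n (f x) m (g x))"
 unfolding continuous_map_PT
proof (intro conjI allI impI)
 show "(%x. tcat n (f x) m (g x)) : topspace X \<rightarrow> TT (n + m)"
  using assms unfolding continuous_map_PT by auto
 show "continuous_map X \<tau> (%x. tcat n (f x) m (g x) i)" if "i < n + m" for i
  using assms that unfolding continuous_map_PT tcat_def by (cases "i < n") auto
qed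

definition Box :: "nat => (nat => 'a) set => nat => (nat => 'a) set => (nat => 'a) set" where
 "Box n U m V = {z : TT (n + m). tfst n z : U & tsnd n m z : V}"

lemma dfb_Box: "dfb n U ==> dfb m V ==> dfb (n + m) (Box n U m V)"
 unfolding Box_def by (rule definable_times)

lemma tcat_in_Box: "U <= TT n ==> V <= TT m ==> x : U ==> y : V ==> tcat n x m y : Box n U m V"
 unfolding Box_def using tcat_in[of x M n y m] by (auto simp: subset_iff)

lemma open_Box: "opn n U ==> opn m V ==> opn (n + m) (Box n U m V)"
proof -
 assume a: "opn n U" "opn m V"
 have "opn (n + m) ({z : topspace (PT (n + m)). tfst n z : U} \<inter> {z : topspace (PT (n + m)). tsnd n m z : V})"
  by (intro openin_Int openin_continuous_map_preimage[OF continuous_map_tfst] openin_continuous_map_preimage[OF continuous_map_tsnd] a)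
 thus ?thesis unfolding topspace_PT Box_def by (auto intro: back_subst[of "openin _"])
qed

lemma Box_subset:
 assumes W: "opn (n + m) W" "z : W"
 obtains U V where "opn n U" "opn m V" "tfst n z : U" "tsnd n m z : V" "Box n U m V <= W"
proof -
 have z: "z : TT (n + m)" using openin_PT_subset W by auto
 have c: "continuous_map (prod_topology (PT n) (PT m)) (PT (n + m)) (%p. tcat n (fst p) m (snd p))"
  by (intro continuous_map_tcat continuous_map_fst continuous_map_snd)
 have o: "openin (prod_topology (PT n) (PT m)) {p : topspace (prod_topology (PT n) (PT m)). tcat n (fst p) m (snd p) : W}"
  using openin_continuous_map_preimage[OF c W(1)] .
 have "(tfst n z, tsnd n m z) : {p : topspace (prod_topology (PT n) (PT m)). tcat n (fst p) m (snd p) : W}"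
  using z W unfolding topspace_prod_topology topspace_PT by auto
 from o[unfolded openin_prod_topology_alt, rule_format, OF this]
 obtain U V where UV: "opn n U" "opn m V" "tfst n z : U" "tsnd n m z : V"
  "U \<times> V <= {p : topspace (prod_topology (PT n) (PT m)). tcat n (fst p) m (snd p) : W}"
  by (elim exE conjE)
 have "Box n U m V <= W"
 proof
  fix w assume "w : Box n U m V"
  hence w: "(tfst n w, tsnd n m w) : U \<times> V" "tcat n (tfst n w) m (tsnd n m w) = w" by (auto simp: Box_def)
  have "tcat n (fst (tfst n w, tsnd n m w)) m (snd (tfst n w, tsnd n m w)) : W"
   using subsetD[OF UV(5) w(1)] unfolding mem_Collect_eq by (rule conjunct2)
  thus "w : W" using w(2) by simp
 qed
 thus thesis using that UV by blast
qed

definition basis_code :: "nat => nat \<times> (nat => 'a) set \<times> (nat => 'a) set => bool" where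
 "basis_code n c = (case c of (p, X, Y) => dfb (n + p) X & dfb p Y &
   (ALL y:Y. opn n {x : TT n. tcat n x p y : X}) &
   (ALL W x. opn n W & x : W -->
   (EX y:Y. x : {x : TT n. tcat n x p y : X} & {x : TT n. tcat n x p y : X} <= W)))"

lemma basis_code_of:
 assumes "has_definable_basis L M n \<rho>"
 obtains p X Y where "dfb (n + p) X" "dfb p Y"
  "!!y. y : Y ==> openin \<rho> {x : TT n. tcat n x p y : X}"
  "!!W x. openin \<rho> W ==> x : W ==>
   EX y:Y. x : {x : TT n. tcat n x p y : X} & {x : TT n. tcat n x p y : X} <= W"
proof -
 obtain F where F: "definable_family L M n F" "openin \<rho> = arbitrary union_of (%B. B : F)"
  using assms unfolding has_definable_basis_def by blast
 obtain p X Y where XY: "dfb (n + p) X" "dfb p Y" "F = (%y. {x : TT n. tcat n x p y : X}) ` Y"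
  using F(1) unfolding definable_family_def by blast
 have "openin \<rho> {x : TT n. tcat n x p y : X}" if "y : Y" for y
  unfolding F(2) by (rule arbitrary_union_of_inc) (use that XY(3) in blast)
 moreover have "EX y:Y. x : {x : TT n. tcat n x p y : X} & {x : TT n. tcat n x p y : X} <= W"
  if "openin \<rho> W" "x : W" for W x
 proof -
  have "EX B. B : F & x : B & B <= W" using that unfolding F(2) arbitrary_union_of_alt by blast
  then obtain B where "B : F" "x : B" "B <= W" by blast
  thus ?thesis unfolding XY(3) image_iff by blast
 qed
 ultimately show thesis using that[OF XY(1,2)] by blast
qed

text \<open>t-minimality provides a definable basis only on \<open>M^1\<close>. Boxes built from it
  form a definable family on every power, indexed by concatenated indices, which is what makes
  interiors definable.\<close>

lemma basis_code_exists: "EX c. basis_code n c"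
proof (induction n)
 case 0
 have "dfb (0 + 0) (TT 0)" "dfb 0 (TT 0)" using definable_tuples[of 0] by (simp_all only: add_0)
 moreover have "{x : TT 0. tcat 0 x 0 y : TT 0} = TT 0" for y :: "nat => 'a" by (auto simp: tcat_def)
 moreover have "EX y:TT 0. x : TT 0 & TT 0 <= W" if "opn 0 W" "x : W" for W x
  using openin_PT_subset[OF that(1)] that(2) by auto
 ultimately have "basis_code 0 (0, TT 0, TT 0)" unfolding basis_code_def prod.case using openin_TT by metis
 thus ?case by blast
next
 case (Suc n)
 obtain p X Y where XY: "dfb (n + p) X" "dfb p Y"
  "!!y. y : Y ==> opn n {x : TT n. tcat n x p y : X}"
  "!!W x. opn n W ==> x : W ==>
   EX y:Y. x : {x : TT n. tcat n x p y : X} & {x : TT n. tcat n x p y : X} <= W"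
  using Suc unfolding basis_code_def by (auto split: prod.splits)
 have "has_definable_basis L M 1 (PT 1)" using tmt by (simp add: t_minimal_topology_def)
 then obtain q X' Y' where XY': "dfb (1 + q) X'" "dfb q Y'"
  "!!y. y : Y' ==> opn 1 {x : TT 1. tcat 1 x q y : X'}"
  "!!W x. opn 1 W ==> x : W ==>
   EX y:Y'. x : {x : TT 1. tcat 1 x q y : X'} & {x : TT 1. tcat 1 x q y : X'} <= W"
  by (rule basis_code_of) blast
 let ?A = "%z. tcat n (tfst n (tfst (n + 1) z)) p (tfst p (tsnd (n + 1) (p + q) z))"
 let ?B = "%z. tcat 1 (tsnd n 1 (tfst (n + 1) z)) q (tsnd p q (tsnd (n + 1) (p + q) z))"
 let ?X = "{z : TT (n + 1 + (p + q)). ?A z : X & ?B z : X'}"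
 let ?Y = "{y : TT (p + q). tfst p y : Y & tsnd p q y : Y'}"
 have X: "dfb (n + 1 + (p + q)) ?X"
  by (rule definableI[OF refl]) (rule dint XY(1) XY'(1) | (simp; fail)[1])+
 have Y: "dfb (p + q) ?Y" using XY XY' by (intro definable_times)
 have eq: "{x : TT (n + 1). tcat (n + 1) x (p + q) y : ?X} =
  Box n {x : TT n. tcat n x p (tfst p y) : X} 1 {x : TT 1. tcat 1 x q (tsnd p q y) : X'}" if "y : TT (p + q)" for y
  using that by (auto simp: Box_def simp del: One_nat_def)
 have "basis_code (n + 1) (p + q, ?X, ?Y)"
  unfolding basis_code_def prod.case
 proof (intro conjI X Y ballI allI impI)
  fix y assume y: "y : ?Y"
  thus "opn (n + 1) {x : TT (n + 1). tcat (n + 1) x (p + q) y : ?X}"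
   by (subst eq) (auto intro!: open_Box XY XY' simp del: One_nat_def)
 next
  fix W z assume "opn (n + 1) W & z : W"
  hence W: "opn (n + 1) W" "z : W" by auto
  have z: "z : TT (n + 1)" using W openin_PT_subset by blast
  obtain U V where UV: "opn n U" "opn 1 V" "tfst n z : U" "tsnd n 1 z : V" "Box n U 1 V <= W"
   using Box_subset[OF W] by blast
  obtain a where a: "a : Y" "tfst n z : {x : TT n. tcat n x p a : X}" "{x : TT n. tcat n x p a : X} <= U"
   using XY(4)[OF UV(1,3)] by blast
  obtain b where b: "b : Y'" "tsnd n 1 z : {x : TT 1. tcat 1 x q b : X'}" "{x : TT 1. tcat 1 x q b : X'} <= V"
   using XY'(4)[OF UV(2,4)] by blast
  have ab1: "a : TT p" by (rule subsetD[OF definable_subset[OF XY(2)] a(1)])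
  have ab2: "b : TT q" by (rule subsetD[OF definable_subset[OF XY'(2)] b(1)])
  note ab = ab1 ab2
  let ?y = "tcat p a q b"
  have y: "?y : ?Y" using ab a(1) b(1) by simp
  let ?C = "Box n {x : TT n. tcat n x p a : X} 1 {x : TT 1. tcat 1 x q b : X'}"
  have E: "{x : TT (n + 1). tcat (n + 1) x (p + q) ?y : ?X} = ?C"
   using eq[OF tcat_in[OF ab1 ab2]] by (simp only: tfst_tcat[OF ab1] tsnd_tcat[OF ab2])
  have "z : ?C" unfolding Box_def mem_Collect_eq using z a(2) b(2) unfolding mem_Collect_eq by (elim conjE, intro conjI)
  moreover have "?C <= W"
  proof (rule subset_trans[OF _ UV(5)], rule subsetI)
   fix w assume "w : ?C"
   thus "w : Box n U 1 V" using a(3) b(3) unfolding Box_def mem_Collect_eq by (elim conjE) (intro conjI; blast)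
  qed
  ultimately show "EX y:?Y. z : {x : TT (n + 1). tcat (n + 1) x (p + q) y : ?X} &
   {x : TT (n + 1). tcat (n + 1) x (p + q) y : ?X} <= W"
   by (intro bexI[OF _ y] conjI) (subst E, assumption)+
 qed
 thus ?case by (intro exI) (simp only: Suc_eq_plus1)
qed

definition "bcode n = (SOME c. basis_code n c)"
definition "BP n = fst (bcode n)"
definition "BX n = fst (snd (bcode n))"
definition "BY n = snd (snd (bcode n))"
definition "BB n y = {x : TT n. tcat n x (BP n) y : BX n}"

lemma basis_facts:
 "dfb (n + BP n) (BX n)" "dfb (BP n) (BY n)"
 "y : BY n ==> opn n (BB n y)"
 "opn n W ==> x : W ==> EX y:BY n. x : BB n y & BB n y <= W"
proof -
 have "basis_code n (bcode n)" unfolding bcode_def by (rule someI_ex[OF basis_code_exists])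
 hence b: "basis_code n (BP n, BX n, BY n)" by (simp add: BP_def BX_def BY_def)
 note b = b[unfolded basis_code_def prod.case, folded BB_def]
 show "dfb (n + BP n) (BX n)" "dfb (BP n) (BY n)" using b by blast+
 show "y : BY n ==> opn n (BB n y)" using b by blast
 show "opn n W ==> x : W ==> EX y:BY n. x : BB n y & BB n y <= W" using b by blast
qed

lemma BY_in: "y : BY n ==> y : TT (BP n)" using basis_facts(2) definable_subset by blast

lemma dfb_BB: "y : BY n ==> dfb n (BB n y)"
 unfolding BB_def
 by (rule definableI[OF refl], (rule dint basis_facts(1) | (simp add: BY_in; fail)[1])+)

lemma D_BB:
 assumes "DT Ga n t" "DT Ga (BP n) s" "wfc Ga"
 shows "D Ga (%x. t x : BB n (s x))"
 unfolding BB_def mem_Collect_eq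
 by (rule dint basis_facts(1) assms)+

lemma interior_iff: "x : PT n interior_of S \<longleftrightarrow> (EX y:BY n. x : BB n y & BB n y <= S)"
 
proof
 assume "x : PT n interior_of S"
 then obtain W where "opn n W" "x : W" "W <= S" unfolding interior_of_def by blast
 moreover from this obtain y where "y : BY n" "x : BB n y" "BB n y <= W" using basis_facts(4)[of n W x] by blast
 ultimately show "EX y:BY n. x : BB n y & BB n y <= S" by blast
next
 assume "EX y:BY n. x : BB n y & BB n y <= S"
 then obtain y where y: "y : BY n" "x : BB n y" "BB n y <= S" by blast
 show "x : PT n interior_of S" using interior_of_maximal[OF y(3) basis_facts(3)[OF y(1)]] y(2) by blast
qed

text \<open>By \<open>interior_iff\<close> being an interior point is a quantification over the
  basis indices in \<open>BY n\<close>; so interiors of the members of a definable family are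
  definable uniformly in the parameters.\<close>

lemma D_interior:
 assumes t: "DT Ga n t" and w: "wfc Ga" and R: "D (cx (cx Ga (BP n) (BY n)) n (TT n)) (%p. R (fst (fst p)) (snd p))"
 shows "D Ga (%g. t g : PT n interior_of {x : TT n. R g x})"
proof -
 have "D Ga (%g. EX y:BY n. t g : BB n y & (ALL x:TT n. x : BB n y --> R g x))"
  by (rule D_BB t w R dint basis_facts(2) | (simp add: basis_facts(2) w; fail)[1])+
 thus ?thesis
  by (rule D_cong) (auto simp: interior_iff BB_def)
qed

lemma dfb_interior:
 assumes "dfb n S" shows "dfb n (PT n interior_of S)"
proof -
 have "D (c0 n (TT n)) (%g. g : PT n interior_of {x : TT n. x : S})"
  by (rule D_interior, (rule dint assms basis_facts(2) | (simp add: basis_facts(2); fail)[1])+)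
 moreover have "{x : TT n. x : S} = S" using definable_subset[OF assms] by blast
 moreover have "PT n interior_of S <= TT n" using openin_PT_subset[OF openin_interior_of] .
 ultimately show ?thesis by (intro definableI[of _ "TT n"]) auto
qed

lemma definable_nbhd:
 assumes "opn n W" "x : W"
 obtains V where "opn n V" "dfb n V" "x : V" "V <= W"
 using basis_facts(4)[OF assms] basis_facts(3)[of _ n] dfb_BB by blast

lemma definable_Box:
 assumes "opn (n + m) W" "z : W"
 obtains U V where "opn n U" "opn m V" "dfb n U" "dfb m V" "tfst n z : U" "tsnd n m z : V" "Box n U m V <= W"
proof -
 obtain U V where UV: "opn n U" "opn m V" "tfst n z : U" "tsnd n m z : V" "Box n U m V <= W"
  using Box_subset[OF assms] .
 obtain U' where "opn n U'" "dfb n U'" "tfst n z : U'" "U' <= U" using definable_nbhd[OF UV(1,3)] .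
 moreover obtain V' where "opn m V'" "dfb m V'" "tsnd n m z : V'" "V' <= V" using definable_nbhd[OF UV(2,4)] .
 ultimately show thesis using UV(5) by (intro that[of U' V']) (auto simp: Box_def)
qed

text \<open>The countably many formulas use only countably many parameters, fewer than
  \<open>\<kappa>\<close>. As the sets decrease, finite satisfiability is the non-emptiness of a
  single member.\<close>

lemma sat1:
 assumes F: "!!N. dfb 1 (F N)" "!!N. F N ~= {}" and dec: "!!N. F (Suc N) <= F N"
 shows "EX x. ALL N::nat. x : F N"
proof -
 have "ALL N. EX c. wf_form L (fst c) & range (snd c) <= UU & F N = {x : TT 1. sat M (%j. if j < 1 then x j else snd c j) (fst c)}"
  using F(1) unfolding definable_def by (simp only: split_paired_Ex fst_conv snd_conv) blast
 from choice[OF this] obtain c where c: "!!N. wf_form L (fst (c N)) & range (snd (c N)) <= UU &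
  F N = {x : TT 1. sat M (%j. if j < 1 then x j else snd (c N) j) (fst (c N))}" by blast
 define \<phi> where "\<phi> N = fst (c N)" for N
 define e where "e N = snd (c N)" for N
 have pe: "!!N. wf_form L (\<phi> N)" "!!N. range (e N) <= UU"
  "!!N. F N = {x : TT 1. sat M (%j. if j < 1 then x j else e N j) (\<phi> N)}"
  using c unfolding \<phi>_def e_def by blast+
 let ?A = "\<Union>N. range (e N)"
 let ?p = "range (%N. (\<phi> N, e N))"
 have mem: "(\<lambda>j\<in>{..<1}. a) : F N \<longleftrightarrow> sat M ((e N)(0 := a)) (\<phi> N)" if "a : UU" for a N
 proof -
  have "(%j. if j < 1 then (\<lambda>j\<in>{..<1}. a) j else e N j) = (e N)(0 := a)" by (auto simp: fun_eq_iff)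
  moreover have "(\<lambda>j\<in>{..<1}. a) : TT 1" using that by (auto simp: tuples_def)
  ultimately show ?thesis unfolding pe(3) by (simp del: One_nat_def)
 qed
 have anti: "N \<le> N' ==> F N' <= F N" for N N' using lift_Suc_antimono_le[of F] dec by blast
 have "countable ?A" by auto
 hence "|?A| \<le>o natLeq" by (rule countable_natLeq)
 hence "|?A| <o \<kappa>" using kappa ordLeq_ordLess_trans by blast
 moreover have "EX a:UU. ALL (\<phi>, e):q. sat M (e(0 := a)) \<phi>" if q: "q <= ?p" "finite q" for q
 proof -
  obtain J where J: "finite J" "q = (%N. (\<phi> N, e N)) ` J" using finite_subset_image[OF q(2,1)] by auto
  obtain N where N: "ALL j:J. j \<le> N" using J(1) finite_nat_set_iff_bounded_le by blast
  obtain x where x: "x : F N" using F(2) by blast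
  hence x1: "x : TT 1" using F(1) definable_subset by blast
  hence "x 0 : UU" "x = (\<lambda>j\<in>{..<1}. x 0)" by (auto simp: tuples_def PiE_iff extensional_def fun_eq_iff)
  have "sat M ((e j)(0 := x 0)) (\<phi> j)" if "j : J" for j
  proof -
   have "x : F j" using x anti[of j N] N that by blast
   thus ?thesis using mem[OF `x 0 : UU`, of j] \<open>x = (\<lambda>j\<in>{..<1}. x 0)\<close> by simp
  qed
  thus ?thesis using `x 0 : UU` unfolding J(2) by (intro bexI[of _ "x 0"]) auto
 qed
 moreover have "?A <= UU" using pe(2) by (intro UN_least)
 moreover have "ALL (\<phi>, e):?p. wf_form L \<phi> & e ` (free_vars \<phi> - {0}) <= ?A"
  using pe(1) by (clarsimp, blast)
 ultimately have "EX a:UU. ALL (\<phi>, e):?p. sat M (e(0 := a)) \<phi>"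
  using sat[unfolded saturated_def, THEN spec[of _ ?A], THEN spec[of _ ?p]] by blast
 then obtain a where a: "a : UU" "!!N. sat M ((e N)(0 := a)) (\<phi> N)" by auto
 have "(\<lambda>j\<in>{..<1}. a) : F N" for N using a(2) mem[OF a(1)] by blast
 thus ?thesis by blast
qed

text \<open>Saturation concerns one variable. The first coordinate is found by \<open>sat1\<close>
  for the projections, which are definable, non-empty and decreasing; the others follow by induction
  in the fibre above it.\<close>

lemma sat_k:
 assumes F: "!!N. dfb k (F N)" "!!N. F N ~= {}" and dec: "!!N. F (Suc N) <= F N"
 shows "EX x. ALL N::nat. x : F N"
 using assms
proof (induction k arbitrary: F)
 case 0
 have "(%_. undefined) : F N" for N
  using 0(1,2)[of N] definable_subset[of 0 "F N"] by auto
 thus ?case by blast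
next
 case (Suc k)
 have d: "dfb (1 + k) (F N)" for N using Suc.prems(1)[of N] by simp
 have ne: "{x : TT 1. EX y:TT k. tcat 1 x k y : F N} ~= {}" for N
 proof -
  obtain z where z: "z : F N" using Suc.prems(2) by blast
  hence "z : TT (1 + k)" using definable_subset[OF d] by blast
  thus ?thesis using z by (auto intro!: exI[of _ "tfst 1 z"] bexI[of _ "tsnd 1 k z"] simp del: One_nat_def plus_1_eq_Suc)
 qed
 obtain x where x: "!!N. x : {x : TT 1. EX y:TT k. tcat 1 x k y : F N}"
  using sat1[of "%N. {x : TT 1. EX y:TT k. tcat 1 x k y : F N}"] definable_proj[OF d] ne Suc.prems(3) by blast
 have "EX y. ALL N. y : {y : TT k. tcat 1 x k y : F N}"
 proof (rule Suc.IH)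
  show "dfb k {y : TT k. tcat 1 x k y : F N}" for N using x by (intro dfb_fiber d) blast
  show "{y : TT k. tcat 1 x k y : F N} ~= {}" for N using x[of N] by blast
  show "{y : TT k. tcat 1 x k y : F (Suc N)} <= {y : TT k. tcat 1 x k y : F N}" for N using Suc.prems(3) by blast
 qed
 thus ?case by blast
qed

text \<open>Compactness: if the fibres were unbounded, the sets of parameters with at least
  \<open>N\<close> fibre points would be non-empty and decreasing, and a common element would have
  an infinite fibre.\<close>

lemma uniform_finiteness:
 assumes X: "dfb (p + k) X" and Y: "dfb p Y"
  and fin: "!!u. u : Y ==> finite {x : TT k. tcat p u k x : X}"
 obtains N where "!!u. u : Y ==> card {x : TT k. tcat p u k x : X} \<le> N"
proof (rule ccontr)
 assume "\<not> thesis"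
 hence n: "EX u:Y. \<not> card {x : TT k. tcat p u k x : X} \<le> N" for N using that by blast
 let ?F = "%N. {u : Y. atleast N {x : TT k. tcat p u k x : X}}"
 have "EX u. ALL N. u : ?F N"
 proof (rule sat_k)
  show "dfb p (?F N)" for N
   by (rule definableI[OF refl], rule D_atleast, (rule dint X Y | (simp add: Y; fail)[1])+)
  show "?F N ~= {}" for N using n[of N] unfolding atleast_def by (auto intro: less_imp_le)
  show "?F (Suc N) <= ?F N" for N by (auto simp: atleast_def)
 qed
 then obtain u where u: "u : Y" "!!N. atleast N {x : TT k. tcat p u k x : X}" by blast
 show False using u(2)[of "Suc (card {x : TT k. tcat p u k x : X})"] fin[OF u(1)] unfolding atleast_def by simp
qed

lemma infinite_iff_interior: "dfb 1 S ==> PT 1 interior_of S ~= {} \<longleftrightarrow> infinite S"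
 using tmt by (simp add: t_minimal_topology_def)

lemma infinite_open1: "opn 1 W ==> W ~= {} ==> infinite W"
proof -
 assume "opn 1 W" "W ~= {}"
 then obtain x V where "opn 1 V" "dfb 1 V" "x : V" "V <= W" using definable_nbhd by (metis ex_in_conv)
 hence "infinite V" using infinite_iff_interior[of V] interior_of_openin[of "PT 1" V] by auto
 thus ?thesis using `V <= W` finite_subset by blast
qed

lemma TT_ne: "TT n ~= {}" using UU_ne by (simp add: tuples_def PiE_eq_empty_iff)

text \<open>What niceness discards has smaller dimension, so by this lemma it cannot be all of a
  non-empty open set.\<close>

lemma tdim_open:
 assumes "opn n U" "U ~= {}" shows "\<not> tdim \<tau> n U < ereal (real n)"
proof -
 let ?K = "{k. EX io. strict_mono_on {..<k} io & io ` {..<k} <= {..<n} &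
   PT k interior_of ((%x. \<lambda>j \<in> {..<k}. x (io j)) ` U) ~= {}}"
 have "k \<le> n" if "k : ?K" for k
 proof -
  obtain io where "strict_mono_on {..<k} io" "io ` {..<k} <= {..<n}" using `k : ?K` by blast
  thus "k \<le> n" using card_inj_on_le[of io "{..<k}" "{..<n}"] strict_mono_on_imp_inj_on by fastforce
 qed
 hence fin: "finite ?K" using finite_nat_set_iff_bounded_le by auto
 have "(%x. \<lambda>j\<in>{..<n}. x j) ` U = U" using openin_PT_subset[OF assms(1)] by (force simp: image_iff)
 hence "n : ?K" using assms interior_of_openin[OF assms(1)]
  by (auto intro!: exI[of _ "%j. j"] simp: strict_mono_on_def)
 hence "n \<le> Max ?K" using fin by simp
 thus ?thesis using assms(2) unfolding tdim_def by simp
qed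

lemma nice_correspondence:
 assumes U: "opn n U" "dfb n U" "U ~= {}"
  and f: "!!x. x : U ==> f x <= TT m & finite (f x) & card (f x) = k"
  and Df: "D (cx (c0 n U) m (TT m)) (%p. snd p : f (fst p))"
 obtains U0 where "opn n U0" "dfb n U0" "U0 ~= {}" "U0 <= U"
  "ALL x:U0. EX W g. opn n W & x : W & W <= U0 &
   (ALL i<k. cont n W m (g i)) & (ALL z:W. f z = (%i. g i z) ` {..<k})"
proof -
 have Us: "U <= TT n" using U(2) definable_subset by blast
 have "corr_graph n U m f = {z : {z : TT (n + m). tfst n z : U & tsnd n m z : TT m}. tsnd n m z : f (tfst n z)}"
 proof (intro Set.set_eqI iffI)
  fix z assume "z : corr_graph n U m f"
  then obtain x y where "z = tcat n x m y" "x : U" "y : f x" unfolding corr_graph_def by blast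
  moreover from this have "x : TT n" "y : TT m" using f Us by auto
  ultimately show "z : {z : {z : TT (n + m). tfst n z : U & tsnd n m z : TT m}. tsnd n m z : f (tfst n z)}" by auto
 next
  fix z assume "z : {z : {z : TT (n + m). tfst n z : U & tsnd n m z : TT m}. tsnd n m z : f (tfst n z)}"
  hence "z = tcat n (tfst n z) m (tsnd n m z) & tfst n z : U & tsnd n m z : f (tfst n z)" by auto
  thus "z : corr_graph n U m f" unfolding corr_graph_def by blast
 qed
 hence "dfb (n + m) (corr_graph n U m f)" using Df unfolding D_def cx_def c0_def by simp
 moreover have "correspondence k U (TT m) f" using f unfolding correspondence_def by blast
 ultimately obtain U0 where U0: "U0 <= U" "dfb n U0" "opn n U0"
  "continuous_correspondence k (sbt n U0) (PT m) f" "tdim \<tau> n (U - U0) < ereal (real n)"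
  using nice[unfolded nice_def, rule_format, of n U k m f] U by (simp only: simp_thms) blast
 have "U0 ~= {}" using U0(5) tdim_open[OF U(1,3)] by auto
 moreover have "EX W g. opn n W & x : W & W <= U0 &
   (ALL i<k. cont n W m (g i)) & (ALL z:W. f z = (%i. g i z) ` {..<k})" if "x : U0" for x
 proof -
  have "x : topspace (sbt n U0)" using that openin_subset[OF U0(3)] by auto
  from U0(4)[unfolded continuous_correspondence_def, rule_format, OF this]
  obtain W g where W: "openin (sbt n U0) W" "x : W"
   "ALL i<k. continuous_map (subtopology (sbt n U0) W) (PT m) (g i)" "ALL z:W. f z = (%i. g i z) ` {..<k}"
   by (elim exE conjE)
  hence "opn n W" "W <= U0" using openin_open_subtopology[OF U0(3)] by auto
  moreover from this have "subtopology (sbt n U0) W = sbt n W"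
   by (simp add: subtopology_subtopology Int_absorb1)
  ultimately show ?thesis using W by auto
 qed
 ultimately show thesis using that[of U0] U0(1-3) by simp
qed

lemma nice_function:
 assumes U: "opn n U" "U ~= {}" and f: "dfn n U m f"
 obtains U0 where "opn n U0" "dfb n U0" "U0 ~= {}" "U0 <= U" "cont n U0 m f"
proof -
 have d: "dfb n U" and t: "DT (c0 n U) m f" using f by (auto simp: dfn_def)
 have 1: "{f x} <= TT m & finite {f x} & card {f x} = 1" if "x : U" for x using dfnD(2)[OF f that] by auto
 have 2: "D (cx (c0 n U) m (TT m)) (%p. snd p : {f (fst p)})" using DT_D[OF t] by simp
 obtain U0 where U0: "opn n U0" "dfb n U0" "U0 ~= {}" "U0 <= U"
  and loc: "ALL x:U0. EX W g. opn n W & x : W & W <= U0 &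
   (ALL i<(1::nat). cont n W m (g i)) & (ALL z:W. {f z} = (%i. g i z) ` {..<(1::nat)})"
  by (rule nice_correspondence[OF U(1) d U(2) 1 2]) (assumption, rule that)
 have "cont n U0 m f"
 proof -
  have "EX W. openin (sbt n U0) W & x : W & continuous_map (subtopology (sbt n U0) W) (PT m) f"
   if x: "x : topspace (sbt n U0)" for x
  proof -
   have "x : U0" using x by auto
   then obtain W g where W: "opn n W" "x : W" "W <= U0"
   "ALL i<1::nat. cont n W m (g i)" "ALL z:W. {f z} = (%i. g i z) ` {..<1}"
   using bspec[OF loc \<open>x \<in> U0\<close>] by (elim exE conjE)
   hence "cont n W m f"
   by (intro continuous_map_eq[where f = "g 0" and g = f]) auto
   moreover have "subtopology (sbt n U0) W = sbt n W"
   using W(3) by (simp add: subtopology_subtopology Int_absorb1)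
   moreover have "openin (sbt n U0) W" using W U0(1) by (simp add: openin_open_subtopology)
   ultimately show ?thesis using W(2) by (intro exI[of _ W]) simp
  qed
  thus ?thesis by (rule continuous_map_locally)
 qed
 thus thesis using that U0 by blast
qed

end

section \<open>Dimension theory\<close>

lemma open_preimage:
 assumes "openin X U" "continuous_map (subtopology X U) Y f" "openin Y V"
 shows "openin X {z : U. f z : V}"
proof -
 have eq: "topspace (subtopology X U) = U" using openin_subset[OF assms(1)] by auto
 have "openin (subtopology X U) {z : topspace (subtopology X U). f z : V}"
  using openin_continuous_map_preimage[OF assms(2,3)] .
 thus ?thesis unfolding eq by (rule openin_trans_full[OF _ assms(1)])
qed

context fo_structure begin

lemmas tcat_simps [simp] = tfst_tcat[where M = M] tsnd_tcat[where M = M] tcat_tfst_tsnd[where M = M]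

definition upd :: "nat => (nat => 'a) => (nat => 'a) => (nat => 'a)" where
 "upd i x c = x(i := c 0)"

definition prj :: "nat => (nat => nat) => (nat => 'a) => (nat => 'a)" where
 "prj e io x = (\<lambda>j\<in>{..<e}. x (io j))"

lemma prj_in: "x : TT n ==> io ` {..<e} <= {..<n} ==> prj e io x : TT e"
 unfolding prj_def tuples_def by (auto simp: PiE_iff image_subset_iff)

lemma DT_prj: "io ` {..<e} <= {..<n} ==> DT Ga n t ==> wfc Ga ==> DT Ga e (%x. prj e io (t x))"
 unfolding prj_def by (rule DT_sel) auto

lemma dfn_prj: "io ` {..<e} <= {..<n} ==> dfb n P ==> dfn n P e (prj e io)"
 using DT_prj[OF _ DT_var0, of io e n P] by (auto intro: dfnI)

lemma DT_upd:
 assumes "i < k" "DT Ga k t" "DT Ga 1 c" "wfc Ga"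
 shows "DT Ga k (%x. upd i (t x) (c x))"
proof (rule DT_I)
 let ?s = "%j. if j = i then Inl k else Inl j"
 have 1: "DT Ga k (%x. tsub k ?s (tcat k (t x) 1 (c x)))"
  by (rule DT_tsub[OF DT_tcat]) (use assms in \<open>auto simp: sok_def\<close>)
 have eq: "tsub k ?s (tcat k (t x) 1 (c x)) = upd i (t x) (c x)" if "x : cset Ga" for x
 proof -
  have "t x : TT k" using assms(2) that by (rule DT_in)
  thus ?thesis using assms(1)
   by (auto simp: tsub_def vval_def tcat_def upd_def fun_eq_iff tuples_def PiE_iff extensional_def)
 qed
 show "D (cx Ga k (TT k)) (%p. snd p = upd i (t (fst p)) (c (fst p)))"
  by (rule D_cong[OF DT_D[OF 1]]) (use eq assms in auto)
 show "upd i (t x) (c x) : TT k" if "x : cset Ga" for x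
  using eq[OF that] DT_in[OF 1 that] by simp
qed (rule assms)

end

context tmin begin

lemma interior_neI: "opn n W ==> W ~= {} ==> W <= S ==> PT n interior_of S ~= {}"
 using interior_of_maximal[of W S "PT n"] by blast

lemma finite_Diff_interior: "dfb 1 S ==> finite (S - PT 1 interior_of S)"
proof (rule ccontr)
 assume S: "dfb 1 S" "infinite (S - PT 1 interior_of S)"
 have "dfb 1 (S - PT 1 interior_of S)" by (intro definable_Diff dfb_interior S)
 hence "PT 1 interior_of (S - PT 1 interior_of S) ~= {}" using S(2) infinite_iff_interior by blast
 moreover have "PT 1 interior_of (S - PT 1 interior_of S) <= PT 1 interior_of S" by (rule interior_of_mono) blast
 moreover have "PT 1 interior_of (S - PT 1 interior_of S) <= S - PT 1 interior_of S" by (rule interior_of_subset)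
 ultimately show False by blast
qed

text \<open>Niceness, applied to a function with two values, shows that the definable sets with empty
 interior form an ideal.\<close>

lemma two_set_interior:
 assumes U: "opn n U" "dfb n U" "U ~= {}" and X: "dfb n X"
 shows "PT n interior_of (U \<inter> X) ~= {} \<or> PT n interior_of (U - X) ~= {}"
proof -
 have "infinite (TT 1)" by (rule infinite_open1[OF openin_TT TT_ne])
 then obtain a where a: "a : TT 1" by (metis finite.emptyI ex_in_conv)
 have "infinite (TT 1 - {a})" using `infinite (TT 1)` by simp
 then obtain b where b: "b : TT 1" "a ~= b" by (metis Diff_iff finite.emptyI ex_in_conv insertI1)
 \<comment> \<open>Where \<open>?f\<close> is continuous, disjoint neighbourhoods of its two values
   make it locally constant; a small open set then lies inside \<open>X\<close> or misses
   it.\<close>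
 let ?f = "%x. if x : X then a else b"
 have "dfn n U 1 ?f"
 proof (rule dfnI[OF U(2)], rule DT_I)
  have "D (cx (c0 n U) 1 (TT 1)) (%p. fst p : X & snd p = a \<or> \<not> fst p : X & snd p = b)"
   by (rule dint X U(2) | (simp add: U(2) a b del: One_nat_def; fail)[1])+
  thus "D (cx (c0 n U) 1 (TT 1)) (%p. snd p = ?f (fst p))" by (rule D_cong) auto
 qed (use a b U in auto)
 then obtain U0 where U0: "opn n U0" "dfb n U0" "U0 ~= {}" "U0 <= U"
  "cont n U0 1 ?f"
  by (rule nice_function[OF U(1,3)])
 have "a : topspace (PT 1)" "b : topspace (PT 1)" using a b unfolding topspace_PT by auto
 then obtain A B where AB: "opn 1 A" "opn 1 B" "a : A" "b : B" "disjnt A B"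
  using Hausdorff_PT[of 1] b(2) unfolding Hausdorff_space_def by blast
 obtain z where z: "z : U0" using U0(3) by blast
 show ?thesis
 proof (cases "z : X")
  case True
  have "PT n interior_of (U \<inter> X) ~= {}"
   by (rule interior_neI[OF open_preimage[OF U0(1,5) AB(1)]])
   (use AB z True U0(4) in \<open>auto simp: disjnt_def split: if_splits\<close>)
  thus ?thesis ..
 next
  case False
  have "PT n interior_of (U - X) ~= {}"
   by (rule interior_neI[OF open_preimage[OF U0(1,5) AB(2)]])
   (use AB z False U0(4) in \<open>auto simp: disjnt_def split: if_splits\<close>)
  thus ?thesis ..
 qed
qed

lemma partition_interior_aux:
 assumes "finite I" "opn n U" "dfb n U" "U ~= {}"
  "!!i. i : I ==> dfb n (X i)" "U <= (\<Union>i\<in>I. X i)"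
 shows "EX i:I. PT n interior_of (U \<inter> X i) ~= {}"
 using assms
proof (induction I arbitrary: U rule: finite_induct)
 case (insert i I)
 consider "PT n interior_of (U \<inter> X i) ~= {}" | "PT n interior_of (U - X i) ~= {}"
  using two_set_interior[OF insert.prems(1-3), of "X i"] insert.prems(4) by blast
 thus ?case
 proof cases
  case 2
  let ?V = "PT n interior_of (U - X i)"
  have sub: "?V <= U - X i" by (rule interior_of_subset)
  have "dfb n ?V" by (intro dfb_interior definable_Diff insert.prems) simp
  hence "EX j:I. PT n interior_of (?V \<inter> X j) ~= {}"
   using insert.prems 2 sub by (intro insert.IH) auto
  then obtain j where j: "j : I" "PT n interior_of (?V \<inter> X j) ~= {}" by blast
  moreover have "PT n interior_of (?V \<inter> X j) <= PT n interior_of (U \<inter> X j)"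
   by (rule interior_of_mono) (use sub in blast)
  ultimately show ?thesis by blast
 qed blast
qed auto

lemma partition_interior:
 assumes "finite I" "opn n U" "dfb n U" "U ~= {}"
  "!!i. i : I ==> dfb n (X i)" "U <= (\<Union>i\<in>I. X i)"
 obtains i V where "i : I" "opn n V" "dfb n V" "V ~= {}" "V <= U" "V <= X i"
proof -
 obtain i where i: "i : I" "PT n interior_of (U \<inter> X i) ~= {}" using partition_interior_aux[OF assms] by blast
 have "dfb n (PT n interior_of (U \<inter> X i))" by (intro dfb_interior definable_Int assms i)
 thus thesis using that[of i "PT n interior_of (U \<inter> X i)"] i interior_of_subset[of "PT n" "U \<inter> X i"] by auto
qed

text \<open>The following property replaces definable choice: a definable family covering all finite
 subsets of an open set has a member with non-empty interior.\<close>

definition dirint :: "nat => bool" where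
 "dirint k \<longleftrightarrow> (ALL p V S T. opn k V & dfb k V & V ~= {} & dfb (k + p) S & dfb p T &
   (ALL A. finite A & A <= V --> (EX t:T. ALL x:A. tcat k x p t : S)) -->
   (EX t:T. PT k interior_of {x : TT k. tcat k x p t : S} ~= {}))"

lemma dirintD:
 assumes "dirint k" "opn k V" "dfb k V" "V ~= {}" "dfb (k + p) S" "dfb p T"
  "!!A. finite A ==> A <= V ==> EX t:T. ALL x:A. tcat k x p t : S"
 shows "EX t:T. PT k interior_of {x : TT k. tcat k x p t : S} ~= {}"
proof -
 have "ALL A. finite A & A <= V --> (EX t:T. ALL x:A. tcat k x p t : S)" using assms(7) by simp
 with assms(2-6) show ?thesis using assms(1)[unfolded dirint_def, THEN spec[of _ p], THEN spec[of _ V], THEN spec[of _ S], THEN spec[of _ T]]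
  by simp
qed

text \<open>The basic neighbourhood of \<open>a\<close> inside the fibre varies with
  \<open>w\<close> and cannot be chosen definably. But finitely many \<open>w\<close> share a
  smaller basic neighbourhood, so \<open>dirint k\<close> yields one index \<open>t\<close> that
  serves an open set of \<open>w\<close>, and the product of the two is an open box in
  \<open>S\<close>.\<close>

lemma interior_section_aux:
 assumes C: "dirint k" and W: "opn k W" "dfb k W" "W ~= {}" and S: "dfb (k + 1) S" and a: "a : TT 1"
  and int: "!!w. w : W ==> a : PT 1 interior_of {x : TT 1. tcat k w 1 x : S}"
 shows "PT (k + 1) interior_of S ~= {}"
proof -
 let ?S = "{w : TT (k + BP 1). ALL x:TT 1. x : BB 1 (tsnd k (BP 1) w) --> tcat k (tfst k w) 1 x : S}"
 let ?T = "{s : BY 1. a : BB 1 s}"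
 have Ws: "W <= TT k" using W(2) definable_subset by blast
 have "EX t:?T. PT k interior_of {x : TT k. tcat k x (BP 1) t : ?S} ~= {}"
 proof (rule dirintD[OF C W])
  show "dfb (k + BP 1) ?S"
   by (rule definableI[OF refl], (rule D_BB dint S | (simp; fail)[1])+)
  show "dfb (BP 1) ?T"
   by (rule definableI[OF refl], (rule D_BB dint basis_facts(2) | (simp add: basis_facts(2) a del: One_nat_def; fail)[1])+)
  fix A assume A: "finite A" "A <= W"
  have "ALL w:A. EX y. y : BY 1 & a : BB 1 y & BB 1 y <= {x : TT 1. tcat k w 1 x : S}"
   using int A(2) unfolding interior_iff by blast
  from bchoice[OF this] obtain y where y: "!!w. w : A ==> y w : BY 1 & a : BB 1 (y w) & BB 1 (y w) <= {x : TT 1. tcat k w 1 x : S}" by blast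
  let ?I = "TT 1 \<inter> (\<Inter>w\<in>A. BB 1 (y w))"
  have "opn 1 ?I"
  proof (cases "A = {}")
   case False
   thus ?thesis using A(1) y basis_facts(3)[of _ 1] by (intro openin_Int openin_TT openin_Inter) auto
  qed (use openin_TT[of 1] in simp)
  moreover have "a : ?I" using a y by blast
  ultimately obtain t where t: "t : BY 1" "a : BB 1 t" "BB 1 t <= ?I" using basis_facts(4)[of 1 ?I a] by blast
  have "tcat k w (BP 1) t : ?S" if w: "w : A" for w
  proof -
   have wt: "w : TT k" "t : TT (BP 1)" using w A(2) Ws t(1) BY_in by blast+
   have "tcat k w 1 x : S" if "x : BB 1 t" for x using t(3) y[OF w] w that by blast
   thus ?thesis using wt by (simp del: One_nat_def)
  qed
  thus "EX t:?T. ALL x:A. tcat k x (BP 1) t : ?S" using t by blast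
 qed
 then obtain t where t: "t : BY 1" "a : BB 1 t" and ne: "PT k interior_of {x : TT k. tcat k x (BP 1) t : ?S} ~= {}" by blast
 let ?W = "PT k interior_of {x : TT k. tcat k x (BP 1) t : ?S}"
 have tt: "t : TT (BP 1)" using t BY_in by blast
 have o: "opn (k + 1) (Box k ?W 1 (BB 1 t))" using t by (intro open_Box basis_facts) auto
 obtain w where w: "w : ?W" using ne by blast
 have "tcat k w 1 a : Box k ?W 1 (BB 1 t)"
  by (rule tcat_in_Box) (use w t openin_PT_subset[OF openin_interior_of] in \<open>auto simp: BB_def\<close>)
 moreover have "Box k ?W 1 (BB 1 t) <= S"
 proof
  fix z assume "z : Box k ?W 1 (BB 1 t)"
  hence z: "z : TT (k + 1)" "tfst k z : ?W" "tsnd k 1 z : BB 1 t" by (auto simp: Box_def)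
  hence "tcat k (tfst k z) (BP 1) t : ?S" using interior_of_subset[of "PT k" "{x : TT k. tcat k x (BP 1) t : ?S}"] by blast
  hence "tcat k (tfst k z) 1 (tsnd k 1 z) : S" using z tt by (auto simp del: One_nat_def)
  thus "z : S" using z(1) by (simp del: One_nat_def)
 qed
 ultimately show ?thesis using interior_neI[OF o] by blast
qed

text \<open>In the induction step a box \<open>V'\<close> times \<open>V1\<close> is taken inside
  \<open>V\<close>. Each fibre differs from its interior by at most \<open>N\<close> points,
  uniformly. With \<open>N + 1\<close> points \<open>A0\<close> in \<open>V1\<close>, the induction
  hypothesis gives one \<open>t\<close> such that over an open set of \<open>v\<close> the fibre
  contains all of \<open>A0\<close>, hence one of them in its interior. By partition the same
  \<open>a\<close> serves a smaller open set, and \<open>interior_section_aux\<close>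
  applies.\<close>

lemma dirint: "dirint k"
proof (induction k)
 case 0
 show ?case unfolding dirint_def
 proof (intro allI impI, elim conjE)
  fix p V S T
  assume V: "opn 0 V" "V ~= {}" and dir: "ALL A. finite A & A <= V --> (EX t:T. ALL x:A. tcat 0 x p t : S)"
  have V0: "V = TT 0" using V openin_PT_subset[OF V(1)] by auto
  hence "finite V" by simp
  then obtain t where t: "t : T" "ALL x:V. tcat 0 x p t : S" using dir by blast
  hence "V <= {x : TT 0. tcat 0 x p t : S}" using V0 by blast
  thus "EX t:T. PT 0 interior_of {x : TT 0. tcat 0 x p t : S} ~= {}" using interior_neI[OF V] t by blast
 qed
next
 case (Suc k)
 have "dirint (k + 1)" unfolding dirint_def
 proof (intro allI impI, elim conjE)
  fix p V S T
  assume V: "opn (k + 1) V" "dfb (k + 1) V" "V ~= {}" and S: "dfb (k + 1 + p) S" and T: "dfb p T"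
   and dir: "ALL A. finite A & A <= V --> (EX t:T. ALL x:A. tcat (k + 1) x p t : S)"
  obtain z where z: "z : V" using V(3) by blast
  obtain V' V1 where B: "opn k V'" "opn 1 V1" "dfb k V'" "dfb 1 V1" "tfst k z : V'" "tsnd k 1 z : V1" "Box k V' 1 V1 <= V"
   using definable_Box[OF V(1) z] .
  have sub: "V' <= TT k" "V1 <= TT 1" using B definable_subset by blast+
  let ?Sec = "%v t. {x : TT 1. tcat (k + 1) (tcat k v 1 x) p t : S}"
  have dSec: "dfb 1 (?Sec v t)" if "v : TT k" "t : TT p" for v t
   by (rule definableI[OF refl], (rule dint S | (simp add: that; fail)[1])+)
  let ?Bd = "{w : TT (k + p + 1). tsnd (k + p) 1 w : ?Sec (tfst k (tfst (k + p) w)) (tsnd k p (tfst (k + p) w)) &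
   \<not> tsnd (k + p) 1 w : PT 1 interior_of (?Sec (tfst k (tfst (k + p) w)) (tsnd k p (tfst (k + p) w)))}"
  have dBd: "dfb (k + p + 1) ?Bd" unfolding mem_Collect_eq
   by (rule definableI[OF refl], (rule D_interior dint S basis_facts(2) | (simp add: basis_facts(2) del: One_nat_def; fail)[1])+)
  have Bd: "{x : TT 1. tcat (k + p) (tcat k v p t) 1 x : ?Bd} = ?Sec v t - PT 1 interior_of ?Sec v t"
   if "v : TT k" "t : TT p" for v t
   using that by (auto simp del: One_nat_def)
  have "finite {x : TT 1. tcat (k + p) u 1 x : ?Bd}" if u: "u : TT (k + p)" for u
  proof -
   obtain v t where vt: "v : TT k" "t : TT p" "u = tcat k v p t" by (rule tuples_split[OF u])
   show ?thesis unfolding vt(3) Bd[OF vt(1,2)] by (rule finite_Diff_interior[OF dSec[OF vt(1,2)]])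
  qed
  from uniform_finiteness[OF dBd definable_tuples this]
  obtain N where N: "!!u. u : TT (k + p) ==> card {x : TT 1. tcat (k + p) u 1 x : ?Bd} \<le> N" by blast
  \<comment> \<open>One point more than the bound on the non-interior points of a fibre.\<close>
  have "infinite V1" using infinite_open1[OF B(2)] B(6) by blast
  then obtain A0 where A0: "A0 <= V1" "finite A0" "card A0 = Suc N" using infinite_arbitrarily_large by blast
  have A01: "a : TT 1" if "a : A0" for a using that A0 sub by blast
  let ?S' = "{w : TT (k + p). ALL a:A0. tcat (k + 1) (tcat k (tfst k w) 1 a) p (tsnd k p w) : S}"
  have "EX t:T. PT k interior_of {x : TT k. tcat k x p t : ?S'} ~= {}"
  proof (rule dirintD[OF Suc.IH B(1,3) _ _ T])
   show "V' ~= {}" using B by blast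
   show "dfb (k + p) ?S'"
   by (rule definableI[OF refl], (rule dint S A0(2) | (simp add: A01 del: One_nat_def; fail)[1])+)
   fix A assume A: "finite A" "A <= V'"
   let ?A = "(%(v, a). tcat k v 1 a) ` (A \<times> A0)"
   have "?A <= Box k V' 1 V1" using A(2) A0(1) sub by (auto intro!: tcat_in_Box)
   hence "finite ?A & ?A <= V" using A A0 B(7) by (intro conjI finite_imageI finite_cartesian_product) auto
   from dir[THEN spec, THEN mp, OF this] obtain t where t: "t : T" "ALL x:?A. tcat (k + 1) x p t : S"
   by (elim bexE)
   have "tcat k x p t : ?S'" if "x : A" for x
   proof -
   have "x : TT k" "t : TT p" using that A(2) sub t(1) T definable_subset by blast+
   thus ?thesis using t(2) that by (auto simp del: One_nat_def)
   qed
   thus "EX t:T. ALL x:A. tcat k x p t : ?S'" using t(1) by blast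
  qed
  then obtain t where t: "t : T" and ne: "PT k interior_of {x : TT k. tcat k x p t : ?S'} ~= {}" by blast
  have tt: "t : TT p" using t T definable_subset by blast
  let ?Q = "{x : TT k. tcat k x p t : ?S'}"
  let ?W = "PT k interior_of ?Q"
  have dS': "dfb (k + p) ?S'"
   by (rule definableI[OF refl], (rule dint S A0(2) | (simp add: A01 del: One_nat_def; fail)[1])+)
  have dQ: "dfb k ?Q"
   by (rule definableI[OF refl], (rule dint dS' | (simp add: tt; fail)[1])+)
  have dW: "dfb k ?W" by (rule dfb_interior[OF dQ])
  have cov: "?W <= (\<Union>a\<in>A0. {v : TT k. a : PT 1 interior_of (?Sec v t)})"
  proof
   fix v assume v: "v : ?W"
   hence vQ: "v : ?Q" by (rule subsetD[OF interior_of_subset])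
   hence vk: "v : TT k" by blast
   have "tcat k v p t : ?S'" using vQ by blast
   hence "A0 <= ?Sec v t" using vk tt A01 by (auto simp del: One_nat_def)
   moreover have "\<not> A0 <= ?Sec v t - PT 1 interior_of ?Sec v t"
   proof
   assume "A0 <= ?Sec v t - PT 1 interior_of ?Sec v t"
   hence "card A0 \<le> card (?Sec v t - PT 1 interior_of ?Sec v t)"
   by (intro card_mono finite_Diff_interior dSec vk tt)
   also have "\<dots> \<le> N" using N[of "tcat k v p t"] vk tt unfolding Bd[OF vk tt] by (simp del: One_nat_def)
   finally show False using A0(3) by simp
   qed
   ultimately show "v : (\<Union>a\<in>A0. {v : TT k. a : PT 1 interior_of (?Sec v t)})" using vk by blast
  qed
  have dI: "dfb k {v : TT k. a : PT 1 interior_of (?Sec v t)}" if "a : A0" for a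
   by (rule definableI[OF refl], (rule D_interior dint S basis_facts(2) | (simp add: tt A01[OF that] basis_facts(2) del: One_nat_def; fail)[1])+)
  obtain a W' where W': "a : A0" "opn k W'" "dfb k W'" "W' ~= {}" "W' <= {v : TT k. a : PT 1 interior_of (?Sec v t)}"
   by (rule partition_interior[OF A0(2) openin_interior_of dW ne dI cov]) (assumption, rule that)
  let ?St = "{x : TT (k + 1). tcat (k + 1) x p t : S}"
  have "PT (k + 1) interior_of ?St ~= {}"
  proof (rule interior_section_aux[OF Suc.IH W'(2-4)])
   show "dfb (k + 1) ?St"
   by (rule definableI[OF refl], (rule dint S | (simp add: tt; fail)[1])+)
   show "a : TT 1" using A01 W' by blast
   fix w assume "w : W'"
   hence "w : TT k" "a : PT 1 interior_of (?Sec w t)" using W' by blast+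
   moreover from this have "{x : TT 1. tcat k w 1 x : ?St} = ?Sec w t" by (auto simp del: One_nat_def)
   ultimately show "a : PT 1 interior_of {x : TT 1. tcat k w 1 x : ?St}" by simp
  qed
  thus "EX t:T. PT (k + 1) interior_of {x : TT (k + 1). tcat (k + 1) x p t : S} ~= {}" using t by blast
 qed
 thus ?case by simp
qed

lemmas directed_interior = dirintD[OF dirint]
lemmas interior_section = interior_section_aux[OF dirint]

text \<open>The 1-tuple with entry \<open>x i\<close> is the position of \<open>x\<close> on its
  line in direction \<open>i\<close>. The points of \<open>Z\<close> that are lost meet every such
  line in a finite set (\<open>dl_line\<close>).\<close>

definition dl :: "nat => (nat => 'a) set => (nat => 'a) set" where
 "dl i Z = {x : Z. (\<lambda>j\<in>{..<1}. x i) : PT 1 interior_of {c : TT 1. upd i x c : Z}}"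

lemma dfb_dl: assumes "i < k" "dfb k Z" shows "dfb k (dl i Z)"
 unfolding dl_def
 by (rule definableI[OF refl], (rule D_interior DT_upd assms DT_sel dint basis_facts(2) | (simp add: assms basis_facts(2); fail)[1])+)

lemma dl_line:
 assumes "i < k" "dfb k Z" "x : TT k" shows "finite {c : TT 1. upd i x c : Z - dl i Z}"
proof -
 let ?A = "{c : TT 1. upd i x c : Z}"
 have d: "dfb 1 ?A"
  by (rule definableI[OF refl], (rule DT_upd assms dint | (simp add: assms; fail)[1])+)
 have "{c : TT 1. upd i x c : Z - dl i Z} <= ?A - PT 1 interior_of ?A"
 proof
  fix c assume "c : {c : TT 1. upd i x c : Z - dl i Z}"
  hence c: "c : TT 1" "upd i x c : Z" "upd i x c \<notin> dl i Z" by auto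
  have "(\<lambda>j\<in>{..<1}. upd i x c i) = c" using c(1) by (auto simp: upd_def tuples_def fun_eq_iff PiE_iff extensional_def)
  moreover have "upd i (upd i x c) c' = upd i x c'" for c' by (simp add: upd_def)
  ultimately have "c \<notin> PT 1 interior_of ?A" using c(2,3) unfolding dl_def by simp
  thus "c : ?A - PT 1 interior_of ?A" using c by blast
 qed
 thus ?thesis using finite_Diff_interior[OF d] finite_subset by blast
qed

text \<open>The directions are treated from \<open>k - 1\<close> down to \<open>0\<close>, so that
  \<open>dls_interior\<close> can open up the coordinates starting with the first.\<close>

primrec dls :: "nat => (nat => 'a) set => nat => (nat => 'a) set" where
 "dls k X 0 = X"
| "dls k X (Suc m) = dl (k - Suc m) (dls k X m)"

lemma dfb_dls: "dfb k X ==> m \<le> k ==> dfb k (dls k X m)"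
 by (induction m) (auto intro: dfb_dl)

definition glue :: "nat => nat => (nat => 'a) => (nat => 'a) => (nat => 'a)" where
 "glue i k w x = (\<lambda>j\<in>{..<k}. if j < i then w j else x j)"

lemma DT_glue:
 assumes "i \<le> k" "DT Ga i t" "x : TT k" "wfc Ga"
 shows "DT Ga k (%g. glue i k (t g) x)"
proof -
 have "DT Ga k (%g. tsub k (%j. if j < i then Inl j else Inr (x j)) (t g))"
  by (rule DT_tsub[OF assms(2)]) (use assms in \<open>auto simp: sok_def tuples_def\<close>)
 moreover have "tsub k (%j. if j < i then Inl j else Inr (x j)) w = glue i k w x" for w
  by (auto simp: tsub_def glue_def vval_def fun_eq_iff)
 ultimately show ?thesis by simp
qed

text \<open>If a point survives all the steps, its first \<open>i\<close> coordinates can be moved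
  in an open set while the point stays in the set obtained before direction \<open>i - 1\<close> was
  treated; \<open>interior_section\<close> adds one coordinate at a time. For \<open>i = k\<close>
  this produces interior of \<open>X\<close>.\<close>

lemma dls_interior:
 assumes X: "dfb k X" and x: "x : dls k X k" and "i \<le> k"
 shows "PT i interior_of {w : TT i. glue i k w x : dls k X (k - i)} ~= {}"
 using `i \<le> k`
proof (induction i)
 case 0
 have xk: "x : TT k" using x dfb_dls[OF X, of k] definable_subset by blast
 hence "glue 0 k w x = x" for w by (auto simp: glue_def tuples_def fun_eq_iff PiE_iff extensional_def)
 hence "TT 0 <= {w : TT 0. glue 0 k w x : dls k X (k - 0)}" using x by simp
 thus ?case by (rule interior_neI[OF openin_TT TT_ne])
next
 case (Suc i)
 have i: "i < k" using Suc.prems by simp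
 have xk: "x : TT k" using x dfb_dls[OF X, of k] definable_subset by blast
 have ki: "k - i = Suc (k - Suc i)" "k - Suc (k - Suc i) = i" using i by auto
 let ?E = "dls k X (k - Suc i)"
 have dE: "dfb k ?E" by (rule dfb_dls[OF X]) simp
 have eq: "dls k X (k - i) = dl i ?E" unfolding ki(1) dls.simps ki(2) ..
 let ?Q = "{w : TT i. glue i k w x : dls k X (k - i)}"
 let ?W = "PT i interior_of ?Q"
 have ne: "?W ~= {}" using Suc by simp
 have ik: "i \<le> k" "Suc i \<le> k" "i + 1 \<le> k" using i by auto
 have dD: "dfb k (dls k X (k - i))" by (rule dfb_dls[OF X]) simp
 have "dfb i ?Q"
  by (rule definableI[OF refl], (rule DT_glue[OF ik(1)] dint dD | (simp add: xk; fail)[1])+)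
 hence dW: "dfb i ?W" by (rule dfb_interior)
 let ?S = "{w : TT (i + 1). glue (i + 1) k w x : ?E}"
 have "PT (i + 1) interior_of ?S ~= {}"
 proof (rule interior_section[OF openin_interior_of dW ne])
  show "dfb (i + 1) ?S"
   by (rule definableI[OF refl], (rule DT_glue[OF ik(3)] dint dE | (simp add: xk; fail)[1])+)
  show "(\<lambda>j\<in>{..<1}. x i) : TT 1" using xk i by (auto simp: tuples_def)
  fix w assume "w : ?W"
  hence "w : ?Q" by (rule subsetD[OF interior_of_subset])
  hence w: "w : TT i" "glue i k w x : dl i ?E" using eq by auto
  have "glue i k w x i = x i" using i by (simp add: glue_def)
  hence 1: "(\<lambda>j\<in>{..<1}. x i) : PT 1 interior_of {c : TT 1. upd i (glue i k w x) c : ?E}"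
   using w(2) unfolding dl_def by simp
  have eq: "upd i (glue i k w x) c = glue (i + 1) k (tcat i w 1 c) x" for c
  proof
   fix j show "upd i (glue i k w x) c j = glue (i + 1) k (tcat i w 1 c) x j"
   using i by (cases j i rule: linorder_cases) (simp_all add: upd_def glue_def tcat_def)
  qed
  have "{c : TT 1. upd i (glue i k w x) c : ?E} = {c : TT 1. tcat i w 1 c : ?S}"
   by (intro Collect_cong conj_cong refl) (simp only: eq mem_Collect_eq tcat_in[OF w(1)] simp_thms)
  thus "(\<lambda>j\<in>{..<1}. x i) : PT 1 interior_of {c : TT 1. tcat i w 1 c : ?S}" using 1 by simp
 qed
 thus ?case by simp
qed

text \<open>Since \<open>X\<close> has empty interior, nothing survives all the steps of
  \<open>dls\<close>; so each point is lost at some direction \<open>i\<close>, and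
  \<open>Z i\<close> collects those. This is how a drop in dimension is turned into finite fibres
  over one coordinate less.\<close>

lemma line_decomposition:
 assumes X: "dfb k X" "PT k interior_of X = {}"
 obtains Z where "!!i. i < k ==> dfb k (Z i)"
  "!!i x. i < k ==> x : TT k ==> finite {c : TT 1. upd i x c : Z i}" "X = (\<Union>i<k. Z i)"
proof
 let ?Z = "%i. dls k X (k - Suc i) - dl i (dls k X (k - Suc i))"
 have d: "dfb k (dls k X (k - Suc i))" for i by (rule dfb_dls[OF X(1)]) simp
 show "dfb k (?Z i)" if "i < k" for i by (intro definable_Diff d dfb_dl that)
 show "finite {c : TT 1. upd i x c : ?Z i}" if "i < k" "x : TT k" for i x by (rule dl_line[OF that(1) d that(2)])
 have "dls k X k = {}"
 proof (rule ccontr)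
  assume "dls k X k ~= {}"
  then obtain x where x: "x : dls k X k" by blast
  have "glue k k w x = w" if "w : TT k" for w
   using that by (auto simp: glue_def tuples_def fun_eq_iff PiE_iff extensional_def)
  hence "{w : TT k. glue k k w x : dls k X (k - k)} = X" using definable_subset[OF X(1)] by auto
  thus False using dls_interior[OF X(1) x order_refl] X(2) by simp
 qed
 moreover have "dls k X m <= X & (m \<le> k --> X - dls k X m <= (\<Union>i<k. ?Z i))" for m
 proof (induction m)
  case (Suc m)
  have 1: "dls k X (Suc m) <= dls k X m" by (auto simp: dl_def)
  have 2: "dls k X m - dls k X (Suc m) <= (\<Union>i<k. ?Z i)" if "Suc m \<le> k"
  proof -
   have "k - Suc (k - Suc m) = m" "k - Suc m < k" using that by auto
   thus ?thesis by (intro subset_trans[OF _ UN_upper[of "k - Suc m"]]) auto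
  qed
  show ?case
  proof (intro conjI impI)
   show "dls k X (Suc m) <= X" using 1 Suc by blast
   assume m: "Suc m \<le> k"
   have "X - dls k X (Suc m) <= (X - dls k X m) \<union> (dls k X m - dls k X (Suc m))" by blast
   also have "\<dots> <= (\<Union>i<k. ?Z i)" by (rule Un_least[OF _ 2[OF m]]) (use Suc m in simp)
   finally show "X - dls k X (Suc m) <= (\<Union>i<k. ?Z i)" .
  qed
 qed simp
 ultimately show "X = (\<Union>i<k. ?Z i)" by (metis (no_types, lifting) Diff_empty UN_least Diff_subset order.trans order_refl subset_antisym)
qed

end

section \<open>Substitutes for definable choice: continuous branches, generic injectivity, local
  sections\<close>

context tmin begin

lemma atleast_exactD: "finite S ==> card S \<le> N ==> EX k:{..N}. atleast k S & \<not> atleast (Suc k) S"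
 unfolding atleast_exact by auto

text \<open>A family of finite sets over an open set becomes, over a smaller open set, a correspondence
 with continuous branches.\<close>

lemma continuous_branches:
 assumes U: "opn n U" "dfb n U" "U ~= {}" and S: "dfb (n + l) S"
  and fin: "!!z. z : U ==> finite {y : TT l. tcat n z l y : S}"
 obtains U0 k g where "opn n U0" "dfb n U0" "U0 ~= {}" "U0 <= U"
  "ALL i<(k::nat). cont n U0 l (g i)"
  "ALL z:U0. {y : TT l. tcat n z l y : S} = (%i. g i z) ` {..<k} & inj_on (%i. g i z) {..<k}"
proof -
 let ?R = "%z. {y : TT l. tcat n z l y : S}"
 obtain N where N: "!!z. z : U ==> card (?R z) \<le> N" using uniform_finiteness[OF S U(2) fin] by blast
 \<comment> \<open>The bound on the fibres splits \<open>U\<close> into finitely many definable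
   pieces of constant fibre size, one of which has interior; niceness needs a constant size.\<close>
 let ?X = "%k. {z : U. atleast k (?R z) & \<not> atleast (Suc k) (?R z)}"
 have dX: "dfb n (?X k)" if "k : {..N}" for k
  by (rule definableI[OF refl], (rule D_atleast D_conj D_not dint S U(2) | (simp add: U(2); fail)[1])+)
 have cov: "U <= (\<Union>k\<in>{..N}. ?X k)"
  using atleast_exactD[OF fin N] by blast
 obtain k U1 where U1: "k : {..N}" "opn n U1" "dfb n U1" "U1 ~= {}" "U1 <= U" "U1 <= ?X k"
  by (rule partition_interior[OF _ U dX cov]) (simp, assumption, rule that)
 have R: "?R z <= TT l & finite (?R z) & card (?R z) = k" if "z : U1" for z
  using U1(6) that unfolding atleast_exact by blast
 have D: "D (cx (c0 n U1) l (TT l)) (%p. snd p : ?R (fst p))"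
  unfolding mem_Collect_eq
  by (rule dint S U1(3) | (simp add: U1(3); fail)[1])+
 obtain U2 where U2: "opn n U2" "dfb n U2" "U2 ~= {}" "U2 <= U1"
  "ALL x:U2. EX W g. opn n W & x : W & W <= U2 &
   (ALL i<k. cont n W l (g i)) & (ALL z:W. ?R z = (%i. g i z) ` {..<k})"
  by (rule nice_correspondence[OF U1(2-4) R D]) (assumption, rule that)
 obtain x where x: "x : U2" using U2(3) by blast
 obtain W g where W: "opn n W" "x : W" "W <= U2"
  "ALL i<k. cont n W l (g i)" "ALL z:W. ?R z = (%i. g i z) ` {..<k}"
  using bspec[OF U2(5) x] by (elim exE conjE)
 obtain U0 where U0: "opn n U0" "dfb n U0" "x : U0" "U0 <= W" using definable_nbhd[OF W(1,2)] .
 have c: "ALL i<k. cont n U0 l (g i)"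
  using W(4) continuous_map_from_subtopology_mono[OF _ U0(4)] by blast
 have "inj_on (%i. g i z) {..<k}" if z: "z : U0" for z
 proof (rule eq_card_imp_inj_on)
  have "card (?R z) = k" using R z U0(4) W(3) U2(4) by blast
  moreover have "?R z = (%i. g i z) ` {..<k}" using W(5) z U0(4) by blast
  ultimately show "card ((%i. g i z) ` {..<k}) = card {..<k}" by simp
 qed simp
 hence "ALL z:U0. ?R z = (%i. g i z) ` {..<k} & inj_on (%i. g i z) {..<k}"
  using W(5) U0(4) by blast
 moreover have "U0 <= U" "U0 ~= {}" using U0 W(3) U2(4) U1(5) by blast+
 ultimately show thesis using that[OF U0(1,2)] c by blast
qed

text \<open>The branches supplied by niceness are continuous but need not be definable.
  Hausdorffness isolates the one through \<open>g i0 x\<close>: near \<open>x\<close> it is the only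
  value in the definable open set \<open>A\<close>, by which it can be defined.\<close>

lemma separate_branch:
 assumes U: "opn n U" "x : U" and k: "i0 < (k::nat)"
  and c: "ALL i<k. cont n U l (g i)" and inj: "inj_on (%i. g i x) {..<k}"
 obtains V A where "opn n V" "dfb n V" "x : V" "V <= U" "opn l A" "dfb l A" "g i0 x : A"
  "ALL z:V. g i0 z : A & (ALL i<k. g i z : A --> i = i0)"
proof -
 have top: "topspace (sbt n U) = U" using openin_subset[OF U(1)] by auto
 have gx: "g i x : topspace (PT l)" if "i < k" for i
  using continuous_map_funspace[of "sbt n U" "PT l" "g i"] c that U(2) unfolding top by blast
 have "EX AB. opn l (fst AB) & opn l (snd AB) & g i0 x : fst AB & g i x : snd AB & fst AB \<inter> snd AB = {}"
  if i: "i : {..<k} - {i0}" for i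
 proof -
  have "g i x ~= g i0 x" using inj i k by (auto simp: inj_on_def)
  then obtain A B where "opn l A" "opn l B" "g i0 x : A" "g i x : B" "disjnt A B"
   using Hausdorff_PT[of l] gx[OF k] gx[of i] i unfolding Hausdorff_space_def by (metis Diff_iff lessThan_iff)
  thus ?thesis by (intro exI[of _ "(A, B)"]) (auto simp: disjnt_def)
 qed
 hence "ALL i:{..<k} - {i0}. EX AB. opn l (fst AB) & opn l (snd AB) & g i0 x : fst AB & g i x : snd AB & fst AB \<inter> snd AB = {}"
  by blast
 from bchoice[OF this] obtain AB where AB: "!!i. i : {..<k} - {i0} ==> opn l (fst (AB i)) & opn l (snd (AB i)) & g i0 x : fst (AB i) & g i x : snd (AB i) & fst (AB i) \<inter> snd (AB i) = {}"
  by blast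
 let ?A = "topspace (PT l) \<inter> (\<Inter>i\<in>{..<k} - {i0}. fst (AB i))"
 have oA: "opn l ?A"
 proof (cases "{..<k} - {i0} = {}")
  case True
  thus ?thesis by (simp only: INT_empty Int_UNIV_right openin_topspace)
 next
  case False
  have "opn l (\<Inter>i\<in>{..<k} - {i0}. fst (AB i))"
   by (rule openin_INT2[OF _ False]) (use AB in auto)
  thus ?thesis by (rule openin_Int[OF openin_topspace])
 qed
 have gA: "g i0 x : ?A" using AB gx[OF k] by blast
 obtain A where A: "opn l A" "dfb l A" "g i0 x : A" "A <= ?A" using definable_nbhd[OF oA gA] .
 let ?B = "%i. if i = i0 then A else snd (AB i)"
 have oB: "opn n {z : U. g i z : ?B i}" if "i < k" for i
  using c that A(1) AB[of i] by (intro open_preimage[OF U(1)]) auto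
 have "opn n (\<Inter>i\<in>{..<k}. {z : U. g i z : ?B i})"
  by (rule openin_INT2) (use k oB in auto)
 moreover have "x : (\<Inter>i\<in>{..<k}. {z : U. g i z : ?B i})" using U(2) A(3) AB by auto
 ultimately obtain V where V: "opn n V" "dfb n V" "x : V" "V <= (\<Inter>i\<in>{..<k}. {z : U. g i z : ?B i})"
  by (rule definable_nbhd)
 have VB: "g i z : ?B i" if "z : V" "i < k" for z i using V(4) that by blast
 have "g i0 z : A & (ALL i<k. g i z : A --> i = i0)" if z: "z : V" for z
 proof (intro conjI allI impI)
  show "g i0 z : A" using VB[OF z k] by simp
  fix i assume i: "i < k" "g i z : A"
  show "i = i0"
  proof (rule ccontr)
   assume ne: "i ~= i0"
   hence "g i z : snd (AB i)" using VB[OF z i(1)] by simp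
   moreover have "g i z : fst (AB i)" using i ne A(4) by blast
   ultimately show False using AB[of i] i ne by blast
  qed
 qed
 moreover have "V <= U" using V(4) k by blast
 ultimately show thesis using that[OF V(1-3) _ A(1-3)] by blast
qed

text \<open>The finitely many values of \<open>F\<close> on the fibre of \<open>f\<close> through
  \<open>z\<close> form continuous branches in \<open>z\<close>. After shrinking, \<open>F\<close>
  takes its values in a set \<open>A\<close> that contains only one branch; so two points with the
  same \<open>f\<close> are forced to have the same \<open>F\<close>.\<close>

lemma generic_factor:
 assumes U: "opn n U" "U ~= {}" and f: "dfn n U m f" and F: "dfn n U l F"
  and fin: "!!z. z : U ==> finite {F z' | z'. z' : U & f z' = f z}"
 obtains V where "opn n V" "dfb n V" "V ~= {}" "V <= U" "!!z z'. z : V ==> z' : V ==> f z = f z' ==> F z = F z'"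
proof -
 have dU: "dfb n U" by (rule dfnD(1)[OF f])
 obtain U1 where U1: "opn n U1" "dfb n U1" "U1 ~= {}" "U1 <= U" "cont n U1 l F"
  by (rule nice_function[OF U F])
 let ?S = "{w : TT (n + l). tfst n w : U & (EX z':U. f z' = f (tfst n w) & tsnd n l w = F z')}"
 have "D (c0 (n + l) {w : TT (n + l). tfst n w : U}) (%w. EX z':U. f z' = f (tfst n w) & tsnd n l w = F z')"
  by (rule dint DT_app[OF f] DT_app[OF F] dU definable_tfst | (auto simp: dU definable_tfst; fail)[1])+
 hence S: "dfb (n + l) ?S" by (intro definableI[of _ "{w : TT (n + l). tfst n w : U}"]) auto
 have Us: "U <= TT n" by (rule definable_subset[OF dU])
 have R: "{y : TT l. tcat n z l y : ?S} = {F z' | z'. z' : U & f z' = f z}" if z: "z : U" for z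
 proof -
  have "z : TT n" using z Us by blast
  thus ?thesis using z dfnD(2)[OF F] by auto
 qed
 have fin': "finite {y : TT l. tcat n z l y : ?S}" if "z : U1" for z
  using R[OF subsetD[OF U1(4) that]] fin[OF subsetD[OF U1(4) that]] by simp
 obtain U2 k g where U2: "opn n U2" "dfb n U2" "U2 ~= {}" "U2 <= U1"
  "ALL i<(k::nat). cont n U2 l (g i)"
  "ALL z:U2. {y : TT l. tcat n z l y : ?S} = (%i. g i z) ` {..<k} & inj_on (%i. g i z) {..<k}"
  by (rule continuous_branches[OF U1(1-3) S fin']) (assumption, rule that)
 have R2: "{F z' | z'. z' : U & f z' = f z} = (%i. g i z) ` {..<k}" if "z : U2" for z
  using conjunct1[OF bspec[OF U2(6) that]] R[OF subsetD[OF U1(4) subsetD[OF U2(4) that]]] by simp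
 obtain x where x: "x : U2" using U2(3) by blast
 have "F x : {F z' | z'. z' : U & f z' = f x}" using x U2(4) U1(4) by blast
 then obtain i0 where i0: "i0 < k" "F x = g i0 x" unfolding R2[OF x] by blast
 obtain V A where V: "opn n V" "dfb n V" "x : V" "V <= U2" "opn l A" "dfb l A" "g i0 x : A"
  "ALL z:V. g i0 z : A & (ALL i<k. g i z : A --> i = i0)"
  by (rule separate_branch[OF U2(1) x i0(1) U2(5) conjunct2[OF bspec[OF U2(6) x]]])
 have o: "opn n {z : U1. F z : A}" by (rule open_preimage[OF U1(1,5) V(5)])
 have "opn n (V \<inter> {z : U1. F z : A})" using o V(1) by blast
 moreover have "x : V \<inter> {z : U1. F z : A}" using V(3,7) i0(2) x U2(4) by auto
 ultimately obtain V' where V': "opn n V'" "dfb n V'" "x : V'" "V' <= V \<inter> {z : U1. F z : A}"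
  by (rule definable_nbhd)
 have key: "F z' = g i0 z" if "z : V'" "z' : V'" "f z' = f z" for z z'
 proof -
  have "z' : U" "z : U2" "F z' : A" using that V'(4) V(4) U2(4) U1(4) by blast+
  hence "F z' : (%i. g i z) ` {..<k}" using R2[of z] that(3) by blast
  then obtain i where "i < k" "F z' = g i z" by blast
  moreover have "z : V" using that V'(4) by blast
  ultimately show ?thesis using V(8) \<open>F z' \<in> A\<close> by metis
 qed
 show thesis
 proof (rule that[OF V'(1,2)])
  show "V' ~= {}" "V' <= U" using V' V(4) U2(4) U1(4) by blast+
  show "F z = F z'" if "z : V'" "z' : V'" "f z = f z'" for z z'
   using key[of z z'] key[of z z] that by simp
 qed
qed

lemma generic_injective:
 assumes U: "opn n U" "U ~= {}" and f: "dfn n U m f"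
  and fin: "!!z. z : U ==> finite {z' : U. f z' = f z}"
 obtains V where "opn n V" "dfb n V" "V ~= {}" "V <= U" "inj_on f V"
proof -
 have fin': "finite {z' | z'. z' : U & f z' = f z}" if "z : U" for z using fin[OF that] by simp
 obtain V where "opn n V" "dfb n V" "V ~= {}" "V <= U" "!!z z'. z : V ==> z' : V ==> f z = f z' ==> z = z'"
  using generic_factor[OF U f dfn_id[OF dfnD(1)[OF f]] fin'] by metis
 thus thesis using that[of V] by (auto simp: inj_on_def)
qed

text \<open>The points of the fibres form continuous branches over an open set, and an isolated
  branch is definable; it is the section.\<close>

lemma generic_section:
 assumes p: "dfn n P e p" and fin: "!!w. w : O1 ==> finite {x : P. p x = w}"
  and O1: "opn e O1" "dfb e O1" "O1 ~= {}" "O1 <= p ` P"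
 obtains V s where "opn e V" "dfb e V" "V ~= {}" "V <= O1" "dfn e V n s" "!!w. w : V ==> s w : P & p (s w) = w"
proof -
 have dP: "dfb n P" by (rule dfnD(1)[OF p])
 let ?S = "{z : TT (e + n). tsnd e n z : P & p (tsnd e n z) = tfst e z}"
 have "D (c0 (e + n) {w : TT (e + n). tsnd e n w : P}) (%z. p (tsnd e n z) = tfst e z)"
  by (rule dint DT_app[OF p] dP definable_tsnd | (auto simp: dP definable_tsnd; fail)[1])+
 hence S: "dfb (e + n) ?S" by (intro definableI[of _ "{w : TT (e + n). tsnd e n w : P}"]) auto
 have O1s: "O1 <= TT e" and Ps: "P <= TT n" using O1(2) dP definable_subset by blast+
 have R: "{y : TT n. tcat e w n y : ?S} = {x : P. p x = w}" if w: "w : O1" for w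
 proof -
  have "w : TT e" using w O1s by blast
  thus ?thesis using Ps by auto
 qed
 have fin': "finite {y : TT n. tcat e w n y : ?S}" if "w : O1" for w
  using fin[OF that] R[OF that] by simp
 obtain U2 k g where U2: "opn e U2" "dfb e U2" "U2 ~= {}" "U2 <= O1"
  "ALL i<(k::nat). cont e U2 n (g i)"
  "ALL z:U2. {y : TT n. tcat e z n y : ?S} = (%i. g i z) ` {..<k} & inj_on (%i. g i z) {..<k}"
  by (rule continuous_branches[OF O1(1-3) S fin']) (assumption, rule that)
 have R2: "{x : P. p x = w} = (%i. g i w) ` {..<k}" if "w : U2" for w
  using conjunct1[OF bspec[OF U2(6) that]] R[OF subsetD[OF U2(4) that]] by simp
 obtain x where x: "x : U2" using U2(3) by blast
 hence "{z : P. p z = x} ~= {}" using O1(4) U2(4) by blast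
 hence k: "0 < k" unfolding R2[OF x] by (cases k) auto
 obtain V A where V: "opn e V" "dfb e V" "x : V" "V <= U2" "opn n A" "dfb n A" "g 0 x : A"
  "ALL z:V. g 0 z : A & (ALL i<k. g i z : A --> i = 0)"
  by (rule separate_branch[OF U2(1) x k U2(5) conjunct2[OF bspec[OF U2(6) x]]])
 have s: "g 0 w : P & p (g 0 w) = w" if "w : V" for w
  using R2[of w] that V(4) k by blast
 have u: "y : P & p y = w & y : A \<longleftrightarrow> y = g 0 w" if w: "w : V" for w y
 proof
  assume y: "y : P & p y = w & y : A"
  hence "y : (%i. g i w) ` {..<k}" using R2[of w] w V(4) by blast
  thus "y = g 0 w" using V(8) w y by auto
 qed (use s[OF w] V(8) w in auto)
 have "dfn e V n (g 0)"
 proof (rule dfnI[OF V(2)], rule DT_I)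
  have "D (cx (c0 e V) n (TT n)) (%q. tcat e (fst q) n (snd q) : ?S & snd q : A)"
   by (rule dint S V(2,6) | (simp add: V(2); fail)[1])+
  thus "D (cx (c0 e V) n (TT n)) (%q. snd q = g 0 (fst q))"
  proof (rule D_cong)
   fix q assume "q : cset (cx (c0 e V) n (TT n))"
   hence q: "fst q : V" "snd q : TT n" using V(2) by auto
   hence "fst q : TT e" using V(2) definable_subset by blast
   thus "(tcat e (fst q) n (snd q) : ?S & snd q : A) = (snd q = g 0 (fst q))"
   using u[OF q(1), of "snd q"] q by auto
  qed
 qed (use V(2) s Ps in auto)
 thus thesis using that[OF V(1,2) _ _ _ s] V(3,4) U2(4) by blast
qed

section \<open>Invariance of domain and of dimension\<close>

definition no_drop :: "nat => bool" where
 "no_drop N \<longleftrightarrow> (ALL U f. opn (N + 1) U & U ~= {} & dfn (N + 1) U N f & inj_on f U --> False)"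

text \<open>Both properties are proved in one induction: \<open>open_images N\<close> gives
  \<open>no_drop N\<close>, which gives \<open>open_images (N + 1)\<close>.\<close>

definition open_images :: "nat => bool" where
 "open_images N \<longleftrightarrow> (ALL U f. opn N U & U ~= {} & dfn N U N f & inj_on f U --> PT N interior_of (f ` U) ~= {})"

lemma dfn_slice:
 assumes f: "dfn (n + m) U l f" and V: "dfb n V" "c : TT m" "!!v. v : V ==> tcat n v m c : U"
 shows "dfn n V l (%v. f (tcat n v m c))"
 by (rule dfnI[OF V(1)], rule DT_app[OF f], (rule dint V | (simp add: V; fail)[1])+)

text \<open>With the last coordinate frozen at \<open>?c\<close>, the injection still has an image
  with interior in \<open>M^N\<close>. By continuity the value remains in that interior when the
  last coordinate moves a little; so it is attained twice.\<close>

lemma no_drop_step: assumes G: "open_images N" shows "no_drop N"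
 unfolding no_drop_def
proof (intro allI impI, elim conjE)
 fix U f assume U: "opn (N + 1) U" "U ~= {}" and f: "dfn (N + 1) U N f" and inj: "inj_on f U"
 obtain U0 where U0: "opn (N + 1) U0" "dfb (N + 1) U0" "U0 ~= {}" "U0 <= U" "cont (N + 1) U0 N f"
  by (rule nice_function[OF U f])
 obtain z where z: "z : U0" using U0(3) by blast
 obtain V B where VB: "opn N V" "opn 1 B" "dfb N V" "dfb 1 B" "tfst N z : V" "tsnd N 1 z : B" "Box N V 1 B <= U0"
  using definable_Box[OF U0(1) z] .
 have sub: "V <= TT N" "B <= TT 1" using VB definable_subset by blast+
 let ?c = "tsnd N 1 z"
 have c: "?c : TT 1" using VB(6) sub by blast
 have inU: "tcat N v 1 b : U0" if "v : V" "b : B" for v b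
  using tcat_in_Box[OF sub that] VB(7) by blast
 let ?h = "%v. f (tcat N v 1 ?c)"
 have h: "dfn N V N ?h" by (rule dfn_slice[OF f VB(3) c]) (use inU VB(6) U0(4) in blast)
 have eqD: "v = v' & b = b'" if "f (tcat N v 1 b) = f (tcat N v' 1 b')" "v : V" "v' : V" "b : B" "b' : B" for v v' b b'
 proof -
  have "tcat N v 1 b : U" "tcat N v' 1 b' : U"
   using subsetD[OF U0(4) inU] that by blast+
  hence "tcat N v 1 b = tcat N v' 1 b'" using inj that(1) unfolding inj_on_def by blast
  thus ?thesis using that sub by (subst (asm) tcat_eq_iff[where M = M]) auto
 qed
 have "inj_on ?h V" using eqD VB(6) by (auto intro!: inj_onI simp del: One_nat_def)
 hence ne: "PT N interior_of (?h ` V) ~= {}" using G h VB(1,5) unfolding open_images_def by blast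
 let ?O = "PT N interior_of (?h ` V)"
 have Os: "?O <= ?h ` V" by (rule interior_of_subset)
 have o: "opn (N + 1) {y : U0. f y : ?O}" by (rule open_preimage[OF U0(1,5) openin_interior_of])
 obtain y where y: "y : ?O" using ne by blast
 then obtain v where v: "v : V" "y = ?h v" using Os by blast
 have vt: "v : TT N" using v sub by blast
 have "tcat N v 1 ?c : {y : U0. f y : ?O}" using inU[OF v(1) VB(6)] y v(2) by blast
 then obtain V' B' where VB': "opn N V'" "opn 1 B'" "tfst N (tcat N v 1 ?c) : V'" "tsnd N 1 (tcat N v 1 ?c) : B'"
  "Box N V' 1 B' <= {y : U0. f y : ?O}" by (rule Box_subset[OF o])
 have v': "v : V'" "?c : B'" using VB'(3,4) vt c by (simp_all del: One_nat_def)
 have "opn 1 (B \<inter> B')" "B \<inter> B' ~= {}" using VB VB' v' by auto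
 hence "infinite (B \<inter> B')" by (rule infinite_open1)
 hence "\<not> B \<inter> B' <= {?c}" using finite_subset by blast
 then obtain b where b: "b : B" "b : B'" "b ~= ?c" by blast
 have bt: "b : TT 1" using b sub by blast
 have "tcat N v 1 b : Box N V' 1 B'" using v' b vt bt by (simp add: Box_def del: One_nat_def)
 hence "f (tcat N v 1 b) : ?O" using VB'(5) by blast
 then obtain v2 where "v2 : V" "f (tcat N v 1 b) = ?h v2" using Os by blast
 thus False using eqD[of v b v2 ?c] v(1) b VB(6) by blast
qed

lemma delete_coordinate_finite:
 assumes i: "i < Suc N" and x: "x : TT (Suc N)" and line: "finite {c : TT 1. upd i x c : Z}" and Z: "Z <= TT (Suc N)"
 shows "finite {y : Z. prj N (%j. if j < i then j else Suc j) y = prj N (%j. if j < i then j else Suc j) x}" (is "finite ?F")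
proof -
 have "?F <= (%c. upd i x c) ` {c : TT 1. upd i x c : Z}"
 proof
  fix y assume y: "y : ?F"
  hence yt: "y : TT (Suc N)" using Z by blast
  have "y j = x j" if "j ~= i" for j
  proof (cases "j < Suc N")
   case True
   have e: "(if j < i then j else Suc j) = (if j < i then j else Suc j)" for j by simp
   have p: "prj N (%j. if j < i then j else Suc j) y j' = prj N (%j. if j < i then j else Suc j) x j'" for j'
   using y by auto
   show ?thesis
   proof (cases "j < i")
   case True
   thus ?thesis using p[of j] i by (simp add: prj_def)
   next
   case False
   thus ?thesis using p[of "j - 1"] True that by (simp add: prj_def split: if_splits)
   qed
  qed (use x yt in \<open>auto simp: tuples_def PiE_iff extensional_def\<close>)
  hence yc: "y = upd i x (\<lambda>_\<in>{..<1}. y i)" by (intro ext) (simp add: upd_def)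
  have "(\<lambda>_\<in>{..<1}. y i) : TT 1" using yt i by (simp add: tuples_def PiE_iff)
  moreover have "y : Z" using y by simp
  ultimately show "y : (%c. upd i x c) ` {c : TT 1. upd i x c : Z}"
   by (intro image_eqI[of _ "%c. upd i x c", OF yc] CollectI conjI) (simp_all only: yc[symmetric])
 qed
 thus ?thesis by (rule finite_subset[OF _ finite_imageI[OF line]])
qed

text \<open>If the image had empty interior, it would split into the sets \<open>Z i\<close> of
  \<open>line_decomposition\<close>, and an open set would map into one of them. Deleting coordinate
  \<open>i\<close> is finite-to-one there, hence generically injective, which gives an injection
  into \<open>M^N\<close>.\<close>

lemma open_images_step: assumes G: "no_drop N" shows "open_images (N + 1)"
 unfolding open_images_def
proof (intro allI impI, elim conjE, rule ccontr)
 fix U f assume U: "opn (N + 1) U" "U ~= {}" and f: "dfn (N + 1) U (N + 1) f" and inj: "inj_on f U"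
  and "\<not> PT (N + 1) interior_of (f ` U) ~= {}"
 hence int: "PT (N + 1) interior_of (f ` U) = {}" by simp
 have dU: "dfb (N + 1) U" by (rule dfnD(1)[OF f])
 obtain Z where Z: "!!i. i < N + 1 ==> dfb (N + 1) (Z i)"
  "!!i x. i < N + 1 ==> x : TT (N + 1) ==> finite {c : TT 1. upd i x c : Z i}" "f ` U = (\<Union>i<N + 1. Z i)"
  by (rule line_decomposition[OF dfb_image[OF f] int]) blast
 have dX: "dfb (N + 1) {x : U. f x : Z i}" if "i : {..<N + 1}" for i
  by (rule dfb_vimage[OF f Z(1)]) (use that in simp)
 have cov: "U <= (\<Union>i\<in>{..<N + 1}. {x : U. f x : Z i})" using Z(3) by blast
 obtain i V where V: "i : {..<N + 1}" "opn (N + 1) V" "dfb (N + 1) V" "V ~= {}" "V <= U" "V <= {x : U. f x : Z i}"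
  by (rule partition_interior[OF _ U(1) dU U(2) dX cov]) (simp, assumption, rule that)
 let ?io = "%j. if j < i then j else Suc j"
 have i: "i < Suc N" using V(1) by simp
 have io: "?io ` {..<N} <= {..<N + 1}" by auto
 have fV: "dfn (N + 1) V (N + 1) f" by (rule dfn_subset[OF f V(3,5)])
 have pf: "dfn (N + 1) V N (%x. prj N ?io (f x))"
  by (rule dfn_comp[OF fV dfn_prj[OF io definable_tuples]]) (use dfnD(2)[OF fV] in blast)
 have fin: "finite {z' : V. prj N ?io (f z') = prj N ?io (f z)}" if z: "z : V" for z
 proof -
  have fz: "f z : TT (Suc N)" using dfnD(2)[OF fV z] by simp
  have "finite {y : Z i. prj N ?io y = prj N ?io (f z)}"
   using delete_coordinate_finite[OF i fz _ , of "Z i"] Z(2)[of i "f z"] fz i definable_subset[OF Z(1)[of i]] by simp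
  hence "finite (f ` {z' : V. prj N ?io (f z') = prj N ?io (f z)})"
   by (rule finite_subset[rotated]) (use V(6) in blast)
  moreover have "inj_on f {z' : V. prj N ?io (f z') = prj N ?io (f z)}"
   by (rule inj_on_subset[OF inj]) (use V(5) in blast)
  ultimately show ?thesis using finite_imageD by blast
 qed
 obtain V' where V': "opn (N + 1) V'" "dfb (N + 1) V'" "V' ~= {}" "V' <= V" "inj_on (%x. prj N ?io (f x)) V'"
  by (rule generic_injective[OF V(2,4) pf fin])
 thus False using G dfn_subset[OF pf V'(2,4)] unfolding no_drop_def by blast
qed

lemma open_images: "open_images N"
proof (induction N)
 case 0
 show ?case unfolding open_images_def
 proof (intro allI impI, elim conjE)
  fix U f assume U: "opn 0 U" "U ~= {}" and f: "dfn 0 U 0 f"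
  have "f ` U = TT 0" using U(2) dfnD(2)[OF f] by auto
  thus "PT 0 interior_of (f ` U) ~= {}" using interior_neI[OF openin_TT TT_ne, of 0 "f ` U"] by simp
 qed
next
 case (Suc N)
 thus ?case using open_images_step[OF no_drop_step] by simp
qed

lemmas no_drop = no_drop_step[OF open_images]

lemma injective_image_interior:
 assumes "opn N U" "U ~= {}" "dfn N U N f" "inj_on f U"
 shows "PT N interior_of (f ` U) ~= {}"
 using open_images[of N] assms unfolding open_images_def by blast

lemma injective_dim_le:
 assumes U: "opn a U" "U ~= {}" and f: "dfn a U b f" and inj: "inj_on f U"
 shows "a \<le> b"
proof (rule ccontr)
 assume "\<not> a \<le> b"
 then obtain l where a: "a = b + l + 1" by (metis add.assoc add_Suc_right not_le less_imp_Suc_add Suc_eq_plus1)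
 obtain c where c: "c : TT l" using TT_ne[of l] by blast
 \<comment> \<open>Constant coordinates raise the target to exactly one dimension below the
   source.\<close>
 let ?f = "%x. tcat b (f x) l c"
 have "dfn a U (b + l) ?f"
  using f c by (auto simp: dfn_def intro!: DT_tcat DT_const)
 moreover have "inj_on ?f U"
 proof (rule inj_onI)
  fix x y assume "x : U" "y : U" "?f x = ?f y"
  thus "x = y" using inj dfnD(2)[OF f] c by (subst (asm) tcat_eq_iff[where M = M]) (auto dest: inj_onD)
 qed
 ultimately show False using no_drop[of "b + l"] U unfolding no_drop_def a by blast
qed

lemma finite_to_one_dim_le:
 assumes U: "opn a U" "U ~= {}" and f: "dfn a U b f" and fin: "!!z. z : U ==> finite {z' : U. f z' = f z}"
 shows "a \<le> b"
proof -
 obtain V where "opn a V" "dfb a V" "V ~= {}" "V <= U" "inj_on f V" by (rule generic_injective[OF U f fin])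
 thus ?thesis using injective_dim_le dfn_subset[OF f] by blast
qed

text \<open>The image has interior by invariance of domain, and on an open part of it the inverse is
  definable and therefore generically continuous; so \<open>f\<close> is open over that
  part.\<close>

lemma local_homeo:
 assumes U: "opn N U" "U ~= {}" and f: "dfn N U N f" and inj: "inj_on f U"
 obtains V where "opn N V" "dfb N V" "V ~= {}" "V <= U" "cont N V N f"
  "!!W. opn N W ==> W <= V ==> opn N (f ` W)"
proof -
 obtain U0 where U0: "opn N U0" "dfb N U0" "U0 ~= {}" "U0 <= U" "cont N U0 N f"
  by (rule nice_function[OF U f])
 have f0: "dfn N U0 N f" by (rule dfn_subset[OF f U0(2,4)])
 have inj0: "inj_on f U0" by (rule inj_on_subset[OF inj U0(4)])
 let ?O = "PT N interior_of (f ` U0)"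
 have ne: "?O ~= {}" by (rule injective_image_interior[OF U0(1,3) f0 inj0])
 have dO: "dfb N ?O" by (rule dfb_interior[OF dfb_image[OF f0]])
 have Os: "?O <= f ` U0" by (rule interior_of_subset)
 let ?h = "inv_into U0 f"
 have h: "dfn N ?O N ?h" by (rule dfn_subset[OF dfn_inv[OF f0 inj0] dO Os])
 obtain O1 where O1: "opn N O1" "dfb N O1" "O1 ~= {}" "O1 <= ?O" "cont N O1 N ?h"
  by (rule nice_function[OF openin_interior_of ne h])
 let ?V = "{x : U0. f x : O1}"
 have oV: "opn N ?V" by (rule open_preimage[OF U0(1,5) O1(1)])
 have dV: "dfb N ?V" by (rule dfb_vimage[OF f0 O1(2)])
 have img: "f ` W = {w : O1. ?h w : W}" if W: "W <= ?V" for W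
 proof (intro Set.set_eqI iffI)
  fix w assume "w : f ` W"
  then obtain x where x: "x : W" "w = f x" by blast
  hence "x : U0" "w : O1" using W by blast+
  thus "w : {w : O1. ?h w : W}" using x inv_into_f_f[OF inj0, of x] by simp
 next
  fix w assume w: "w : {w : O1. ?h w : W}"
  hence "w : f ` U0" using O1(4) Os by blast
  hence "f (?h w) = w" by (rule f_inv_into_f)
  thus "w : f ` W" using w by (metis (mono_tags, lifting) image_eqI mem_Collect_eq)
 qed
 show thesis
 proof (rule that[OF oV dV])
  obtain w where w: "w : O1" using O1(3) by blast
  then obtain x where "x : U0" "w = f x" using O1(4) Os by blast
  thus "?V ~= {}" using w by blast
  show "?V <= U" using U0(4) by blast
  show "continuous_map (sbt N ?V) (PT N) f"
   by (rule continuous_map_from_subtopology_mono[OF U0(5)]) blast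
  fix W assume W: "opn N W" "W <= ?V"
  show "opn N (f ` W)" unfolding img[OF W(2)] by (rule open_preimage[OF O1(1,5) W(1)])
 qed
qed

section \<open>Decomposition of definable sets into sheets over open sets\<close>

definition sheet :: "nat => (nat => 'a) set => nat => (nat => nat) => bool" where
 "sheet n P e io \<longleftrightarrow> dfb n P & inj_on io {..<e} & io ` {..<e} <= {..<n} &
   (ALL w. finite {x : P. prj e io x = w}) & opn e (prj e io ` P)"

definition sheeted :: "nat => (nat => 'a) set => bool" where
 "sheeted n X \<longleftrightarrow> (EX \<P>. finite \<P> & X = (\<Union>(P, e, io)\<in>\<P>. P) & (ALL (P, e, io):\<P>. sheet n P e io))"

lemma sheeted_Un: "sheeted n X ==> sheeted n Y ==> sheeted n (X \<union> Y)"
proof -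
 assume "sheeted n X" "sheeted n Y"
 then obtain A B where "finite A" "X = (\<Union>(P, e, io)\<in>A. P)" "ALL (P, e, io):A. sheet n P e io"
  "finite B" "Y = (\<Union>(P, e, io)\<in>B. P)" "ALL (P, e, io):B. sheet n P e io" unfolding sheeted_def by blast
 thus ?thesis unfolding sheeted_def by (intro exI[of _ "A \<union> B"]) auto
qed

lemma sheeted_UN: "finite I ==> (!!i. i : I ==> sheeted n (X i)) ==> sheeted n (\<Union>i\<in>I. X i)"
proof (induction I rule: finite_induct)
 case empty
 show ?case unfolding sheeted_def by (intro exI[of _ "{}"]) auto
next
 case (insert i I)
 hence "sheeted n (X i \<union> (\<Union>i\<in>I. X i))" by (intro sheeted_Un) auto
 thus ?case by simp
qed

text \<open>Over the interior of the projection \<open>P\<close> is a sheet. The remainder of the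
  projection has empty interior, so by \<open>line_decomposition\<close> it splits into pieces from
  which one more coordinate can be deleted with finite fibres; this is an induction on
  \<open>e\<close>.\<close>

lemma sheeted_finite_projection:
 assumes "dfb n P" "inj_on io {..<e}" "io ` {..<e} <= {..<n}" "!!w. finite {x : P. prj e io x = w}"
 shows "sheeted n P"
 using assms
proof (induction e arbitrary: P io)
 case (0 P io)
 have "prj 0 io = (%_ _. undefined)" by (auto simp: prj_def fun_eq_iff)
 hence "prj 0 io ` P = (if P = {} then {} else TT 0)" by (simp add: image_constant_conv)
 hence "sheet n P 0 io" using 0 openin_TT[of 0] unfolding sheet_def by auto
 thus ?case unfolding sheeted_def by (intro exI[of _ "{(P, 0, io)}"]) auto
next
 case (Suc e P io)
 let ?p = "prj (Suc e) io"
 have p: "dfn n P (Suc e) ?p" by (rule dfn_prj) (use Suc.prems in auto)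
 have dI: "dfb (Suc e) (?p ` P)" by (rule dfb_image[OF p])
 let ?O = "PT (Suc e) interior_of (?p ` P)"
 have Os: "?O <= ?p ` P" by (rule interior_of_subset)
 have dO: "dfb (Suc e) ?O" by (rule dfb_interior[OF dI])
 let ?P0 = "{x : P. ?p x : ?O}"
 have "?p ` ?P0 = ?O" using Os by blast
 hence "sheet n ?P0 (Suc e) io" unfolding sheet_def
  using Suc.prems dfb_vimage[OF p dO] openin_interior_of[of "PT (Suc e)" "?p ` P"]
  by (auto intro: finite_subset[OF _ Suc.prems(4)])
 hence s0: "sheeted n ?P0" unfolding sheeted_def by (intro exI[of _ "{(?P0, Suc e, io)}"]) auto
 let ?Q = "?p ` P - ?O"
 have dQ: "dfb (Suc e) ?Q" by (intro definable_Diff dI dO)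
 have "PT (Suc e) interior_of ?Q <= ?O" by (rule interior_of_mono) blast
 moreover have "PT (Suc e) interior_of ?Q <= ?Q" by (rule interior_of_subset)
 ultimately have iQ: "PT (Suc e) interior_of ?Q = {}" by blast
 obtain Z where Z: "!!i. i < Suc e ==> dfb (Suc e) (Z i)"
  "!!i x. i < Suc e ==> x : TT (Suc e) ==> finite {c : TT 1. upd i x c : Z i}" "?Q = (\<Union>i<Suc e. Z i)"
  by (rule line_decomposition[OF dQ iQ]) blast
 have "sheeted n {x : P. ?p x : Z i}" if "i : {..<Suc e}" for i
 proof -
  have i: "i < Suc e" using that by simp
  let ?s = "%j. if j < i then j else Suc j"
  let ?io = "%j. io (?s j)"
  have pp: "prj e ?io x = prj e ?s (?p x)" for x by (auto simp: prj_def fun_eq_iff)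
  show ?thesis
  proof (rule Suc.IH)
   show "dfb n {x : P. ?p x : Z i}" by (rule dfb_vimage[OF p Z(1)[OF i]])
   have "inj_on ?s {..<e}" by (auto simp: inj_on_def)
   moreover have "inj_on io (?s ` {..<e})" by (rule inj_on_subset[OF Suc.prems(2)]) auto
   ultimately show "inj_on ?io {..<e}" using comp_inj_on[of ?s "{..<e}" io] unfolding comp_def by blast
   show "?io ` {..<e} <= {..<n}" using Suc.prems(3) by (auto simp: image_subset_iff)
   fix w
   show "finite {x : {x : P. ?p x : Z i}. prj e ?io x = w}"
   proof (cases "EX x0. x0 : P & prj e ?io x0 = w")
   case True
   then obtain x0 where x0: "x0 : P" "prj e ?io x0 = w" by blast
   have t: "?p x0 : TT (Suc e)" using dfnD(2)[OF p x0(1)] .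
   have F: "finite {y : Z i. prj e ?s y = prj e ?s (?p x0)}"
   by (rule delete_coordinate_finite[OF i t Z(2)[OF i t] definable_subset[OF Z(1)[OF i]]])
   have "{x : {x : P. ?p x : Z i}. prj e ?io x = w} <= (\<Union>y\<in>{y : Z i. prj e ?s y = prj e ?s (?p x0)}. {x : P. ?p x = y})"
   using x0(2) unfolding pp by auto
   thus ?thesis by (rule finite_subset) (use F Suc.prems(4) in auto)
   next
   case False
   hence "{x : {x : P. ?p x : Z i}. prj e ?io x = w} = {}" by blast
   thus ?thesis by (simp only: finite.emptyI)
   qed
  qed
 qed
 hence "sheeted n (\<Union>i\<in>{..<Suc e}. {x : P. ?p x : Z i})" by (intro sheeted_UN) auto
 hence "sheeted n (?P0 \<union> (\<Union>i\<in>{..<Suc e}. {x : P. ?p x : Z i}))" by (rule sheeted_Un[OF s0])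
 moreover have "?P0 \<union> (\<Union>i\<in>{..<Suc e}. {x : P. ?p x : Z i}) = P" using Z(3) by blast
 ultimately show ?case by simp
qed

lemma sheeted: "dfb n X ==> sheeted n X"
proof (rule sheeted_finite_projection[of n X "%j. j" n])
 assume X: "dfb n X"
 have "prj n (%j. j) x = x" if "x : X" for x
  using that definable_subset[OF X] unfolding prj_def by (auto simp: subset_iff)
 hence "{x : X. prj n (%j. j) x = w} <= {w}" for w by auto
 thus "finite {x : X. prj n (%j. j) x = w}" for w using finite_subset by blast
qed auto

end

section \<open>The group topology of a definable field\<close>

locale dfield = tmin L M \<tau> \<kappa> + field K
 for L :: "('f, 'r) fo_lang" and M :: "('a, 'f, 'r) fo_struct" and \<tau> :: "'a topology" and \<kappa> :: "'k rel"
  and K :: "(nat => 'a) ring" (structure) +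
 fixes n :: nat
 assumes df: "definable_field L M n K" and inf: "infinite (carrier K)"
begin

abbreviation "CK \<equiv> carrier K"

lemma dCK: "dfb n CK" using df by (simp add: definable_field_def)

lemma CK_sub: "CK <= TT n" by (rule definable_subset[OF dCK])

lemma CK_in [simp]: "x : CK ==> x : TT n" using CK_sub by blast

definition "GA = {tcat n x (n + n) (tcat n y n (x \<oplus> y)) | x y. x : CK & y : CK}"
definition "GM = {tcat n x (n + n) (tcat n y n (x \<otimes> y)) | x y. x : CK & y : CK}"

lemma dGA: "dfb (n + (n + n)) GA" and dGM: "dfb (n + (n + n)) GM"
 using df by (simp_all add: definable_field_def definable_op_def GA_def GM_def)

lemma in_graph_iff:
 assumes "x : TT n" "y : TT n" "z : TT n" and cl: "!!x y. x : CK ==> y : CK ==> g x y : CK"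
 shows "tcat n x (n + n) (tcat n y n z) : {tcat n x (n + n) (tcat n y n (g x y)) | x y. x : CK & y : CK}
  \<longleftrightarrow> x : CK & y : CK & z = g x y"
proof
 assume "tcat n x (n + n) (tcat n y n z) : {tcat n x (n + n) (tcat n y n (g x y)) | x y. x : CK & y : CK}"
 then obtain x' y' where xy: "x' : CK" "y' : CK" "tcat n x (n + n) (tcat n y n z) = tcat n x' (n + n) (tcat n y' n (g x' y'))" by blast
 have "x = x' & tcat n y n z = tcat n y' n (g x' y')"
  using xy assms by (subst tcat_eq_iff[where M = M, symmetric]) auto
 moreover from this have "y = y' & z = g x' y'"
  using xy assms by (subst tcat_eq_iff[where M = M, symmetric]) auto
 ultimately show "x : CK & y : CK & z = g x y" using xy by simp
qed blast

lemma GA_iff: "x : TT n ==> y : TT n ==> z : TT n ==>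
  tcat n x (n + n) (tcat n y n z) : GA \<longleftrightarrow> x : CK & y : CK & z = x \<oplus> y"
 unfolding GA_def by (rule in_graph_iff) auto

lemma GM_iff: "x : TT n ==> y : TT n ==> z : TT n ==>
  tcat n x (n + n) (tcat n y n z) : GM \<longleftrightarrow> x : CK & y : CK & z = x \<otimes> y"
 unfolding GM_def by (rule in_graph_iff) auto

lemma DT_add:
 assumes "DT Ga n t" "DT Ga n u" "wfc Ga" "!!x. x : cset Ga ==> t x : CK" "!!x. x : cset Ga ==> u x : CK"
 shows "DT Ga n (%x. t x \<oplus> u x)"
proof (rule DT_I[OF assms(3)])
 have "D (cx Ga n (TT n)) (%p. tcat n (t (fst p)) (n + n) (tcat n (u (fst p)) n (snd p)) : GA)"
  by (rule dint dGA assms(1-3) | (simp add: assms(3); fail)[1])+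
 thus "D (cx Ga n (TT n)) (%p. snd p = t (fst p) \<oplus> u (fst p))"
  by (rule D_cong) (use assms in \<open>auto simp: GA_iff\<close>)
qed (use assms in auto)

lemma DT_mult:
 assumes "DT Ga n t" "DT Ga n u" "wfc Ga" "!!x. x : cset Ga ==> t x : CK" "!!x. x : cset Ga ==> u x : CK"
 shows "DT Ga n (%x. t x \<otimes> u x)"
proof (rule DT_I[OF assms(3)])
 have "D (cx Ga n (TT n)) (%p. tcat n (t (fst p)) (n + n) (tcat n (u (fst p)) n (snd p)) : GM)"
  by (rule dint dGM assms(1-3) | (simp add: assms(3); fail)[1])+
 thus "D (cx Ga n (TT n)) (%p. snd p = t (fst p) \<otimes> u (fst p))"
  by (rule D_cong) (use assms in \<open>auto simp: GM_iff\<close>)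
qed (use assms in auto)

lemma DT_neg:
 assumes "DT Ga n t" "wfc Ga" "!!x. x : cset Ga ==> t x : CK"
 shows "DT Ga n (%x. \<ominus> t x)"
proof (rule DT_I[OF assms(2)])
 have "D (cx Ga n (TT n)) (%p. tcat n (snd p) (n + n) (tcat n (t (fst p)) n \<zero>) : GA)"
  by (rule dint dGA assms(1,2) | (simp add: assms(2); fail)[1])+
 thus "D (cx Ga n (TT n)) (%p. snd p = \<ominus> t (fst p))"
 proof (rule D_cong)
  fix p assume "p : cset (cx Ga n (TT n))"
  hence p: "fst p : cset Ga" "snd p : TT n" using assms(2) by auto
  hence t: "t (fst p) : CK" using assms(3) by blast
  hence "(snd p : CK & \<zero> = snd p \<oplus> t (fst p)) = (snd p = \<ominus> t (fst p))"
   by (metis a_inv_closed l_neg minus_equality)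
  thus "(tcat n (snd p) (n + n) (tcat n (t (fst p)) n \<zero>) : GA) = (snd p = \<ominus> t (fst p))"
   using p t by (simp add: GA_iff)
 qed
qed (use assms in auto)

lemma DT_inv:
 assumes "DT Ga n t" "wfc Ga" "!!x. x : cset Ga ==> t x : CK - {\<zero>}"
 shows "DT Ga n (%x. inv (t x))"
proof (rule DT_I[OF assms(2)])
 have i: "inv (t x) : CK" "inv (t x) \<otimes> t x = \<one>" if "x : cset Ga" for x
  using assms(3)[OF that] field_Units by auto
 thus "inv (t x) : TT n" if "x : cset Ga" for x using that by simp
 have "D (cx Ga n (TT n)) (%p. tcat n (snd p) (n + n) (tcat n (t (fst p)) n \<one>) : GM)"
  by (rule dint dGM assms(1,2) | (simp add: assms(2); fail)[1])+
 thus "D (cx Ga n (TT n)) (%p. snd p = inv (t (fst p)))"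
 proof (rule D_cong)
  fix p assume "p : cset (cx Ga n (TT n))"
  hence p: "fst p : cset Ga" "snd p : TT n" using assms(2) by auto
  hence t: "t (fst p) : CK" "t (fst p) : Units K" using assms(3) field_Units by auto
  have "(snd p : CK & \<one> = snd p \<otimes> t (fst p)) = (snd p = inv (t (fst p)))"
   using i[OF p(1)] t by (metis comm_inv_char m_comm)
  thus "(tcat n (snd p) (n + n) (tcat n (t (fst p)) n \<one>) : GM) = (snd p = inv (t (fst p)))"
   using p t by (simp add: GM_iff)
 qed
qed

definition chart :: "nat => (nat => 'a) set => ((nat => 'a) => (nat => 'a)) => bool" where
 "chart e U g \<longleftrightarrow> opn e U & U ~= {} & dfn e U n g & inj_on g U & g ` U <= CK"

lemma chart_subset: "chart e U g ==> opn e V ==> dfb e V ==> V ~= {} ==> V <= U ==> chart e V g"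
 unfolding chart_def by (meson dfn_subset inj_on_subset image_mono order.trans)

lemma chart_le_n: "chart e U g ==> e \<le> n"
 unfolding chart_def using injective_dim_le by blast

text \<open>The dimension of \<open>K\<close>. The maximum is over a finite set by
  \<open>chart_le_n\<close> and over a non-empty one by \<open>chart_0\<close>.\<close>

definition "dK = Max {e. EX U g. chart e U g}"

lemma chart_0: "EX U g. chart 0 U g"
proof -
 have "wfc (c0 0 (TT 0))" by (simp only: wfc_c0 definable_tuples)
 hence "dfn 0 (TT 0) n (%_. \<zero>)" by (intro dfnI[OF definable_tuples] DT_const) auto
 thus ?thesis unfolding chart_def using TT_ne[of 0] openin_TT[of 0]
  by (intro exI[of _ "TT 0"] exI[of _ "%_. \<zero>"]) (auto simp: inj_on_def)
qed

lemma finite_chart_dims: "finite {e. EX U g. chart e U g}"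
 by (rule finite_subset[of _ "{..n}"]) (auto dest: chart_le_n)

lemma dK_chart: "EX U g. chart dK U g"
 using Max_in[OF finite_chart_dims] chart_0 unfolding dK_def by blast

lemma chart_le: "chart e U g ==> e \<le> dK"
 unfolding dK_def by (rule Max_ge[OF finite_chart_dims]) blast

lemma sheet_prj: "sheet n P e io ==> dfn n P e (prj e io)"
 unfolding sheet_def by (blast intro: dfn_prj)

text \<open>A local section of the projection of a sheet is a chart; so sheets contained in
  \<open>K\<close> have dimension at most \<open>dK\<close>.\<close>

lemma sheet_chart:
 assumes P: "sheet n P e io" "P <= CK" "P ~= {}"
 shows "EX U g. chart e U g & g ` U <= P"
proof -
 have p: "dfn n P e (prj e io)" by (rule sheet_prj[OF P(1)])
 have o: "opn e (prj e io ` P)" and fin: "!!w. w : prj e io ` P ==> finite {x : P. prj e io x = w}"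
  using P(1) unfolding sheet_def by blast+
 have ne: "prj e io ` P ~= {}" using P(3) by blast
 obtain V s where V: "opn e V" "dfb e V" "V ~= {}" "V <= prj e io ` P" "dfn e V n s" "!!w. w : V ==> s w : P & prj e io (s w) = w"
  by (rule generic_section[OF p fin o dfb_image[OF p] ne order_refl]) (assumption, rule that)
 have "inj_on s V" using V(6) by (metis inj_onI)
 thus ?thesis using V P(2) unfolding chart_def by blast
qed

text \<open>If all charts had dimension \<open>0\<close>, so would all sheets of \<open>K\<close>;
  such a sheet is a single fibre, and \<open>K\<close> would be finite.\<close>

lemma dK_pos: "dK > 0"
proof (rule ccontr)
 assume "\<not> dK > 0"
 hence d0: "dK = 0" by simp
 obtain \<P> where F: "finite \<P>" "CK = (\<Union>(P, e, io)\<in>\<P>. P)" "ALL (P, e, io):\<P>. sheet n P e io"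
  using sheeted[OF dCK] unfolding sheeted_def by blast
 have "finite P" if "(P, e, io) : \<P>" for P e io
 proof (cases "P = {}")
  case False
  have s: "sheet n P e io" using F(3) that by blast
  have "P <= CK" using F(2) that by blast
  hence "e = 0" using sheet_chart[OF s _ False] chart_le d0 by fastforce
  hence "prj e io x = (%_. undefined)" for x by (simp add: prj_def fun_eq_iff)
  hence eq: "P = {x : P. prj e io x = (%_. undefined)}" by simp
  have "finite {x : P. prj e io x = (%_. undefined)}" using s unfolding sheet_def by blast
  thus ?thesis by (subst eq)
 qed simp
 hence "finite CK" unfolding F(2) using F(1) by auto
 thus False using inf by simp
qed

lemma sheet_cover:
 assumes U: "opn e U" "U ~= {}" and f: "dfn e U n f" "f ` U <= X" and X: "dfb n X"
 obtains V P k io where "opn e V" "dfb e V" "V ~= {}" "V <= U" "sheet n P k io" "P <= X" "f ` V <= P"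
proof -
 obtain \<P> where F: "finite \<P>" "X = (\<Union>(P, e, io)\<in>\<P>. P)" "ALL (P, e, io):\<P>. sheet n P e io"
  using sheeted[OF X] unfolding sheeted_def by blast
 have d: "dfb e {x : U. f x : fst c}" if "c : \<P>" for c
  by (rule dfb_vimage[OF f(1)]) (use F(3) that in \<open>auto simp: sheet_def\<close>)
 have cov: "U <= (\<Union>c\<in>\<P>. {x : U. f x : fst c})"
 proof
  fix x assume x: "x : U"
  hence "f x : (\<Union>(P, e, io)\<in>\<P>. P)" using f(2) F(2) by blast
  then obtain c where "c : \<P>" "f x : fst c" by (auto split: prod.splits)
  thus "x : (\<Union>c\<in>\<P>. {x : U. f x : fst c})" using x by blast
 qed
 obtain c V where V: "c : \<P>" "opn e V" "dfb e V" "V ~= {}" "V <= U" "V <= {x : U. f x : fst c}"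
  by (rule partition_interior[OF F(1) U(1) dfnD(1)[OF f(1)] U(2) d cov]) (assumption, rule that)
 obtain P k io where c: "c = (P, k, io)" by (cases c)
 have "sheet n P k io" "P <= X" using F(2,3) V(1) c by blast+
 moreover have "f ` V <= P" using V(6) c by auto
 ultimately show thesis using that[OF V(2-5)] by blast
qed

text \<open>The filter of neighbourhoods of zero that the chart suggests at \<open>x\<close>, after
  translating \<open>g x\<close> to zero.\<close>

definition germ :: "(nat => 'a) set => ((nat => 'a) => (nat => 'a)) => (nat => 'a) => (nat => 'a) set => bool" where
 "germ U g x A \<longleftrightarrow> (EX N. opn dK N & x : N & N <= U & (ALL u:N. g u \<ominus> g x : A))"

lemma germ_subset: "opn dK V ==> V <= U ==> x : V ==> germ V g x A \<longleftrightarrow> germ U g x A"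
 unfolding germ_def
proof
 assume V: "opn dK V" "V <= U" "x : V"
  and "EX N. opn dK N & x : N & N <= U & (ALL u:N. g u \<ominus> g x : A)"
 then obtain N where "opn dK N" "x : N" "N <= U" "ALL u:N. g u \<ominus> g x : A" by blast
 thus "EX N. opn dK N & x : N & N <= V & (ALL u:N. g u \<ominus> g x : A)"
  using V by (intro exI[of _ "N \<inter> V"]) auto
qed blast

lemma minus_eqI: "a : CK ==> b : CK ==> c : CK ==> e : CK ==> a \<oplus> b = c \<oplus> e ==> a \<ominus> c = e \<ominus> b"
proof -
 assume a: "a : CK" "b : CK" "c : CK" "e : CK" "a \<oplus> b = c \<oplus> e"
 have "a \<ominus> c = (a \<oplus> b) \<ominus> b \<ominus> c" using a(1-4) by algebra
 also have "\<dots> = (c \<oplus> e) \<ominus> b \<ominus> c" using a(5) by simp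
 also have "\<dots> = e \<ominus> b" using a(1-4) by algebra
 finally show ?thesis .
qed

lemma add_cancel_r: "a : CK ==> b : CK ==> c : CK ==> a \<oplus> b = c \<oplus> b ==> a = c"
proof -
 assume a: "a : CK" "b : CK" "c : CK" "a \<oplus> b = c \<oplus> b"
 have "a = (a \<oplus> b) \<ominus> b" using a(1-3) by algebra
 also have "\<dots> = c" unfolding a(4) using a(1-3) by algebra
 finally show ?thesis .
qed

lemma add_cancel_l: "a : CK ==> b : CK ==> c : CK ==> a \<oplus> b = a \<oplus> c ==> b = c"
 using add_cancel_r[of b a c] by (simp only: a_comm)

text \<open>The sum of the charts maps a small box into a sheet of \<open>K\<close>;
  \<open>q\<close> is its composition with the projection of that sheet. It has exactly
  \<open>dK\<close> coordinates: not more, since charts have dimension at most \<open>dK\<close>,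
  and not fewer, since for fixed \<open>y\<close> it is finite-to-one in \<open>x\<close>. Hence it
  is open in each variable by \<open>local_homeo\<close>, and generically the sum itself depends
  only on \<open>q\<close>.\<close>

lemma chart_sum_coordinates:
 assumes g1: "chart dK U1 g1" and g2: "chart dK U2 g2"
 obtains X Y q where "opn dK X" "dfb dK X" "X ~= {}" "X <= U1" "opn dK Y" "dfb dK Y" "Y ~= {}" "Y <= U2"
  "!!x y x' y'. x : X ==> y : Y ==> x' : X ==> y' : Y ==> q (tcat dK x dK y) = q (tcat dK x' dK y') ==> g1 x \<oplus> g2 y = g1 x' \<oplus> g2 y'"
  "cont (dK + dK) (Box dK X dK Y) dK q"
  "!!N y. opn dK N ==> N <= X ==> y : Y ==> opn dK ((%x. q (tcat dK x dK y)) ` N)"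
  "!!N x. opn dK N ==> N <= Y ==> x : X ==> opn dK ((%y. q (tcat dK x dK y)) ` N)"
proof -
 let ?d = dK
 have o12: "openin (PT ?d) U1" "openin (PT ?d) U2" "U1 ~= {}" "U2 ~= {}" and f1: "dfn ?d U1 n g1" and f2: "dfn ?d U2 n g2"
  and inj: "inj_on g1 U1" "inj_on g2 U2" and im: "g1 ` U1 <= CK" "g2 ` U2 <= CK"
  using g1 g2 unfolding chart_def by blast+
 have d12: "dfb ?d U1" "dfb ?d U2" using f1 f2 dfnD by blast+
 have sub: "U1 <= TT ?d" "U2 <= TT ?d" using d12 definable_subset by blast+
 let ?B = "Box ?d U1 ?d U2"
 have oB: "opn (?d + ?d) ?B" and dB: "dfb (?d + ?d) ?B" using o12 d12 by (simp_all add: open_Box dfb_Box)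
 obtain x1 y1 where "x1 : U1" "y1 : U2" using o12 by blast
 hence neB: "?B ~= {}" using tcat_in_Box[OF sub] by blast
 let ?F = "%z. g1 (tfst ?d z) \<oplus> g2 (tsnd ?d ?d z)"
 have Bz: "tfst ?d z : U1" "tsnd ?d ?d z : U2" if "z : ?B" for z using that by (auto simp: Box_def)
 have Fim: "?F ` ?B <= CK" using im Bz by (auto simp: image_subset_iff)
 have F: "dfn (?d + ?d) ?B n ?F"
  by (rule dfnI[OF dB], (rule DT_add DT_app[OF f1] DT_app[OF f2] dint dB | (use Bz im dB in \<open>force\<close>)[1])+)
 obtain V P e io where V: "opn (?d + ?d) V" "dfb (?d + ?d) V" "V ~= {}" "V <= ?B" "sheet n P e io" "P <= CK" "?F ` V <= P"
  by (rule sheet_cover[OF oB neB F Fim dCK])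
 have P: "dfn n P e (prj e io)" by (rule sheet_prj[OF V(5)])
 have Pfin: "finite {x : P. prj e io x = w}" for w using V(5) unfolding sheet_def by blast
 have "P ~= {}" using V(3,7) by blast
 hence ed: "e \<le> ?d" using sheet_chart[OF V(5,6)] chart_le by blast
 obtain z0 where z0: "z0 : V" using V(3) by blast
 obtain X0 Y0 where XY0: "openin (PT ?d) X0" "openin (PT ?d) Y0" "dfb ?d X0" "dfb ?d Y0" "tfst ?d z0 : X0" "tsnd ?d ?d z0 : Y0" "Box ?d X0 ?d Y0 <= V"
  using definable_Box[OF V(1) z0] .
 let ?C = "Box ?d X0 ?d Y0"
 have oB0: "opn (?d + ?d) ?C" and dB0: "dfb (?d + ?d) ?C" using XY0 by (simp_all add: open_Box dfb_Box)
 have B0B: "?C <= ?B" using XY0(7) V(4) by blast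
 have s0: "X0 <= TT ?d" "Y0 <= TT ?d" using XY0 definable_subset by blast+
 have mem0: "tcat ?d x ?d y : ?C" if "x : X0" "y : Y0" for x y using tcat_in_Box[OF s0 that] .
 have neB0: "?C ~= {}" using mem0 XY0(5,6) by blast
 let ?q = "%z. prj e io (?F z)"
 have F0: "dfn (?d + ?d) ?C n ?F" by (rule dfn_subset[OF F dB0 B0B])
 have FP: "?F ` ?C <= P" using V(7) XY0(7) by blast
 have q: "dfn (?d + ?d) ?C e ?q" by (rule dfn_comp[OF F0 P FP])
 have canc1: "tfst ?d z = tfst ?d z'" if "z : ?C" "z' : ?C" "tsnd ?d ?d z = tsnd ?d ?d z'" "?F z = ?F z'" for z z'
 proof -
  have U: "tfst ?d z : U1" "tsnd ?d ?d z : U2" "tfst ?d z' : U1" using that Bz B0B by blast+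
  hence c: "g1 (tfst ?d z) : CK" "g2 (tsnd ?d ?d z) : CK" "g1 (tfst ?d z') : CK" using im by blast+
  have "g1 (tfst ?d z) \<oplus> g2 (tsnd ?d ?d z) = g1 (tfst ?d z') \<oplus> g2 (tsnd ?d ?d z)"
   unfolding that(4) that(3)[symmetric] ..
  hence "g1 (tfst ?d z) = g1 (tfst ?d z')" by (rule add_cancel_r[OF c(1,2,3)])
  thus ?thesis using inj_onD[OF inj(1)] U by blast
 qed
 have canc2: "tsnd ?d ?d z = tsnd ?d ?d z'" if "z : ?C" "z' : ?C" "tfst ?d z = tfst ?d z'" "?F z = ?F z'" for z z'
 proof -
  have U: "tfst ?d z : U1" "tsnd ?d ?d z : U2" "tsnd ?d ?d z' : U2" using that Bz B0B by blast+
  hence c: "g1 (tfst ?d z) : CK" "g2 (tsnd ?d ?d z) : CK" "g2 (tsnd ?d ?d z') : CK" using im by blast+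
  have "g1 (tfst ?d z) \<oplus> g2 (tsnd ?d ?d z) = g1 (tfst ?d z) \<oplus> g2 (tsnd ?d ?d z')"
   unfolding that(4) that(3)[symmetric] ..
  hence "g2 (tsnd ?d ?d z) = g2 (tsnd ?d ?d z')" by (rule add_cancel_l[OF c])
  thus ?thesis using inj_onD[OF inj(2)] U by blast
 qed
 have zt: "tcat ?d (tfst ?d z) ?d (tsnd ?d ?d z) = z" if "z : ?C" for z using that by (auto simp: Box_def)
 have zeq: "z = z'" if "z : ?C" "z' : ?C" "tfst ?d z = tfst ?d z'" "tsnd ?d ?d z = tsnd ?d ?d z'" for z z'
  by (subst zt[OF that(1), symmetric], subst zt[OF that(2), symmetric]) (simp only: that(3,4))
 have fin1: "finite {z' : ?C. tsnd ?d ?d z' = y & ?q z' = w}" for y w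
 proof (rule finite_imageD)
  show "finite (?F ` {z' : ?C. tsnd ?d ?d z' = y & ?q z' = w})"
   by (rule finite_subset[OF _ Pfin[of w]]) (use FP in blast)
  show "inj_on ?F {z' : ?C. tsnd ?d ?d z' = y & ?q z' = w}"
  proof (rule inj_onI)
   fix z z' assume z: "z : {z' : ?C. tsnd ?d ?d z' = y & ?q z' = w}" "z' : {z' : ?C. tsnd ?d ?d z' = y & ?q z' = w}" "?F z = ?F z'"
   hence m: "z : ?C" "z' : ?C" "tsnd ?d ?d z = tsnd ?d ?d z'" by simp_all
   show "z = z'" by (rule zeq[OF m(1,2) canc1[OF m z(3)] m(3)])
  qed
 qed
 have fin2: "finite {z' : ?C. tfst ?d z' = y & ?q z' = w}" for y w
 proof (rule finite_imageD)
  show "finite (?F ` {z' : ?C. tfst ?d z' = y & ?q z' = w})"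
   by (rule finite_subset[OF _ Pfin[of w]]) (use FP in blast)
  show "inj_on ?F {z' : ?C. tfst ?d z' = y & ?q z' = w}"
  proof (rule inj_onI)
   fix z z' assume z: "z : {z' : ?C. tfst ?d z' = y & ?q z' = w}" "z' : {z' : ?C. tfst ?d z' = y & ?q z' = w}" "?F z = ?F z'"
   hence m: "z : ?C" "z' : ?C" "tfst ?d z = tfst ?d z'" by simp_all
   show "z = z'" by (rule zeq[OF m(1,2) m(3) canc2[OF m z(3)]])
  qed
 qed
 \<comment> \<open>For fixed second argument the sum is injective and the projection of the sheet is
   finite-to-one, so \<open>dK\<close> coordinates are mapped with finite fibres into
   \<open>M^e\<close>.\<close>
 have de: "?d \<le> e"
 proof -
  let ?y = "tsnd ?d ?d z0"
  have yt: "?y : TT ?d" using XY0(6) s0 by blast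
  have sl: "dfn ?d X0 e (%x. ?q (tcat ?d x ?d ?y))"
   by (rule dfn_slice[OF q XY0(3) yt]) (use mem0 XY0(6) in blast)
  have "finite {x' : X0. ?q (tcat ?d x' ?d ?y) = ?q (tcat ?d x ?d ?y)}" if "x : X0" for x
  proof (rule finite_imageD)
   show "finite ((%x. tcat ?d x ?d ?y) ` {x' : X0. ?q (tcat ?d x' ?d ?y) = ?q (tcat ?d x ?d ?y)})"
   by (rule finite_subset[OF _ fin1[of ?y "?q (tcat ?d x ?d ?y)"]]) (use mem0 XY0(6) yt s0 in auto)
   show "inj_on (%x. tcat ?d x ?d ?y) {x' : X0. ?q (tcat ?d x' ?d ?y) = ?q (tcat ?d x ?d ?y)}"
   proof (rule inj_onI)
   fix a b assume "a : {x' : X0. ?q (tcat ?d x' ?d ?y) = ?q (tcat ?d x ?d ?y)}" "b : {x' : X0. ?q (tcat ?d x' ?d ?y) = ?q (tcat ?d x ?d ?y)}"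
   "tcat ?d a ?d ?y = tcat ?d b ?d ?y"
   moreover from this have "a : TT ?d" "b : TT ?d" using s0 by blast+
   ultimately show "a = b" using tcat_eq_iff[OF _ _ yt yt] by blast
   qed
  qed
  thus ?thesis using finite_to_one_dim_le[OF XY0(1) _ sl] XY0(5) by blast
 qed
 have e: "e = ?d" using ed de by simp
 have q': "dfn (?d + ?d) ?C ?d ?q" using q e by simp
 \<comment> \<open>Keeping one argument and replacing the other by \<open>q\<close> gives
   finite-to-one maps between spaces of equal dimension, so both can be made open; openness of
   \<open>q\<close> in a single variable is read off from them.\<close>
 let ?Pa = "%z. tcat ?d (?q z) ?d (tsnd ?d ?d z)"
 let ?Pb = "%z. tcat ?d (tfst ?d z) ?d (?q z)"
 have Dq: "DT (c0 (?d + ?d) ?C) ?d ?q" using q' by (simp add: dfn_def)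
 have P1: "dfn (?d + ?d) ?C (?d + ?d) ?Pa" by (rule dfnI[OF dB0], (rule Dq dint dB0 | (simp add: dB0; fail)[1])+)
 have P2: "dfn (?d + ?d) ?C (?d + ?d) ?Pb" by (rule dfnI[OF dB0], (rule Dq dint dB0 | (simp add: dB0; fail)[1])+)
 have qt: "?q z : TT ?d" if "z : ?C" for z using dfnD(2)[OF q' that] .
 have tt: "tfst ?d z : TT ?d" "tsnd ?d ?d z : TT ?d" if "z : ?C" for z using that by (auto simp: Box_def)
 have eq1: "?q z = ?q z' & tsnd ?d ?d z = tsnd ?d ?d z'" if "?Pa z = ?Pa z'" "z : ?C" "z' : ?C" for z z'
  using that(1) unfolding tcat_eq_iff[OF qt[OF that(2)] qt[OF that(3)] tt(2)[OF that(2)] tt(2)[OF that(3)]] .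
 have eq2: "?q z = ?q z' & tfst ?d z = tfst ?d z'" if "?Pb z = ?Pb z'" "z : ?C" "z' : ?C" for z z'
  using that(1) unfolding tcat_eq_iff[OF tt(1)[OF that(2)] tt(1)[OF that(3)] qt[OF that(2)] qt[OF that(3)]] by blast
 have finP1: "finite {z' : ?C. ?Pa z' = ?Pa z}" if "z : ?C" for z
  by (rule finite_subset[OF _ fin1[of "tsnd ?d ?d z" "?q z"]]) (use eq1 that in blast)
 obtain W1 where W1: "opn (?d + ?d) W1" "dfb (?d + ?d) W1" "W1 ~= {}" "W1 <= ?C" "inj_on ?Pa W1"
  by (rule generic_injective[OF oB0 neB0 P1 finP1])
 obtain W2 where W2: "opn (?d + ?d) W2" "dfb (?d + ?d) W2" "W2 ~= {}" "W2 <= W1" "cont (?d + ?d) W2 (?d + ?d) ?Pa"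
  and op1: "!!W. opn (?d + ?d) W ==> W <= W2 ==> opn (?d + ?d) (?Pa ` W)"
  by (rule local_homeo[OF W1(1,3) dfn_subset[OF P1 W1(2,4)] W1(5)]) (rule that)
 have W2B: "W2 <= ?C" using W1 W2 by blast
 have finP2: "finite {z' : W2. ?Pb z' = ?Pb z}" if "z : W2" for z
  by (rule finite_subset[OF _ fin2[of "tfst ?d z" "?q z"]]) (use eq2 that W2B in blast)
 have P2W2: "dfn (?d + ?d) W2 (?d + ?d) ?Pb" by (rule dfn_subset[OF P2 W2(2) W2B])
 obtain W3 where W3: "opn (?d + ?d) W3" "dfb (?d + ?d) W3" "W3 ~= {}" "W3 <= W2" "inj_on ?Pb W3"
  by (rule generic_injective[OF W2(1,3) P2W2 finP2])
 obtain W4 where W4: "opn (?d + ?d) W4" "dfb (?d + ?d) W4" "W4 ~= {}" "W4 <= W3" "cont (?d + ?d) W4 (?d + ?d) ?Pb"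
  and op2: "!!W. opn (?d + ?d) W ==> W <= W4 ==> opn (?d + ?d) (?Pb ` W)"
  by (rule local_homeo[OF W3(1,3) dfn_subset[OF P2W2 W3(2,4)] W3(5)]) (rule that)
 have W4B: "W4 <= ?C" and W42: "W4 <= W2" using W2B W3 W4 by blast+
 \<comment> \<open>The values of the sum with a given \<open>q\<close> lie in one fibre of the
   sheet, so \<open>generic_factor\<close> applies.\<close>
 have finF: "finite {?F z' | z'. z' : W4 & ?q z' = ?q z}" if "z : W4" for z
  by (rule finite_subset[OF _ Pfin[of "?q z"]]) (use FP W4B in blast)
 obtain W5 where W5: "opn (?d + ?d) W5" "dfb (?d + ?d) W5" "W5 ~= {}" "W5 <= W4"
  and fac: "!!z z'. z : W5 ==> z' : W5 ==> ?q z = ?q z' ==> ?F z = ?F z'"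
  by (rule generic_factor[OF W4(1,3) dfn_subset[OF q' W4(2) W4B] dfn_subset[OF F0 W4(2) W4B] finF]) (assumption, rule that)
 obtain z1 where z1: "z1 : W5" using W5(3) by blast
 obtain X Y where XY: "openin (PT ?d) X" "openin (PT ?d) Y" "dfb ?d X" "dfb ?d Y" "tfst ?d z1 : X" "tsnd ?d ?d z1 : Y" "Box ?d X ?d Y <= W5"
  using definable_Box[OF W5(1) z1] .
 have s: "X <= TT ?d" "Y <= TT ?d" using XY definable_subset by blast+
 have mem: "tcat ?d x ?d y : Box ?d X ?d Y" if "x : X" "y : Y" for x y using tcat_in_Box[OF s that] .
 have BW2: "Box ?d X ?d Y <= W2" and BB0: "Box ?d X ?d Y <= ?C" using XY(7) W5(4) W42 W4B by blast+
 have tf: "tfst ?d (tcat ?d x ?d y) = x" "tsnd ?d ?d (tcat ?d x ?d y) = y" if "x : X" "y : Y" for x y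
  using that s by (metis subsetD tcat_simps(1), metis subsetD tcat_simps(2))
 show thesis
 proof (rule that[of X Y ?q])
  show "openin (PT ?d) X" "dfb ?d X" "X ~= {}" "openin (PT ?d) Y" "dfb ?d Y" "Y ~= {}" using XY by blast+
  show "X <= U1"
  proof
   fix x assume "x : X"
   hence "tcat ?d x ?d (tsnd ?d ?d z1) : ?B" using mem XY(6) BB0 B0B by blast
   thus "x : U1" using Bz(1) tf(1)[OF `x : X` XY(6)] by metis
  qed
  show "Y <= U2"
  proof
   fix y assume "y : Y"
   hence "tcat ?d (tfst ?d z1) ?d y : ?B" using mem XY(5) BB0 B0B by blast
   thus "y : U2" using Bz(2) tf(2)[OF XY(5) \<open>y \<in> Y\<close>] by metis
  qed
  show "g1 x \<oplus> g2 y = g1 x' \<oplus> g2 y'" if "x : X" "y : Y" "x' : X" "y' : Y" "?q (tcat ?d x ?d y) = ?q (tcat ?d x' ?d y')" for x y x' y'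
   using fac[OF subsetD[OF XY(7) mem[OF that(1,2)]] subsetD[OF XY(7) mem[OF that(3,4)]] that(5)]
   unfolding tf[OF that(1,2)] tf[OF that(3,4)] .
  have c1: "continuous_map (sbt (?d + ?d) W2) (PT ?d) (tfst ?d \<circ> ?Pa)"
   by (rule continuous_map_compose[OF W2(5) continuous_map_tfst])
  have "continuous_map (sbt (?d + ?d) W2) (PT ?d) ?q"
  proof (rule continuous_map_eq[OF c1])
   fix z assume "z : topspace (sbt (?d + ?d) W2)"
   hence "z : ?C" using W2B by auto
   thus "(tfst ?d \<circ> ?Pa) z = ?q z" using qt tt by simp
  qed
  thus "continuous_map (sbt (?d + ?d) (Box ?d X ?d Y)) (PT ?d) ?q"
   by (rule continuous_map_from_subtopology_mono[OF _ BW2])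
  show "openin (PT ?d) ((%x. ?q (tcat ?d x ?d y)) ` N)" if N: "openin (PT ?d) N" "N <= X" "y : Y" for N y
  proof -
   have NB: "Box ?d N ?d Y <= Box ?d X ?d Y" using N(2) by (auto simp: Box_def)
   have y: "y : TT ?d" using N(3) s by blast
   have o: "opn (?d + ?d) (?Pa ` Box ?d N ?d Y)"
   by (rule op1) (use N XY(2) NB BW2 in \<open>auto intro: open_Box\<close>)
   have "continuous_map (PT ?d) (PT (?d + ?d)) (%w. tcat ?d w ?d y)"
   by (intro continuous_map_tcat continuous_map_id[unfolded id_def]) (use y in \<open>simp only: continuous_map_const topspace_PT simp_thms\<close>)
   from openin_continuous_map_preimage[OF this o]
   have "openin (PT ?d) {w : TT ?d. tcat ?d w ?d y : ?Pa ` Box ?d N ?d Y}" unfolding topspace_PT .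
   moreover have "{w : TT ?d. tcat ?d w ?d y : ?Pa ` Box ?d N ?d Y} = (%x. ?q (tcat ?d x ?d y)) ` N"
   proof (intro Set.set_eqI iffI)
   fix w assume w: "w : {w : TT ?d. tcat ?d w ?d y : ?Pa ` Box ?d N ?d Y}"
   then obtain z where z: "z : Box ?d N ?d Y" "tcat ?d w ?d y = ?Pa z" by blast
   have zB: "z : ?C" using z(1) NB BB0 by blast
   have e: "w = ?q z & y = tsnd ?d ?d z" using z(2) w y qt[OF zB] tt[OF zB] by (subst tcat_eq_iff[where M = M, symmetric]) auto
   have m: "tfst ?d z : N" using z(1) by (simp add: Box_def)
   have eq: "w = ?q (tcat ?d (tfst ?d z) ?d y)" unfolding conjunct2[OF e] zt[OF zB] by (rule conjunct1[OF e])
   show "w : (%x. ?q (tcat ?d x ?d y)) ` N" using m by (rule image_eqI[where x = "tfst ?d z", rotated]) (rule eq)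
   next
   fix w assume "w : (%x. ?q (tcat ?d x ?d y)) ` N"
   then obtain x where x: "x : N" "w = ?q (tcat ?d x ?d y)" by blast
   have xX: "x : X" "x : TT ?d" using x N s by blast+
   have zN: "tcat ?d x ?d y : Box ?d N ?d Y" using x(1) N(3) xX y by (simp add: Box_def)
   have "tcat ?d w ?d y = ?Pa (tcat ?d x ?d y)" using x(2) tf(2)[OF xX(1) N(3)] by simp
   moreover have "w : TT ?d" using x(2) qt[of "tcat ?d x ?d y"] zN NB BB0 by blast
   ultimately show "w : {w : TT ?d. tcat ?d w ?d y : ?Pa ` Box ?d N ?d Y}" using zN by blast
   qed
   ultimately show ?thesis by simp
  qed
  show "openin (PT ?d) ((%y. ?q (tcat ?d x ?d y)) ` N)" if N: "openin (PT ?d) N" "N <= Y" "x : X" for N x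
  proof -
   have NB: "Box ?d X ?d N <= Box ?d X ?d Y" using N(2) by (auto simp: Box_def)
   have x: "x : TT ?d" using N(3) s by blast
   have o: "opn (?d + ?d) (?Pb ` Box ?d X ?d N)"
   by (rule op2) (use N XY(1) NB XY(7) W5(4) in \<open>auto intro: open_Box\<close>)
   have "continuous_map (PT ?d) (PT (?d + ?d)) (%w. tcat ?d x ?d w)"
   by (intro continuous_map_tcat continuous_map_id[unfolded id_def]) (use x in \<open>simp only: continuous_map_const topspace_PT simp_thms\<close>)
   from openin_continuous_map_preimage[OF this o]
   have "openin (PT ?d) {w : TT ?d. tcat ?d x ?d w : ?Pb ` Box ?d X ?d N}" unfolding topspace_PT .
   moreover have "{w : TT ?d. tcat ?d x ?d w : ?Pb ` Box ?d X ?d N} = (%y. ?q (tcat ?d x ?d y)) ` N"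
   proof (intro Set.set_eqI iffI)
   fix w assume w: "w : {w : TT ?d. tcat ?d x ?d w : ?Pb ` Box ?d X ?d N}"
   then obtain z where z: "z : Box ?d X ?d N" "tcat ?d x ?d w = ?Pb z" by blast
   have zB: "z : ?C" using z(1) NB BB0 by blast
   have e: "x = tfst ?d z & w = ?q z" using z(2) w x qt[OF zB] tt[OF zB] by (subst tcat_eq_iff[where M = M, symmetric]) auto
   have m: "tsnd ?d ?d z : N" using z(1) by (simp add: Box_def)
   have eq: "w = ?q (tcat ?d x ?d (tsnd ?d ?d z))" unfolding conjunct1[OF e] zt[OF zB] by (rule conjunct2[OF e])
   show "w : (%y. ?q (tcat ?d x ?d y)) ` N" using m by (rule image_eqI[where x = "tsnd ?d ?d z", rotated]) (rule eq)
   next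
   fix w assume "w : (%y. ?q (tcat ?d x ?d y)) ` N"
   then obtain y where y: "y : N" "w = ?q (tcat ?d x ?d y)" by blast
   have yY: "y : Y" "y : TT ?d" using y N s by blast+
   have zN: "tcat ?d x ?d y : Box ?d X ?d N" using y(1) N(3) yY x by (simp add: Box_def)
   have "tcat ?d x ?d w = ?Pb (tcat ?d x ?d y)" using y(2) tf(1)[OF N(3) yY(1)] by simp
   moreover have "w : TT ?d" using y(2) qt[of "tcat ?d x ?d y"] zN NB BB0 by blast
   ultimately show "w : {w : TT ?d. tcat ?d x ?d w : ?Pb ` Box ?d X ?d N}" using zN by blast
   qed
   ultimately show ?thesis by simp
  qed
 qed
qed

end

section \<open>The group topology \<open>rho\<close>, its definable basis and its charts\<close>

context dfield begin

lemma germ_mono: "germ U g x A ==> A <= B ==> germ U g x B"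
 unfolding germ_def by blast

lemma germ_Int: "germ U g x A ==> germ U g x B ==> germ U g x (A \<inter> B)"
proof -
 assume "germ U g x A" "germ U g x B"
 then obtain N N' where "opn dK N" "x : N" "N <= U" "ALL u:N. g u \<ominus> g x : A"
  "opn dK N'" "x : N'" "N' <= U" "ALL u:N'. g u \<ominus> g x : B" unfolding germ_def by blast
 thus ?thesis unfolding germ_def by (intro exI[of _ "N \<inter> N'"]) auto
qed

lemma germ_zero: "g ` U <= CK ==> germ U g x A ==> \<zero> : A"
proof -
 assume g: "g ` U <= CK" and "germ U g x A"
 then obtain N where N: "x : N" "N <= U" "ALL u:N. g u \<ominus> g x : A" unfolding germ_def by blast
 hence "g x : CK" using g by blast
 hence "g x \<ominus> g x = \<zero>" by algebra
 thus ?thesis using N by force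
qed

text \<open>The sum of two charts factors through a coordinate map that is open in each variable, so
 moving one summand can be compensated by moving the other one: the germs agree.\<close>

lemma germ_agree:
 assumes g1: "chart dK U1 g1" and g2: "chart dK U2 g2"
 obtains X Y where "opn dK X" "dfb dK X" "X ~= {}" "X <= U1" "opn dK Y" "dfb dK Y" "Y ~= {}" "Y <= U2"
  "!!x y A. x : X ==> y : Y ==> germ X g1 x A \<longleftrightarrow> germ Y g2 y A"
  "!!x y A. x : X ==> y : Y ==> germ Y g2 y A ==> EX B. germ Y g2 y B & (ALL b:B. ALL b':B. b \<oplus> b' : A)"
proof -
 obtain X Y q where X: "opn dK X" "dfb dK X" "X ~= {}" "X <= U1"
  and Y: "opn dK Y" "dfb dK Y" "Y ~= {}" "Y <= U2"
  and fac: "!!x y x' y'. x : X ==> y : Y ==> x' : X ==> y' : Y ==> q (tcat dK x dK y) = q (tcat dK x' dK y') ==> g1 x \<oplus> g2 y = g1 x' \<oplus> g2 y'"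
  and c: "cont (dK + dK) (Box dK X dK Y) dK q"
  and op1: "!!N y. opn dK N ==> N <= X ==> y : Y ==> opn dK ((%x. q (tcat dK x dK y)) ` N)"
  and op2: "!!N x. opn dK N ==> N <= Y ==> x : X ==> opn dK ((%y. q (tcat dK x dK y)) ` N)"
  by (rule chart_sum_coordinates[OF g1 g2]) (rule that)
 have im: "!!x. x : X ==> g1 x : CK" "!!y. y : Y ==> g2 y : CK"
  using g1 g2 X Y unfolding chart_def by blast+
 have s: "X <= TT dK" "Y <= TT dK" using X Y definable_subset by blast+
 have oB: "opn (dK + dK) (Box dK X dK Y)" by (rule open_Box[OF X(1) Y(1)])
 have nb: "EX N1 N2. opn dK N1 & opn dK N2 & x : N1 & y : N2 & N1 <= X & N2 <= Y &
   (ALL x':N1. ALL y':N2. q (tcat dK x' dK y') : Q)"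
  if xy: "x : X" "y : Y" and Q: "opn dK Q" "q (tcat dK x dK y) : Q" for x y Q
 proof -
  have t: "x : TT dK" "y : TT dK" using xy s by blast+
  have o: "opn (dK + dK) {z : Box dK X dK Y. q z : Q}" by (rule open_preimage[OF oB c Q(1)])
  have "tcat dK x dK y : {z : Box dK X dK Y. q z : Q}" using tcat_in_Box[OF s xy] Q(2) by blast
  then obtain N1 N2 where N: "opn dK N1" "opn dK N2" "tfst dK (tcat dK x dK y) : N1" "tsnd dK dK (tcat dK x dK y) : N2"
   "Box dK N1 dK N2 <= {z : Box dK X dK Y. q z : Q}" by (rule Box_subset[OF o])
  have ns: "N1 <= TT dK" "N2 <= TT dK" using N openin_PT_subset by blast+
  have q: "q (tcat dK x' dK y') : Q" if "x' : N1" "y' : N2" for x' y'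
   using subsetD[OF N(5) tcat_in_Box[OF ns that]] by blast
  show ?thesis
   by (rule exI[of _ "N1 \<inter> X"], rule exI[of _ "N2 \<inter> Y"]) (use N(1-4) X(1) Y(1) xy q t in auto)
 qed
 \<comment> \<open>Since \<open>q\<close> is open in its second variable, the values of
   \<open>q\<close> for \<open>x'\<close> near \<open>x\<close> and \<open>y'\<close> near
   \<open>y\<close> are already attained at \<open>x\<close> by some \<open>u\<close> in
   \<open>N\<close>; equal values of \<open>q\<close> mean equal sums.\<close>
 have A1: "EX N1 N2. opn dK N1 & opn dK N2 & x : N1 & y : N2 & N1 <= X & N2 <= Y &
   (ALL x':N1. ALL y':N2. EX u:N. g1 x' \<oplus> g2 y' = g1 x \<oplus> g2 u)"
  if xy: "x : X" "y : Y" and N: "opn dK N" "y : N" "N <= Y" for x y N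
 proof -
  have "q (tcat dK x dK y) : (%y. q (tcat dK x dK y)) ` N" using N by blast
  from nb[OF xy op2[OF N(1,3) xy(1)] this] obtain N1 N2 where N12: "opn dK N1" "opn dK N2" "x : N1" "y : N2" "N1 <= X" "N2 <= Y"
   "ALL x':N1. ALL y':N2. q (tcat dK x' dK y') : (%y. q (tcat dK x dK y)) ` N" by (elim exE conjE)
  have "EX u:N. g1 x' \<oplus> g2 y' = g1 x \<oplus> g2 u" if m: "x' : N1" "y' : N2" for x' y'
  proof -
   have "q (tcat dK x' dK y') : (%y. q (tcat dK x dK y)) ` N" using N12(7) m by blast
   then obtain u where u: "u : N" "q (tcat dK x' dK y') = q (tcat dK x dK u)" by (rule imageE)
   show ?thesis by (rule bexI[OF _ u(1)], rule fac) (use m N12 xy u N in blast)+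
  qed
  thus ?thesis using N12(1-6) by blast
 qed
 have A2: "EX N2. opn dK N2 & y : N2 & N2 <= Y & (ALL y':N2. EX u:N. g1 x \<oplus> g2 y' = g1 u \<oplus> g2 y)"
  if xy: "x : X" "y : Y" and N: "opn dK N" "x : N" "N <= X" for x y N
 proof -
  have "q (tcat dK x dK y) : (%x. q (tcat dK x dK y)) ` N" using N by blast
  from nb[OF xy op1[OF N(1,3) xy(2)] this] obtain N1 N2 where N12: "opn dK N1" "opn dK N2" "x : N1" "y : N2" "N1 <= X" "N2 <= Y"
   "ALL x':N1. ALL y':N2. q (tcat dK x' dK y') : (%x. q (tcat dK x dK y)) ` N" by (elim exE conjE)
  have "EX u:N. g1 x \<oplus> g2 y' = g1 u \<oplus> g2 y" if m: "y' : N2" for y'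
  proof -
   have "q (tcat dK x dK y') : (%x. q (tcat dK x dK y)) ` N" using N12(3,7) m by blast
   then obtain u where u: "u : N" "q (tcat dK x dK y') = q (tcat dK u dK y)" by (rule imageE)
   show ?thesis by (rule bexI[OF _ u(1)], rule fac) (use m N12 xy u N in blast)+
  qed
  thus ?thesis using N12 by blast
 qed
 have G21: "germ X g1 x A" if xy: "x : X" "y : Y" and A: "germ Y g2 y A" for x y A
 proof -
  obtain N where N: "opn dK N" "y : N" "N <= Y" "ALL u:N. g2 u \<ominus> g2 y : A" using A unfolding germ_def by blast
  obtain N1 N2 where N12: "opn dK N1" "x : N1" "y : N2" "N1 <= X"
   "ALL x':N1. ALL y':N2. EX u:N. g1 x' \<oplus> g2 y' = g1 x \<oplus> g2 u" using A1[OF xy N(1-3)] by blast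
  have "g1 x' \<ominus> g1 x : A" if x': "x' : N1" for x'
  proof -
   obtain u where u: "u : N" "g1 x' \<oplus> g2 y = g1 x \<oplus> g2 u" using N12(3,5) x' by blast
   have "g1 x' \<ominus> g1 x = g2 u \<ominus> g2 y"
   by (rule minus_eqI[OF _ _ _ _ u(2)]) (use im x' u(1) xy N12(4) N(3) in blast)+
   thus ?thesis using N(4) u(1) by simp
  qed
  thus ?thesis unfolding germ_def using N12 by blast
 qed
 have G12: "germ Y g2 y A" if xy: "x : X" "y : Y" and A: "germ X g1 x A" for x y A
 proof -
  obtain N where N: "opn dK N" "x : N" "N <= X" "ALL u:N. g1 u \<ominus> g1 x : A" using A unfolding germ_def by blast
  obtain N2 where N2: "opn dK N2" "y : N2" "N2 <= Y" "ALL y':N2. EX u:N. g1 x \<oplus> g2 y' = g1 u \<oplus> g2 y"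
   using A2[OF xy N(1-3)] by blast
  have "g2 y' \<ominus> g2 y : A" if y': "y' : N2" for y'
  proof -
   obtain u where u: "u : N" "g1 x \<oplus> g2 y' = g1 u \<oplus> g2 y" using N2(4) y' by blast
   have eqq: "g1 u \<ominus> g1 x = g2 y' \<ominus> g2 y"
   by (rule minus_eqI[OF _ _ _ _ u(2)[symmetric]]) (use im y' u(1) xy N2(3) N(3) in blast)+
   show ?thesis using bspec[OF N(4) u(1)] eqq by simp
  qed
  thus ?thesis unfolding germ_def using N2 by blast
 qed
 \<comment> \<open>Differences of \<open>g1\<close> near \<open>x\<close> and of \<open>g2\<close>
   near \<open>y\<close> add up to a difference of \<open>g2\<close> near \<open>y\<close>, by
   \<open>A1\<close>. The set of the former is a germ at \<open>y\<close> as well, by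
   \<open>G12\<close>, so the intersection of the two sets can serve as \<open>B\<close>.\<close>
 have S: "EX B. germ Y g2 y B & (ALL b:B. ALL b':B. b \<oplus> b' : A)" if xy: "x : X" "y : Y" and A: "germ Y g2 y A" for x y A
 proof -
  obtain N where N: "opn dK N" "y : N" "N <= Y" "ALL u:N. g2 u \<ominus> g2 y : A" using A unfolding germ_def by blast
  obtain N1 N2 where N12: "opn dK N1" "opn dK N2" "x : N1" "y : N2" "N1 <= X" "N2 <= Y"
   "ALL x':N1. ALL y':N2. EX u:N. g1 x' \<oplus> g2 y' = g1 x \<oplus> g2 u" using A1[OF xy N(1-3)] by blast
  let ?B1 = "(%x'. g1 x' \<ominus> g1 x) ` N1" and ?B2 = "(%y'. g2 y' \<ominus> g2 y) ` N2"
  have "germ X g1 x ?B1" unfolding germ_def using N12(1,3,5) by blast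
  hence "germ Y g2 y ?B1" by (rule G12[OF xy])
  moreover have "germ Y g2 y ?B2" unfolding germ_def using N12(2,4,6) by blast
  ultimately have "germ Y g2 y (?B1 \<inter> ?B2)" by (rule germ_Int)
  moreover have "b \<oplus> b' : A" if bb: "b : ?B1" "b' : ?B2" for b b'
  proof -
   obtain x' y' where x': "x' : N1" "b = g1 x' \<ominus> g1 x" "y' : N2" "b' = g2 y' \<ominus> g2 y" using bb by blast
   obtain u where u: "u : N" "g1 x' \<oplus> g2 y' = g1 x \<oplus> g2 u" using N12(7) x' by blast
   have c: "g1 x' : CK" "g2 y' : CK" "g1 x : CK" "g2 u : CK" "g2 y : CK" using im x' u xy N12(5,6) N(3) by blast+
   have "b \<oplus> b' = (g1 x' \<oplus> g2 y') \<ominus> g1 x \<ominus> g2 y" unfolding x' using c by algebra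
   also have "\<dots> = g2 u \<ominus> g2 y" unfolding u(2) using c by algebra
   finally show ?thesis using N(4) u(1) by simp
  qed
  ultimately show ?thesis by blast
 qed
 show thesis by (rule that[OF X Y]) (use G12 G21 S in blast)+
qed

lemma DT_neg_chart: "chart dK V g ==> chart dK V (%x. \<ominus> g x)"
proof -
 assume g: "chart dK V g"
 hence f: "dfn dK V n g" and im: "g ` V <= CK" and inj: "inj_on g V" unfolding chart_def by blast+
 have "dfn dK V n (%x. \<ominus> g x)"
  by (rule dfnI[OF dfnD(1)[OF f]], rule DT_neg) (use f im in \<open>auto simp: dfn_def\<close>)
 moreover have "inj_on (%x. \<ominus> g x) V"
 proof (rule inj_onI)
  fix x y assume xy: "x : V" "y : V" "\<ominus> g x = \<ominus> g y"
  hence "g x : CK" "g y : CK" using im by blast+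
  hence "g x = g y" using xy(3) by (metis minus_minus)
  thus "x = y" using inj xy by (auto dest: inj_onD)
 qed
 ultimately show ?thesis using g unfolding chart_def by auto
qed

text \<open>Independence of the point, together with the existence of half-size neighbourhoods and
  symmetry: what the filter of neighbourhoods of zero in a commutative group needs.\<close>

definition good_base :: "(nat => 'a) set => ((nat => 'a) => (nat => 'a)) => (nat => 'a) => bool" where
 "good_base V g x0 \<longleftrightarrow> chart dK V g & x0 : V & (ALL x:V. ALL A. germ V g x A \<longleftrightarrow> germ V g x0 A) &
   (ALL A. germ V g x0 A --> (EX B. germ V g x0 B & (ALL b:B. ALL b':B. b \<oplus> b' : A))) &
   (ALL A. germ V g x0 A --> germ V g x0 {b : CK. \<ominus> b : A})"

text \<open>Comparing a chart with itself on two open sets \<open>X\<close> and \<open>Y\<close>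
  makes its germ the same at all points of \<open>X\<close> and gives the sum property; comparing it
  with its negative gives symmetry.\<close>

lemma good_base_exists: "EX V g x0. good_base V g x0"
proof -
 obtain U g where g: "chart dK U g" using dK_chart by blast
 obtain X Y where X: "opn dK X" "dfb dK X" "X ~= {}" "X <= U" and Y: "opn dK Y" "dfb dK Y" "Y ~= {}" "Y <= U"
  and eq: "!!x y A. x : X ==> y : Y ==> germ X g x A \<longleftrightarrow> germ Y g y A"
  and sum: "!!x y A. x : X ==> y : Y ==> germ Y g y A ==> EX B. germ Y g y B & (ALL b:B. ALL b':B. b \<oplus> b' : A)"
  by (rule germ_agree[OF g g]) (rule that)
 obtain y0 where y0: "y0 : Y" using Y(3) by blast
 obtain x0 where x0: "x0 : X" using X(3) by blast
 have gX: "chart dK X g" by (rule chart_subset[OF g X])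
 obtain X' Y' where X': "opn dK X'" "dfb dK X'" "X' ~= {}" "X' <= X" and Y': "opn dK Y'" "dfb dK Y'" "Y' ~= {}" "Y' <= X"
  and eq': "!!x y A. x : X' ==> y : Y' ==> germ X' g x A \<longleftrightarrow> germ Y' (%x. \<ominus> g x) y A"
  by (rule germ_agree[OF gX DT_neg_chart[OF gX]]) (rule that)
 obtain x' y' where x': "x' : X'" "y' : Y'" using X'(3) Y'(3) by blast
 have im: "g x : CK" if "x : X" for x using gX that unfolding chart_def by blast
 have all: "germ X g x A \<longleftrightarrow> germ X g x0 A" if "x : X" for x A using eq[OF that y0] eq[OF x0 y0] by simp
 have neg: "germ X g x0 {b : CK. \<ominus> b : A}" if A: "germ X g x0 A" for A
 proof -
  have "germ X g x' A" using A all X'(4) x'(1) by blast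
  hence "germ X' g x' A" using germ_subset[OF X'(1,4) x'(1)] by blast
  hence "germ Y' (%x. \<ominus> g x) y' A" using eq'[OF x'] by blast
  then obtain N where N: "opn dK N" "y' : N" "N <= Y'" "ALL u:N. \<ominus> g u \<ominus> (\<ominus> g y') : A" unfolding germ_def by blast
  have "g u \<ominus> g y' : {b : CK. \<ominus> b : A}" if "u : N" for u
  proof -
   have c: "g u : CK" "g y' : CK" using im that N(3) x'(2) Y'(4) by blast+
   hence "\<ominus> (g u \<ominus> g y') = \<ominus> g u \<ominus> (\<ominus> g y')" by algebra
   thus ?thesis using N(4) that c by auto
  qed
  hence "germ Y' g y' {b : CK. \<ominus> b : A}" unfolding germ_def using N by blast
  hence "germ X g y' {b : CK. \<ominus> b : A}" using germ_subset[OF Y'(1,4) x'(2)] by blast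
  thus ?thesis using all Y'(4) x'(2) by blast
 qed
 have "EX B. germ X g x0 B & (ALL b:B. ALL b':B. b \<oplus> b' : A)" if "germ X g x0 A" for A
  using sum[OF x0 y0, of A] eq[OF x0 y0] that by blast
 hence "good_base X g x0" unfolding good_base_def using gX x0 all neg by blast
 thus ?thesis by blast
qed

definition "base = (SOME b. case b of (V, g, x0) => good_base V g x0)"
definition "V0 = fst base"
definition "g0 = fst (snd base)"
text \<open>The filter of neighbourhoods of zero that defines \<open>rho\<close>.\<close>

definition "GG A = germ V0 g0 (snd (snd base)) A"

lemma base: "good_base V0 g0 (snd (snd base))"
proof -
 have "EX b. case b of (V, g, x0) => good_base V g x0" using good_base_exists by auto
 from someI_ex[OF this] show ?thesis unfolding base_def[symmetric] V0_def g0_def by (simp split: prod.splits)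
qed

lemma chart0: "chart dK V0 g0" using base unfolding good_base_def by blast
lemma germ0: "x : V0 ==> germ V0 g0 x A \<longleftrightarrow> GG A" using base unfolding good_base_def GG_def by blast
lemma GG_sum: "GG A ==> EX B. GG B & (ALL b:B. ALL b':B. b \<oplus> b' : A)" using base unfolding good_base_def GG_def by blast
lemma GG_neg: "GG A ==> GG {b : CK. \<ominus> b : A}" using base unfolding good_base_def GG_def by blast
lemma GG_mono: "GG A ==> A <= B ==> GG B" unfolding GG_def by (rule germ_mono)
lemma GG_Int: "GG A ==> GG B ==> GG (A \<inter> B)" unfolding GG_def by (rule germ_Int)
lemma GG_zero: "GG A ==> \<zero> : A" unfolding GG_def by (rule germ_zero) (use chart0 in \<open>auto simp: chart_def\<close>)

lemma V0: "opn dK V0" "dfb dK V0" "V0 ~= {}" "dfn dK V0 n g0" "inj_on g0 V0" "!!x. x : V0 ==> g0 x : CK"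
 using chart0 dfnD(1) unfolding chart_def by blast+

lemma GG_CK: "GG CK"
proof -
 obtain x where x: "x : V0" using V0 by blast
 have "germ V0 g0 x CK" unfolding germ_def using x V0(1,6) by blast
 thus ?thesis using germ0[OF x] by blast
qed

definition good_chart :: "(nat => 'a) set => ((nat => 'a) => (nat => 'a)) => bool" where
 "good_chart V g \<longleftrightarrow> chart dK V g & (ALL x:V. ALL A. germ V g x A \<longleftrightarrow> GG A)"

lemma good_chart0: "good_chart V0 g0" unfolding good_chart_def using chart0 germ0 by blast

text \<open>By \<open>germ_agree\<close> with the base chart, every chart of full dimension induces
  the filter \<open>GG\<close> near generic points; so \<open>rho\<close> does not depend on the
  chosen base.\<close>

lemma generic_good_chart:
 assumes g: "chart dK U g"
 obtains V where "V <= U" "good_chart V g"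
proof -
 obtain X Y where X: "opn dK X" "dfb dK X" "X ~= {}" "X <= U" and Y: "opn dK Y" "dfb dK Y" "Y ~= {}" "Y <= V0"
  and eq: "!!x y A. x : X ==> y : Y ==> germ X g x A \<longleftrightarrow> germ Y g0 y A"
  by (rule germ_agree[OF g chart0]) (rule that)
 obtain y where y: "y : Y" using Y(3) by blast
 have "germ X g x A \<longleftrightarrow> GG A" if "x : X" for x A
  using eq[OF that y] germ_subset[OF Y(1,4) y] germ0[of y] Y(4) y by blast
 thus thesis using that[OF X(4)] chart_subset[OF g X] unfolding good_chart_def by blast
qed

definition "rho = topology (%S. S <= CK & (ALL x:S. GG {a : CK. x \<oplus> a : S}))"

lemma openin_rho: "openin rho S \<longleftrightarrow> S <= CK & (ALL x:S. GG {a : CK. x \<oplus> a : S})"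
proof -
 have "istopology (%S. S <= CK & (ALL x:S. GG {a : CK. x \<oplus> a : S}))"
  unfolding istopology_def
 proof (intro conjI allI impI, goal_cases)
  case (2 S T)
  have "GG {a : CK. x \<oplus> a : S \<inter> T}" if "x : S \<inter> T" for x
   by (rule GG_mono[OF GG_Int[of "{a : CK. x \<oplus> a : S}" "{a : CK. x \<oplus> a : T}"]]) (use 2 that in auto)
  thus ?case by blast
 next
  case (4 \<K>)
  have "GG {a : CK. x \<oplus> a : \<Union>\<K>}" if x: "x : \<Union>\<K>" for x
  proof -
   obtain S where "S : \<K>" "x : S" using x by blast
   hence "GG {a : CK. x \<oplus> a : S}" using 4 by blast
   thus ?thesis by (rule GG_mono) (use \<open>S \<in> \<K>\<close> in blast)
  qed
  thus ?case by blast
 qed blast+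
 thus ?thesis unfolding rho_def by (simp add: topology_inverse')
qed

lemma topspace_rho [simp]: "topspace rho = CK"
proof -
 have "{a : CK. x \<oplus> a : CK} = CK" if "x : CK" for x using that by auto
 hence "openin rho CK" unfolding openin_rho using GG_CK by simp
 thus ?thesis by (metis openin_rho openin_subset openin_topspace subset_antisym)
qed

lemma open_translate: assumes S: "openin rho S" and c: "c : CK" shows "openin rho ((%x. c \<oplus> x) ` S)"
 unfolding openin_rho
proof (intro conjI ballI)
 have SC: "S <= CK" using S openin_rho by blast
 thus "(%x. c \<oplus> x) ` S <= CK" using c by auto
 fix y assume "y : (%x. c \<oplus> x) ` S"
 then obtain x where x: "x : S" "y = c \<oplus> x" by blast
 have "GG {a : CK. x \<oplus> a : S}" using S x openin_rho by blast
 thus "GG {a : CK. y \<oplus> a : (%x. c \<oplus> x) ` S}"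
 proof (rule GG_mono)
  show "{a : CK. x \<oplus> a : S} <= {a : CK. y \<oplus> a : (%x. c \<oplus> x) ` S}"
   using x SC c by (auto simp: a_assoc)
 qed
qed

text \<open>\<open>GG\<close> is given only as a filter. The points \<open>w\<close> at which
  \<open>A\<close> is a neighbourhood in the sense of \<open>GG\<close> form an open set, because
  \<open>GG_sum\<close> splits a small displacement into two.\<close>

lemma nbhd_zero:
 assumes A: "GG A" shows "EX W. openin rho W & \<zero> : W & W <= A"
proof -
 let ?W = "{w : CK. GG {a : CK. w \<oplus> a : A}}"
 have "{a : CK. \<zero> \<oplus> a : A} = CK \<inter> A" by auto
 hence z: "\<zero> : ?W" using GG_Int[OF GG_CK A] by simp
 have sub: "?W <= A"
 proof
  fix w assume w: "w : ?W"
  hence "\<zero> : {a : CK. w \<oplus> a : A}" using GG_zero by blast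
  thus "w : A" using w by simp
 qed
 have "openin rho ?W" unfolding openin_rho
 proof (intro conjI ballI)
  fix w assume w: "w : ?W"
  let ?C = "{a : CK. w \<oplus> a : A}"
  have "GG ?C" "w : CK" using w by blast+
  then obtain B where B: "GG B" "ALL b:B. ALL b':B. b \<oplus> b' : ?C" using GG_sum by blast
  show "GG {a : CK. w \<oplus> a : ?W}"
  proof (rule GG_mono[OF GG_Int[OF B(1) GG_CK]])
   show "B \<inter> CK <= {a : CK. w \<oplus> a : ?W}"
   proof
   fix b assume b: "b : B \<inter> CK"
   have "GG {a : CK. (w \<oplus> b) \<oplus> a : A}"
   by (rule GG_mono[OF GG_Int[OF B(1) GG_CK]]) (use B(2) b \<open>w \<in> CK\<close> in \<open>auto simp: a_assoc\<close>)
   thus "b : {a : CK. w \<oplus> a : ?W}" using b \<open>w \<in> CK\<close> by auto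
   qed
  qed
 qed blast
 thus ?thesis using z sub by blast
qed

lemma nbhd_at:
 assumes x: "x : CK" and A: "GG A"
 shows "EX W. openin rho W & x : W & (ALL w:W. EX a:A. a : CK & w = x \<oplus> a)"
proof -
 obtain W where W: "openin rho W" "\<zero> : W" "W <= A" using nbhd_zero[OF A] by blast
 have "W <= CK" using W(1) openin_rho by blast
 have "x = x \<oplus> \<zero>" using x by simp
 hence "x : (%w. x \<oplus> w) ` W" using W(2) by blast
 thus ?thesis using open_translate[OF W(1) x] W(3) \<open>W \<subseteq> CK\<close> by blast
qed

lemma continuous_rhoI:
 assumes f: "f : topspace X \<rightarrow> CK"
  and loc: "!!x A. x : topspace X ==> GG A ==> EX W. openin X W & x : W & (ALL w:W. f w : (%a. f x \<oplus> a) ` A)"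
 shows "continuous_map X rho f"
 unfolding continuous_map_def
proof (intro conjI allI impI)
 fix S assume S: "openin rho S"
 show "openin X {x : topspace X. f x : S}"
 proof (subst openin_subopen, intro ballI)
  fix x assume x: "x : {x : topspace X. f x : S}"
  hence "GG {a : CK. f x \<oplus> a : S}" using S openin_rho by blast
  then obtain W where W: "openin X W" "x : W" "ALL w:W. f w : (%a. f x \<oplus> a) ` {a : CK. f x \<oplus> a : S}" using loc x by blast
  have "W <= {x : topspace X. f x : S}"
  proof
   fix w assume w: "w : W"
   from W(3) w obtain a where "f x \<oplus> a : S" "f w = f x \<oplus> a" by blast
   thus "w : {x : topspace X. f x : S}" using openin_subset[OF W(1)] w by auto
  qed
  thus "EX T. openin X T & x : T & T <= {x : topspace X. f x : S}" using W by blast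
 qed
qed (use f in simp)

lemma continuous_add: "continuous_map (prod_topology rho rho) rho (%(x, y). x \<oplus> y)"
proof (rule continuous_rhoI)
 fix p A assume p: "p : topspace (prod_topology rho rho)" and A: "GG A"
 obtain x y where xy: "p = (x, y)" "x : CK" "y : CK" using p by auto
 obtain B where B: "GG B" "ALL b:B. ALL b':B. b \<oplus> b' : A" using GG_sum[OF A] by blast
 obtain W1 where W1: "openin rho W1" "x : W1" "ALL w:W1. EX a:B. a : CK & w = x \<oplus> a" using nbhd_at[OF xy(2) B(1)] by blast
 obtain W2 where W2: "openin rho W2" "y : W2" "ALL w:W2. EX a:B. a : CK & w = y \<oplus> a" using nbhd_at[OF xy(3) B(1)] by blast
 have "(%(x, y). x \<oplus> y) w : (%a. (%(x, y). x \<oplus> y) p \<oplus> a) ` A" if w: "w : W1 \<times> W2" for w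
 proof -
  obtain a b where ab: "a : B" "a : CK" "fst w = x \<oplus> a" "b : B" "b : CK" "snd w = y \<oplus> b" using W1(3) W2(3) w by fastforce
  have "fst w \<oplus> snd w = (x \<oplus> y) \<oplus> (a \<oplus> b)" unfolding ab(3,6) using ab xy by algebra
  thus ?thesis using B(2) ab xy(1) by (simp add: case_prod_beta)
 qed
 thus "EX W. openin (prod_topology rho rho) W & p : W & (ALL w:W. (%(x, y). x \<oplus> y) w : (%a. (%(x, y). x \<oplus> y) p \<oplus> a) ` A)"
  using W1(1,2) W2(1,2) xy(1) by (intro exI[of _ "W1 \<times> W2"]) (auto simp: openin_prod_Times_iff)
qed auto

lemma continuous_neg: "continuous_map rho rho (%x. \<ominus> x)"
proof (rule continuous_rhoI)
 fix x A assume x: "x : topspace rho" and A: "GG A"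
 hence xc: "x : CK" by simp
 obtain W where W: "openin rho W" "x : W" "ALL w:W. EX a:{b : CK. \<ominus> b : A}. a : CK & w = x \<oplus> a" using nbhd_at[OF xc GG_neg[OF A]] by blast
 have "\<ominus> w : (%a. \<ominus> x \<oplus> a) ` A" if w: "w : W" for w
 proof -
  obtain a where a: "a : CK" "\<ominus> a : A" "w = x \<oplus> a" using W(3) w by blast
  have "\<ominus> w = \<ominus> x \<oplus> \<ominus> a" unfolding a(3) using a xc by algebra
  thus ?thesis using a(2) by blast
 qed
 thus "EX W. openin rho W & x : W & (ALL w:W. \<ominus> w : (%a. \<ominus> x \<oplus> a) ` A)" using W by blast
qed auto

lemma topological_group_rho: "topological_group (add_monoid K) rho"
 unfolding topological_group_def
 using continuous_add continuous_neg a_group by (simp add: a_inv_def)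

lemma good_chart_open:
 assumes g: "good_chart V g" and N: "opn dK N" "N <= V"
 shows "openin rho (g ` N)"
 unfolding openin_rho
proof (intro conjI ballI)
 have im: "g x : CK" if "x : V" for x using g that unfolding good_chart_def chart_def by blast
 thus "g ` N <= CK" using N(2) by blast
 fix y assume "y : g ` N"
 then obtain x where x: "x : N" "y = g x" by blast
 have xV: "x : V" using x N(2) by blast
 have "g x \<oplus> (g u \<ominus> g x) = g u" if "u : N" for u
 proof -
  have "g x : CK" "g u : CK" using im xV that N(2) by blast+
  thus ?thesis by algebra
 qed
 moreover have "g u \<ominus> g x : CK" if "u : N" for u using im xV that N(2) by (meson minus_closed subsetD)
 ultimately have "germ V g x {a : CK. g x \<oplus> a : g ` N}" unfolding germ_def using N x by (intro exI[of _ N]) auto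
 thus "GG {a : CK. y \<oplus> a : g ` N}" using g xV x(2) unfolding good_chart_def by blast
qed

lemma good_chart_continuous:
 assumes g: "good_chart V g" shows "continuous_map (sbt dK V) rho g"
proof (rule continuous_rhoI)
 have im: "g x : CK" if "x : V" for x using g that unfolding good_chart_def chart_def by blast
 have oV: "opn dK V" using g unfolding good_chart_def chart_def by blast
 hence top: "topspace (sbt dK V) = V" using openin_subset[OF oV] by auto
 show "g : topspace (sbt dK V) \<rightarrow> CK" unfolding top using im by blast
 fix x A assume x: "x : topspace (sbt dK V)" and A: "GG A"
 hence xV: "x : V" unfolding top by blast
 hence "germ V g x A" using g A unfolding good_chart_def by blast
 then obtain N where N: "opn dK N" "x : N" "N <= V" "ALL u:N. g u \<ominus> g x : A" unfolding germ_def by blast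
 have "g w : (%a. g x \<oplus> a) ` A" if w: "w : N" for w
 proof -
  have "g x : CK" "g w : CK" using im xV w N(3) by blast+
  hence "g w = g x \<oplus> (g w \<ominus> g x)" by algebra
  thus ?thesis using N(4) w by blast
 qed
 moreover have "openin (sbt dK V) N" using N oV by (simp add: openin_open_subtopology)
 ultimately show "EX W. openin (sbt dK V) W & x : W & (ALL w:W. g w : (%a. g x \<oplus> a) ` A)" using N(2) by blast
qed

text \<open>A definable basis: translates of the images of basic boxes under the chart \<open>g0\<close>.\<close>

definition "RY = {w : TT (BP dK + n). tfst (BP dK) w : BY dK & tsnd (BP dK) n w : CK &
 (ALL u:TT dK. u : BB dK (tfst (BP dK) w) --> u : V0)}"
definition "RB w = {x : TT n. EX u:V0. u : BB dK (tfst (BP dK) w) & x = tsnd (BP dK) n w \<oplus> g0 u}"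

lemma dRY: "dfb (BP dK + n) RY"
proof -
 let ?R = "{w : TT (BP dK + n). tfst (BP dK) w : BY dK & tsnd (BP dK) n w : CK}"
 have R: "dfb (BP dK + n) ?R" by (intro definable_times basis_facts dCK)
 have "dfb (BP dK + n) {w : ?R. ALL u:TT dK. u : BB dK (tfst (BP dK) w) --> u : V0}"
  by (rule definableI[OF refl], (rule D_BB dint R V0(2) | (simp add: R; fail)[1])+)
 moreover have "{w : ?R. ALL u:TT dK. u : BB dK (tfst (BP dK) w) --> u : V0} = RY" unfolding RY_def by blast
 ultimately show ?thesis by simp
qed

lemma D_RB:
 assumes t: "DT Ga n t" and s: "DT Ga (BP dK + n) s" and w: "wfc Ga" and R: "!!x. x : cset Ga ==> s x : RY"
 shows "D Ga (%x. t x : RB (s x))"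
proof -
 have c: "tsnd (BP dK) n (s x) : CK" if "x : cset Ga" for x using R[OF that] unfolding RY_def by blast
 have "D Ga (%x. EX u:V0. u : BB dK (tfst (BP dK) (s x)) & t x = tsnd (BP dK) n (s x) \<oplus> g0 u)"
  by (rule D_BB t s dint V0(2) DT_add DT_app[OF V0(4)] w | (use w V0(2,6) c in \<open>auto; fail\<close>)[1])+
 thus ?thesis by (rule D_cong) (use DT_in[OF t] in \<open>auto simp: RB_def\<close>)
qed

lemma BB_V0: "w : RY ==> BB dK (tfst (BP dK) w) <= V0" unfolding RY_def BB_def by blast

lemma RB_eq: "w : RY ==> RB w = (%x. tsnd (BP dK) n w \<oplus> x) ` (g0 ` BB dK (tfst (BP dK) w))"
proof -
 assume w: "w : RY"
 hence "tsnd (BP dK) n w : CK" unfolding RY_def by blast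
 thus ?thesis unfolding RB_def using BB_V0[OF w] V0(6) by auto
qed

lemma open_RB: "w : RY ==> openin rho (RB w)"
proof -
 assume w: "w : RY"
 have "tfst (BP dK) w : BY dK" "tsnd (BP dK) n w : CK" using w unfolding RY_def by blast+
 thus ?thesis unfolding RB_eq[OF w]
  by (intro open_translate good_chart_open[OF good_chart0] basis_facts BB_V0[OF w])
qed

lemma RB_basis: assumes "openin rho S" "x : S" shows "EX w:RY. x : RB w & RB w <= S"
proof -
 obtain u where u: "u : V0" using V0(3) by blast
 have xc: "x : CK" and A: "GG {a : CK. x \<oplus> a : S}" using assms openin_rho by blast+
 have uc: "g0 u : CK" by (rule V0(6)[OF u])
 have "germ V0 g0 u {a : CK. x \<oplus> a : S}" using germ0[OF u] A by blast
 then obtain N where N: "opn dK N" "u : N" "N <= V0" "ALL v:N. g0 v \<ominus> g0 u : {a : CK. x \<oplus> a : S}" unfolding germ_def by blast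
 obtain y where y: "y : BY dK" "u : BB dK y" "BB dK y <= N" using basis_facts(4)[OF N(1,2)] by blast
 \<comment> \<open>This translation moves the point \<open>g0 u\<close> of the base chart to
   \<open>x\<close>.\<close>
 let ?c = "x \<ominus> g0 u"
 have cc: "?c : CK" using xc uc by simp
 let ?w = "tcat (BP dK) y n ?c"
 have yt: "y : TT (BP dK)" using y(1) BY_in by blast
 have wf: "tfst (BP dK) ?w = y" "tsnd (BP dK) n ?w = ?c" using yt cc by simp_all
 have w: "?w : RY" unfolding RY_def mem_Collect_eq wf using y cc N(3) yt by (auto simp: BB_def)
 have e: "?c \<oplus> g0 v = x \<oplus> (g0 v \<ominus> g0 u)" if "v : V0" for v
  using V0(6)[OF that] xc uc by algebra
 have "?c \<oplus> g0 u = x" using xc uc by algebra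
 hence "x : RB ?w" unfolding RB_eq[OF w] wf using imageI[OF imageI[OF y(2), of g0], of "%z. ?c \<oplus> z"] by simp
 moreover have "RB ?w <= S"
 proof
  fix z assume "z : RB ?w"
  then obtain v where v: "v : BB dK y" "z = ?c \<oplus> g0 v" unfolding RB_eq[OF w] wf by blast
  hence "v : N" "v : V0" using y(3) N(3) by blast+
  thus "z : S" using N(4) e v(2) by auto
 qed
 ultimately show ?thesis using w by blast
qed

lemma has_definable_basis_rho: "has_definable_basis L M n rho"
proof -
 let ?m = "BP dK + n"
 let ?X = "{z : TT (n + ?m). tsnd n ?m z : RY & tfst n z : RB (tsnd n ?m z)}"
 have d1: "dfb (n + ?m) {z : TT (n + ?m). tsnd n ?m z : RY}" by (rule definable_tsnd[OF dRY])
 have "D (c0 (n + ?m) {z : TT (n + ?m). tsnd n ?m z : RY}) (%z. tfst n z : RB (tsnd n ?m z))"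
  by (rule D_RB dint d1 | (auto simp: d1; fail)[1])+
 hence X: "dfb (n + ?m) ?X" by (intro definableI[of _ "{z : TT (n + ?m). tsnd n ?m z : RY}"]) auto
 have eq: "{x : TT n. tcat n x ?m y : ?X} = RB y" if y: "y : RY" for y
 proof -
  have "y : TT ?m" using y definable_subset[OF dRY] by blast
  thus ?thesis using y by (auto simp: RB_def)
 qed
 let ?F = "(%y. {x : TT n. tcat n x ?m y : ?X}) ` RY"
 have F: "?F = RB ` RY" using eq by (rule image_cong[OF refl])
 have "definable_family L M n ?F" unfolding definable_family_def using X dRY by blast
 moreover have "openin rho = arbitrary union_of (%B. B : ?F)"
 proof (rule ext)
  fix S show "openin rho S = (arbitrary union_of (%B. B : ?F)) S"
   unfolding F arbitrary_union_of_alt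
  proof
   assume S: "openin rho S"
   show "ALL x:S. EX U. U : RB ` RY & x : U & U <= S"
   proof
   fix x assume "x : S"
   then obtain w where "w : RY" "x : RB w" "RB w <= S" using RB_basis[OF S] by blast
   thus "EX U. U : RB ` RY & x : U & U <= S" by (intro exI[of _ "RB w"]) simp
   qed
  next
   assume a: "ALL x:S. EX U. U : RB ` RY & x : U & U <= S"
   show "openin rho S"
   proof (subst openin_subopen, intro ballI)
   fix x assume "x : S"
   then obtain w where "w : RY" "x : RB w" "RB w <= S" using a by blast
   thus "EX T. openin rho T & x : T & T <= S" using open_RB by blast
   qed
  qed
 qed
 ultimately show ?thesis unfolding has_definable_basis_def by blast
qed

end

section \<open>Uniqueness of the manifold group topology\<close>

context dfield begin

text \<open>What is kept of the graph of a continuous correspondence: finite fibres, and near each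
  point the graph of one continuous function \<open>s\<close>, cut out by an open set
  \<open>A\<close>. The number of branches is forgotten.\<close>

definition graph_like :: "nat => nat => (nat => 'a) set => bool" where
 "graph_like i l G \<longleftrightarrow> dfb (i + l) G & (ALL z. finite {a : TT l. tcat i z l a : G}) &
   (ALL y:G. EX Z A s. opn i Z & tfst i y : Z & dfb l A & opn l A &
   cont i Z l s & tsnd i l y : A &
   (ALL z:Z. ALL a:TT l. tcat i z l a : G & a : A \<longleftrightarrow> a = s z))"

lemma graph_like_corr_graph:
 assumes U: "opn i U" and cor: "correspondence k U (TT l) f" and d: "dfb (i + l) (corr_graph i U l f)"
  and c: "continuous_correspondence k (sbt i U) (PT l) f"
 shows "graph_like i l (corr_graph i U l f)"
 unfolding graph_like_def
proof (intro conjI allI ballI)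
 have Us: "U <= TT i" by (rule openin_PT_subset[OF U])
 have fl: "f z <= TT l" "finite (f z)" "card (f z) = k" if "z : U" for z using cor that unfolding correspondence_def by blast+
 have iff: "tcat i z l a : corr_graph i U l f \<longleftrightarrow> z : U & a : f z" if z: "z : TT i" and a: "a : TT l" for z a
 proof
  assume "tcat i z l a : corr_graph i U l f"
  then obtain x y where xy: "tcat i z l a = tcat i x l y" "x : U" "y : f x" unfolding corr_graph_def by blast
  hence "x : TT i" "y : TT l" using Us fl by blast+
  hence "z = x & a = y" using xy(1) z a by (subst tcat_eq_iff[where M = M, symmetric])
  thus "z : U & a : f z" using xy by simp
 qed (auto simp: corr_graph_def)
 show "dfb (i + l) (corr_graph i U l f)" by (rule d)
 show "finite {a : TT l. tcat i z l a : corr_graph i U l f}" for z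
 proof -
  have r: "tcat i z l a = tcat i (restrict z {..<i}) l a" for a by (auto simp: tcat_def fun_eq_iff)
  have f1: "finite {a : TT l. tcat i z l a : corr_graph i U l f}" if z: "restrict z {..<i} : TT i"
   by (rule finite_subset[of _ "if restrict z {..<i} : U then f (restrict z {..<i}) else {}"])
   (use fl iff[OF z] r in auto)
  have f2: "{a : TT l. tcat i z l a : corr_graph i U l f} = {}" if z: "restrict z {..<i} \<notin> TT i"
  proof -
   have "z j : UU" if "tcat i z l a : TT (i + l)" "j < i" for j a
   using that by (auto simp: tuples_def tcat_def PiE_iff split: if_splits)
   hence "tcat i z l a \<notin> TT (i + l)" for a using z unfolding tuples_def by auto
   thus ?thesis using definable_subset[OF d] by blast
  qed
  show ?thesis
  proof (cases "restrict z {..<i} : TT i")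
   case False
   show ?thesis unfolding f2[OF False] by (rule finite.emptyI)
  qed (rule f1)
 qed
 fix y assume "y : corr_graph i U l f"
 then obtain z b where y: "y = tcat i z l b" "z : U" "b : f z" unfolding corr_graph_def by blast
 have zb: "z : TT i" "b : TT l" using subsetD[OF Us y(2)] subsetD[OF fl(1)[OF y(2)] y(3)] .
 have "z : topspace (sbt i U)" using y(2) zb(1) by (simp add: topspace_PT del: topspace_power_top)
 from c[unfolded continuous_correspondence_def, rule_format, OF this]
 obtain W g where W: "openin (sbt i U) W" "z : W"
  "ALL j<k. continuous_map (subtopology (sbt i U) W) (PT l) (g j)" "ALL z:W. f z = (%j. g j z) ` {..<k}"
  by (elim exE conjE)
 have oW: "opn i W" and WU: "W <= U" using W(1) openin_open_subtopology[OF U] by auto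
 hence ss: "subtopology (sbt i U) W = sbt i W" by (simp add: subtopology_subtopology Int_absorb1)
 have cg: "ALL j<k. cont i W l (g j)" using W(3) unfolding ss .
 obtain j0 where j0: "j0 < k" "b = g j0 z" using y(3) W(2,4) by auto
 have "card ((%j. g j z) ` {..<k}) = card {..<k}" using fl(3)[of z] W(2,4) WU by auto
 hence inj: "inj_on (%j. g j z) {..<k}" by (rule eq_card_imp_inj_on[rotated]) simp
 obtain V A where VA: "opn i V" "dfb i V" "z : V" "V <= W" "opn l A" "dfb l A" "g j0 z : A"
  "ALL z:V. g j0 z : A & (ALL j<k. g j z : A --> j = j0)"
  by (rule separate_branch[OF oW W(2) j0(1) cg inj])
 have "tcat i z' l a : corr_graph i U l f & a : A \<longleftrightarrow> a = g j0 z'" if z': "z' : V" and a: "a : TT l" for z' a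
 proof -
  have m: "z' : W" "z' : U" "z' : TT i" using z' VA(4) WU Us by blast+
  have e: "f z' = (%j. g j z') ` {..<k}" by (rule bspec[OF W(4) m(1)])
  note v = conjunct1[OF bspec[OF VA(8) z']] conjunct2[OF bspec[OF VA(8) z'], rule_format]
  have "a : f z' & a : A \<longleftrightarrow> a = g j0 z'"
  proof
   assume "a : f z' & a : A"
   then obtain j where "j < k" "a = g j z'" "a : A" unfolding e by auto
   thus "a = g j0 z'" using v(2)[of j] by simp
  next
   assume "a = g j0 z'"
   thus "a : f z' & a : A" unfolding e using v(1) j0(1) by simp
  qed
  thus ?thesis using iff[OF m(3) a] m(2) by blast
 qed
 moreover have "cont i V l (g j0)"
  using cg j0(1) continuous_map_from_subtopology_mono VA(4) by blast
 moreover have "tfst i y = z" "tsnd i l y = b" using y(1) zb by simp_all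
 ultimately show "EX Z A s. opn i Z & tfst i y : Z & dfb l A & opn l A &
   cont i Z l s & tsnd i l y : A &
   (ALL z:Z. ALL a:TT l. tcat i z l a : corr_graph i U l f & a : A \<longleftrightarrow> a = s z)"
  using VA j0(2) by (intro exI[of _ V] exI[of _ A] exI[of _ "g j0"]) auto
qed

text \<open>A chart of an arbitrary manifold topology, with the coordinate permutation of the cell
  undone so that its values lie in a graph over \<open>M^i\<close>. The last clause says that
  \<open>h\<close> is open onto its image in the subspace topology of \<open>G\<close>.\<close>

definition patch :: "(nat => 'a) topology => (nat => 'a) set => nat => nat => (nat => 'a) set => ((nat => 'a) => (nat => 'a)) => bool" where
 "patch \<rho> W i l G h \<longleftrightarrow> openin \<rho> W & dfn n W (i + l) h & inj_on h W & h ` W <= G & graph_like i l G &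
   continuous_map (subtopology \<rho> W) (PT (i + l)) h &
   (ALL S. openin \<rho> S & S <= W --> (EX N. opn (i + l) N & h ` S = N \<inter> G))"

lemma permutes_tuple:
 assumes s: "s permutes {..<m}" and y: "y : TT m"
 shows "y \<circ> s = (\<lambda>j\<in>{..<m}. y (s j))" "y \<circ> s : TT m"
proof -
 show e: "y \<circ> s = (\<lambda>j\<in>{..<m}. y (s j))"
  using y permutes_not_in[OF s] by (auto simp: fun_eq_iff tuples_def PiE_iff extensional_def)
 show "y \<circ> s : TT m" unfolding e using y permutes_in_image[OF s] by (auto simp: tuples_def PiE_iff)
qed

lemma continuous_map_permute:
 assumes s: "s permutes {..<m}" shows "continuous_map (PT m) (PT m) (%y. y \<circ> s)"
proof (rule continuous_map_eq[OF continuous_map_sel[of m s m]])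
 show "s j < m" if "j < m" for j using that permutes_in_image[OF s] by simp
 show "(\<lambda>j\<in>{..<m}. x (s j)) = x \<circ> s" if "x : topspace (PT m)" for x
  using permutes_tuple(1)[OF s] that unfolding topspace_PT by simp
qed

lemma patch_of_cell:
 assumes W: "dfb n W" "openin \<rho> W" and cell: "cell L M \<tau> m C"
  and V: "openin (sbt m C) V"
  and hom: "homeomorphic_map (subtopology \<rho> W) (sbt m V) h0"
  and dh: "dfb (n + m) {tcat n x m (h0 x) | x. x : W}"
 shows "EX i l G h. patch \<rho> W i l G h"
proof -
 from cell obtain i k U f s where i: "i \<le> m" and U: "opn i U"
  and cor: "correspondence k U (TT (m - i)) f" and dG: "dfb m (corr_graph i U (m - i) f)"
  and cc: "continuous_correspondence k (sbt i U) (PT (m - i)) f"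
  and s: "s permutes {..<m}" and C: "C = (%x. x \<circ> s) ` corr_graph i U (m - i) f"
  unfolding cell_def by (elim exE conjE)
 define l where "l = m - i"
 have m: "m = i + l" using i by (simp add: l_def)
 let ?G = "corr_graph i U l f" and ?t = "inv_into UNIV s"
 \<comment> \<open>Composition with the inverse permutation moves the values from the cell back into
   the graph.\<close>
 let ?h = "%x. h0 x \<circ> ?t"
 note cor = cor[folded l_def] and dG = dG[folded l_def] and cc = cc[folded l_def] and C = C[folded l_def]
 have t: "?t permutes {..<m}" by (rule permutes_inv[OF s])
 have G: "graph_like i l ?G" by (rule graph_like_corr_graph[OF U cor _ cc]) (use dG m in simp)
 have Gs: "?G <= TT m" by (rule definable_subset[OF dG])
 have st: "(y \<circ> s) \<circ> ?t = y" "(y \<circ> ?t) \<circ> s = y" for y :: "nat => 'a"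
  using permutes_inv_o[OF s] by (simp_all add: comp_assoc)
 have VC: "V <= C" using openin_subset[OF V] by auto
 have Vt: "V <= TT m" using openin_subset[OF V] by (simp add: topspace_PT del: topspace_power_top)
 have tW: "topspace (subtopology \<rho> W) = W" using openin_subset[OF W(2)] by auto
 have tV: "topspace (sbt m V) = V" using Vt by (simp add: topspace_PT Int_absorb1 del: topspace_power_top)
 have h0V: "h0 ` W = V" using homeomorphic_imp_surjective_map[OF hom] unfolding tW tV .
 have h0t: "h0 x : TT m" if "x : W" for x using h0V Vt that by blast
 have inj0: "inj_on h0 W" using homeomorphic_imp_injective_map[OF hom] unfolding tW .
 have d0: "dfn n W m h0"
 proof (intro dfnI W(1) DT_I)
  have "D (cx (c0 n W) m (TT m)) (%p. tcat n (fst p) m (snd p) : {tcat n x m (h0 x) | x. x : W})"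
   by (rule dint dh W(1) | (simp add: W(1); fail)[1])+
  thus "D (cx (c0 n W) m (TT m)) (%p. snd p = h0 (fst p))"
  proof (rule D_cong)
   fix p assume "p : cset (cx (c0 n W) m (TT m))"
   hence p: "fst p : W" "snd p : TT m" using W(1) by auto
   have sub: "W <= TT n" by (rule definable_subset[OF W(1)])
   show "(tcat n (fst p) m (snd p) : {tcat n x m (h0 x) | x. x : W}) = (snd p = h0 (fst p))"
   proof
   assume "tcat n (fst p) m (snd p) : {tcat n x m (h0 x) | x. x : W}"
   then obtain x where x: "tcat n (fst p) m (snd p) = tcat n x m (h0 x)" "x : W" by blast
   have "fst p = x & snd p = h0 x" using x p sub h0t[OF x(2)] by (subst tcat_eq_iff[where M = M, symmetric]) auto
   thus "snd p = h0 (fst p)" by simp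
   next
   assume "snd p = h0 (fst p)"
   thus "tcat n (fst p) m (snd p) : {tcat n x m (h0 x) | x. x : W}"
   using p(1) by (intro CollectI exI[of _ "fst p"]) simp
   qed
  qed
 qed (use W(1) h0t in auto)
 have "dfn n W m ?h"
 proof (rule dfn_cong[of _ _ _ "%x. \<lambda>j\<in>{..<m}. h0 x (?t j)"])
  show "dfn n W m (%x. \<lambda>j\<in>{..<m}. h0 x (?t j))"
   by (intro dfnI W(1) DT_sel[of _ m]) (use d0 W(1) permutes_in_image[OF t] in \<open>auto simp: dfn_def\<close>)
  show "(\<lambda>j\<in>{..<m}. h0 x (?t j)) = ?h x" if "x : W" for x by (rule permutes_tuple(1)[OF t h0t[OF that], symmetric])
 qed
 moreover have "inj_on ?h W"
 proof (rule inj_onI)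
  fix x y assume xy: "x : W" "y : W" "?h x = ?h y"
  hence "?h x \<circ> s = ?h y \<circ> s" by simp
  hence "h0 x = h0 y" unfolding st .
  thus "x = y" using inj0 xy by (auto dest: inj_onD)
 qed
 moreover have hG: "?h ` W <= ?G"
 proof (rule image_subsetI)
  fix x assume "x : W"
  hence "h0 x : C" using h0V VC by blast
  then obtain y where "y : ?G" "h0 x = y \<circ> s" unfolding C by blast
  thus "?h x : ?G" by (simp add: st)
 qed
 moreover have "continuous_map (subtopology \<rho> W) (PT m) ?h"
 proof -
  have "continuous_map (subtopology \<rho> W) (PT m) h0"
   using homeomorphic_imp_continuous_map[OF hom] continuous_map_in_subtopology by blast
  from continuous_map_compose[OF this continuous_map_permute[OF t]] show ?thesis by (simp add: comp_def)
 qed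
 moreover have "EX N. opn m N & ?h ` S = N \<inter> ?G" if S: "openin \<rho> S" "S <= W" for S
 proof -
  have "openin (subtopology \<rho> W) S" using S W(2) by (simp add: openin_open_subtopology)
  hence "openin (sbt m V) (h0 ` S)" using homeomorphic_imp_open_map[OF hom] by (simp add: open_map_def)
  then obtain N1 where N1: "opn m N1" "h0 ` S = N1 \<inter> V" by (auto simp: openin_subtopology)
  obtain N2 where N2: "opn m N2" "V = N2 \<inter> C" using V by (auto simp: openin_subtopology)
  let ?N = "{y : TT m. y \<circ> s : N1 \<inter> N2}"
  have "opn m ?N"
   using openin_continuous_map_preimage[OF continuous_map_permute[OF s] openin_Int[OF N1(1) N2(1)]] unfolding topspace_PT .
  moreover have "?h ` S = ?N \<inter> ?G"
  proof (intro Set.set_eqI iffI)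
   fix y assume "y : ?h ` S"
   then obtain x where x: "x : S" "y = h0 x \<circ> ?t" by blast
   have "h0 x : N1 \<inter> V" using N1(2) x(1) by blast
   moreover have "y : ?G" using hG x S(2) by blast
   ultimately show "y : ?N \<inter> ?G" using x(2) N2(2) Gs by (auto simp: st)
  next
   fix y assume y: "y : ?N \<inter> ?G"
   hence "y \<circ> s : C" unfolding C by blast
   hence "y \<circ> s : h0 ` S" using y N1(2) N2(2) by blast
   then obtain x where "x : S" "y \<circ> s = h0 x" by blast
   thus "y : ?h ` S" using st(1)[of y] by (intro image_eqI[of _ _ x]) simp_all
  qed
  ultimately show ?thesis by blast
 qed
 ultimately have "patch \<rho> W i l ?G ?h" unfolding patch_def using W(2) G m by simp
 thus ?thesis by blast
qed

lemma manifold_patches: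
 assumes "definable_manifold L M \<tau> n CK \<rho>"
 obtains \<W> where "finite \<W>" "\<Union>\<W> = CK" "ALL W:\<W>. EX i l G h. patch \<rho> W i l G h"
proof -
 obtain \<W> where W: "finite \<W>" "\<Union>\<W> = CK" "ALL W : \<W>. dfb n W & openin \<rho> W &
   (EX m C V h. cell L M \<tau> m C & openin (sbt m C) V &
   homeomorphic_map (subtopology \<rho> W) (sbt m V) h &
   dfb (n + m) {tcat n x m (h x) | x. x : W})"
  using assms unfolding definable_manifold_def by (elim exE conjE)
 show thesis
 proof (rule that[OF W(1,2)], rule ballI)
  fix W1 assume "W1 : \<W>"
  from bspec[OF W(3) this] obtain m C V h where "dfb n W1" "openin \<rho> W1" "cell L M \<tau> m C"
   "openin (sbt m C) V" "homeomorphic_map (subtopology \<rho> W1) (sbt m V) h"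
   "dfb (n + m) {tcat n x m (h x) | x. x : W1}" by (elim exE conjE)
  thus "EX i l G h. patch \<rho> W1 i l G h" by (rule patch_of_cell)
 qed
qed

lemma patchD:
 assumes "patch \<rho> W i l G h"
 shows "openin \<rho> W" "dfb n W" "dfn n W (i + l) h" "inj_on h W" "h ` W <= G" "graph_like i l G"
  "continuous_map (subtopology \<rho> W) (PT (i + l)) h"
  "!!S. openin \<rho> S ==> S <= W ==> EX N. opn (i + l) N & h ` S = N \<inter> G"
proof -
 note p = assms[unfolded patch_def]
 show "openin \<rho> W" "dfn n W (i + l) h" "inj_on h W" "h ` W <= G" "graph_like i l G"
  "continuous_map (subtopology \<rho> W) (PT (i + l)) h" using p by (simp_all only: simp_thms)
 show "dfb n W" by (rule dfnD(1)[of n W "i + l" h]) (use p in \<open>simp only: simp_thms\<close>)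
 show "EX N. opn (i + l) N & h ` S = N \<inter> G" if "openin \<rho> S" "S <= W" for S
  using p that by (simp only: simp_thms)
qed

text \<open>Near a point of the graph the first \<open>i\<close> coordinates parametrize it through
  \<open>s\<close>; composing with the inverse of \<open>h\<close> turns the patch into a chart of
  \<open>K\<close> that is continuous and open for the manifold topology.\<close>

lemma patch_chart:
 assumes P: "patch \<rho> W i l G h" and W: "W ~= {}" "W <= CK"
 obtains U g where "chart i U g" "!!N. opn i N ==> N <= U ==> openin \<rho> (g ` N)"
  "continuous_map (sbt i U) \<rho> g"
proof -
 note p = patchD[OF P]
 have GT: "G <= TT (i + l)" using p(6) definable_subset unfolding graph_like_def by blast
 obtain x0 where x0: "x0 : W" using W by blast
 have "h x0 : G" using x0 p(5) by blast
 from bspec[OF p(6)[unfolded graph_like_def, THEN conjunct2, THEN conjunct2] this]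
 obtain Z A s where Z: "opn i Z" "tfst i (h x0) : Z" "dfb l A" "opn l A"
  and s: "cont i Z l s" and xA: "tsnd i l (h x0) : A"
  and iff: "ALL z:Z. ALL a:TT l. tcat i z l a : G & a : A \<longleftrightarrow> a = s z"
  by (elim conjE exE)
 have dG: "dfb (i + l) G" using p(6) unfolding graph_like_def by blast
 obtain N0 where N0: "opn (i + l) N0" "h ` W = N0 \<inter> G" using p(8)[OF p(1) order_refl] by blast
 have Zt: "Z <= TT i" by (rule openin_PT_subset[OF Z(1)])
 have tZ: "topspace (sbt i Z) = Z" using Zt by (simp add: topspace_PT Int_absorb1 del: topspace_power_top)
 have st: "s z : TT l" if "z : Z" for z
  using continuous_map_funspace[OF s] that unfolding tZ topspace_PT by blast
 have sG: "tcat i z l (s z) : G" "s z : A" if "z : Z" for z using iff that st by blast+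
 have cs: "cont i Z (i + l) (%z. tcat i z l (s z))"
  by (rule continuous_map_tcat[OF _ s]) (rule continuous_map_from_subtopology[OF continuous_map_id[unfolded id_def]])
 have z0: "tcat i (tfst i (h x0)) l (s (tfst i (h x0))) = h x0"
 proof -
  have t: "h x0 : TT (i + l)" using `h x0 : G` GT by blast
  have "tsnd i l (h x0) = s (tfst i (h x0))"
   using iff[rule_format, OF Z(2), of "tsnd i l (h x0)"] xA \<open>h x0 \<in> G\<close> t by simp
  thus ?thesis using t by (metis tcat_tfst_tsnd)
 qed
 have "opn i {z : Z. tcat i z l (s z) : N0}" by (rule open_preimage[OF Z(1) cs N0(1)])
 moreover have "tfst i (h x0) : {z : Z. tcat i z l (s z) : N0}" using z0 Z(2) N0(2) x0 by auto
 ultimately obtain U where U: "opn i U" "dfb i U" "tfst i (h x0) : U" "U <= {z : Z. tcat i z l (s z) : N0}"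
  by (rule definable_nbhd)
 have UZ: "U <= Z" using U(4) by blast
 let ?s = "%z. tcat i z l (s z)"
 have ds: "dfn i U l s"
 proof (intro dfnI U(2) DT_I)
  have "D (cx (c0 i U) l (TT l)) (%p. tcat i (fst p) l (snd p) : G & snd p : A)"
   by (rule dint dG Z(3) U(2) | (simp add: U(2); fail)[1])+
  thus "D (cx (c0 i U) l (TT l)) (%p. snd p = s (fst p))"
  proof (rule D_cong)
   fix p assume "p : cset (cx (c0 i U) l (TT l))"
   hence "fst p : Z" "snd p : TT l" using U(2) UZ by auto
   thus "(tcat i (fst p) l (snd p) : G & snd p : A) = (snd p = s (fst p))"
   by (rule iff[rule_format])
  qed
 qed (use U(2) UZ st in auto)
 have ds': "dfn i U (i + l) ?s"
  by (rule dfnI[OF U(2)], (rule dint U(2) ds[unfolded dfn_def, THEN conjunct2] | (simp add: U(2); fail)[1])+)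
 have sW: "?s ` U <= h ` W" using U(4) sG UZ N0(2) by blast
 let ?g = "%z. inv_into W h (?s z)"
 have dg: "dfn i U n ?g" by (rule dfn_comp[OF ds' dfn_inv[OF p(3,4)] sW])
 have hg: "h (?g z) = ?s z" "?g z : W" if "z : U" for z
  using sW that by (auto simp: f_inv_into_f inv_into_into image_subset_iff)
 have injs: "z = z'" if "z : U" "z' : U" "?s z = ?s z'" for z z'
 proof -
  have "tfst i (?s z) = tfst i (?s z')" using that(3) by (rule arg_cong)
  moreover have "z : TT i" "z' : TT i" using that UZ Zt by blast+
  ultimately show ?thesis by simp
 qed
 have "inj_on ?g U"
 proof (rule inj_onI)
  fix z z' assume z: "z : U" "z' : U" "?g z = ?g z'"
  hence "h (?g z) = h (?g z')" by simp
  thus "z = z'" unfolding hg(1)[OF z(1)] hg(1)[OF z(2)] by (rule injs[OF z(1,2)])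
 qed
 moreover have "?g ` U <= CK" using hg(2) W(2) by blast
 ultimately have ch: "chart i U ?g" unfolding chart_def using U(1,3) dg by blast
 show thesis
 proof (rule that[OF ch])
  fix N assume N: "opn i N" "N <= U"
  have oB: "opn (i + l) (Box i N l A)" by (rule open_Box[OF N(1) Z(4)])
  have "?g ` N = {x : W. h x : Box i N l A}"
  proof (intro Set.set_eqI iffI)
   fix x assume "x : ?g ` N"
   then obtain z where z: "z : N" "x = ?g z" by blast
   hence "z : U" "z : Z" "z : TT i" using N(2) UZ Zt by blast+
   thus "x : {x : W. h x : Box i N l A}" using hg z sG st by (auto simp: Box_def)
  next
   fix x assume x: "x : {x : W. h x : Box i N l A}"
   hence t: "h x : TT (i + l)" "tfst i (h x) : N" "tsnd i l (h x) : A" by (auto simp: Box_def)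
   have zU: "tfst i (h x) : U" "tfst i (h x) : Z" using t(2) N(2) UZ by blast+
   have "h x : G" using x p(5) by blast
   hence "tsnd i l (h x) = s (tfst i (h x))"
   using iff[rule_format, OF zU(2), of "tsnd i l (h x)"] t by simp
   hence "?s (tfst i (h x)) = h x" using t(1) by (metis tcat_tfst_tsnd)
   hence "h (?g (tfst i (h x))) = h x" using hg(1)[OF zU(1)] by simp
   hence "?g (tfst i (h x)) = x" using p(4) hg(2)[OF zU(1)] x by (auto dest: inj_onD)
   thus "x : ?g ` N" using t(2) by (intro image_eqI[of _ _ "tfst i (h x)"]) simp_all
  qed
  thus "openin \<rho> (?g ` N)" using open_preimage[OF p(1,7) oB] by simp
 next
  have tU: "topspace (sbt i U) = U" using UZ Zt by (auto simp: topspace_PT simp del: topspace_power_top)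
  show "continuous_map (sbt i U) \<rho> ?g"
   unfolding continuous_map_def tU
  proof (intro conjI allI impI)
   show "?g : U \<rightarrow> topspace \<rho>" using hg(2) openin_subset[OF p(1)] by blast
   fix S assume S: "openin \<rho> S"
   have "openin \<rho> (S \<inter> W)" using S p(1) by blast
   then obtain N where N: "opn (i + l) N" "h ` (S \<inter> W) = N \<inter> G" using p(8) by blast
   have "{z : U. ?g z : S} = {z : U. ?s z : N}"
   proof (intro Collect_cong conj_cong refl)
   fix z assume z: "z : U"
   have "?g z : S \<longleftrightarrow> h (?g z) : h ` (S \<inter> W)"
   using hg(2)[OF z] p(4) by (auto dest: inj_onD)
   thus "(?g z : S) = (?s z : N)" unfolding hg(1)[OF z] N(2) using sG z UZ by blast
   qed
   moreover have "opn i {z : U. ?s z : N}"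
   by (rule open_preimage[OF U(1) continuous_map_from_subtopology_mono[OF cs UZ] N(1)])
   ultimately show "openin (sbt i U) {z : U. ?g z : S}" using U(1) by (auto simp: openin_open_subtopology)
  qed
 qed
qed

lemma patch_section_continuous:
 assumes P: "patch \<rho> W i l G h" and U: "opn e U" and f: "f ` U <= W"
  and c: "cont e U (i + l) (%u. h (f u))"
 shows "continuous_map (sbt e U) \<rho> f"
proof -
 note p = patchD[OF P]
 have tU: "topspace (sbt e U) = U" using openin_PT_subset[OF U] by (auto simp: topspace_PT simp del: topspace_power_top)
 show ?thesis unfolding continuous_map_def tU
 proof (intro conjI allI impI)
  show "f : U \<rightarrow> topspace \<rho>" using f openin_subset[OF p(1)] by blast
  fix S assume S: "openin \<rho> S"
  have "openin \<rho> (S \<inter> W)" using S p(1) by blast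
  then obtain N where N: "opn (i + l) N" "h ` (S \<inter> W) = N \<inter> G" using p(8) by blast
  have "{z : U. f z : S} = {z : U. h (f z) : N}"
  proof (intro Collect_cong conj_cong refl)
   fix z assume z: "z : U"
   have "f z : W" using f z by blast
   hence "f z : S \<longleftrightarrow> h (f z) : h ` (S \<inter> W)" using p(4) by (auto dest: inj_onD)
   thus "(f z : S) = (h (f z) : N)" unfolding N(2) using p(5) \<open>f z \<in> W\<close> by blast
  qed
  thus "openin (sbt e U) {z : U. f z : S}"
   using open_preimage[OF U c N(1)] U by (auto simp: openin_open_subtopology)
 qed
qed

lemma manifold_generic_continuity:
 assumes m: "definable_manifold L M \<tau> n CK \<rho>" and U: "opn e U" "U ~= {}" and f: "dfn e U n f" "f ` U <= CK"
 obtains V W i l G h where "opn e V" "dfb e V" "V ~= {}" "V <= U" "patch \<rho> W i l G h" "W <= CK" "f ` V <= W"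
  "continuous_map (sbt e V) \<rho> f"
proof -
 obtain \<W> where W: "finite \<W>" "\<Union>\<W> = CK" "ALL W:\<W>. EX i l G h. patch \<rho> W i l G h" by (rule manifold_patches[OF m])
 have d: "dfb e {x : U. f x : W}" if "W : \<W>" for W
  by (rule dfb_vimage[OF f(1)]) (use W(3) that patchD(2) in blast)
 have cov: "U <= (\<Union>W\<in>\<W>. {x : U. f x : W})" using f(2) W(2) by blast
 obtain W1 V where V: "W1 : \<W>" "opn e V" "dfb e V" "V ~= {}" "V <= U" "V <= {x : U. f x : W1}"
  by (rule partition_interior[OF W(1) U(1) dfnD(1)[OF f(1)] U(2) d cov]) (assumption, rule that)
 obtain i l G h where P: "patch \<rho> W1 i l G h" using W(3) V(1) by blast
 have fV: "f ` V <= W1" using V(6) by blast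
 have "dfn e V (i + l) (%u. h (f u))" by (rule dfn_comp[OF dfn_subset[OF f(1) V(3,5)] patchD(3)[OF P] fV])
 then obtain V' where V': "opn e V'" "dfb e V'" "V' ~= {}" "V' <= V" "continuous_map (sbt e V') (PT (i + l)) (%u. h (f u))"
  by (rule nice_function[OF V(2,4)])
 show thesis
 proof (rule that[OF V'(1-3) _ P])
  show "f ` V' <= W1" using fV V'(4) by blast
  thus "continuous_map (sbt e V') \<rho> f" by (rule patch_section_continuous[OF P V'(1) _ V'(5)])
 qed (use V'(4) V(1,5) W(2) in blast)+
qed

text \<open>The base chart generically maps into one patch, so \<open>dK \<le> i\<close>, and
  \<open>patch_chart\<close> yields a chart of dimension \<open>i\<close>, so \<open>i = dK\<close>.
  That chart is open and continuous for \<open>\<rho>\<close> and, after shrinking, good for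
  \<open>rho\<close>. Hence the neighbourhoods of zero are the same, and translations are continuous
  in both topologies.\<close>

lemma manifold_group_unique:
 assumes m: "definable_manifold L M \<tau> n CK \<rho>" and tg: "topological_group (add_monoid K) \<rho>"
 shows "\<rho> = rho"
proof -
 have top: "topspace \<rho> = CK" and ca: "continuous_map (prod_topology \<rho> \<rho>) \<rho> (%(x, y). x \<oplus> y)"
  using tg unfolding topological_group_def by simp_all
 obtain V W i l G h where V: "opn dK V" "dfb dK V" "V ~= {}" "V <= V0" and P: "patch \<rho> W i l G h" "W <= CK" "g0 ` V <= W"
  by (rule manifold_generic_continuity[OF m V0(1,3,4) image_subsetI[OF V0(6)]]) (assumption, rule that)
 note p = patchD[OF P(1)]
 have "dK \<le> i"
 proof -
  have f: "dfn dK V i (%v. tfst i (h (g0 v)))"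
  proof (rule dfnI[OF V(2)], rule DT_tfst)
   show "DT (c0 dK V) (i + l) (%v. h (g0 v))"
   using dfn_comp[OF dfn_subset[OF V0(4) V(2,4)] p(3) P(3)] unfolding dfn_def by blast
  qed (use V in simp)
  have hg: "inj_on (%v. h (g0 v)) V"
   using comp_inj_on[OF inj_on_subset[OF V0(5) V(4)] inj_on_subset[OF p(4) P(3)]] by (simp add: comp_def)
  have GT: "G <= TT (i + l)" using p(6) definable_subset unfolding graph_like_def by blast
  have "finite {z' : V. tfst i (h (g0 z')) = w}" for w
  proof (rule finite_imageD[OF _ inj_on_subset[OF hg]])
   have "finite {a : TT l. tcat i w l a : G}" using p(6) unfolding graph_like_def by blast
   moreover have "(%v. h (g0 v)) ` {z' : V. tfst i (h (g0 z')) = w} <= (%a. tcat i w l a) ` {a : TT l. tcat i w l a : G}"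
   proof (rule image_subsetI)
   fix v assume v: "v : {z' : V. tfst i (h (g0 z')) = w}"
   hence "h (g0 v) : G" using P(3) p(5) by blast
   moreover from this have t: "h (g0 v) : TT (i + l)" using GT by blast
   moreover have "h (g0 v) = tcat i w l (tsnd i l (h (g0 v)))" using v tcat_tfst_tsnd[OF t] by simp
   ultimately show "h (g0 v) : (%a. tcat i w l a) ` {a : TT l. tcat i w l a : G}"
   by (intro image_eqI[where x = "tsnd i l (h (g0 v))"]) auto
   qed
   ultimately show "finite ((%v. h (g0 v)) ` {z' : V. tfst i (h (g0 z')) = w})" using finite_surj by blast
  qed blast
  thus ?thesis by (intro finite_to_one_dim_le[OF V(1,3) f])
 qed
 have "W ~= {}" using V(3) P(3) by blast
 then obtain U g where g: "chart i U g" "!!N. opn i N ==> N <= U ==> openin \<rho> (g ` N)"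
  "continuous_map (sbt i U) \<rho> g"
  by (rule patch_chart[OF P(1) _ P(2)]) (rule that)
 have "i = dK" using `dK \<le> i` chart_le[OF g(1)] by simp
 note g = g[unfolded \<open>i = dK\<close>]
 obtain U' where U': "U' <= U" "good_chart U' g" by (rule generic_good_chart[OF g(1)])
 have U'c: "opn dK U'" "U' ~= {}" and im: "!!x. x : U' ==> g x : CK" using U'(2) unfolding good_chart_def chart_def by blast+
 obtain x0 where x0: "x0 : U'" using U'c by blast
 have tr: "openin \<rho> {x : CK. c \<oplus> x : S}" if "openin \<rho> S" "c : CK" for S c
 proof -
  have "continuous_map \<rho> (prod_topology \<rho> \<rho>) (%x. (c, x))"
   by (rule continuous_map_pairedI) (use that(2) top in auto)
  hence "continuous_map \<rho> \<rho> ((%(x, y). x \<oplus> y) \<circ> (%x. (c, x)))" by (rule continuous_map_compose[OF _ ca])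
  from openin_continuous_map_preimage[OF this that(1)] show ?thesis unfolding top by simp
 qed
 have gg: "GG A \<longleftrightarrow> (EX S. openin \<rho> S & \<zero> : S & S <= A)" for A
 proof
  assume "GG A"
  hence "germ U' g x0 A" using U'(2) x0 unfolding good_chart_def by blast
  then obtain N where N: "opn dK N" "x0 : N" "N <= U'" "ALL u:N. g u \<ominus> g x0 : A" unfolding germ_def by blast
  have "openin \<rho> (g ` N)" using g(2)[OF N(1)] N(3) U'(1) by blast
  hence "openin \<rho> {x : CK. g x0 \<oplus> x : g ` N}" by (rule tr[OF _ im[OF x0]])
  moreover have "\<zero> : {x : CK. g x0 \<oplus> x : g ` N}" using im[OF x0] N(2) by auto
  moreover have "{x : CK. g x0 \<oplus> x : g ` N} <= A"
  proof
   fix x assume "x : {x : CK. g x0 \<oplus> x : g ` N}"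
   then obtain u where u: "x : CK" "u : N" "g x0 \<oplus> x = g u" by blast
   have "g u \<ominus> g x0 = x" unfolding u(3)[symmetric] using u(1) im[OF x0] by algebra
   thus "x : A" using bspec[OF N(4) u(2)] by simp
  qed
  ultimately show "EX S. openin \<rho> S & \<zero> : S & S <= A" by blast
 next
  assume "EX S. openin \<rho> S & \<zero> : S & S <= A"
  then obtain S where S: "openin \<rho> S" "\<zero> : S" "S <= A" by blast
  have "openin \<rho> {x : CK. \<ominus> g x0 \<oplus> x : S}" by (rule tr[OF S(1)]) (use im[OF x0] in simp)
  hence o: "opn dK {u : U'. g u : {x : CK. \<ominus> g x0 \<oplus> x : S}}"
   by (rule open_preimage[OF U'c(1) continuous_map_from_subtopology_mono[OF g(3) U'(1)]])
  have "germ U' g x0 A" unfolding germ_def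
  proof (intro exI conjI ballI)
   show "x0 : {u : U'. g u : {x : CK. \<ominus> g x0 \<oplus> x : S}}" using x0 im[OF x0] S(2) by (simp add: l_neg)
   fix u assume u: "u : {u : U'. g u : {x : CK. \<ominus> g x0 \<oplus> x : S}}"
   hence "g u : CK" "\<ominus> g x0 \<oplus> g u : S" by simp_all
   moreover have "g u \<ominus> g x0 = \<ominus> g x0 \<oplus> g u" using `g u : CK` im[OF x0] by algebra
   ultimately show "g u \<ominus> g x0 : A" using S(3) by auto
  qed (use o in blast)+
  thus "GG A" using U'(2) x0 unfolding good_chart_def by blast
 qed
 show ?thesis
 proof (rule topology_eq[THEN iffD2], intro allI iffI)
  fix S assume S: "openin \<rho> S"
  have "S <= CK" using openin_subset[OF S] top by simp
  moreover have "GG {a : CK. x \<oplus> a : S}" if "x : S" for x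
   unfolding gg using tr[OF S, of x] that \<open>S \<subseteq> CK\<close> by (intro exI[of _ "{a : CK. x \<oplus> a : S}"]) auto
  ultimately show "openin rho S" unfolding openin_rho by blast
 next
  fix S assume S: "openin rho S"
  hence SC: "S <= CK" using openin_rho by blast
  show "openin \<rho> S"
  proof (subst openin_subopen, intro ballI)
   fix x assume x: "x : S"
   hence "GG {a : CK. x \<oplus> a : S}" using S openin_rho by blast
   then obtain T where T: "openin \<rho> T" "\<zero> : T" "T <= {a : CK. x \<oplus> a : S}" unfolding gg by blast
   have xc: "x : CK" using x SC by blast
   have o: "openin \<rho> {a : CK. \<ominus> x \<oplus> a : T}" by (rule tr[OF T(1)]) (use xc in simp)
   have "{a : CK. \<ominus> x \<oplus> a : T} <= S"
   proof
   fix a assume a: "a : {a : CK. \<ominus> x \<oplus> a : T}"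
   hence "x \<oplus> (\<ominus> x \<oplus> a) : S" using T(3) by blast
   moreover have "x \<oplus> (\<ominus> x \<oplus> a) = a" using a xc by (simp add: r_neg2)
   ultimately show "a : S" by simp
   qed
   moreover have "x : {a : CK. \<ominus> x \<oplus> a : T}" using xc T(2) by (simp add: l_neg)
   ultimately show "EX T. openin \<rho> T & x : T & T <= S" using o by blast
  qed
 qed
qed

end

section \<open>Existence: \<open>rho\<close> is a manifold topology\<close>

context dfield begin

text \<open>At \<open>y\<close> the topology \<open>rho\<close> is compared with the one
  \<open>Q\<close> inherits from \<open>M^n\<close>. Both halves quantify only over indices of basic
  sets, so the condition is definable; the second also makes \<open>Q\<close> a neighbourhood of
  \<open>y\<close> for \<open>rho\<close>.\<close>

definition topologies_agree :: "(nat => 'a) set => (nat => 'a) => bool" where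
 "topologies_agree Q y \<longleftrightarrow>
   (ALL w:RY. y : RB w --> (EX v:BY n. y : BB n v & (ALL x:Q. x : BB n v --> x : RB w))) &
   (ALL v:BY n. y : BB n v --> (EX w:RY. y : RB w & (ALL x:TT n. x : RB w --> x : BB n v & x : Q)))"

text \<open>The largest \<open>rho\<close>-open subset of \<open>Q\<close> on which \<open>rho\<close> is the subspace topology.\<close>

definition core :: "(nat => 'a) set => (nat => 'a) set" where
 "core Q = {y : Q. EX w:RY. y : RB w & (ALL z:TT n. z : RB w --> z : Q & topologies_agree Q z)}"

lemma D_topologies_agree:
 assumes Q: "dfb n Q" and t: "DT Ga n t" and w: "wfc Ga"
 shows "D Ga (%x. topologies_agree Q (t x))"
 unfolding topologies_agree_def
 by (rule D_BB D_RB dint t Q dRY basis_facts(2) w | (simp add: w Q dRY basis_facts(2); fail)[1] | (auto simp: w Q dRY basis_facts(2); fail)[1])+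

lemma dfb_core: assumes Q: "dfb n Q" shows "dfb n (core Q)"
 unfolding core_def
 by (rule definableI[OF refl], (rule D_topologies_agree D_RB dint Q dRY | (simp add: Q dRY; fail)[1] | (auto simp: Q dRY; fail)[1])+)

lemma RB_TT: "RB w <= TT n" unfolding RB_def by blast

lemma core_agree: "y : core Q ==> topologies_agree Q y" unfolding core_def using RB_TT by blast

lemma core_sub: "core Q <= Q" unfolding core_def by blast

lemma open_core: "openin rho (core Q)"
proof (subst openin_subopen, intro ballI)
 fix y assume "y : core Q"
 then obtain w where w: "w : RY" "y : RB w" "ALL z:TT n. z : RB w --> z : Q & topologies_agree Q z" unfolding core_def by blast
 have "RB w <= core Q" using w RB_TT unfolding core_def by blast
 thus "EX T. openin rho T & y : T & T <= core Q" using open_RB[OF w(1)] w(2) by blast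
qed

lemma topologies_agreeD1:
 assumes "topologies_agree Q y" "openin rho S" "y : S"
 shows "EX N. opn n N & y : N & N \<inter> Q <= S"
proof -
 obtain w where w: "w : RY" "y : RB w" "RB w <= S" using RB_basis[OF assms(2,3)] by blast
 from mp[OF bspec[OF conjunct1[OF assms(1)[unfolded topologies_agree_def]] w(1)] w(2)]
 obtain v where v: "v : BY n" "y : BB n v" "ALL x:Q. x : BB n v --> x : RB w" by (elim bexE conjE)
 have "BB n v \<inter> Q <= S" using v(3) w(3) by blast
 thus ?thesis using basis_facts(3)[OF v(1)] v(2) by blast
qed

lemma topologies_agreeD2:
 assumes "topologies_agree Q y" "opn n N" "y : N"
 shows "EX S. openin rho S & y : S & S <= N"
proof -
 obtain v where v: "v : BY n" "y : BB n v" "BB n v <= N" using basis_facts(4)[OF assms(2,3)] by blast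
 from mp[OF bspec[OF conjunct2[OF assms(1)[unfolded topologies_agree_def]] v(1)] v(2)]
 obtain w where w: "w : RY" "y : RB w" "ALL x:TT n. x : RB w --> x : BB n v & x : Q" by (elim bexE conjE)
 have "RB w <= N" using w(3) RB_TT v(3) by blast
 thus ?thesis using open_RB[OF w(1)] w(2) by blast
qed

lemma core_trace:
 assumes S: "openin rho S" "S <= core Q" shows "EX N. opn n N & S = N \<inter> Q"
proof (intro exI conjI)
 let ?N = "\<Union>{N. opn n N & N \<inter> Q <= S}"
 show "opn n ?N" by blast
 have "S <= ?N"
 proof
  fix y assume y: "y : S"
  hence "topologies_agree Q y" using S(2) core_agree by blast
  from topologies_agreeD1[OF this S(1) y] show "y : ?N" by blast
 qed
 thus "S = ?N \<inter> Q" using S(2) core_sub by blast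
qed

lemma core_continuous_id: "continuous_map (subtopology rho (core Q)) (PT n) (%x. x)"
 unfolding continuous_map_def
proof (intro conjI allI impI)
 have t: "topspace (subtopology rho (core Q)) = core Q" using openin_subset[OF open_core] by auto
 show "(%x. x) : topspace (subtopology rho (core Q)) \<rightarrow> topspace (PT n)"
  using openin_subset[OF open_core[of Q]] unfolding t topspace_PT by auto
 fix N assume N: "opn n N"
 have "openin rho {x : core Q. x : N}"
 proof (subst openin_subopen, intro ballI)
  fix y assume y: "y : {x : core Q. x : N}"
  then obtain S where "openin rho S" "y : S" "S <= N" using topologies_agreeD2[OF core_agree N] by blast
  thus "EX T. openin rho T & y : T & T <= {x : core Q. x : N}"
   using y by (intro exI[of _ "S \<inter> core Q"]) (auto intro: open_core)
 qed
 thus "openin (subtopology rho (core Q)) {x : topspace (subtopology rho (core Q)). x : N}"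
  unfolding t by (auto simp: openin_open_subtopology open_core)
qed

definition cell_patch :: "(nat => 'a) set => bool" where
 "cell_patch A \<longleftrightarrow> openin rho A & (EX m C V h. cell L M \<tau> m C & openin (sbt m C) V &
   homeomorphic_map (subtopology rho A) (sbt m V) h & dfn n A m h)"

lemma cell_patch_translate:
 assumes A: "cell_patch A" and c: "c : CK" shows "cell_patch ((%x. c \<oplus> x) ` A)"
proof -
 from A obtain m C V h where o: "openin rho A" and C: "cell L M \<tau> m C" "openin (sbt m C) V"
  and h: "homeomorphic_map (subtopology rho A) (sbt m V) h" and d: "dfn n A m h"
  unfolding cell_patch_def by (elim exE conjE)
 have AC: "A <= CK" using openin_subset[OF o] by simp
 let ?W = "(%x. c \<oplus> x) ` A" and ?t = "%x. \<ominus> c \<oplus> x"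
 have oW: "openin rho ?W" by (rule open_translate[OF o c])
 have WC: "?W <= CK" using openin_subset[OF oW] by simp
 have tc: "?t (c \<oplus> x) = x" "c \<oplus> ?t x = x" if "x : CK" for x using that c by (simp_all add: r_neg1 r_neg2)
 have tW: "topspace (subtopology rho ?W) = ?W" using WC by (simp add: Int_absorb1)
 have tA: "topspace (subtopology rho A) = A" using AC by (simp add: Int_absorb1)
 have "?t ` ?W = (%x. x) ` A" unfolding image_image by (rule image_cong[OF refl], rule tc(1)) (use AC in blast)
 hence img: "?t ` ?W = A" by simp
 have ct: "continuous_map rho rho (%x. b \<oplus> x)" if "b : CK" for b
 proof -
  have "continuous_map rho (prod_topology rho rho) (%x. (b, x))"
   by (rule continuous_map_pairedI) (use that in auto)
  from continuous_map_compose[OF this continuous_add] show ?thesis by (simp add: comp_def)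
 qed
 have "homeomorphic_map (subtopology rho ?W) (subtopology rho A) ?t"
 proof (rule bijective_open_imp_homeomorphic_map)
  show "continuous_map (subtopology rho ?W) (subtopology rho A) ?t"
   using img by (intro continuous_map_into_subtopology continuous_map_from_subtopology ct) (use c tW in auto)
  show "open_map (subtopology rho ?W) (subtopology rho A) ?t"
   unfolding open_map_def openin_open_subtopology[OF oW] openin_open_subtopology[OF o]
   using open_translate c img by (auto 0 3)
  show "?t ` topspace (subtopology rho ?W) = topspace (subtopology rho A)" unfolding tW tA by (rule img)
  show "inj_on ?t (topspace (subtopology rho ?W))" unfolding tW
   by (rule inj_on_inverseI[where g = "%x. c \<oplus> x"]) (use tc WC in blast)
 qed
 from homeomorphic_map_compose[OF this h]
 have "homeomorphic_map (subtopology rho ?W) (sbt m V) (h \<circ> ?t)" .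
 moreover have "dfn n ?W m (h \<circ> ?t)"
 proof -
  have dA: "dfb n A" by (rule dfnD(1)[OF d])
  have dt: "dfn n S n (%x. b \<oplus> x)" if "b : CK" "dfb n S" "S <= CK" for b S
   by (rule dfnI[OF that(2)], (rule DT_add dint that | (use that in \<open>auto; fail\<close>)[1])+)
  have dW: "dfb n ?W" by (rule dfb_image[OF dt[OF c dA AC]])
  show ?thesis unfolding comp_def by (rule dfn_comp[OF dt[OF _ dW WC] d]) (use img c in auto)
 qed
 ultimately show ?thesis unfolding cell_patch_def using oW C by blast
qed

lemma manifold_rho:
 assumes F: "finite \<A>" "\<Union>\<A> = CK" "!!A. A : \<A> ==> cell_patch A"
 shows "definable_manifold L M \<tau> n CK rho"
 unfolding definable_manifold_def
proof (intro conjI exI[of _ \<A>] ballI)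
 fix W assume "W : \<A>"
 from F(3)[OF this, unfolded cell_patch_def] obtain m C V h where o: "openin rho W" and C: "cell L M \<tau> m C" "openin (sbt m C) V"
  and h: "homeomorphic_map (subtopology rho W) (sbt m V) h" and d: "dfn n W m h"
  by (elim exE conjE)
 show "dfb n W" "openin rho W" using dfnD(1)[OF d] o by blast+
 have WT: "W <= TT n" by (rule definable_subset[OF dfnD(1)[OF d]])
 have "{tcat n x m (h x) | x. x : W} = {z : TT (n + m). tfst n z : W & tsnd n m z = h (tfst n z)}"
 proof (intro Set.set_eqI iffI)
  fix z assume "z : {tcat n x m (h x) | x. x : W}"
  then obtain x where x: "z = tcat n x m (h x)" "x : W" by blast
  moreover have "x : TT n" "h x : TT m" using x(2) WT dfnD(2)[OF d x(2)] by blast+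
  ultimately show "z : {z : TT (n + m). tfst n z : W & tsnd n m z = h (tfst n z)}" by simp
 next
  fix z assume z: "z : {z : TT (n + m). tfst n z : W & tsnd n m z = h (tfst n z)}"
  hence "z = tcat n (tfst n z) m (h (tfst n z))" using tcat_tfst_tsnd[of z M n m] by simp
  thus "z : {tcat n x m (h x) | x. x : W}" using z by blast
 qed
 hence "dfb (n + m) {tcat n x m (h x) | x. x : W}" using dfn_graph[OF d] by simp
 thus "EX m C V h. cell L M \<tau> m C & openin (sbt m C) V &
   homeomorphic_map (subtopology rho W) (sbt m V) h & dfb (n + m) {tcat n x m (h x) | x. x : W}"
  using C h by blast
qed (use F dCK has_definable_basis_rho in auto)

text \<open>If no finite union of translates of \<open>V\<close> is \<open>K\<close>, then for
  finitely many \<open>u\<close> there is \<open>t\<close> with all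
  \<open>\<ominus> g0 u \<oplus> t\<close> outside \<open>V\<close>. By
  \<open>directed_interior\<close> one \<open>t\<close> serves an open set of \<open>u\<close>, and
  there \<open>\<ominus> g0 u \<oplus> t\<close> is a chart that misses \<open>V\<close>.\<close>

lemma finitely_many_translates:
 assumes V: "dfb n V" and large: "!!U g. chart dK U g ==> EX u:U. g u : V"
 obtains F where "finite F" "F <= CK" "!!x. x : CK ==> EX c:F. \<ominus> c \<oplus> x : V"
proof (rule ccontr)
 assume a: "\<not> thesis"
 note conc = that
 have no: "EX x:CK. ALL c:F. \<ominus> c \<oplus> x \<notin> V" if "finite F" "F <= CK" for F
  using conc[OF that] a by blast
 let ?R = "{z : TT (dK + n). tfst dK z : V0 & tsnd dK n z : CK}"
 let ?S = "{z : ?R. \<ominus> g0 (tfst dK z) \<oplus> tsnd dK n z \<notin> V}"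
 have dR: "dfb (dK + n) ?R" by (rule definable_times[OF V0(2) dCK])
 have dS: "dfb (dK + n) ?S"
  by (rule definableI[OF refl], (rule DT_add DT_neg DT_app[OF V0(4)] dint dR V | (use V0(6) dR in \<open>auto; fail\<close>)[1])+)
 have "EX t:CK. PT dK interior_of {x : TT dK. tcat dK x n t : ?S} ~= {}"
 proof (rule directed_interior[OF V0(1,2,3) dS dCK])
  fix A assume A: "finite A" "A <= V0"
  have s: "V0 <= TT dK" by (rule definable_subset[OF V0(2)])
  obtain x where x: "x : CK" "ALL c:g0 ` A. \<ominus> c \<oplus> x \<notin> V" using no[of "g0 ` A"] A V0(6) by blast
  have "tcat dK u n x : ?S" if "u : A" for u
  proof -
   have "u : V0" "u : TT dK" using that A(2) s by blast+
   thus ?thesis using x that by auto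
  qed
  thus "EX t:CK. ALL x:A. tcat dK x n t : ?S" using x(1) by blast
 qed
 then obtain t where t: "t : CK" "PT dK interior_of {x : TT dK. tcat dK x n t : ?S} ~= {}" by blast
 let ?O = "PT dK interior_of {x : TT dK. tcat dK x n t : ?S}"
 have Os: "?O <= {x : TT dK. tcat dK x n t : ?S}" by (rule interior_of_subset)
 have O: "u : V0" "\<ominus> g0 u \<oplus> t \<notin> V" if "u : ?O" for u
 proof -
  have "u : TT dK" "tcat dK u n t : ?S" using that Os by blast+
  thus "u : V0" "\<ominus> g0 u \<oplus> t \<notin> V" using t(1) by auto
 qed
 have dO: "dfb dK ?O"
 proof (rule dfb_interior)
  have "dfb dK {x : TT dK. tcat dK x n t : ?S}"
   by (rule definableI[OF refl], (rule dint dS | (use t in \<open>simp; fail\<close>)[1])+)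
  thus "dfb dK {x : TT dK. tcat dK x n t : ?S}" .
 qed
 define Z where "Z = ?O"
 have Z: "opn dK Z" "dfb dK Z" "Z ~= {}" "!!u. u : Z ==> u : V0" "!!u. u : Z ==> \<ominus> g0 u \<oplus> t \<notin> V"
  unfolding Z_def by (rule openin_interior_of, rule dO, rule t(2), erule O(1), erule O(2))
 have "chart dK Z (%u. \<ominus> g0 u \<oplus> t)" unfolding chart_def
 proof (intro conjI)
  show "dfn dK Z n (%u. \<ominus> g0 u \<oplus> t)"
   by (rule dfnI[OF Z(2)], (rule DT_add DT_neg DT_app[OF V0(4)] dint Z(2) | (use V0(6) Z(2,4) t(1) in \<open>auto; fail\<close>)[1])+)
  show "inj_on (%u. \<ominus> g0 u \<oplus> t) Z"
  proof (rule inj_onI)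
   fix u v assume uv: "u : Z" "v : Z" "\<ominus> g0 u \<oplus> t = \<ominus> g0 v \<oplus> t"
   have m: "u : V0" "v : V0" "g0 u : CK" "g0 v : CK" using Z(4) uv V0(6) by blast+
   have "\<ominus> g0 u = \<ominus> g0 v" by (rule add_cancel_r[OF _ t(1) _ uv(3)]) (use m in simp_all)
   hence "g0 u = g0 v" using m by (metis minus_minus)
   thus "u = v" using V0(5) m by (auto dest: inj_onD)
  qed
  show "(%u. \<ominus> g0 u \<oplus> t) ` Z <= CK" using Z(4) V0(6) t(1) by blast
 qed (rule Z(1), rule Z(3))
 from large[OF this] show False using Z(5) by blast
qed

text \<open>\<open>tdim_open\<close> for sets that need not be open; it shows that the part
  discarded by niceness has empty interior.\<close>

lemma tdim_interior: "dfb m S ==> PT m interior_of S ~= {} ==> \<not> tdim \<tau> m S < ereal (real m)"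
proof -
 assume S: "dfb m S" "PT m interior_of S ~= {}"
 let ?K = "{k. EX io. strict_mono_on {..<k} io & io ` {..<k} <= {..<m} &
   PT k interior_of ((%x. \<lambda>j \<in> {..<k}. x (io j)) ` S) ~= {}}"
 have "k \<le> m" if "k : ?K" for k
 proof -
  obtain io where "strict_mono_on {..<k} io" "io ` {..<k} <= {..<m}" using `k : ?K` by blast
  thus "k \<le> m" using card_inj_on_le[of io "{..<k}" "{..<m}"] strict_mono_on_imp_inj_on by fastforce
 qed
 hence fin: "finite ?K" using finite_nat_set_iff_bounded_le by auto
 have "(%x. \<lambda>j\<in>{..<m}. x j) ` S = S" using definable_subset[OF S(1)] by (force simp: image_iff tuples_def)
 hence "m : ?K" using S(2)
  by (auto intro!: exI[of _ "%j. j"] simp: strict_mono_on_def)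
 hence "m \<le> Max ?K" using fin by simp
 moreover have "S ~= {}" using S(2) by auto
 ultimately show ?thesis unfolding tdim_def by simp
qed

text \<open>The points with exactly \<open>k\<close> preimages form a definable set, and niceness
  makes the fibres a continuous correspondence on \<open>U\<close>, which lies in its interior. The
  part of this interior outside \<open>U\<close> has empty interior; so \<open>U\<close> meets every
  non-empty open \<open>W\<close> on which the fibres have size \<open>k\<close>.\<close>

lemma fibre_correspondence:
 assumes s: "sheet n P dK io"
 shows "EX U. dfb dK U & opn dK U & correspondence k U (TT n) (%w. {x : P. prj dK io x = w}) &
  dfb (dK + n) (corr_graph dK U n (%w. {x : P. prj dK io x = w})) &
  continuous_correspondence k (sbt dK U) (PT n) (%w. {x : P. prj dK io x = w}) &
  (ALL W. opn dK W & dfb dK W & W ~= {} & (ALL w:W. card {x : P. prj dK io x = w} = k) -->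
   (EX W'. opn dK W' & dfb dK W' & W' ~= {} & W' <= W & W' <= U))"
proof -
 let ?f = "%w. {x : P. prj dK io x = w}"
 have P: "dfb n P" "io ` {..<dK} <= {..<n}" "!!w. finite (?f w)" using s unfolding sheet_def by blast+
 have PT: "P <= TT n" by (rule definable_subset[OF P(1)])
 have pj: "prj dK io x : TT dK" if "x : P" for x using prj_in[OF _ P(2)] PT that by blast
 let ?E = "{w : TT dK. card (?f w) = k}"
 have fT: "?f w = {x : TT n. x : P & prj dK io x = w}" for w using PT by blast
 have D: "D (cx Ga n (TT n)) (%p. snd p : P & prj dK io (snd p) = t (fst p))" if "DT Ga dK t" "wfc Ga" for Ga :: "nat \<times> (nat => 'a) set \<times> ((nat => 'a) => 'z)" and t
  by (rule dint DT_prj[OF P(2)] P(1) that | (use that in \<open>simp; fail\<close>)[1])+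
 have "dfb dK {w : TT dK. atleast k (?f w) & \<not> atleast (Suc k) (?f w)}"
  unfolding fT
  by (rule definableI[OF refl], (rule D_atleast D dint | (simp; fail)[1])+)
 moreover have "{w : TT dK. atleast k (?f w) & \<not> atleast (Suc k) (?f w)} = ?E"
  unfolding atleast_exact using P(3) by blast
 ultimately have dE: "dfb dK ?E" by simp
 let ?O = "PT dK interior_of ?E"
 have dO: "dfb dK ?O" by (rule dfb_interior[OF dE])
 have oO: "opn dK ?O" by (rule openin_interior_of)
 have OE: "?O <= ?E" by (rule interior_of_subset)
 have cor: "correspondence k ?O (TT n) ?f" unfolding correspondence_def
 proof (intro ballI conjI)
  fix w assume "w : ?O"
  thus "card (?f w) = k" using OE by blast
 qed (use PT P(3) in blast)+
 have gr: "dfb (dK + n) (corr_graph dK U n ?f)" if U: "dfb dK U" for U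
 proof -
  have UT: "U <= TT dK" by (rule definable_subset[OF U])
  have "corr_graph dK U n ?f = {z : Box dK U n P. prj dK io (tsnd dK n z) = tfst dK z}"
  proof (intro Set.set_eqI iffI)
   fix z assume "z : corr_graph dK U n ?f"
   then obtain w x where z: "z = tcat dK w n x" "w : U" "x : P" "prj dK io x = w" unfolding corr_graph_def by blast
   have "w : TT dK" "x : TT n" using z(2,3) UT PT by blast+
   thus "z : {z : Box dK U n P. prj dK io (tsnd dK n z) = tfst dK z}" using z by (simp add: Box_def)
  next
   fix z assume "z : {z : Box dK U n P. prj dK io (tsnd dK n z) = tfst dK z}"
   hence z: "z : TT (dK + n)" "tfst dK z : U" "tsnd dK n z : ?f (tfst dK z)" by (auto simp: Box_def)
   have "z = tcat dK (tfst dK z) n (tsnd dK n z)" using z(1) by simp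
   thus "z : corr_graph dK U n ?f" unfolding corr_graph_def using z(2,3) by blast
  qed
  moreover have "dfb (dK + n) {z : Box dK U n P. prj dK io (tsnd dK n z) = tfst dK z}"
   by (rule definableI[OF refl], (rule dint DT_prj[OF P(2)] dfb_Box U P(1) | (simp add: dfb_Box U P(1); fail)[1])+)
  ultimately show ?thesis by simp
 qed
 from nice[unfolded nice_def, rule_format, OF conjI[OF dO conjI[OF oO conjI[OF cor gr[OF dO]]]]]
 obtain U where U: "U <= ?O" "dfb dK U" "opn dK U"
  "continuous_correspondence k (sbt dK U) (PT n) ?f" "tdim \<tau> dK (?O - U) < ereal (real dK)"
  by (elim exE conjE)
 have small: "PT dK interior_of (?O - U) = {}" using tdim_interior[OF definable_Diff[OF dO U(2)]] U(5) by blast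
 have main: "EX W'. opn dK W' & dfb dK W' & W' ~= {} & W' <= W & W' <= U"
  if W: "opn dK W" "dfb dK W" "W ~= {}" "ALL w:W. card (?f w) = k" for W
 proof -
  have "W <= ?O" by (rule interior_of_maximal) (use W openin_PT_subset in blast)+
  hence "\<not> W \<inter> U = {}" using small interior_neI[OF W(1,3), of "?O - U"] by blast
  thus ?thesis using W U(2,3) by (intro exI[of _ "W \<inter> U"]) (auto intro: definable_Int)
 qed
 have "correspondence k U (TT n) ?f" using cor U(1) unfolding correspondence_def by blast
 thus ?thesis using U(2-4) gr[OF U(2)] main by (intro exI[of _ U]) simp
qed

text \<open>Over \<open>U\<close> the graph of the fibre correspondence is a cell in
  \<open>M^(dK + n)\<close>, and \<open>x\<close> is sent to \<open>x\<close> preceded by its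
  projection. On the core \<open>rho\<close> is the subspace topology, so this map is a
  homeomorphism onto an open part of the cell.\<close>

lemma core_cell_patch:
 assumes s: "sheet n P dK io" and U: "dfb dK U" "opn dK U"
  and cor: "correspondence k U (TT n) (%w. {x : P. prj dK io x = w})"
  and gr: "dfb (dK + n) (corr_graph dK U n (%w. {x : P. prj dK io x = w}))"
  and cc: "continuous_correspondence k (sbt dK U) (PT n) (%w. {x : P. prj dK io x = w})"
 shows "cell_patch (core {x : P. prj dK io x : U})"
proof -
 let ?Q = "{x : P. prj dK io x : U}" and ?f = "%w. {x : P. prj dK io x = w}"
 let ?C = "corr_graph dK U n ?f" and ?h = "%x. tcat dK (prj dK io x) n x"
 have P: "dfb n P" "io ` {..<dK} <= {..<n}" using s unfolding sheet_def by blast+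
 have PT: "P <= TT n" by (rule definable_subset[OF P(1)])
 have pj: "prj dK io x : TT dK" if "x : TT n" for x using prj_in[OF that P(2)] .
 have dQ: "dfb n ?Q" by (rule dfb_vimage[OF dfn_prj[OF P(2,1)] U(1)])
 have C: "?C = ?h ` ?Q" unfolding corr_graph_def by auto
 have cell: "cell L M \<tau> (dK + n) ?C" unfolding cell_def
  by (intro exI[of _ dK] exI[of _ k] exI[of _ U] exI[of _ ?f] exI[of _ id])
   (use U cor gr cc in \<open>simp add: permutes_id\<close>)
 let ?A = "core ?Q"
 have oA: "openin rho ?A" by (rule open_core)
 have dA: "dfb n ?A" by (rule dfb_core[OF dQ])
 have AQ: "?A <= ?Q" by (rule core_sub)
 have AT: "?A <= TT n" using AQ PT by blast
 have tA: "topspace (subtopology rho ?A) = ?A" using openin_subset[OF oA] by auto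
 have inj: "inj_on ?h ?Q"
 proof (rule inj_onI)
  fix x y assume xy: "x : ?Q" "y : ?Q" "?h x = ?h y"
  have "tsnd dK n (?h x) = tsnd dK n (?h y)" using xy(3) by (rule arg_cong)
  moreover have "x : TT n" "y : TT n" using xy(1,2) PT by blast+
  ultimately show "x = y" by simp
 qed
 have tr: "EX N. opn (dK + n) N & ?h ` S = N \<inter> ?C" if S: "openin rho S" "S <= ?A" for S
 proof -
  obtain N where N: "opn n N" "S = N \<inter> ?Q" using core_trace[OF S] by blast
  have "opn (dK + n) {z : TT (dK + n). tsnd dK n z : N}"
   using openin_continuous_map_preimage[OF continuous_map_tsnd N(1)] unfolding topspace_PT .
  moreover have "?h ` S = {z : TT (dK + n). tsnd dK n z : N} \<inter> ?C"
  proof (intro Set.set_eqI iffI)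
   fix z assume "z : ?h ` S"
   then obtain x where x: "x : N" "x : ?Q" "z = ?h x" unfolding N(2) by blast
   have "x : TT n" using x(2) PT by blast
   thus "z : {z : TT (dK + n). tsnd dK n z : N} \<inter> ?C" using x pj unfolding C by auto
  next
   fix z assume z: "z : {z : TT (dK + n). tsnd dK n z : N} \<inter> ?C"
   then obtain x where x: "x : ?Q" "z = ?h x" unfolding C by blast
   have "x : TT n" using x PT by blast
   hence "x : N" using z x(2) by simp
   thus "z : ?h ` S" unfolding N(2) using x by blast
  qed
  ultimately show ?thesis by blast
 qed
 let ?V = "?h ` ?A"
 obtain NA where NA: "opn (dK + n) NA" "?V = NA \<inter> ?C" using tr[OF oA order_refl] by blast
 have V: "openin (sbt (dK + n) ?C) ?V" unfolding openin_subtopology using NA by blast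
 have VT: "?V <= TT (dK + n)" using NA openin_PT_subset by blast
 have tV: "topspace (sbt (dK + n) ?V) = ?V" using VT by (auto simp: topspace_PT simp del: topspace_power_top)
 have cp: "continuous_map (PT n) (PT dK) (prj dK io)" unfolding prj_def by (rule continuous_map_sel) (use P(2) in auto)
 have "homeomorphic_map (subtopology rho ?A) (sbt (dK + n) ?V) ?h"
 proof (rule bijective_open_imp_homeomorphic_map)
  have "continuous_map (subtopology rho ?A) (PT dK) (prj dK io \<circ> (%x. x))"
   by (rule continuous_map_compose[OF core_continuous_id cp])
  hence "continuous_map (subtopology rho ?A) (PT (dK + n)) ?h"
   by (intro continuous_map_tcat core_continuous_id) (simp add: comp_def)
  thus "continuous_map (subtopology rho ?A) (sbt (dK + n) ?V) ?h"
   by (rule continuous_map_into_subtopology) (use tA in blast)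
  show "open_map (subtopology rho ?A) (sbt (dK + n) ?V) ?h" unfolding open_map_def
  proof (intro allI impI)
   fix S assume "openin (subtopology rho ?A) S"
   hence S: "openin rho S" "S <= ?A" using openin_open_subtopology[OF oA] by auto
   obtain N where N: "opn (dK + n) N" "?h ` S = N \<inter> ?C" using tr[OF S] by blast
   have "?h ` S <= ?V" using S(2) by blast
   hence "?h ` S = N \<inter> ?V" using N(2) NA(2) by blast
   thus "openin (sbt (dK + n) ?V) (?h ` S)" unfolding openin_subtopology using N(1) by blast
  qed
  show "?h ` topspace (subtopology rho ?A) = topspace (sbt (dK + n) ?V)" unfolding tA tV ..
  show "inj_on ?h (topspace (subtopology rho ?A))" unfolding tA by (rule inj_on_subset[OF inj AQ])
 qed
 moreover have "dfn n ?A (dK + n) ?h"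
  by (rule dfnI[OF dA], (rule dint DT_prj[OF P(2)] dA | (simp add: dA; fail)[1])+)
 ultimately show ?thesis unfolding cell_patch_def using oA cell V by blast
qed

text \<open>On a small open set the chart is continuous into \<open>M^n\<close> and open for
  \<open>rho\<close>, which is one half of the agreement. For the other half, near
  \<open>g u\<close> the sheet has only one branch, and the projections of chart points fill an open
  set; so each nearby point of the sheet equals a chart point.\<close>

lemma chart_meets_core:
 assumes s: "sheet n P dK io" and U: "dfb dK U" "opn dK U"
  and cor: "correspondence k U (TT n) (%w. {x : P. prj dK io x = w})"
  and gr: "dfb (dK + n) (corr_graph dK U n (%w. {x : P. prj dK io x = w}))"
  and cc: "continuous_correspondence k (sbt dK U) (PT n) (%w. {x : P. prj dK io x = w})"
  and g: "chart dK V g" and gP: "!!u. u : V ==> g u : P & prj dK io (g u) : U"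
  and op: "!!N. opn dK N ==> N <= V ==> opn dK ((%u. prj dK io (g u)) ` N)"
 shows "EX u:V. g u : core {x : P. prj dK io x : U}"
proof -
 let ?Q = "{x : P. prj dK io x : U}" and ?f = "%w. {x : P. prj dK io x = w}"
 let ?C = "corr_graph dK U n ?f"
 have P: "dfb n P" "io ` {..<dK} <= {..<n}" using s unfolding sheet_def by blast+
 have PT: "P <= TT n" by (rule definable_subset[OF P(1)])
 have UT: "U <= TT dK" by (rule definable_subset[OF U(1)])
 have Cm: "tcat dK (prj dK io x) n x : ?C" if "x : ?Q" for x using that unfolding corr_graph_def by blast
 have cp: "continuous_map (PT n) (PT dK) (prj dK io)" unfolding prj_def by (rule continuous_map_sel) (use P(2) in auto)
 obtain V1 where V1: "V1 <= V" "good_chart V1 g" by (rule generic_good_chart[OF g])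
 have V1c: "opn dK V1" "V1 ~= {}" "dfn dK V1 n g" "g ` V1 <= CK" using V1(2) unfolding good_chart_def chart_def by blast+
 obtain V2 where V2: "opn dK V2" "dfb dK V2" "V2 ~= {}" "V2 <= V1" "cont dK V2 n g"
  by (rule nice_function[OF V1c(1,2,3)])
 have cg: "continuous_map (sbt dK V2) rho g"
  by (rule continuous_map_from_subtopology_mono[OF good_chart_continuous[OF V1(2)] V2(4)])
 have og: "openin rho (g ` N)" if "opn dK N" "N <= V2" for N
  by (rule good_chart_open[OF V1(2) that(1)]) (use that(2) V2(4) in blast)
 have gQ: "g u : ?Q" if "u : V2" for u using gP V1(1) V2(4) that by blast
 have opV: "opn dK ((%u. prj dK io (g u)) ` N)" if "opn dK N" "N <= V2" for N
  by (rule op[OF that(1)]) (use that V1(1) V2(4) in blast)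
 have ag: "topologies_agree ?Q (g u)" if u: "u : V2" for u
  unfolding topologies_agree_def
 proof (intro conjI ballI impI)
  fix w assume w: "w : RY" "g u : RB w"
  have G: "graph_like dK n ?C" by (rule graph_like_corr_graph[OF U(2) cor gr cc])
  have gt: "g u : TT n" "prj dK io (g u) : TT dK" using gQ[OF u] PT UT by blast+
  from bspec[OF G[unfolded graph_like_def, THEN conjunct2, THEN conjunct2] Cm[OF gQ[OF u]]]
  obtain Z A t where Z: "opn dK Z" "tfst dK (tcat dK (prj dK io (g u)) n (g u)) : Z" "opn n A"
   "tsnd dK n (tcat dK (prj dK io (g u)) n (g u)) : A"
   and iff: "ALL z:Z. ALL a:TT n. tcat dK z n a : ?C & a : A \<longleftrightarrow> a = t z" by (elim exE conjE)
  have Z2: "prj dK io (g u) : Z" "g u : A" using Z(2,4) gt by simp_all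
  let ?B = "{v : V2. g v : RB w} \<inter> {v : V2. g v : A}"
  have oB: "opn dK ?B"
   by (intro openin_Int open_preimage[OF V2(1) cg open_RB[OF w(1)]] open_preimage[OF V2(1,5) Z(3)])
  let ?Y = "Z \<inter> (%u. prj dK io (g u)) ` ?B"
  have "opn dK ?Y" by (intro openin_Int Z(1) opV oB) blast
  from openin_Int[OF Z(3) openin_continuous_map_preimage[OF cp this]]
  have oN: "opn n (A \<inter> {x : TT n. prj dK io x : ?Y})" unfolding topspace_PT .
  moreover have "g u : A \<inter> {x : TT n. prj dK io x : ?Y}" using Z2 gt u w by blast
  ultimately obtain v where v: "v : BY n" "g u : BB n v" "BB n v <= A \<inter> {x : TT n. prj dK io x : ?Y}"
   using basis_facts(4) by blast
  have "x : RB w" if x: "x : ?Q" "x : BB n v" for x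
  proof -
   have xA: "x : A" "x : TT n" "prj dK io x : Z" using x(2) v(3) by blast+
   obtain b where b: "b : V2" "g b : RB w" "g b : A" "prj dK io x = prj dK io (g b)" using x(2) v(3) by blast
   have bt: "g b : TT n" using gQ[OF b(1)] PT by blast
   have "x = t (prj dK io x)" using iff xA Cm[OF x(1)] by blast
   moreover have "g b = t (prj dK io x)"
   using iff[rule_format, OF xA(3) bt] Cm[OF gQ[OF b(1)]] b(3) unfolding b(4) by blast
   ultimately show "x : RB w" using b(2) by simp
  qed
  thus "EX v:BY n. g u : BB n v & (ALL x:?Q. x : BB n v --> x : RB w)" using v(1,2) by blast
 next
  fix v assume v: "v : BY n" "g u : BB n v"
  let ?B = "{a : V2. g a : BB n v}"
  have "openin rho (g ` ?B)" by (rule og[OF open_preimage[OF V2(1,5) basis_facts(3)[OF v(1)]]]) blast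
  moreover have "g u : g ` ?B" using u v(2) by blast
  ultimately obtain w where "w : RY" "g u : RB w" "RB w <= g ` ?B" using RB_basis by blast
  thus "EX w:RY. g u : RB w & (ALL x:TT n. x : RB w --> x : BB n v & x : ?Q)" using gQ by blast
 qed
 obtain u where u: "u : V2" using V2(3) by blast
 have "g u : g ` V2" using u by blast
 then obtain w where w: "w : RY" "g u : RB w" "RB w <= g ` V2" using RB_basis[OF og[OF V2(1) order_refl]] by blast
 have "g u : core ?Q" unfolding core_def using w gQ[OF u] gQ ag by blast
 thus ?thesis using u V2(4) V1(1) by blast
qed

text \<open>The cores of the sheets of dimension \<open>dK\<close>, sorted by fibre size, are
  finitely many cell patches. They need not cover \<open>K\<close>, but every chart meets one of
  them, so finitely many translates of their union cover.\<close>

lemma manifold_group_rho: "definable_manifold L M \<tau> n CK rho"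
proof -
 obtain \<P> where F: "finite \<P>" "CK = (\<Union>(P, e, io)\<in>\<P>. P)" "ALL (P, e, io):\<P>. sheet n P e io"
  using sheeted[OF dCK] unfolding sheeted_def by blast
 let ?fib = "%P io w. {x : P. prj dK io x = w}"
 define good where "good P io k U \<longleftrightarrow> dfb dK U & opn dK U & correspondence k U (TT n) (?fib P io) &
  dfb (dK + n) (corr_graph dK U n (?fib P io)) &
  continuous_correspondence k (sbt dK U) (PT n) (?fib P io) &
  (ALL W. opn dK W & dfb dK W & W ~= {} & (ALL w:W. card (?fib P io w) = k) -->
   (EX W'. opn dK W' & dfb dK W' & W' ~= {} & W' <= W & W' <= U))" for P io k U
 define Uc where "Uc P io k = (SOME U. good P io k U)" for P io k
 have Uc: "good P io k (Uc P io k)" if "sheet n P dK io" for P io k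
 proof -
  have "EX U. good P io k U" using fibre_correspondence[OF that, of k] unfolding good_def .
  thus ?thesis unfolding Uc_def by (rule someI_ex)
 qed
 have "EX N. ALL w:TT dK. card (?fib P io w) \<le> N" if s: "sheet n P dK io" for P io
 proof -
  have P: "dfb n P" "io ` {..<dK} <= {..<n}" "!!w. finite (?fib P io w)" using s unfolding sheet_def by blast+
  have d: "dfb (dK + n) {z : TT (dK + n). tsnd dK n z : P & prj dK io (tsnd dK n z) = tfst dK z}"
   by (rule definableI[OF refl], (rule dint DT_prj[OF P(2)] P(1) | (simp; fail)[1])+)
  have e: "{x : TT n. tcat dK w n x : {z : TT (dK + n). tsnd dK n z : P & prj dK io (tsnd dK n z) = tfst dK z}} = ?fib P io w"
   if "w : TT dK" for w
   using that definable_subset[OF P(1)] by auto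
  have fin: "finite {x : TT n. tcat dK w n x : {z : TT (dK + n). tsnd dK n z : P & prj dK io (tsnd dK n z) = tfst dK z}}"
   if "w : TT dK" for w unfolding e[OF that] by (rule P(3))
  obtain N where N: "!!w. w : TT dK ==> card {x : TT n. tcat dK w n x : {z : TT (dK + n). tsnd dK n z : P & prj dK io (tsnd dK n z) = tfst dK z}} \<le> N"
   by (rule uniform_finiteness[OF d definable_tuples fin]) (assumption, rule that)
  have "card (?fib P io w) \<le> N" if "w : TT dK" for w using N[OF that] unfolding e[OF that] .
  thus ?thesis by blast
 qed
 note exN = this
 define N where "N P io = (SOME N. ALL w:TT dK. card (?fib P io w) \<le> N)" for P io
 have N: "card (?fib P io w) \<le> N P io" if "sheet n P dK io" "w : TT dK" for P io w
  using someI_ex[OF exN[OF that(1)], folded N_def] that(2) by (rule bspec)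
 let ?co = "%P io k. core {x : P. prj dK io x : Uc P io k}"
 \<comment> \<open>One core for each sheet of full dimension and each fibre size up to the uniform
   bound.\<close>
 define \<V> where "\<V> = (\<Union>(P, e, io)\<in>{c : \<P>. fst (snd c) = dK}. ?co P io ` {..N P io})"
 have finV: "finite \<V>" unfolding \<V>_def using F(1) by (auto split: prod.splits)
 have Vp: "cell_patch A" if "A : \<V>" for A
 proof -
  obtain P io k where A: "(P, dK, io) : \<P>" "A = ?co P io k" using `A : \<V>` unfolding \<V>_def by auto
  have s: "sheet n P dK io" using F(3) A(1) by blast
  show ?thesis unfolding A(2) using Uc[OF s, of k] unfolding good_def by (elim conjE) (rule core_cell_patch[OF s])
 qed
 have dV: "dfb n A" if "A : \<V>" for A using Vp[OF that] dfnD(1) unfolding cell_patch_def by blast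
 have VC: "A <= CK" if "A : \<V>" for A using Vp[OF that] openin_subset unfolding cell_patch_def by fastforce
 have dUV: "dfb n (\<Union>\<V>)" using definable_UN[OF finV, of n "%A. A"] dV by simp
 \<comment> \<open>The image of the chart lies generically in one sheet, necessarily of dimension
   \<open>dK\<close>, with open projection. After shrinking, the fibre size is a constant
   \<open>k\<close> and the projection lies in the set chosen for this \<open>k\<close>.\<close>
 have large: "EX u:U. g u : \<Union>\<V>" if g: "chart dK U g" for U g
 proof -
  have gc: "opn dK U" "U ~= {}" "dfn dK U n g" "inj_on g U" "g ` U <= CK" using g unfolding chart_def by blast+
  have d: "dfb dK {u : U. g u : fst c}" if "c : \<P>" for c
   by (rule dfb_vimage[OF gc(3)]) (use F(3) that in \<open>auto simp: sheet_def\<close>)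
  have cov: "U <= (\<Union>c\<in>\<P>. {u : U. g u : fst c})"
  proof
   fix x assume x: "x : U"
   hence "g x : (\<Union>(P, e, io)\<in>\<P>. P)" using gc(5) F(2) by blast
   then obtain c where "c : \<P>" "g x : fst c" by (auto split: prod.splits)
   thus "x : (\<Union>c\<in>\<P>. {u : U. g u : fst c})" using x by blast
  qed
  obtain c V where V: "c : \<P>" "opn dK V" "dfb dK V" "V ~= {}" "V <= U" "V <= {u : U. g u : fst c}"
   by (rule partition_interior[OF F(1) gc(1) dfnD(1)[OF gc(3)] gc(2) d cov]) (assumption, rule that)
  obtain P e io where c: "c = (P, e, io)" by (cases c)
  have s: "sheet n P e io" and PC: "P <= CK" using F(2,3) V(1) c by blast+
  have gV: "g ` V <= P" using V(6) c by auto
  have gVd: "dfn dK V n g" by (rule dfn_subset[OF gc(3) V(3,5)])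
  have q: "dfn dK V e (%u. prj e io (g u))" by (rule dfn_comp[OF gVd sheet_prj[OF s] gV])
  have fin: "finite {v : V. prj e io (g v) = w}" for w
  proof (rule finite_imageD[OF _ inj_on_subset[OF gc(4)]])
   have "finite {x : P. prj e io x = w}" using s unfolding sheet_def by blast
   thus "finite (g ` {v : V. prj e io (g v) = w})" by (rule finite_subset[rotated]) (use gV in blast)
  qed (use V(5) in blast)
  have "dK \<le> e" by (rule finite_to_one_dim_le[OF V(2,4) q fin])
  moreover have "P ~= {}" using V(4) gV by blast
  hence "e \<le> dK" using sheet_chart[OF s PC] chart_le by blast
  ultimately have e: "e = dK" by simp
  note s = s[unfolded e] and q = q[unfolded e] and fin = fin[unfolded e]
  obtain V1 where V1: "opn dK V1" "dfb dK V1" "V1 ~= {}" "V1 <= V" "inj_on (%u. prj dK io (g u)) V1"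
   by (rule generic_injective[OF V(2,4) q fin])
  obtain V2 where V2: "opn dK V2" "dfb dK V2" "V2 ~= {}" "V2 <= V1" "cont dK V2 dK (%u. prj dK io (g u))"
   and op: "!!W. opn dK W ==> W <= V2 ==> opn dK ((%u. prj dK io (g u)) ` W)"
   by (rule local_homeo[OF V1(1,3) dfn_subset[OF q V1(2,4)] V1(5)]) (rule that)
  have V2V: "V2 <= V" using V1(4) V2(4) by blast
  have q2: "dfn dK V2 dK (%u. prj dK io (g u))" by (rule dfn_subset[OF q V2(2) V2V])
  let ?W = "(%u. prj dK io (g u)) ` V2"
  have W: "opn dK ?W" "dfb dK ?W" "?W ~= {}" using op[OF V2(1) order_refl] dfb_image[OF q2] V2(3) by blast+
  have P: "dfb n P" "io ` {..<dK} <= {..<n}" "!!w. finite (?fib P io w)" using s unfolding sheet_def by blast+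
  have fT: "?fib P io w = {x : TT n. x : P & prj dK io x = w}" for w using definable_subset[OF P(1)] by blast
  let ?X = "%k. {w : TT dK. atleast k (?fib P io w) & \<not> atleast (Suc k) (?fib P io w)}"
  have dX: "dfb dK (?X k)" for k
   unfolding fT
   by (rule definableI[OF refl], (rule D_atleast DT_prj[OF P(2)] P(1) dint | (simp; fail)[1])+)
  have cX: "?W <= (\<Union>k\<in>{..N P io}. ?X k)"
  proof
   fix w assume "w : ?W"
   hence w: "w : TT dK" using openin_PT_subset[OF W(1)] by blast
   thus "w : (\<Union>k\<in>{..N P io}. ?X k)" unfolding atleast_exact using N[OF s w] P(3) by blast
  qed
  have dX': "dfb dK (?X k)" if "k : {..N P io}" for k by (rule dX)
  obtain k W1 where W1: "k : {..N P io}" "opn dK W1" "dfb dK W1" "W1 ~= {}" "W1 <= ?W" "W1 <= ?X k"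
   by (rule partition_interior[OF finite_atMost W dX' cX]) (assumption, rule that)
  have "ALL w:W1. card (?fib P io w) = k" using W1(6) unfolding atleast_exact by blast
  moreover note gd = Uc[OF s, of k, unfolded good_def]
  ultimately obtain W2 where W2: "opn dK W2" "dfb dK W2" "W2 ~= {}" "W2 <= W1" "W2 <= Uc P io k"
   using W1 by blast
  let ?V3 = "{u : V2. prj dK io (g u) : W2}"
  have V3: "opn dK ?V3" by (rule open_preimage[OF V2(1,5) W2(1)])
  have dV3: "dfb dK ?V3" by (rule dfb_vimage[OF q2 W2(2)])
  have ne: "?V3 ~= {}" using W2(3,4) W1(5) by blast
  have "chart dK ?V3 g" by (rule chart_subset[OF g V3 dV3 ne]) (use V2V V(5) in blast)
  moreover have "g u : P & prj dK io (g u) : Uc P io k" if "u : ?V3" for u using that gV V2V W2(5) by blast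
  moreover have "opn dK ((%u. prj dK io (g u)) ` N)" if "opn dK N" "N <= ?V3" for N
   by (rule op[OF that(1)]) (use that(2) in blast)
  ultimately have "EX u:?V3. g u : ?co P io k" using gd by (intro chart_meets_core[OF s, where k = k]) blast+
  moreover have "?co P io k : \<V>" unfolding \<V>_def using V(1) c e W1(1) by force
  ultimately show ?thesis using V2V V(5) by blast
 qed
 obtain T where T: "finite T" "T <= CK" "!!x. x : CK ==> EX c:T. \<ominus> c \<oplus> x : \<Union>\<V>"
  using finitely_many_translates[OF dUV large] by blast
 let ?A = "(%(c, A). (%x. c \<oplus> x) ` A) ` (T \<times> \<V>)"
 show ?thesis
 proof (rule manifold_rho[of ?A])
  show "finite ?A" using T(1) finV by blast
  show "\<Union>?A = CK"
  proof (intro equalityI subsetI)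
   fix x assume "x : \<Union>?A"
   then obtain c A y where "c : T" "A : \<V>" "y : A" "x = c \<oplus> y" by auto
   thus "x : CK" using T(2) VC by blast
  next
   fix x assume x: "x : CK"
   obtain c A where cA: "c : T" "A : \<V>" "\<ominus> c \<oplus> x : A" using T(3)[OF x] by blast
   have "c \<oplus> (\<ominus> c \<oplus> x) = x" using cA(1) T(2) x by (auto simp: r_neg2)
   hence "x : (%x. c \<oplus> x) ` A" using cA(3) by (metis image_eqI)
   thus "x : \<Union>?A" using cA(1,2) by auto
  qed
  show "cell_patch A" if "A : ?A" for A using that cell_patch_translate Vp T(2) by auto
 qed
qed

theorem canonical_topology_rho: "canonical_topology L M \<tau> n (add_monoid K) = rho"
 unfolding canonical_topology_def
proof (rule the_equality)
 show "definable_manifold L M \<tau> n (carrier (add_monoid K)) rho & topological_group (add_monoid K) rho"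
  using manifold_group_rho topological_group_rho by simp
 fix \<rho> assume "definable_manifold L M \<tau> n (carrier (add_monoid K)) \<rho> & topological_group (add_monoid K) \<rho>"
 hence "definable_manifold L M \<tau> n CK \<rho>" "topological_group (add_monoid K) \<rho>" by simp_all
 thus "\<rho> = rho" by (rule manifold_group_unique)
qed

lemma generic_continuity:
 assumes "opn e U" "U ~= {}" "dfn e U n f" "f ` U <= CK"
 obtains V where "opn e V" "dfb e V" "V ~= {}" "V <= U" "continuous_map (sbt e V) rho f"
proof -
 obtain V W i l G h where V: "opn e V" "dfb e V" "V ~= {}" "V <= U" "patch rho W i l G h" "W <= CK" "f ` V <= W"
  "continuous_map (sbt e V) rho f"
  by (rule manifold_generic_continuity[OF manifold_group_rho assms])
 show thesis by (rule that[OF V(1-4,8)])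
qed

end

section \<open>\<open>rho\<close> is a non-discrete field topology\<close>

context dfield begin

lemma germ_mult_chart:
 assumes a: "a : CK" "a ~= \<zero>" shows "chart dK V0 (%x. a \<otimes> g0 x)"
 unfolding chart_def
proof (intro conjI)
 show "dfn dK V0 n (%x. a \<otimes> g0 x)"
  by (rule dfnI[OF V0(2)], (rule DT_mult DT_app[OF V0(4)] dint V0(2) | (use V0(2,6) a in \<open>auto; fail\<close>)[1])+)
 show "inj_on (%x. a \<otimes> g0 x) V0"
 proof (rule inj_onI)
  fix x y assume xy: "x : V0" "y : V0" "a \<otimes> g0 x = a \<otimes> g0 y"
  hence "g0 x = g0 y" using V0(6) a m_lcancel by blast
  thus "x = y" using V0(5) xy by (auto dest: inj_onD)
 qed
 show "(%x. a \<otimes> g0 x) ` V0 <= CK" using V0(6) a by blast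
qed (rule V0(1), rule V0(3))

text \<open>For non-zero \<open>a\<close> the multiple of the base chart by \<open>a\<close> is
  again a chart of full dimension, so generically it induces the same filter.\<close>

lemma GG_scale: assumes A: "GG A" and a: "a : CK" shows "GG {b : CK. a \<otimes> b : A}"
proof (cases "a = \<zero>")
 case True
 have "{b : CK. a \<otimes> b : A} = CK" using True GG_zero[OF A] by auto
 thus ?thesis using GG_CK by simp
next
 case False
 obtain V where V: "V <= V0" "good_chart V (%x. a \<otimes> g0 x)" by (rule generic_good_chart[OF germ_mult_chart[OF a False]])
 have oV: "opn dK V" "V ~= {}" using V(2) unfolding good_chart_def chart_def by blast+
 obtain x where x: "x : V" using oV by blast
 have "germ V (%x. a \<otimes> g0 x) x A" using V(2) x A unfolding good_chart_def by blast
 then obtain N where N: "opn dK N" "x : N" "N <= V" "ALL u:N. a \<otimes> g0 u \<ominus> a \<otimes> g0 x : A" unfolding germ_def by blast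
 have "g0 u \<ominus> g0 x : {b : CK. a \<otimes> b : A}" if u: "u : N" for u
 proof -
  have c: "g0 u : CK" "g0 x : CK" using u x N(3) V(1) V0(6) by blast+
  hence "a \<otimes> (g0 u \<ominus> g0 x) = a \<otimes> g0 u \<ominus> a \<otimes> g0 x" using a by algebra
  thus ?thesis using bspec[OF N(4) u] c by simp
 qed
 moreover have "N <= V0" using N(3) V(1) by blast
 ultimately have "germ V0 g0 x {b : CK. a \<otimes> b : A}" unfolding germ_def using N by blast
 thus ?thesis using germ0 x V(1) by blast
qed

lemma nbhd_chart:
 assumes f: "continuous_map (sbt e V) rho f" and V: "opn e V" "x : V" and A: "GG A"
 obtains N where "opn e N" "x : N" "N <= V" "!!u. u : N ==> f u \<ominus> f x : A"
proof -
 have tV: "topspace (sbt e V) = V" using openin_subset[OF V(1)] by auto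
 have fc: "f u : CK" if "u : V" for u using continuous_map_funspace[OF f] that unfolding tV by auto
 obtain W where W: "openin rho W" "f x : W" "ALL w:W. EX a:A. a : CK & w = f x \<oplus> a" using nbhd_at[OF fc[OF V(2)] A] by blast
 have "f u \<ominus> f x : A" if u: "u : V" "f u : W" for u
 proof -
  obtain a where a: "a : A" "a : CK" "f u = f x \<oplus> a" using W(3) u(2) by blast
  have "f u \<ominus> f x = a" unfolding a(3) using a(2) fc[OF V(2)] by algebra
  thus ?thesis using a(1) by simp
 qed
 thus thesis using that[OF open_preimage[OF V(1) f W(1)]] V(2) W(2) by blast
qed

lemma germ_in_chart:
 assumes N: "opn dK N" "x : N" "N <= V0"
 shows "GG {b : CK. EX u:N. g0 u = g0 x \<oplus> b}"
proof -
 have "g0 u \<ominus> g0 x : {b : CK. EX u:N. g0 u = g0 x \<oplus> b}" if "u : N" for u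
 proof -
  have c: "g0 u : CK" "g0 x : CK" using that N V0(6) by blast+
  hence "g0 u = g0 x \<oplus> (g0 u \<ominus> g0 x)" by algebra
  thus ?thesis using that c by auto
 qed
 hence "germ V0 g0 x {b : CK. EX u:N. g0 u = g0 x \<oplus> b}" unfolding germ_def using N by blast
 thus ?thesis using germ0 N by blast
qed

lemma GG_sum4: assumes "GG A" shows "EX B. GG B & B <= CK & (ALL x:B. ALL y:B. ALL z:B. ALL w:B. (x \<oplus> y) \<oplus> (z \<oplus> w) : A)"
proof -
 obtain B where B: "GG B" "ALL b:B. ALL b':B. b \<oplus> b' : A" using GG_sum[OF assms] by blast
 obtain C where C: "GG C" "ALL b:C. ALL b':C. b \<oplus> b' : B" using GG_sum[OF B(1)] by blast
 show ?thesis using GG_Int[OF C(1) GG_CK] B(2) C(2) by (intro exI[of _ "C \<inter> CK"]) blast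
qed

text \<open>Generic continuity gives continuity of the product at some point, with values
  \<open>?c\<close> and \<open>?e\<close> of the two factors. It moves to the origin by expanding
  the product of \<open>?c \<oplus> b\<close> and \<open>?e \<oplus> b'\<close>: the mixed terms are
  small by \<open>GG_scale\<close>.\<close>

lemma GG_mult: assumes A: "GG A" shows "EX B. GG B & B <= CK & (ALL b:B. ALL b':B. b \<otimes> b' : A)"
proof -
 obtain B where B: "GG B" "B <= CK" "ALL x:B. ALL y:B. ALL z:B. ALL w:B. (x \<oplus> y) \<oplus> (z \<oplus> w) : A" using GG_sum4[OF A] by blast
 let ?Q = "Box dK V0 dK V0" and ?f = "%z. g0 (tfst dK z) \<otimes> g0 (tsnd dK dK z)"
 have Vs: "V0 <= TT dK" by (rule definable_subset[OF V0(2)])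
 have oQ: "opn (dK + dK) ?Q" by (rule open_Box[OF V0(1,1)])
 have dQ: "dfb (dK + dK) ?Q" by (rule dfb_Box[OF V0(2,2)])
 have neQ: "?Q ~= {}" using tcat_in_Box[OF Vs Vs] V0(3) by blast
 have Qz: "tfst dK z : V0" "tsnd dK dK z : V0" if "z : ?Q" for z using that by (auto simp: Box_def)
 have f: "dfn (dK + dK) ?Q n ?f"
  by (rule dfnI[OF dQ], (rule DT_mult DT_app[OF V0(4)] dint dQ | (use dQ Qz V0(6) in \<open>auto; fail\<close>)[1])+)
 have im: "?f ` ?Q <= CK" using Qz V0(6) by blast
 obtain V where V: "opn (dK + dK) V" "dfb (dK + dK) V" "V ~= {}" "V <= ?Q" "continuous_map (sbt (dK + dK) V) rho ?f"
  by (rule generic_continuity[OF oQ neQ f im])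
 obtain z where z: "z : V" using V(3) by blast
 obtain N where N: "opn (dK + dK) N" "z : N" "N <= V" "!!u. u : N ==> ?f u \<ominus> ?f z : B"
  by (rule nbhd_chart[OF V(5,1) z B(1)]) (rule that)
 obtain X Y where XY: "opn dK X" "opn dK Y" "tfst dK z : X" "tsnd dK dK z : Y" "Box dK X dK Y <= N"
  by (rule Box_subset[OF N(1,2)])
 have NQ: "N <= ?Q" using N(3) V(4) by blast
 have zt: "tfst dK z : V0" "tsnd dK dK z : V0" using Qz N(2) NQ by blast+
 let ?c = "g0 (tfst dK z)" and ?e = "g0 (tsnd dK dK z)"
 have ce: "?c : CK" "?e : CK" using V0(6) zt by blast+
 let ?BX = "{b : CK. EX u:X \<inter> V0. g0 u = ?c \<oplus> b}" and ?BY = "{b : CK. EX u:Y \<inter> V0. g0 u = ?e \<oplus> b}"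
 have GX: "GG ?BX" by (rule germ_in_chart) (use XY zt V0(1) in auto)
 have GY: "GG ?BY" by (rule germ_in_chart) (use XY zt V0(1) in auto)
 have mix: "(?c \<oplus> b) \<otimes> (?e \<oplus> b') \<ominus> ?c \<otimes> ?e : B" if b: "b : ?BX" "b' : ?BY" for b b'
 proof -
  obtain u v where uv: "u : X" "u : V0" "g0 u = ?c \<oplus> b" "v : Y" "v : V0" "g0 v = ?e \<oplus> b'" using b by blast
  have t: "u : TT dK" "v : TT dK" using uv Vs by blast+
  have "tcat dK u dK v : Box dK X dK Y" using uv t by (simp add: Box_def)
  hence "?f (tcat dK u dK v) \<ominus> ?f z : B" using N(4) XY(5) by blast
  thus ?thesis using t uv by simp
 qed
 let ?Bm = "{b : CK. \<ominus> b : B}"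
 let ?D = "(?BX \<inter> ?BY) \<inter> ({b : CK. ?c \<otimes> b : ?Bm} \<inter> {b : CK. ?e \<otimes> b : ?Bm}) \<inter> CK"
 have "GG ?D" by (intro GG_Int GX GY GG_scale GG_neg B(1) ce GG_CK)
 moreover have "b \<otimes> b' : A" if b: "b : ?D" "b' : ?D" for b b'
 proof -
  have c: "b : CK" "b' : CK" and m: "(?c \<oplus> b) \<otimes> (?e \<oplus> b') \<ominus> ?c \<otimes> ?e : B" "\<ominus> (?c \<otimes> b') : B" "\<ominus> (?e \<otimes> b) : B"
   using b mix by blast+
  have "\<zero> : B" by (rule GG_zero[OF B(1)])
  hence "(((?c \<oplus> b) \<otimes> (?e \<oplus> b') \<ominus> ?c \<otimes> ?e) \<oplus> \<ominus> (?c \<otimes> b')) \<oplus> (\<ominus> (?e \<otimes> b) \<oplus> \<zero>) : A" using B(3) m by blast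
  moreover have "(((?c \<oplus> b) \<otimes> (?e \<oplus> b') \<ominus> ?c \<otimes> ?e) \<oplus> \<ominus> (?c \<otimes> b')) \<oplus> (\<ominus> (?e \<otimes> b) \<oplus> \<zero>) = b \<otimes> b'"
   using c ce by algebra
  ultimately show ?thesis by simp
 qed
 ultimately show ?thesis by blast
qed

lemma continuous_mult: "continuous_map (prod_topology rho rho) rho (%(x, y). x \<otimes> y)"
proof (rule continuous_rhoI)
 fix p A assume p: "p : topspace (prod_topology rho rho)" and A: "GG A"
 obtain x y where xy: "p = (x, y)" "x : CK" "y : CK" using p by auto
 obtain B where B: "GG B" "B <= CK" "ALL x:B. ALL y:B. ALL z:B. ALL w:B. (x \<oplus> y) \<oplus> (z \<oplus> w) : A" using GG_sum4[OF A] by blast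
 obtain C where C: "GG C" "C <= CK" "ALL b:C. ALL b':C. b \<otimes> b' : B" using GG_mult[OF B(1)] by blast
 have D1: "GG (C \<inter> {b : CK. y \<otimes> b : B})" and D2: "GG (C \<inter> {b : CK. x \<otimes> b : B})" by (intro GG_Int C(1) GG_scale B(1) xy)+
 obtain W1 where W1: "openin rho W1" "x : W1" "ALL w:W1. EX a:C \<inter> {b : CK. y \<otimes> b : B}. a : CK & w = x \<oplus> a" using nbhd_at[OF xy(2) D1] by blast
 obtain W2 where W2: "openin rho W2" "y : W2" "ALL w:W2. EX a:C \<inter> {b : CK. x \<otimes> b : B}. a : CK & w = y \<oplus> a" using nbhd_at[OF xy(3) D2] by blast
 have "(%(x, y). x \<otimes> y) w : (%a. (%(x, y). x \<otimes> y) p \<oplus> a) ` A" if w: "w : W1 \<times> W2" for w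
 proof -
  have "fst w : W1" "snd w : W2" using w by auto
  then obtain a b where ab: "a : C" "y \<otimes> a : B" "a : CK" "fst w = x \<oplus> a" "b : C" "x \<otimes> b : B" "b : CK" "snd w = y \<oplus> b" using W1(3) W2(3) by blast
  have "\<zero> : B" by (rule GG_zero[OF B(1)])
  hence "(y \<otimes> a \<oplus> x \<otimes> b) \<oplus> (a \<otimes> b \<oplus> \<zero>) : A" using B(3) C(3) ab by blast
  moreover have "fst w \<otimes> snd w = (x \<otimes> y) \<oplus> ((y \<otimes> a \<oplus> x \<otimes> b) \<oplus> (a \<otimes> b \<oplus> \<zero>))" unfolding ab(4,8) using ab(3,7) xy by algebra
  ultimately show ?thesis using xy(1) by (simp add: case_prod_beta)
 qed
 thus "EX W. openin (prod_topology rho rho) W & p : W & (ALL w:W. (%(x, y). x \<otimes> y) w : (%a. (%(x, y). x \<otimes> y) p \<oplus> a) ` A)"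
  using W1(1,2) W2(1,2) xy(1) by (intro exI[of _ "W1 \<times> W2"]) (auto simp: openin_prod_Times_iff)
qed auto

text \<open>A singleton could be mapped injectively into \<open>M^0\<close>, which contradicts
  \<open>dK > 0\<close>.\<close>

lemma open_not_singleton:
 assumes "opn dK V" "dfb dK V" "x : V" obtains y where "y : V" "y ~= x"
proof (rule ccontr)
 assume "\<not> thesis"
 hence V: "V = {x}" using that assms(3) by blast
 obtain c where c: "c : TT 0" using TT_ne by blast
 have "dfn dK V 0 (%_. c)" by (rule dfnI[OF assms(2)], rule DT_const) (use assms c in simp_all)
 from finite_to_one_dim_le[OF assms(1) _ this] have "dK \<le> 0" using V by auto
 thus False using dK_pos by simp
qed

text \<open>Inversion, extended by zero, is generically continuous along the base chart. Non-empty
  open sets have two points and the chart is injective, so a point with non-zero value can be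
  taken.\<close>

lemma GG_inverse_one_point:
 obtains c where "c : CK" "c ~= \<zero>" "!!A. GG A ==> GG {b : CK. c \<oplus> b ~= \<zero> --> inv (c \<oplus> b) \<ominus> inv c : A}"
proof -
 let ?f = "%x. if g0 x = \<zero> then \<zero> else inv (g0 x)"
 have inv_c: "inv a : CK" if "a : CK" "a ~= \<zero>" for a using that field_Units by auto
 have f: "dfn dK V0 n ?f"
 proof (intro dfnI V0(2) DT_I)
  have dV: "dfb n (CK - {\<zero>})"
  proof -
   have "dfb n {x : CK. \<not> x = \<zero>}" by (rule definableI[OF refl], (rule dint dCK | (use dCK in \<open>simp; fail\<close>)[1])+)
   moreover have "{x : CK. \<not> x = \<zero>} = CK - {\<zero>}" by blast
   ultimately show ?thesis by simp
  qed
  have "D (cx (c0 dK V0) n (TT n)) (%p. (g0 (fst p) = \<zero> & snd p = \<zero>) \<or> (EX y:CK - {\<zero>}. g0 (fst p) = y & snd p = inv y))"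
   by (rule DT_inv DT_app[OF V0(4)] dint dV V0(2) | (use dV V0(2) in \<open>simp; fail\<close>)[1] | (use dV V0(2) in \<open>auto; fail\<close>)[1])+
  thus "D (cx (c0 dK V0) n (TT n)) (%p. snd p = ?f (fst p))"
  proof (rule D_cong)
   fix p assume "p : cset (cx (c0 dK V0) n (TT n))"
   hence "g0 (fst p) : CK" using V0(2,6) by auto
   thus "((g0 (fst p) = \<zero> & snd p = \<zero>) \<or> (EX y:CK - {\<zero>}. g0 (fst p) = y & snd p = inv y)) = (snd p = ?f (fst p))" by auto
  qed
 qed (use V0(2,6) inv_c in auto)
 have im: "?f ` V0 <= CK" using V0(6) inv_c by auto
 obtain V where V: "opn dK V" "dfb dK V" "V ~= {}" "V <= V0" "continuous_map (sbt dK V) rho ?f"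
  by (rule generic_continuity[OF V0(1,3) f im])
 obtain x1 where x1: "x1 : V" using V(3) by blast
 obtain x2 where x2: "x2 : V" "x2 ~= x1" by (rule open_not_singleton[OF V(1,2) x1])
 have "g0 x2 ~= g0 x1" using V0(5) x1 x2 V(4) by (auto dest: inj_onD)
 then obtain x where x: "x : V" "g0 x ~= \<zero>" using x1 x2 by metis
 show thesis
 proof (rule that)
  show gx: "g0 x : CK" "g0 x ~= \<zero>" using x V(4) V0(6) by blast+
  fix A assume A: "GG A"
  obtain N where N: "opn dK N" "x : N" "N <= V" "!!u. u : N ==> ?f u \<ominus> ?f x : A"
   by (rule nbhd_chart[OF V(5,1) x(1) A]) (rule that)
  have "N <= V0" using N(3) V(4) by blast
  from germ_in_chart[OF N(1,2) this] show "GG {b : CK. g0 x \<oplus> b ~= \<zero> --> inv (g0 x \<oplus> b) \<ominus> inv (g0 x) : A}"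
  proof (rule GG_mono, intro subsetI CollectI conjI impI)
   fix b assume b: "b : {b : CK. EX u:N. g0 u = g0 x \<oplus> b}"
   thus "b : CK" by blast
   assume nz: "g0 x \<oplus> b ~= \<zero>"
   from b obtain u where u: "u : N" "g0 u = g0 x \<oplus> b" by blast
   from N(4)[OF u(1)] show "inv (g0 x \<oplus> b) \<ominus> inv (g0 x) : A" using u(2) nz x(2) by simp
  qed
 qed
qed

lemma continuous_inv: "continuous_map (subtopology rho (CK - {\<zero>})) rho (%x. inv x)"
proof (rule continuous_rhoI)
 have top: "topspace (subtopology rho (CK - {\<zero>})) = CK - {\<zero>}" by auto
 have inv_c: "inv a : CK" "a \<otimes> inv a = \<one>" "inv a \<otimes> a = \<one>" if "a : CK" "a ~= \<zero>" for a using that field_Units by auto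
 show "(%x. inv x) : topspace (subtopology rho (CK - {\<zero>})) \<rightarrow> CK" unfolding top using inv_c by blast
 fix y A assume "y : topspace (subtopology rho (CK - {\<zero>}))" and A: "GG A"
 hence y: "y : CK" "y ~= \<zero>" unfolding top by blast+
 obtain c where c: "c : CK" "c ~= \<zero>" "!!A. GG A ==> GG {b : CK. c \<oplus> b ~= \<zero> --> inv (c \<oplus> b) \<ominus> inv c : A}"
  by (rule GG_inverse_one_point) (rule that)
 \<comment> \<open>Multiplication by \<open>?q\<close> carries \<open>y\<close> to \<open>c\<close>,
   and \<open>inv w\<close> equals \<open>?q\<close> times the inverse of
   \<open>?q \<otimes> w\<close>; so continuity at \<open>c\<close> gives continuity at
   \<open>y\<close>.\<close>
 let ?q = "c \<otimes> inv y"
 have q: "?q : CK" using c(1) inv_c(1)[OF y] by simp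
 let ?A = "{b : CK. ?q \<otimes> b : A}"
 let ?B = "{b : CK. ?q \<otimes> b : {b : CK. c \<oplus> b ~= \<zero> --> inv (c \<oplus> b) \<ominus> inv c : ?A}}"
 have "GG ?B" by (intro GG_scale c(3) A q)
 then obtain W where W: "openin rho W" "y : W" "ALL w:W. EX a:?B. a : CK & w = y \<oplus> a" using nbhd_at[OF y(1)] by blast
 have "inv w : (%a. inv y \<oplus> a) ` A" if w: "w : W" "w ~= \<zero>" for w
 proof -
  obtain b where b: "b : CK" "w = y \<oplus> b" "c \<oplus> ?q \<otimes> b ~= \<zero> --> inv (c \<oplus> ?q \<otimes> b) \<ominus> inv c : ?A" using W(3) w(1) by blast
  have wc: "w : CK" using b y by simp
  note i = inv_c[OF y] inv_c[OF wc w(2)] inv_c[OF c(1,2)]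
  have e: "c \<oplus> ?q \<otimes> b = ?q \<otimes> w"
  proof -
   have "?q \<otimes> w = ?q \<otimes> y \<oplus> ?q \<otimes> b" unfolding b(2) by (rule r_distr[OF y(1) b(1) q])
   moreover have "?q \<otimes> y = c" using i(3) c(1) i(1) y(1) by (simp add: m_assoc)
   ultimately show ?thesis by simp
  qed
  have nz: "?q \<otimes> w ~= \<zero>" using c(1,2) i wc w(2) y integral by (metis m_closed r_null zero_not_one)
  have iq: "inv (?q \<otimes> w) = inv c \<otimes> y \<otimes> inv w"
  proof (rule comm_inv_char)
   have "?q \<otimes> w \<otimes> (inv c \<otimes> y \<otimes> inv w) = (c \<otimes> inv c) \<otimes> (y \<otimes> inv y) \<otimes> (w \<otimes> inv w)"
   using c(1) i(1,4,7) y(1) wc by algebra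
   thus "?q \<otimes> w \<otimes> (inv c \<otimes> y \<otimes> inv w) = \<one>" using i by simp
  qed (use q wc i y in auto)
  have "?q \<otimes> (inv c \<otimes> y \<otimes> inv w \<ominus> inv c) : A" using b(3) e nz iq by auto
  moreover have "?q \<otimes> (inv c \<otimes> y \<otimes> inv w \<ominus> inv c) = (c \<otimes> inv c) \<otimes> (inv y \<otimes> y) \<otimes> inv w \<ominus> (c \<otimes> inv c) \<otimes> inv y"
   using c(1) i(1,4,7) y(1) by algebra
  ultimately have "inv w \<ominus> inv y : A" using i by simp
  moreover have "inv w = inv y \<oplus> (inv w \<ominus> inv y)" using i(1,4) by algebra
  ultimately show ?thesis by blast
 qed
 thus "EX W. openin (subtopology rho (CK - {\<zero>})) W & y : W & (ALL w:W. inv w : (%a. inv y \<oplus> a) ` A)"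
  using W(1,2) y by (intro exI[of _ "W \<inter> (CK - {\<zero>})"]) (auto simp: openin_subtopology)
qed

lemma field_topology_rho: "field_topology K rho"
 unfolding field_topology_def
 using continuous_add continuous_neg continuous_mult continuous_inv by simp

lemma chart_at: assumes c: "c : CK" obtains g x where "good_chart V0 g" "x : V0" "g x = c"
proof -
 obtain x where x: "x : V0" using V0(3) by blast
 let ?a = "c \<ominus> g0 x"
 have a: "?a : CK" and gx: "g0 x : CK" using c V0(6)[OF x] by simp_all
 let ?g = "%u. ?a \<oplus> g0 u"
 have "dfn dK V0 n ?g"
  by (rule dfnI[OF V0(2)], (rule DT_add DT_app[OF V0(4)] dint V0(2) | (use V0(2,6) a in \<open>auto; fail\<close>)[1])+)
 moreover have "inj_on ?g V0"
 proof (rule inj_onI)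
  fix u v assume uv: "u : V0" "v : V0" "?g u = ?g v"
  hence "g0 u = g0 v" using add_cancel_l[OF a] V0(6) by blast
  thus "u = v" using V0(5) uv by (auto dest: inj_onD)
 qed
 moreover have "?g ` V0 <= CK" using a V0(6) by blast
 ultimately have ch: "chart dK V0 ?g" unfolding chart_def using V0(1,3) by blast
 have "germ V0 ?g y A \<longleftrightarrow> germ V0 g0 y A" if y: "y : V0" for y A
 proof -
  have e: "?g u \<ominus> ?g y = g0 u \<ominus> g0 y" if "u : V0" for u
  proof -
   have "g0 u : CK" "g0 y : CK" using V0(6) that y by blast+
   thus ?thesis using a by algebra
  qed
  show ?thesis unfolding germ_def
   by (intro iff_exI conj_cong ball_cong refl) (drule (1) subsetD, simp only: e)
 qed
 hence "good_chart V0 ?g" unfolding good_chart_def using ch germ0 by blast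
 moreover have "?g x = c" using gx c by algebra
 ultimately show thesis using that x by blast
qed

lemma rho_separates: assumes "x : CK" "y : CK" "x ~= y" shows "EX S. openin rho S & x : S & y \<notin> S"
proof -
 obtain g u where g: "good_chart V0 g" "u : V0" "g u = x" by (rule chart_at[OF assms(1)])
 have inj: "inj_on g V0" using g(1) unfolding good_chart_def chart_def by blast
 show ?thesis
 proof (cases "y : g ` V0")
  case True
  then obtain v where v: "v : V0" "y = g v" by blast
  have "u : TT dK" "v : TT dK" "u ~= v" using g v assms(3) definable_subset[OF V0(2)] by blast+
  then obtain N N' where N: "opn dK N" "opn dK N'" "u : N" "v : N'" "disjnt N N'"
   using Hausdorff_PT[of dK] unfolding Hausdorff_space_def topspace_PT by metis
  have "openin rho (g ` (N \<inter> V0))" by (rule good_chart_open[OF g(1)]) (use N(1) V0(1) in auto)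
  moreover have "x : g ` (N \<inter> V0)" using g N(3) by blast
  moreover have "y \<notin> g ` (N \<inter> V0)" using inj v N(4,5) unfolding disjnt_def by (auto dest: inj_onD)
  ultimately show ?thesis by blast
 next
  case False
  thus ?thesis using good_chart_open[OF g(1) V0(1) order_refl] g(2,3) by blast
 qed
qed

lemma rho_nondiscrete: assumes "openin rho S" "x : S" shows "EX y:S. y ~= x"
proof -
 have xc: "x : CK" using assms openin_rho by blast
 obtain g u where g: "good_chart V0 g" "u : V0" "g u = x" by (rule chart_at[OF xc])
 have inj: "inj_on g V0" using g(1) unfolding good_chart_def chart_def by blast
 have "opn dK {z : V0. g z : S}" by (rule open_preimage[OF V0(1) good_chart_continuous[OF g(1)] assms(1)])
 moreover have "u : {z : V0. g z : S}" using g assms(2) by blast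
 ultimately obtain N where N: "opn dK N" "dfb dK N" "u : N" "N <= {z : V0. g z : S}" by (rule definable_nbhd)
 obtain v where v: "v : N" "v ~= u" by (rule open_not_singleton[OF N(1-3)])
 have "g v ~= x" using inj v N(4) g(2,3) by (auto dest: inj_onD)
 thus ?thesis using v(1) N(4) by blast
qed

section \<open>Finite-to-one definable maps on open subsets of \<open>K^m\<close>\<close>

lemma open_flat_box:
 assumes W: "opn (N * k) W" "z : W"
 obtains Y where "!!i. i < N ==> opn k (Y i)" "!!i. i < N ==> slc k i z : Y i"
  "ALL z':TT (N * k). (ALL i<N. slc k i z' : Y i) --> z' : W"
proof -
 have "EX U. finite {j : {..<N * k}. U j ~= topspace \<tau>} & (ALL j:{..<N * k}. openin \<tau> (U j)) &
   z : Pi\<^sub>E {..<N * k} U & Pi\<^sub>E {..<N * k} U <= W"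
  using W unfolding power_top_def openin_product_topology_alt by blast
 then obtain U where U: "ALL j:{..<N * k}. openin \<tau> (U j)" "z : Pi\<^sub>E {..<N * k} U" "Pi\<^sub>E {..<N * k} U <= W" by blast
 let ?Y = "%i. Pi\<^sub>E {..<k} (%j. U (i * k + j))"
 show thesis
 proof (rule that[of ?Y])
  fix i assume i: "i < N"
  show "opn k (?Y i)" unfolding power_top_def
   using U(1) slc_index[OF i] by (simp add: openin_PiE)
  show "slc k i z : ?Y i" using U(2) slc_index[OF i] by (auto simp: slc_def PiE_iff)
 next
  show "ALL z':TT (N * k). (ALL i<N. slc k i z' : ?Y i) --> z' : W"
  proof (intro ballI impI)
  fix z' assume z': "z' : TT (N * k)" "ALL i<N. slc k i z' : ?Y i"
  have "z' j : U j" if j: "j < N * k" for j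
  proof -
   have d: "j div k < N" "j mod k < k" using flat_index[OF j] by auto
   have "slc k (j div k) z' (j mod k) : U (j div k * k + j mod k)" using PiE_mem[OF z'(2)[rule_format, OF d(1)], of "j mod k"] d(2) by simp
   thus ?thesis using d(2) by (simp add: slc_def)
  qed
  hence "z' : Pi\<^sub>E {..<N * k} U" using z'(1) by (auto simp: tuples_def PiE_iff)
  thus "z' : W" using U(3) by blast
  qed
 qed
qed

lemma patch_fibre:
 assumes P: "patch \<rho> W i l G h" shows "finite {x : W. tfst i (h x) = w}"
proof -
 note p = patchD[OF P]
 have GT: "G <= TT (i + l)" using p(6) definable_subset unfolding graph_like_def by blast
 have "finite {a : TT l. tcat i w l a : G}" using p(6) unfolding graph_like_def by blast
 moreover have "h ` {x : W. tfst i (h x) = w} <= (%a. tcat i w l a) ` {a : TT l. tcat i w l a : G}"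
 proof (rule image_subsetI)
  fix x assume x: "x : {x : W. tfst i (h x) = w}"
  hence "h x : G" using p(5) by blast
  moreover from this have t: "h x : TT (i + l)" using GT by blast
  moreover have "h x = tcat i w l (tsnd i l (h x))" using x tcat_tfst_tsnd[OF t] by simp
  ultimately show "h x : (%a. tcat i w l a) ` {a : TT l. tcat i w l a : G}"
   by (intro image_eqI[where x = "tsnd i l (h x)"]) auto
 qed
 ultimately have "finite (h ` {x : W. tfst i (h x) = w})" using finite_surj by blast
 thus ?thesis by (rule finite_imageD) (rule inj_on_subset[OF p(4)], blast)
qed

lemma patch_dim:
 assumes P: "patch \<rho> W i l G h" and V: "chart dK V g" "g ` V <= W"
 shows "dK \<le> i"
proof -
 note p = patchD[OF P]
 have c: "opn dK V" "V ~= {}" "dfn dK V n g" "inj_on g V" using V(1) unfolding chart_def by blast+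
 have dV: "dfb dK V" by (rule dfnD(1)[OF c(3)])
 have f: "dfn dK V i (%v. tfst i (h (g v)))"
 proof (rule dfnI[OF dV], rule DT_tfst)
  show "DT (c0 dK V) (i + l) (%v. h (g v))" using dfn_comp[OF c(3) p(3) V(2)] unfolding dfn_def by blast
 qed (use dV in simp)
 have "finite {z' : V. tfst i (h (g z')) = w}" for w
 proof (rule finite_imageD)
  show "finite (g ` {z' : V. tfst i (h (g z')) = w})"
   by (rule finite_subset[OF _ patch_fibre[OF P, of w]]) (use V(2) in blast)
  show "inj_on g {z' : V. tfst i (h (g z')) = w}" by (rule inj_on_subset[OF c(4)]) blast
 qed
 thus ?thesis by (intro finite_to_one_dim_le[OF c(1,2) f])
qed

text \<open>A chart through a point of the patch gives \<open>dK \<le> i\<close> because the patch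
  is finite-to-one over \<open>M^i\<close>, and \<open>patch_chart\<close> gives the
  converse.\<close>

lemma rho_patch_dim:
 assumes P: "patch rho W i l G h" and "W ~= {}" shows "i = dK"
proof -
 have W: "openin rho W" using P unfolding patch_def by blast
 have WC: "W <= CK" using openin_subset[OF W] by simp
 obtain c where c: "c : W" using assms(2) by blast
 have cc: "c : CK" using c WC by blast
 obtain g u where g: "good_chart V0 g" "u : V0" "g u = c" by (rule chart_at[OF cc])
 have "opn dK {z : V0. g z : W}" by (rule open_preimage[OF V0(1) good_chart_continuous[OF g(1)] W])
 moreover have "u : {z : V0. g z : W}" using g c by blast
 ultimately obtain N where N: "opn dK N" "dfb dK N" "u : N" "N <= {z : V0. g z : W}" by (rule definable_nbhd)
 have "chart dK N g" by (rule chart_subset[where U = V0, OF _ N(1,2)]) (use g(1) N(3,4) in \<open>auto simp: good_chart_def\<close>)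
 hence "dK \<le> i" by (rule patch_dim[OF P]) (use N(4) in blast)
 moreover obtain U g' where "chart i U g'" by (rule patch_chart[OF P assms(2) WC])
 hence "i \<le> dK" by (rule chart_le)
 ultimately show ?thesis by simp
qed

lemma slc_eqI:
 assumes "w : TT (m * e)" "w' : TT (m * e)" "!!i. i < m ==> slc e i w = slc e i w'" shows "w = w'"
proof -
 have "flat e m (%i. slc e i w) = flat e m (%i. slc e i w')"
  unfolding flat_def by (rule restrict_ext) (use assms(3) flat_index in \<open>metis lessThan_iff\<close>)
 thus ?thesis using assms(1,2) by (simp add: flat_slc)
qed

lemma slc_flatI: "(!!i. i < N ==> f i : TT k) ==> i < N ==> slc k i (flat k N f) = f i"
 by (rule slc_flat[where M = M]) auto

lemma dfn_flat:
 assumes X: "dfb N X" and f: "!!i. i < m ==> dfn N X e (f i)"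
 shows "dfn N X (m * e) (%v. flat e m (%i. f i v))"
proof (intro dfnI X DT_I)
 have ft: "f i v : TT e" if "i < m" "v : X" for i v by (rule dfnD(2)[OF f[OF that(1)] that(2)])
 show "wfc (c0 N X)" using X by simp
 show "flat e m (%i. f i x) : TT (m * e)" if "x : cset (c0 N X)" for x
  by (rule flat_in) (use ft that in simp)
 have fa: "DT (cx (c0 N X) (m * e) (TT (m * e))) e (%p. f i (fst p))" if "i : {..<m}" for i
  by (rule DT_app[OF f]) (use that X in \<open>auto intro!: DT_fst DT_var0\<close>)
 have "D (cx (c0 N X) (m * e) (TT (m * e))) (%p. ALL i:{..<m}. slc e i (snd p) = f i (fst p))"
  by (rule DT_slc fa dint X | assumption | (simp add: X; fail)[1])+
 thus "D (cx (c0 N X) (m * e) (TT (m * e))) (%p. snd p = flat e m (%i. f i (fst p)))"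
 proof (rule D_cong)
  fix p assume "p : cset (cx (c0 N X) (m * e) (TT (m * e)))"
  hence p: "fst p : X" "snd p : TT (m * e)" using X by auto
  have ff: "flat e m (%i. f i (fst p)) : TT (m * e)" by (rule flat_in) (rule ft[OF _ p(1)])
  have fs: "slc e i (flat e m (%i. f i (fst p))) = f i (fst p)" if "i < m" for i
   by (rule slc_flatI[OF ft[OF _ p(1)] that])
  show "(ALL i:{..<m}. slc e i (snd p) = f i (fst p)) = (snd p = flat e m (%i. f i (fst p)))"
  proof
   assume "ALL i:{..<m}. slc e i (snd p) = f i (fst p)"
   thus "snd p = flat e m (%i. f i (fst p))" by (intro slc_eqI[OF p(2) ff]) (simp add: fs)
  qed (simp add: fs)
 qed
qed

lemma open_finite_preimage:
 assumes X: "openin A X" and f: "!!i. i < (m::nat) ==> continuous_map (subtopology A X) Y (f i)"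
  and S: "!!i. i < m ==> openin Y (S i)"
 shows "openin A {v : X. ALL i<m. f i v : S i}"
 using f S
proof (induction m)
 case (Suc m)
 have "openin A ({v : X. ALL i<m. f i v : S i} \<inter> {v : X. f m v : S m})"
  by (intro openin_Int Suc.IH open_preimage[OF X Suc.prems]) (use Suc.prems in auto)
 moreover have "{v : X. ALL i<m. f i v : S i} \<inter> {v : X. f m v : S m} = {v : X. ALL i<Suc m. f i v : S i}"
  by (auto simp: less_Suc_eq)
 ultimately show ?case by simp
qed (simp add: X)

lemma shrink_to_patches:
 assumes X: "opn e X" "dfb e X" "X ~= {}" and f: "!!i. i < (m::nat) ==> dfn e X n (f i) & f i ` X <= CK"
 shows "EX X'. opn e X' & dfb e X' & X' ~= {} & X' <= X &
  (ALL i<m. continuous_map (sbt e X') rho (f i) & (EX W l G h. patch rho W dK l G h & f i ` X' <= W))"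
 using f
proof (induction m)
 case (Suc m)
 have "EX X'. opn e X' & dfb e X' & X' ~= {} & X' <= X &
  (ALL i<m. continuous_map (sbt e X') rho (f i) & (EX W l G h. patch rho W dK l G h & f i ` X' <= W))"
  by (rule Suc.IH) (use Suc.prems in simp)
 then obtain X' where X': "opn e X'" "dfb e X'" "X' ~= {}" "X' <= X"
  "ALL i<m. continuous_map (sbt e X') rho (f i) & (EX W l G h. patch rho W dK l G h & f i ` X' <= W)"
  by (elim exE conjE)
 have fm: "dfn e X' n (f m)" "f m ` X' <= CK"
  using Suc.prems[of m] dfn_subset[OF _ X'(2,4)] order.trans[OF image_mono[OF X'(4), of "f m"]] by simp_all
 obtain V W i l G h where V: "opn e V" "dfb e V" "V ~= {}" "V <= X'" "patch rho W i l G h" "W <= CK" "f m ` V <= W"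
  "continuous_map (sbt e V) rho (f m)"
  by (rule manifold_generic_continuity[OF manifold_group_rho X'(1,3) fm])
 have "W ~= {}" using V(3,7) by blast
 hence "i = dK" by (rule rho_patch_dim[OF V(5)])
 have "continuous_map (sbt e V) rho (f j) & (EX W l G h. patch rho W dK l G h & f j ` V <= W)" if "j < Suc m" for j
 proof (cases "j = m")
  case True
  thus ?thesis using V(5,7,8) \<open>i = dK\<close> by blast
 next
  case False
  hence "j < m" using that by simp
  then obtain W l G h where "continuous_map (sbt e X') rho (f j)" "patch rho W dK l G h" "f j ` X' <= W"
   using X'(5) by blast
  thus ?thesis using V(4) continuous_map_from_subtopology_mono by blast
 qed
 thus ?case using V(1-4) X'(4) by (intro exI[of _ V]) auto
qed (use X in auto)

text \<open>Definable maps between open subsets of \<open>K\<^sup>m\<close> with finite fibres are open somewhere: this stands in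
 for the inverse function theorem.\<close>

lemma gen_open:
 assumes W: "dfb (m * n) W" "W ~= {}" "!!w i. w : W ==> i < m ==> slc n i w : CK"
  and open_W: "!!w. w : W ==> EX S. (ALL i<m. openin rho (S i) & slc n i w : S i) &
   (ALL w':TT (m * n). (ALL i<m. slc n i w' : S i) --> w' : W)"
  and F: "dfn (m * n) W (m * n) F" "!!w i. w : W ==> i < m ==> slc n i (F w) : CK"
  and fin: "!!y. finite {w : W. F w = y}"
 obtains w where "w : W"
  "!!S. (ALL i<m. openin rho (S i) & slc n i w : S i) ==>
   EX T. (ALL i<m. openin rho (T i) & slc n i (F w) : T i) &
   (ALL y:TT (m * n). (ALL i<m. slc n i y : T i) --> (EX w':W. (ALL i<m. slc n i w' : S i) & F w' = y))"
proof -
 have Ft: "F w : TT (m * n)" if "w : W" for w by (rule dfnD(2)[OF F(1) that])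
 obtain w0 where w0: "w0 : W" using W(2) by blast
 have "EX g u. good_chart V0 g & u : V0 & g u = slc n i w0" if "i < m" for i
  using chart_at[OF W(3)[OF w0 that]] by metis
 then obtain g u where g: "!!i. i < m ==> good_chart V0 (g i)" "!!i. i < m ==> u i : V0" "!!i. i < m ==> g i (u i) = slc n i w0" by metis
 have gc: "dfn dK V0 n (g i)" "inj_on (g i) V0" "!!x. x : V0 ==> g i x : CK" if "i < m" for i
  using g(1)[OF that] unfolding good_chart_def chart_def by blast+
 have Vs: "V0 <= TT dK" by (rule definable_subset[OF V0(2)])
 define B where "B = {v : TT (m * dK). ALL i<m. slc dK i v : V0}"
 have BT: "B <= TT (m * dK)" unfolding B_def by blast
 have Bs: "slc dK i v : V0" if "v : B" "i < m" for v i using that unfolding B_def by blast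
 have dB: "dfb (m * dK) B"
 proof -
  have "dfb (m * dK) {v : TT (m * dK). ALL i:{..<m}. slc dK i v : V0}"
   by (rule definableI[OF refl], (rule DT_slc dint V0(2) | (simp; fail)[1])+)
  moreover have "{v : TT (m * dK). ALL i:{..<m}. slc dK i v : V0} = B" unfolding B_def by auto
  ultimately show ?thesis by simp
 qed
 have oB: "opn (m * dK) B" unfolding B_def
  by (rule open_finite_preimage[OF openin_TT]) (auto intro: V0(1) continuous_map_slc continuous_map_from_subtopology)
 \<comment> \<open>Charts in all coordinates parametrize a neighbourhood of \<open>w0\<close> by an
   open subset of \<open>M^(m * dK)\<close>.\<close>
 define P where "P v = flat n m (%i. g i (slc dK i v))" for v
 have Pt: "P v : TT (m * n)" if "v : B" for v unfolding P_def by (rule flat_in) (use gc(3) Bs[OF that] in simp)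
 have Ps: "slc n i (P v) = g i (slc dK i v)" if "v : B" "i < m" for v i
  unfolding P_def by (rule slc_flatI[OF _ that(2)]) (use gc(3) Bs[OF that(1)] in simp)
 have Pinj: "v = v'" if "v : B" "v' : B" "P v = P v'" for v v'
 proof (rule slc_eqI)
  show "v : TT (m * dK)" "v' : TT (m * dK)" using that BT by blast+
  fix i assume i: "i < m"
  have "g i (slc dK i v) = g i (slc dK i v')" using Ps[OF that(1) i] Ps[OF that(2) i] that(3) by simp
  thus "slc dK i v = slc dK i v'" using gc(2)[OF i] Bs[OF that(1) i] Bs[OF that(2) i] by (auto dest: inj_onD)
 qed
 have slD: "dfn (m * dK) B dK (slc dK i)" if "i < m" for i
  by (rule dfnI[OF dB], (rule DT_slc that dint dB | (simp add: dB; fail)[1])+)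
 have gD: "dfn (m * dK) B n (%v. g i (slc dK i v))" if "i < m" for i
  by (rule dfn_comp[OF slD[OF that] gc(1)[OF that]]) (use Bs[OF _ that] in blast)
 have P: "dfn (m * dK) B (m * n) P" unfolding P_def by (rule dfn_flat[OF dB gD])
 have cP: "continuous_map (sbt (m * dK) B) rho (%v. g i (slc dK i v))" if i: "i < m" for i
 proof -
  have "continuous_map (sbt (m * dK) B) (sbt dK V0) (slc dK i)"
   by (intro continuous_map_into_subtopology continuous_map_from_subtopology continuous_map_slc i) (use Bs[OF _ i] in auto)
  from continuous_map_compose[OF this good_chart_continuous[OF g(1)[OF i]]] show ?thesis by (simp add: comp_def)
 qed
 from open_W[OF w0] obtain S0 where S0: "ALL i<m. openin rho (S0 i) & slc n i w0 : S0 i"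
  "ALL w':TT (m * n). (ALL i<m. slc n i w' : S0 i) --> w' : W" by (elim exE conjE)
 define v0 where "v0 = flat dK m u"
 have ut: "u i : TT dK" if "i < m" for i using g(2)[OF that] Vs by blast
 have v0s: "slc dK i v0 = u i" if "i < m" for i unfolding v0_def by (rule slc_flatI[OF ut that])
 have v0t: "v0 : TT (m * dK)" unfolding v0_def by (rule flat_in) (rule ut)
 have v0: "v0 : B" unfolding B_def using v0t v0s g(2) by simp
 have "opn (m * dK) {v : B. ALL i<m. g i (slc dK i v) : S0 i}"
  by (rule open_finite_preimage[OF oB cP]) (use S0(1) in auto)
 moreover have "v0 : {v : B. ALL i<m. g i (slc dK i v) : S0 i}" using v0 v0s g(3) S0(1) by auto
 ultimately obtain X1 where X1: "opn (m * dK) X1" "dfb (m * dK) X1" "v0 : X1" "X1 <= {v : B. ALL i<m. g i (slc dK i v) : S0 i}"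
  by (rule definable_nbhd)
 have X1B: "X1 <= B" using X1(4) by blast
 have PW: "P v : W" if "v : X1" for v
 proof -
  have vB: "v : B" using that X1B by blast
  have "slc n i (P v) : S0 i" if "i < m" for i using Ps[OF vB that] X1(4) \<open>v \<in> X1\<close> that by auto
  thus ?thesis using S0(2) Pt[OF vB] by blast
 qed
 define f where "f i v = slc n i (F (P v))" for i v
 have FP: "dfn (m * dK) X1 (m * n) (%v. F (P v))"
  by (rule dfn_comp[OF dfn_subset[OF P X1(2) X1B] F(1)]) (use PW in blast)
 have slN: "dfn (m * n) (TT (m * n)) n (slc n i)" if "i < m" for i
  by (rule dfnI[OF], (rule DT_slc that dint | (simp; fail)[1])+)
 have fD: "dfn (m * dK) X1 n (f i) & f i ` X1 <= CK" if "i < m" for i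
 proof
  show "dfn (m * dK) X1 n (f i)" unfolding f_def by (rule dfn_comp[OF FP slN[OF that]]) (use Ft PW in blast)
  show "f i ` X1 <= CK" unfolding f_def using F(2)[OF PW that] by blast
 qed
 have "X1 ~= {}" using X1(3) by blast
 have "EX X'. opn (m * dK) X' & dfb (m * dK) X' & X' ~= {} & X' <= X1 &
  (ALL i<m. continuous_map (sbt (m * dK) X') rho (f i) & (EX W l G h. patch rho W dK l G h & f i ` X' <= W))"
  by (rule shrink_to_patches[where f = f and m = m, OF X1(1,2) \<open>X1 \<noteq> {}\<close> fD])
 then
 obtain X2 where X2: "opn (m * dK) X2" "dfb (m * dK) X2" "X2 ~= {}" "X2 <= X1"
  and ex: "ALL i<m. continuous_map (sbt (m * dK) X2) rho (f i) & (EX W l G h. patch rho W dK l G h & f i ` X2 <= W)"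
  by (elim exE conjE)
 from ex have "ALL i. EX W l G h. i < m --> patch rho W dK l G h & f i ` X2 <= W" by blast
 then obtain Wi li Gi hi where "ALL i. i < m --> patch rho (Wi i) dK (li i) (Gi i) (hi i) & f i ` X2 <= Wi i"
  by (simp only: choice_iff) (elim exE)
 hence pt: "!!i. i < m ==> patch rho (Wi i) dK (li i) (Gi i) (hi i)" and fW: "!!i v. i < m ==> v : X2 ==> f i v : Wi i"
  by blast+
 note p = patchD[OF pt]
 have hG: "hi i x : Gi i" if "i < m" "x : Wi i" for i x using p(5)[OF that(1)] that(2) by blast
 have ht: "hi i x : TT (dK + li i)" if "i < m" "x : Wi i" for i x by (rule dfnD(2)[OF p(3)[OF that(1)] that(2)])
 have fX2: "dfn (m * dK) X2 n (f i)" if "i < m" for i by (rule dfn_subset[OF _ X2(2,4)]) (use fD[OF that] in blast)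
 \<comment> \<open>The values of \<open>F\<close> are read in patches and projected to
   \<open>M^dK\<close> coordinatewise. Patches, \<open>F\<close> and \<open>P\<close> have finite
   fibres, so \<open>q\<close> is finite-to-one between spaces of the same dimension.\<close>
 define q where "q v = flat dK m (%i. tfst dK (hi i (f i v)))" for v
 have qt: "tfst dK (hi i (f i v)) : TT dK" if "i < m" "v : X2" for i v using ht[OF that(1) fW[OF that]] by blast
 have qs: "slc dK i (q v) = tfst dK (hi i (f i v))" if "i < m" "v : X2" for i v
  unfolding q_def by (rule slc_flatI[OF qt[OF _ that(2)] that(1)])
 have qD: "dfn (m * dK) X2 (m * dK) q" unfolding q_def
 proof (rule dfn_flat[OF X2(2)])
  fix i assume i: "i < m"
  have "dfn (m * dK) X2 (dK + li i) (%v. hi i (f i v))" by (rule dfn_comp[OF fX2[OF i] p(3)[OF i]]) (use fW[OF i] in blast)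
  thus "dfn (m * dK) X2 dK (%v. tfst dK (hi i (f i v)))"
   by (intro dfnI X2(2) DT_tfst) (use X2(2) in \<open>simp_all add: dfn_def\<close>)
 qed
 have qfin: "finite {v' : X2. q v' = q v}" if "v : X2" for v
 proof -
  let ?Y = "(%a. flat n m a) ` (Pi\<^sub>E {..<m} (%i. {x : Wi i. tfst dK (hi i x) = slc dK i (q v)}))"
  have "finite ?Y" by (intro finite_imageI finite_PiE) (use patch_fibre[OF pt] in auto)
  hence "finite (\<Union>y\<in>?Y. {w : W. F w = y})" using fin by blast
  moreover have "P ` {v' : X2. q v' = q v} <= (\<Union>y\<in>?Y. {w : W. F w = y})"
  proof (rule image_subsetI)
   fix v' assume "v' : {v' : X2. q v' = q v}"
   hence v': "v' : X2" "q v' = q v" by blast+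
   have vW: "P v' : W" using PW v'(1) X2(4) by blast
   let ?a = "\<lambda>i\<in>{..<m}. f i v'"
   have "?a : Pi\<^sub>E {..<m} (%i. {x : Wi i. tfst dK (hi i x) = slc dK i (q v)})"
   using fW v' qs[OF _ v'(1)] by auto
   moreover have "F (P v') = flat n m ?a"
   proof (rule slc_eqI[OF Ft[OF vW]])
   have at: "?a i : TT n" if "i < m" for i using F(2)[OF vW that] that by (simp add: f_def)
   show "flat n m ?a : TT (m * n)" by (rule flat_in) (rule at)
   show "slc n i (F (P v')) = slc n i (flat n m ?a)" if "i < m" for i
   proof -
   have "slc n i (flat n m ?a) = ?a i" by (rule slc_flatI[OF at that])
   thus ?thesis using that by (simp add: f_def)
   qed
   qed
   ultimately show "P v' : (\<Union>y\<in>?Y. {w : W. F w = y})" using vW by blast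
  qed
  ultimately have "finite (P ` {v' : X2. q v' = q v})" by (rule finite_subset[rotated])
  thus ?thesis by (rule finite_imageD) (use Pinj X2(4) X1B in \<open>auto intro!: inj_onI\<close>)
 qed
 \<comment> \<open>From here \<open>q\<close> is injective on an open set, and then open on a
   smaller one by invariance of domain.\<close>
 obtain X3 where X3: "opn (m * dK) X3" "dfb (m * dK) X3" "X3 ~= {}" "X3 <= X2" "inj_on q X3"
  by (rule generic_injective[OF X2(1,3) qD qfin])
 obtain X4 where X4: "opn (m * dK) X4" "dfb (m * dK) X4" "X4 ~= {}" "X4 <= X3" "cont (m * dK) X4 (m * dK) q"
  and op: "!!W. opn (m * dK) W ==> W <= X4 ==> opn (m * dK) (q ` W)"
  by (rule local_homeo[OF X3(1,3) dfn_subset[OF qD X3(2,4)] X3(5)]) (rule that)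
 obtain v1 where v1: "v1 : X4" using X4(3) by blast
 have X42: "X4 <= X2" using X4(4) X3(4) by blast
 have X4B: "X4 <= B" using X42 X2(4) X1B by blast
 have v1X: "v1 : X2" "v1 : X1" using v1 X42 X2(4) by blast+
 show thesis
 proof (rule that)
  show "P v1 : W" by (rule PW[OF v1X(2)])
  fix S assume S: "ALL i<m. openin rho (S i) & slc n i (P v1) : S i"
  have "EX Z A t. i < m --> opn dK Z & tfst dK (hi i (f i v1)) : Z & opn (li i) A & tsnd dK (li i) (hi i (f i v1)) : A &
   (ALL z:Z. ALL a:TT (li i). tcat dK z (li i) a : Gi i & a : A \<longleftrightarrow> a = t z)" for i
  proof (cases "i < m")
   case True
   from bspec[OF p(6)[OF True, unfolded graph_like_def, THEN conjunct2, THEN conjunct2] hG[OF True fW[OF True v1X(1)]]]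
   show ?thesis by blast
  qed blast
  hence "ALL i. EX Z A t. i < m --> opn dK Z & tfst dK (hi i (f i v1)) : Z & opn (li i) A & tsnd dK (li i) (hi i (f i v1)) : A &
   (ALL z:Z. ALL a:TT (li i). tcat dK z (li i) a : Gi i & a : A \<longleftrightarrow> a = t z)" by (rule allI)
  then obtain Z A t where ZAt: "ALL i. i < m --> opn dK (Z i) & tfst dK (hi i (f i v1)) : Z i & opn (li i) (A i) & tsnd dK (li i) (hi i (f i v1)) : A i &
   (ALL z:Z i. ALL a:TT (li i). tcat dK z (li i) a : Gi i & a : A i \<longleftrightarrow> a = t i z)"
   by (simp only: choice_iff) (elim exE)
  have Z: "opn dK (Z i)" "tfst dK (hi i (f i v1)) : Z i" "opn (li i) (A i)" "tsnd dK (li i) (hi i (f i v1)) : A i" if "i < m" for i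
   using ZAt that by blast+
  have iff: "tcat dK z (li i) a : Gi i & a : A i \<longleftrightarrow> a = t i z" if "i < m" "z : Z i" "a : TT (li i)" for i z a
   using ZAt that by blast
  \<comment> \<open>The box with \<open>A i\<close> keeps the patch to the single branch through the
    value at \<open>v1\<close>, so a point of it is determined by its projection.\<close>
  define T1 where "T1 Y i = {x : Wi i. hi i x : Box dK (Z i \<inter> Y i) (li i) (A i)}" for Y i
  have T1o: "openin rho (T1 Y i)" if "i < m" "opn dK (Y i)" for Y i
   unfolding T1_def by (rule open_preimage[OF p(1)[OF that(1)] p(7)[OF that(1)]]) (intro open_Box openin_Int Z that)
  have T1v: "f i v1 : T1 Y i" if "i < m" "tfst dK (hi i (f i v1)) : Y i" for Y i
   unfolding T1_def Box_def using that Z ht[OF that(1) fW[OF that(1) v1X(1)]] fW[OF that(1) v1X(1)] by simp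
  let ?U = "%i. TT dK"
  define B1 where "B1 = {v : {v : X4. ALL i<m. g i (slc dK i v) : S i}. ALL i<m. f i v : T1 ?U i}"
  have oA: "opn (m * dK) {v : X4. ALL i<m. g i (slc dK i v) : S i}"
   by (rule open_finite_preimage[OF X4(1) continuous_map_from_subtopology_mono[OF cP X4B]]) (use S in auto)
  have sub: "{v : X4. ALL i<m. g i (slc dK i v) : S i} <= X2" using X42 by blast
  have cf: "continuous_map (sbt (m * dK) {v : X4. ALL i<m. g i (slc dK i v) : S i}) rho (f i)" if "i < m" for i
   by (rule continuous_map_from_subtopology_mono[OF _ sub]) (use ex that in blast)
  have oB1: "opn (m * dK) B1" unfolding B1_def
   by (rule open_finite_preimage[OF oA cf T1o]) (simp_all add: openin_TT)
  have B1X: "B1 <= X4" unfolding B1_def by blast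
  have "v1 : B1" unfolding B1_def using v1 S Ps[OF subsetD[OF X4B v1]] T1v qt[OF _ v1X(1)] by auto
  hence qv1: "q v1 : q ` B1" by blast
  obtain Y where Y: "!!i. i < m ==> opn dK (Y i)" "!!i. i < m ==> slc dK i (q v1) : Y i"
   "ALL z':TT (m * dK). (ALL i<m. slc dK i z' : Y i) --> z' : q ` B1"
   by (rule open_flat_box[OF op[OF oB1 B1X] qv1]) (rule that)
  show "EX T. (ALL i<m. openin rho (T i) & slc n i (F (P v1)) : T i) &
   (ALL y:TT (m * n). (ALL i<m. slc n i y : T i) --> (EX w':W. (ALL i<m. slc n i w' : S i) & F w' = y))"
  proof (intro exI[of _ "T1 Y"] conjI allI impI ballI)
   fix i assume i: "i < m"
   show "openin rho (T1 Y i)" by (rule T1o) (rule i, rule Y(1)[OF i])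
   show "slc n i (F (P v1)) : T1 Y i"
   using Y(2)[OF i] unfolding qs[OF i v1X(1)] f_def[symmetric] by (rule T1v[OF i])
  next
   fix y assume y: "y : TT (m * n)" "ALL i<m. slc n i y : T1 Y i"
   have yW: "slc n i y : Wi i" and yB: "hi i (slc n i y) : Box dK (Z i \<inter> Y i) (li i) (A i)" if "i < m" for i
   using y(2) that unfolding T1_def by blast+
   define z where "z = flat dK m (%i. tfst dK (hi i (slc n i y)))"
   have zt: "tfst dK (hi i (slc n i y)) : TT dK" if "i < m" for i using ht[OF that yW[OF that]] by blast
   have zs: "slc dK i z = tfst dK (hi i (slc n i y))" if "i < m" for i unfolding z_def by (rule slc_flatI[OF zt that])
   have "z : q ` B1"
   proof (rule Y(3)[rule_format])
   show "z : TT (m * dK)" unfolding z_def by (rule flat_in) (rule zt)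
   show "slc dK i z : Y i" if "i < m" for i unfolding zs[OF that] using yB[OF that] unfolding Box_def by blast
   qed
   then obtain v where v: "v : B1" "z = q v" by blast
   have vX: "v : X4" "v : X2" "v : B" "v : X1" using v(1) B1X X42 X4B X2(4) by blast+
   have "slc n i y = f i v" if i: "i < m" for i
   proof -
   have e: "tfst dK (hi i (slc n i y)) = tfst dK (hi i (f i v))" using zs[OF i] qs[OF i vX(2)] v(2) by simp
   have fB: "hi i (f i v) : Box dK (Z i \<inter> TT dK) (li i) (A i)" "f i v : Wi i" using v(1) i unfolding B1_def T1_def by blast+
   have tt: "hi i (slc n i y) : TT (dK + li i)" "hi i (f i v) : TT (dK + li i)" using ht[OF i yW[OF i]] ht[OF i fB(2)] .
   \<comment> \<open>Both points lie on the branch \<open>t i\<close> over the same projection, so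
     they coincide.\<close>
   have s1: "tsnd dK (li i) (hi i (slc n i y)) = t i (tfst dK (hi i (slc n i y)))"
   by (rule iff[OF i, THEN iffD1]) (use yB[OF i] tt(1) hG[OF i yW[OF i]] in \<open>auto simp: Box_def\<close>)
   have s2: "tsnd dK (li i) (hi i (f i v)) = t i (tfst dK (hi i (f i v)))"
   by (rule iff[OF i, THEN iffD1]) (use fB tt(2) hG[OF i fB(2)] in \<open>auto simp: Box_def\<close>)
   have "hi i (slc n i y) = tcat dK (tfst dK (hi i (slc n i y))) (li i) (tsnd dK (li i) (hi i (slc n i y)))"
   by (rule tcat_tfst_tsnd[OF tt(1), symmetric])
   also have "\<dots> = tcat dK (tfst dK (hi i (f i v))) (li i) (tsnd dK (li i) (hi i (f i v)))" unfolding s1 s2 e ..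
   also have "\<dots> = hi i (f i v)" by (rule tcat_tfst_tsnd[OF tt(2)])
   finally show ?thesis using p(4)[OF i] yW[OF i] fB(2) by (auto dest: inj_onD)
   qed
   hence "F (P v) = y" by (intro slc_eqI[OF Ft[OF PW[OF vX(4)]] y(1)]) (simp add: f_def)
   moreover have "slc n i (P v) : S i" if "i < m" for i using Ps[OF vX(3) that] v(1) that unfolding B1_def by auto
   ultimately show "EX w':W. (ALL i<m. slc n i w' : S i) & F w' = y" using PW[OF vX(4)] by blast
  qed
 qed
qed

end

section \<open>Arithmetic modulo a monic polynomial, by explicit formulas in the
  coefficients\<close>

definition lpoly :: "nat => (nat => 'k) => 'k::field_gcd poly" where
 "lpoly m k = (\<Sum>i<m. monom (k i) i)"

definition mpoly :: "nat => (nat => 'k) => 'k::field_gcd poly" where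
 "mpoly m c = monom 1 m + lpoly m c"

lemma coeff_lpoly: "coeff (lpoly m k) i = (if i < m then k i else 0)"
 unfolding lpoly_def by (simp add: coeff_sum)

lemma coeff_mpoly: "coeff (mpoly m c) i = (if i < m then c i else if i = m then 1 else 0)"
 unfolding mpoly_def by (simp add: coeff_lpoly)

lemma degree_lpoly: "m > 0 ==> degree (lpoly m k) < m"
 by (rule le_less_trans[OF degree_le, of "m - 1"]) (auto simp: coeff_lpoly)

lemma degree_mpoly: "degree (mpoly m c) = m"
 by (rule antisym[OF degree_le le_degree]) (auto simp: coeff_mpoly)

lemma mpoly_coeff: "degree Q = m ==> coeff Q m = 1 ==> mpoly m (coeff Q) = Q"
 by (rule poly_eqI) (auto simp: coeff_mpoly coeff_eq_0)

lemma lpoly_coeff: "degree R < m ==> lpoly m (coeff R) = R"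
 by (rule poly_eqI) (auto simp: coeff_lpoly coeff_eq_0)

lemma mpoly_nz: "mpoly m c ~= 0"
 using coeff_mpoly[of m c m] by auto

lemma lpoly_dvd_0: "mpoly m c dvd lpoly m r ==> i < m ==> r i = 0"
proof -
 assume d: "mpoly m c dvd lpoly m r" and i: "i < m"
 have "lpoly m r = 0"
  using dvd_imp_degree_le[OF d] degree_lpoly[of m r] i by (cases "lpoly m r = 0") (auto simp: degree_mpoly)
 thus ?thesis using coeff_lpoly[of m r i] i by simp
qed

text \<open>Coefficients of \<open>X^i\<close> reduced modulo \<open>mpoly m P\<close>: multiplying
  by \<open>X\<close> creates a term of degree \<open>m\<close>, which the recursion removes.
  Explicit recursions make the dependence on \<open>P\<close> visibly polynomial.\<close>

fun xm :: "nat => (nat => 'k::field_gcd) => nat => nat => 'k" where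
 "xm m P 0 l = (if l = 0 then 1 else 0)"
| "xm m P (Suc i) l = (if l = 0 then 0 else xm m P i (l - 1)) - xm m P i (m - 1) * P l"

lemma xm: "m > 0 ==> mpoly m P dvd monom 1 i - lpoly m (xm m P i)"
proof (induction i)
 case 0
 have e: "monom 1 0 - lpoly m (xm m P 0) = 0" using 0 by (intro poly_eqI) (auto simp: coeff_lpoly)
 show ?case unfolding e by (rule dvd_0_right)
next
 case (Suc i)
 let ?L = "lpoly m (xm m P i)"
 have e: "monom 1 (Suc i) - lpoly m (xm m P (Suc i)) = [:0, 1:] * (monom 1 i - ?L) + smult (xm m P i (m - 1)) (mpoly m P)"
 proof (rule poly_eqI)
  fix j show "coeff (monom 1 (Suc i) - lpoly m (xm m P (Suc i))) j =
   coeff ([:0, 1:] * (monom 1 i - ?L) + smult (xm m P i (m - 1)) (mpoly m P)) j"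
   using Suc.prems by (cases j) (auto simp: coeff_lpoly coeff_mpoly coeff_pCons algebra_simps less_Suc_eq_le le_less intro!: arg_cong[where f = "xm m P i"])
 qed
 show ?case unfolding e by (intro dvd_add dvd_mult dvd_smult dvd_refl Suc.IH Suc.prems)
qed

text \<open>Coefficients of the \<open>j\<close>-th power of \<open>lpoly m k\<close> in the same
  quotient ring.\<close>

fun kp :: "nat => (nat => 'k::field_gcd) => (nat => 'k) => nat => nat => 'k" where
 "kp m P k 0 l = (if l = 0 then 1 else 0)"
| "kp m P k (Suc j) l = (\<Sum>i<m. \<Sum>i'<m. kp m P k j i * k i' * xm m P (i + i') l)"

lemma lpoly_sum: "lpoly m (%l. \<Sum>i\<in>I. f i l) = (\<Sum>i\<in>I. lpoly m (f i))"
 by (rule poly_eqI) (simp add: coeff_lpoly coeff_sum)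

lemma lpoly_smult: "lpoly m (%l. c * f l) = smult c (lpoly m f)"
 by (rule poly_eqI) (simp add: coeff_lpoly)

lemma kp: "m > 0 ==> mpoly m P dvd lpoly m k ^ j - lpoly m (kp m P k j)"
proof (induction j)
 case 0
 have e: "lpoly m k ^ 0 - lpoly m (kp m P k 0) = 0" using 0 by (intro poly_eqI) (auto simp: coeff_lpoly)
 show ?case unfolding e by (rule dvd_0_right)
next
 case (Suc j)
 let ?L = "lpoly m (kp m P k j)"
 have 1: "lpoly m k * ?L = (\<Sum>i<m. \<Sum>i'<m. smult (kp m P k j i * k i') (monom 1 (i + i')))"
  by (subst mult.commute, unfold lpoly_def) (simp add: sum_product mult_monom smult_monom)
 have "kp m P k (Suc j) = (%l. \<Sum>i<m. \<Sum>i'<m. kp m P k j i * k i' * xm m P (i + i') l)" by (rule ext) simp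
 hence 2: "lpoly m (kp m P k (Suc j)) = (\<Sum>i<m. \<Sum>i'<m. smult (kp m P k j i * k i') (lpoly m (xm m P (i + i'))))"
  by (simp only: lpoly_sum lpoly_smult)
 have d2: "lpoly m k * ?L - lpoly m (kp m P k (Suc j)) =
   (\<Sum>i<m. \<Sum>i'<m. smult (kp m P k j i * k i') (monom 1 (i + i') - lpoly m (xm m P (i + i'))))"
  unfolding 1 2 by (simp add: sum_subtractf smult_diff_right)
 have split: "a * b - d = a * (b - c) + (a * c - d)" for a b c d :: "'a poly" by (simp add: algebra_simps)
 have e: "lpoly m k ^ Suc j - lpoly m (kp m P k (Suc j)) =
   lpoly m k * (lpoly m k ^ j - ?L) + (lpoly m k * ?L - lpoly m (kp m P k (Suc j)))"
  using split[of "lpoly m k" "lpoly m k ^ j"] by simp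
 show ?case unfolding e d2 by (intro dvd_add dvd_mult dvd_sum dvd_smult xm Suc.prems Suc.IH)
qed

text \<open>Column \<open>j\<close> holds the \<open>j\<close>-th power of \<open>k\<close>; so a
  non-zero determinant \<open>den\<close> says that the powers below \<open>m\<close> form a basis
  of the quotient ring.\<close>

definition kmat :: "nat => (nat => 'k) => (nat => 'k) => 'k::field_gcd mat" where
 "kmat m P k = mat m m (%(l, j). kp m P k j l)"

definition den :: "nat => (nat => 'k) => (nat => 'k) => 'k::field_gcd" where
 "den m P k = det (kmat m P k)"

text \<open>Numerators of Cramer's rule: divided by \<open>den\<close>, they are the coordinates of
  \<open>v\<close> in the basis of powers of \<open>k\<close>.\<close>

definition num :: "nat => (nat => 'k) => (nat => 'k) => (nat => 'k) => nat => 'k::field_gcd" where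
 "num m P k v j = (\<Sum>l<m. adj_mat (kmat m P k) $$ (j, l) * v l)"

lemma kmat_carrier: "kmat m P k : carrier_mat m m" unfolding kmat_def by simp

lemma adj_entry: "l < m ==> l' < m ==>
  (\<Sum>j<m. kp m P k j l * adj_mat (kmat m P k) $$ (j, l')) = (if l = l' then den m P k else 0)"
proof -
 assume l: "l < m" "l' < m"
 note c = kmat_carrier[of m P k] adj_mat(1)[OF kmat_carrier[of m P k]]
 have 1: "(kmat m P k * adj_mat (kmat m P k)) $$ (l, l') = (\<Sum>j<m. kp m P k j l * adj_mat (kmat m P k) $$ (j, l'))"
  using c l by (auto simp: scalar_prod_def kmat_def lessThan_atLeast0 intro!: sum.cong)
 have 2: "(kmat m P k * adj_mat (kmat m P k)) $$ (l, l') = (if l = l' then den m P k else 0)"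
  using l unfolding adj_mat(2)[OF c(1)] den_def by simp
 show ?thesis by (simp only: 1[symmetric] 2)
qed

lemma adj_entry': "l < m ==> l' < m ==>
  (\<Sum>j<m. adj_mat (kmat m P k) $$ (l, j) * kp m P k l' j) = (if l = l' then den m P k else 0)"
proof -
 assume l: "l < m" "l' < m"
 note c = kmat_carrier[of m P k] adj_mat(1)[OF kmat_carrier[of m P k]]
 have 1: "(adj_mat (kmat m P k) * kmat m P k) $$ (l, l') = (\<Sum>j<m. adj_mat (kmat m P k) $$ (l, j) * kp m P k l' j)"
  using c l by (auto simp: scalar_prod_def kmat_def lessThan_atLeast0 intro!: sum.cong)
 have 2: "(adj_mat (kmat m P k) * kmat m P k) $$ (l, l') = (if l = l' then den m P k else 0)"
  using l unfolding adj_mat(3)[OF c(1)] den_def by simp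
 show ?thesis by (simp only: 1[symmetric] 2)
qed

lemma cramer: "l < m ==> (\<Sum>j<m. kp m P k j l * num m P k v j) = den m P k * v l"
proof -
 assume l: "l < m"
 have "(\<Sum>j<m. kp m P k j l * num m P k v j) = (\<Sum>l'<m. (\<Sum>j<m. kp m P k j l * adj_mat (kmat m P k) $$ (j, l')) * v l')"
  unfolding num_def sum_distrib_left sum_distrib_right by (subst sum.swap) (simp add: mult.assoc)
 also have "\<dots> = (\<Sum>l'<m. (if l = l' then den m P k else 0) * v l')"
  by (rule sum.cong) (simp_all add: adj_entry l)
 also have "\<dots> = den m P k * v l" using l by (simp add: if_distrib[of "%x. x * _"] cong: if_cong)
 finally show ?thesis .
qed

lemma cramer_unique:
 assumes "den m P k ~= 0" "!!l. l < m ==> (\<Sum>j<m. kp m P k j l * c j) = 0" "i < m"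
 shows "c i = 0"
proof -
 have "(\<Sum>l<m. adj_mat (kmat m P k) $$ (i, l) * (\<Sum>j<m. kp m P k j l * c j)) =
   (\<Sum>j<m. (\<Sum>l<m. adj_mat (kmat m P k) $$ (i, l) * kp m P k j l) * c j)"
  unfolding sum_distrib_left sum_distrib_right by (subst sum.swap) (simp add: mult.assoc)
 also have "\<dots> = (\<Sum>j<m. (if i = j then den m P k else 0) * c j)"
  by (rule sum.cong) (simp_all add: adj_entry' assms(3))
 also have "\<dots> = den m P k * c i" using assms(3) by (simp add: if_distrib[of "%x. x * _"] cong: if_cong)
 finally show ?thesis using assms by simp
qed

lemma pcompose_monom': "pcompose (monom a j) q = smult a (q ^ j)" for q :: "'k::field_gcd poly"
 by (induction j) (simp_all add: monom_Suc pcompose_pCons monom_0)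

lemma pcompose_X: "pcompose p [:0, 1:] = p" for p :: "'k::field_gcd poly"
 by (induction p) (simp_all add: pcompose_pCons)

lemma pcompose_lpoly: "pcompose (lpoly m c) q = (\<Sum>j<m. smult (c j) (q ^ j))"
 unfolding lpoly_def by (simp add: pcompose_sum pcompose_monom')

lemma pcompose_mpoly: "pcompose (mpoly m c) q = q ^ m + (\<Sum>j<m. smult (c j) (q ^ j))"
 unfolding mpoly_def by (simp add: pcompose_add pcompose_lpoly pcompose_monom')

lemma dvd_pcompose_diff: "d dvd a - b ==> d dvd pcompose p a - pcompose p b" for d :: "'k::field_gcd poly"
proof (induction p)
 case (pCons c p)
 have "pcompose (pCons c p) a - pcompose (pCons c p) b = a * (pcompose p a - pcompose p b) + (a - b) * pcompose p b"
  by (simp add: pcompose_pCons algebra_simps)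
 thus ?case using pCons by simp
qed simp

context
 fixes m :: nat and P k :: "nat => 'k::field_gcd"
 assumes m: "m > 0"
begin

lemma combination_mod: "mpoly m P dvd (\<Sum>j<m. smult (c j) (lpoly m k ^ j)) - lpoly m (%l. \<Sum>j<m. c j * kp m P k j l)"
proof -
 have "(\<Sum>j<m. smult (c j) (lpoly m k ^ j)) - lpoly m (%l. \<Sum>j<m. c j * kp m P k j l) =
   (\<Sum>j<m. smult (c j) (lpoly m k ^ j - lpoly m (kp m P k j)))"
  by (simp add: lpoly_sum lpoly_smult sum_subtractf smult_diff_right)
 moreover have "mpoly m P dvd \<dots>" by (intro dvd_sum dvd_smult kp m)
 ultimately show ?thesis by simp
qed

lemma solve_mod:
 assumes d: "den m P k ~= 0"
 shows "mpoly m P dvd pcompose (lpoly m (%j. num m P k v j / den m P k)) (lpoly m k) - lpoly m v"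
proof -
 have "lpoly m (%l. \<Sum>j<m. (num m P k v j / den m P k) * kp m P k j l) = lpoly m v"
 proof (rule poly_eqI)
  fix l
  have "(\<Sum>j<m. (num m P k v j / den m P k) * kp m P k j l) = (\<Sum>j<m. kp m P k j l * num m P k v j) / den m P k"
   by (simp add: sum_divide_distrib mult.commute)
  thus "coeff (lpoly m (%l. \<Sum>j<m. (num m P k v j / den m P k) * kp m P k j l)) l = coeff (lpoly m v) l"
   using cramer[of l m P k v] d by (simp add: coeff_lpoly)
 qed
 thus ?thesis using combination_mod[of "%j. num m P k v j / den m P k"] by (simp add: pcompose_lpoly)
qed

text \<open>Coefficients of the monic relation of degree \<open>m\<close> that \<open>k\<close>
  satisfies modulo \<open>mpoly m P\<close>, obtained by expanding the \<open>m\<close>-th power of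
  \<open>k\<close> in the lower ones.\<close>

definition "chp j = - (num m P k (kp m P k m) j / den m P k)"
text \<open>Coordinates of the class of \<open>X\<close> in the powers of \<open>k\<close>; as a
  polynomial this undoes the passage from \<open>X\<close> to \<open>k\<close>.\<close>

definition "inv_el j = num m P k (xm m P 1) j / den m P k"

lemma chp_root: assumes d: "den m P k ~= 0" shows "mpoly m P dvd pcompose (mpoly m chp) (lpoly m k)"
proof -
 have "pcompose (mpoly m chp) (lpoly m k) = (lpoly m k ^ m - lpoly m (kp m P k m)) -
   (pcompose (lpoly m (%j. num m P k (kp m P k m) j / den m P k)) (lpoly m k) - lpoly m (kp m P k m))"
  unfolding pcompose_mpoly pcompose_lpoly chp_def by (simp add: sum_negf)
 thus ?thesis using dvd_diff[OF kp[OF m, of P k m] solve_mod[OF d, of "kp m P k m"]] by simp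
qed

lemma inv_el: assumes d: "den m P k ~= 0" shows "mpoly m P dvd pcompose (lpoly m inv_el) (lpoly m k) - [:0, 1:]"
proof -
 have "mpoly m P dvd (pcompose (lpoly m inv_el) (lpoly m k) - lpoly m (xm m P 1)) - (monom 1 1 - lpoly m (xm m P 1))"
  unfolding inv_el_def by (rule dvd_diff[OF solve_mod[OF d] xm[OF m]])
 moreover have "monom 1 1 = ([:0, 1:] :: 'k poly)" by (simp add: monom_altdef)
 ultimately show ?thesis by simp
qed

lemma independent:
 assumes d: "den m P k ~= 0" and "mpoly m P dvd pcompose (lpoly m r) (lpoly m k)" and "i < m" shows "r i = 0"
proof (rule cramer_unique[OF d _ assms(3)])
 fix l assume l: "l < m"
 have "mpoly m P dvd lpoly m (%l. \<Sum>j<m. r j * kp m P k j l)"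
  using dvd_diff[OF assms(2) combination_mod[of r]] by (simp add: pcompose_lpoly)
 from lpoly_dvd_0[OF this l] show "(\<Sum>j<m. kp m P k j l * r j) = 0" by (simp add: mult.commute)
qed

text \<open>Let \<open>?R\<close> be the remainder of \<open>?F\<close> modulo \<open>?C\<close>.
  Substituting \<open>k\<close> for the variable turns \<open>?F\<close> into
  \<open>mpoly m P\<close> modulo itself and kills \<open>?C\<close>; so \<open>?R\<close> is a
  relation of degree below \<open>m\<close> among independent powers and vanishes. Consequently
  \<open>inv_el\<close> sends each root of \<open>chp\<close> to a root of
  \<open>mpoly m P\<close>.\<close>

lemma chp_dvd: assumes d: "den m P k ~= 0" shows "mpoly m chp dvd pcompose (mpoly m P) (lpoly m inv_el)"
proof -
 let ?F = "pcompose (mpoly m P) (lpoly m inv_el)" and ?C = "mpoly m chp"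
 let ?R = "?F mod ?C"
 have dR: "degree ?R < m" using degree_mod_less[of ?C ?F] m mpoly_nz[of m chp] by (auto simp: degree_mpoly)
 have "mpoly m P dvd pcompose (mpoly m P) (pcompose (lpoly m inv_el) (lpoly m k)) - pcompose (mpoly m P) [:0, 1:]"
  by (rule dvd_pcompose_diff[OF inv_el[OF d]])
 hence "mpoly m P dvd pcompose ?F (lpoly m k) - mpoly m P" unfolding pcompose_assoc pcompose_X .
 hence F: "mpoly m P dvd pcompose ?F (lpoly m k)" using dvd_add[OF _ dvd_refl[of "mpoly m P"]] by fastforce
 have "pcompose ?F (lpoly m k) = pcompose (?F div ?C) (lpoly m k) * pcompose ?C (lpoly m k) + pcompose ?R (lpoly m k)"
  by (metis div_mult_mod_eq pcompose_add pcompose_mult)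
 moreover have "mpoly m P dvd pcompose (?F div ?C) (lpoly m k) * pcompose ?C (lpoly m k)" by (intro dvd_mult chp_root d)
 ultimately have "mpoly m P dvd pcompose ?R (lpoly m k)" using F by (simp add: dvd_add_right_iff)
 hence "mpoly m P dvd pcompose (lpoly m (coeff ?R)) (lpoly m k)" by (simp add: lpoly_coeff[OF dR])
 from independent[OF d this] have "lpoly m (coeff ?R) = 0" by (intro poly_eqI) (simp add: coeff_lpoly)
 hence "?R = 0" using lpoly_coeff[OF dR] by simp
 thus ?thesis by (rule mod_0_imp_dvd)
qed

end

text \<open>For \<open>k = X\<close> the powers are the standard basis; so \<open>den\<close> is not
  identically zero. Writing \<open>X\<close> as \<open>xm m P 1\<close> covers \<open>m = 1\<close>,
  where \<open>X\<close> reduces to a constant.\<close>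

lemma den_X: assumes m: "m > 0" shows "den m P (xm m P 1) = 1"
proof -
 let ?k = "xm m P 1"
 have X: "mpoly m P dvd lpoly m ?k - [:0, 1:]"
  using xm[OF m, of P 1] by (metis dvd_minus_iff minus_diff_eq monom_altdef One_nat_def power_one_right smult_1_left)
 have "kp m P ?k j l = (if l = j then 1 else 0)" if j: "j < m" "l < m" for j l
 proof -
  have "mpoly m P dvd pcompose (monom 1 j) (lpoly m ?k) - pcompose (monom 1 j) [:0, 1:]" by (rule dvd_pcompose_diff[OF X])
  hence "mpoly m P dvd smult 1 (lpoly m ?k ^ j) - smult 1 ([:0, 1:] ^ j)" unfolding pcompose_monom' .
  hence "mpoly m P dvd lpoly m ?k ^ j - monom 1 j" by (simp only: smult_1_left monom_altdef)
  hence "mpoly m P dvd (lpoly m ?k ^ j - monom 1 j) - (lpoly m ?k ^ j - lpoly m (kp m P ?k j))"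
   by (rule dvd_diff[OF _ kp[OF m]])
  moreover have "(lpoly m ?k ^ j - monom 1 j) - (lpoly m ?k ^ j - lpoly m (kp m P ?k j)) =
   lpoly m (%l. kp m P ?k j l - (if l = j then 1 else 0))"
   using j(1) by (intro poly_eqI) (simp add: coeff_lpoly)
  ultimately have "mpoly m P dvd lpoly m (%l. kp m P ?k j l - (if l = j then 1 else 0))" by simp
  from lpoly_dvd_0[OF this j(2)] show ?thesis by simp
 qed
 hence "kmat m P ?k = 1\<^sub>m m" unfolding kmat_def by (intro eq_matI) auto
 thus ?thesis unfolding den_def by simp
qed

section \<open>Roots in the algebraic closure; finite fibres of \<open>chp\<close>\<close>

interpretation ac: map_poly_inj_idom_hom "to_ac :: 'k::field => 'k alg_closure" by unfold_locales auto

definition ev :: "'k::field alg_closure => 'k poly => 'k alg_closure" where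
 "ev r p = poly (map_poly to_ac p) r"

lemma ev_simps: "ev r (p + q) = ev r p + ev r q" "ev r (p * q) = ev r p * ev r q" "ev r (p - q) = ev r p - ev r q" "ev r 1 = 1" "ev r 0 = 0"
 unfolding ev_def by (simp_all add: ac.hom_mult ac.hom_add ac.hom_minus)

lemma ev_pcompose: "ev r (pcompose p q) = ev (ev r q) p"
 unfolding ev_def by (simp add: ac.base.map_poly_pcompose poly_pcompose)

lemma ev_dvd: "p dvd q ==> ev r p = 0 ==> ev r q = 0"
 by (auto simp: dvd_def ev_simps)

lemma finite_ev_roots: "p ~= 0 ==> finite {r. ev r p = 0}"
 unfolding ev_def by (rule poly_roots_finite) simp

lemma ev_root: assumes "degree p > 0" obtains r where "ev r p = 0"
proof -
 have "degree (map_poly to_ac p) > 0" using assms by simp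
 then obtain r where "poly (map_poly to_ac p) r = 0" using alg_closed_imp_poly_has_root by blast
 thus thesis using that unfolding ev_def by blast
qed

text \<open>If \<open>f\<close> were non-zero, the cofactor \<open>h\<close> of the gcd in
  \<open>Q\<close> would have positive degree. A root of \<open>h\<close> is a root of
  \<open>Q\<close>, hence of \<open>f\<close>, hence of the gcd, so it would be a double root of
  \<open>Q\<close>.\<close>

lemma separable_interpolation:
 fixes Q f :: "'k::field_gcd poly"
 assumes cop: "coprime Q (pderiv Q)" and deg: "degree f < degree Q" and roots: "!!r. ev r Q = 0 ==> ev r f = 0"
 shows "f = 0"
proof (rule ccontr)
 assume f: "f ~= 0"
 let ?g = "gcd f Q"
 obtain h where h: "Q = ?g * h" by (metis dvd_def gcd_dvd2)
 have "degree ?g \<le> degree f" using f by (simp add: dvd_imp_degree_le)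
 moreover have "degree Q = degree ?g + degree h" using h deg by (metis degree_0 degree_mult_eq less_zeroE mult_zero_left mult_zero_right)
 ultimately have "degree h > 0" using deg by simp
 then obtain r where r: "ev r h = 0" by (rule ev_root)
 have Qr: "ev r Q = 0" by (subst h) (simp add: ev_simps r)
 obtain a b where "a * f + b * Q = ?g" using bezout_coefficients_fst_snd by metis
 hence "ev r ?g = 0" using Qr roots[OF Qr] by (metis add.right_neutral ev_simps(1,2) mult_zero_right)
 moreover have "pderiv Q = ?g * pderiv h + pderiv ?g * h" by (subst h) (simp add: pderiv_mult algebra_simps)
 ultimately have "ev r (pderiv Q) = 0" using r by (simp add: ev_simps)
 moreover obtain a b where "a * Q + b * pderiv Q = 1" using cop bezout_coefficients_fst_snd by (metis coprime_iff_gcd_eq_1)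
 ultimately have "(1 :: 'k alg_closure) = 0" using Qr by (metis add.right_neutral ev_simps(1,2,4) mult_zero_right)
 thus False by simp
qed

text \<open>By separability \<open>k\<close> is determined by its values at the roots of
  \<open>mpoly m P\<close>, and these are roots of \<open>mpoly m y\<close>, for which there are
  finitely many choices. The vanishing of \<open>k\<close> from \<open>m\<close> on makes
  \<open>k\<close> a function of its relevant entries.\<close>

lemma finite_chp_fibre:
 fixes P y :: "nat => 'k::field_gcd"
 assumes m: "m > 0" and cop: "coprime (mpoly m P) (pderiv (mpoly m P))"
 shows "finite {k. (\<forall>i\<ge>m. k i = 0) & den m P k ~= 0 & (ALL i<m. chp m P k i = y i)}"
proof -
 let ?S = "{k. (\<forall>i\<ge>m. k i = 0) & den m P k ~= 0 & (ALL i<m. chp m P k i = y i)}"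
 let ?R = "{r. ev r (mpoly m P) = 0}" and ?Y = "{r. ev r (mpoly m y) = 0}"
 let ?f = "%k. \<lambda>r\<in>?R. ev r (lpoly m k)"
 have fR: "finite ?R" "finite ?Y" using finite_ev_roots mpoly_nz by blast+
 show ?thesis
 proof (rule inj_on_finite[of ?f])
  show "inj_on ?f ?S"
  proof (rule inj_onI)
   fix k k' assume k: "k : ?S" "k' : ?S" "?f k = ?f k'"
   have "ev r (lpoly m k) = ev r (lpoly m k')" if "ev r (mpoly m P) = 0" for r
   using fun_cong[OF k(3), of r] that by simp
   hence "lpoly m k - lpoly m k' = 0"
   using m by (intro separable_interpolation[OF cop]) (auto simp: degree_mpoly ev_simps intro!: degree_diff_less degree_lpoly)
   hence "coeff (lpoly m k) i = coeff (lpoly m k') i" for i by simp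
   thus "k = k'" using k(1,2) by (intro ext) (metis (mono_tags, lifting) coeff_lpoly linorder_not_less mem_Collect_eq)
  qed
  show "?f ` ?S <= ?R \<rightarrow>\<^sub>E ?Y"
  proof (intro image_subsetI PiE_I)
   fix k r assume k: "k : ?S" and r: "r : ?R"
   have "mpoly m (chp m P k) = mpoly m y" using k by (intro poly_eqI) (auto simp: coeff_mpoly)
   hence "mpoly m P dvd pcompose (mpoly m y) (lpoly m k)" using chp_root[OF m, of P k] k by simp
   hence "ev r (pcompose (mpoly m y) (lpoly m k)) = 0" using r ev_dvd by blast
   thus "?f k r : ?Y" using r by (simp add: ev_pcompose)
  qed auto
  show "finite (?R \<rightarrow>\<^sub>E ?Y)" by (rule finite_PiE) (use fR in auto)
 qed
qed

text \<open>Polynomial functions, generated inductively so that continuity and the transfer to other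
  encodings follow by induction.\<close>

inductive PF :: "('x => 'k::field_gcd) set => ('x => 'k) => bool" for V where
 base: "f : V ==> PF V f"
| const: "PF V (%_. c)"
| add: "PF V f ==> PF V g ==> PF V (%x. f x + g x)"
| mult: "PF V f ==> PF V g ==> PF V (%x. f x * g x)"

lemma PF_sum: "(!!i. i : I ==> PF V (f i)) ==> PF V (%x. \<Sum>i\<in>I. f i x)"
 by (induction I rule: infinite_finite_induct) (auto intro: PF.intros)

lemma PF_prod: "(!!i. i : I ==> PF V (f i)) ==> PF V (%x. \<Prod>i\<in>I. f i x)"
 by (induction I rule: infinite_finite_induct) (auto intro: PF.intros)

lemma PF_uminus: "PF V f ==> PF V (%x. - f x)"
 using PF.mult[OF PF.const[of V "-1"]] by simp

lemma PF_diff: "PF V f ==> PF V g ==> PF V (%x. f x - g x)"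
 using PF.add[OF _ PF_uminus] by fastforce

lemma PF_det:
 assumes "!!i j. i < m ==> j < m ==> PF V (%x. A x i j)"
 shows "PF V (%x. det (mat m m (%(i, j). A x i j)))"
proof -
 have "det (mat m m (%(i, j). A x i j)) = (\<Sum>p\<in>{p. p permutes {0..<m}}. signof p * (\<Prod>i\<in>{0..<m}. A x i (p i)))" for x
  unfolding det_def'[OF mat_carrier] by (intro sum.cong prod.cong refl arg_cong2[where f = "(*)"]) (use permutes_in_image in fastforce)
 moreover have "PF V (%x. \<Sum>p\<in>{p. p permutes {0..<m}}. signof p * (\<Prod>i\<in>{0..<m}. A x i (p i)))"
  by (intro PF_sum PF.mult PF_prod PF.const assms) (use permutes_in_image in fastforce)+
 ultimately show ?thesis by simp
qed

lemma PF_adj: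
 assumes A: "!!i j. i < m ==> j < m ==> PF V (%x. A x i j)" and jl: "j < m" "l < m"
 shows "PF V (%x. adj_mat (mat m m (%(i, j). A x i j)) $$ (j, l))"
proof -
 have "adj_mat (mat m m (%(i, j). A x i j)) $$ (j, l) = (-1) ^ (l + j) *
   det (mat (m - 1) (m - 1) (%(i', j'). A x (if i' < l then i' else Suc i') (if j' < j then j' else Suc j')))" for x
 proof -
  have "mat_delete (mat m m (%(i, j). A x i j)) l j =
   mat (m - 1) (m - 1) (%(i', j'). A x (if i' < l then i' else Suc i') (if j' < j then j' else Suc j'))"
   unfolding mat_delete_def using jl by (intro eq_matI) auto
  thus ?thesis using jl by (simp add: adj_mat_def cofactor_def)
 qed
 moreover have "PF V (%x. (-1) ^ (l + j) *
   det (mat (m - 1) (m - 1) (%(i', j'). A x (if i' < l then i' else Suc i') (if j' < j then j' else Suc j'))))"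
  by (intro PF.mult PF.const PF_det A) (use jl in auto)
 ultimately show ?thesis by simp
qed

context
 fixes m :: nat and P k :: "'x => nat => 'k::field_gcd" and V :: "('x => 'k) set"
 assumes m: "m > 0" and P: "!!i. i < m ==> PF V (%x. P x i)" and k: "!!i. i < m ==> PF V (%x. k x i)"
begin

lemma PF_xm: "l < m ==> PF V (%x. xm m (P x) i l)"
proof (induction i arbitrary: l)
 case (Suc i)
 have "PF V (%x. (if l = 0 then 0 else xm m (P x) i (l - 1)) - xm m (P x) i (m - 1) * P x l)"
  by (intro PF_diff PF.mult P Suc) (cases "l = 0"; use Suc m in \<open>simp add: PF.const\<close>)+
 thus ?case by simp
qed (simp add: PF.const)

lemma PF_kp: "l < m ==> PF V (%x. kp m (P x) (k x) j l)"
proof (induction j arbitrary: l)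
 case (Suc j)
 have "PF V (%x. \<Sum>i<m. \<Sum>i'<m. kp m (P x) (k x) j i * k x i' * xm m (P x) (i + i') l)"
  by (intro PF_sum PF.mult Suc PF_xm k) auto
 thus ?case by simp
qed (simp add: PF.const)

lemma PF_den: "PF V (%x. den m (P x) (k x))"
 unfolding den_def kmat_def by (intro PF_det PF_kp)

lemma PF_num: "(!!l. l < m ==> PF V (%x. v x l)) ==> j < m ==> PF V (%x. num m (P x) (k x) (v x) j)"
 unfolding num_def kmat_def by (intro PF_sum PF.mult PF_adj PF_kp) auto

end

section \<open>Persistence of separable roots in a topological field with generic openness\<close>

definition nbm :: "('k => 'k filter) => nat => (nat => 'k) => (nat => 'k) filter" where
 "nbm nb m k = (INF i\<in>{..<m}. filtercomap (%x. x i) (nb (k i)))"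

lemma filterlim_nbm: "filterlim f (nbm nb m k) F \<longleftrightarrow> (ALL i<m. filterlim (%x. f x i) (nb (k i)) F)"
 unfolding nbm_def by (auto simp: filterlim_INF filterlim_filtercomap_iff comp_def)

definition coords :: "nat => ((nat => 'k) => 'k) set" where
 "coords m = (%i k. k i) ` {..<m}"

text \<open>The topology enters only through filters of neighbourhoods on a type-class field. The
  assumption \<open>gen\<close> stands for the inverse function theorem: a rational map with finite
  fibres is open at some point where the denominator does not vanish.\<close>

locale open_field =
 fixes nb :: "'k::field_gcd => 'k filter"
 assumes nb_add: "filterlim (%p. fst p + snd p) (nb (a + b)) (nb a \<times>\<^sub>F nb b)"
  and nb_mult: "filterlim (%p. fst p * snd p) (nb (a * b)) (nb a \<times>\<^sub>F nb b)"
  and nb_inverse: "a ~= 0 ==> filterlim inverse (nb (inverse a)) (nb a)"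
  and nb_at: "eventually E (nb a) ==> E a"
  and nb_sep: "a ~= b ==> eventually (%x. x ~= b) (nb a)"
  and nb_nondiscrete: "eventually E (nb a) ==> EX x. x ~= a & E x"
  and gen: "(!!i. i < m ==> PF (coords m) (N i)) ==> PF (coords m) D ==> D k0 ~= 0 ==>
   (!!y. finite {k. (\<forall>i\<ge>m. k i = 0) & D k ~= 0 & (ALL i<m. N i k / D k = y i)}) ==>
   EX k1. D k1 ~= 0 & (ALL E. eventually E (nbm nb m k1) -->
   eventually (%y. EX k. E k & D k ~= 0 & (ALL i<m. N i k / D k = y i)) (nbm nb m (%i. N i k1 / D k1)))"
begin

lemma tends_const: "filterlim (%_. c) (nb c) F"
 unfolding filterlim_iff using nb_at by (auto intro: always_eventually)

lemma tends_add: "filterlim f (nb a) F ==> filterlim g (nb b) F ==> filterlim (%x. f x + g x) (nb (a + b)) F"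
 using filterlim_compose[OF nb_add filterlim_Pair] by fastforce

lemma tends_mult: "filterlim f (nb a) F ==> filterlim g (nb b) F ==> filterlim (%x. f x * g x) (nb (a * b)) F"
 using filterlim_compose[OF nb_mult filterlim_Pair] by fastforce

lemma tends_divide:
 assumes "filterlim f (nb a) F" "filterlim g (nb b) F" "b ~= 0"
 shows "filterlim (%x. f x / g x) (nb (a / b)) F"
 using tends_mult[OF assms(1) filterlim_compose[OF nb_inverse[OF assms(3)] assms(2)]] by (simp add: divide_inverse)

lemma tends_uminus: "filterlim f (nb a) F ==> filterlim (%x. - f x) (nb (- a)) F"
 using tends_mult[OF tends_const[of "-1"]] by fastforce

lemma tends_sum: "(!!i. i : I ==> filterlim (f i) (nb (a i)) F) ==> filterlim (%x. \<Sum>i\<in>I. f i x) (nb (\<Sum>i\<in>I. a i)) F"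
 by (induction I rule: infinite_finite_induct) (auto intro: tends_const tends_add)

lemma tends_power: "filterlim f (nb a) F ==> filterlim (%x. f x ^ (n::nat)) (nb (a ^ n)) F"
 by (induction n) (auto intro: tends_const tends_mult)

lemma tends_PF: "PF V f ==> (!!g. g : V ==> filterlim g (nb (g x0)) F) ==> filterlim f (nb (f x0)) F"
 by (induction rule: PF.induct) (auto intro: tends_const tends_add tends_mult)

lemma tends_nonzero: "filterlim f (nb a) F ==> a ~= 0 ==> eventually (%x. f x ~= 0) F"
 using nb_sep unfolding filterlim_iff by blast

lemma poly_lpoly: "poly (lpoly m c) x = (\<Sum>i<m. c i * x ^ i)"
 unfolding lpoly_def by (simp add: poly_sum poly_monom)

lemma tends_poly_lpoly:
 "(!!i. i < m ==> filterlim (%x. c x i) (nb (c0 i)) F) ==> filterlim f (nb b) F ==>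
  filterlim (%x. poly (lpoly m (c x)) (f x)) (nb (poly (lpoly m c0) b)) F"
 unfolding poly_lpoly by (intro tends_sum tends_mult tends_power) auto

lemma tends_coord: "g : coords m ==> filterlim g (nb (g k)) (nbm nb m k)"
 using filterlim_nbm[of "%x. x" nb m k "nbm nb m k"] by (auto simp: coords_def filterlim_ident)

text \<open>Put \<open>\<alpha> = k1(a)\<close>, a root of the polynomial of \<open>k1\<close>
  modulo \<open>Q\<close>. Openness at \<open>k1\<close> shows that all nearby monic polynomials
  have a root \<open>k(a)\<close> near \<open>\<alpha>\<close>. For \<open>p\<close> near
  \<open>Q\<close> the polynomial of \<open>k1\<close> modulo \<open>p\<close> is such a neighbour,
  and \<open>inv_el\<close> maps its root to a root of \<open>p\<close>; by continuity the latter is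
  near \<open>inv_el\<close> at \<open>\<alpha>\<close>, which is \<open>a\<close>.\<close>

theorem separable_root_persists:
 assumes Q: "degree Q = m" "coeff Q m = 1" and cop: "coprime Q (pderiv Q)" and root: "poly Q a = 0"
  and E: "eventually E (nb a)"
 shows "eventually (%p. EX b. E b & poly (mpoly m p) b = 0) (nbm nb m (coeff Q))"
proof -
 define q where "q = coeff Q"
 have Qq: "mpoly m q = Q" unfolding q_def by (rule mpoly_coeff[OF Q])
 have m: "m > 0"
 proof (rule ccontr)
  assume "\<not> m > 0"
  hence "Q = 1" using Q by (metis degree_eq_zeroE coeff_pCons_0 gr0I one_pCons)
  thus False using root by simp
 qed
 have crd: "PF (coords m) (%x. x i)" if "i < m" for i using that by (intro PF.base) (auto simp: coords_def)
 let ?N = "%i k. - num m q k (kp m q k m) i" and ?D = "%k. den m q k"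
 have chp: "?N i k / ?D k = chp m q k i" for i k by (simp add: chp_def[OF m])
 note pf1 = PF_kp[where P = "%_. q" and k = "%k. k", OF m PF.const crd] PF_den[where P = "%_. q" and k = "%k. k", OF m PF.const crd]
  PF_num[where P = "%_. q" and k = "%k. k", OF m PF.const crd]
 \<comment> \<open>The modulus is fixed and \<open>k\<close> varies: this is the map to which
   \<open>gen\<close> is applied.\<close>
 have "EX k1. ?D k1 ~= 0 & (ALL E. eventually E (nbm nb m k1) -->
   eventually (%y. EX k. E k & ?D k ~= 0 & (ALL i<m. ?N i k / ?D k = y i)) (nbm nb m (%i. ?N i k1 / ?D k1)))"
 proof (rule gen)
  show "PF (coords m) (?N i)" if "i < m" for i by (intro PF_uminus pf1(3) pf1(1) that)
  show "PF (coords m) ?D" by (rule pf1(2))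
  show "?D (xm m q 1) ~= 0" unfolding den_X[OF m] by (rule one_neq_zero)
  show "finite {k. (\<forall>i\<ge>m. k i = 0) & ?D k ~= 0 & (ALL i<m. ?N i k / ?D k = y i)}" for y
   unfolding chp by (rule finite_chp_fibre[OF m]) (use cop Qq in simp)
 qed
 then obtain k1 where k1: "den m q k1 ~= 0" and op: "!!E. eventually E (nbm nb m k1) ==>
   eventually (%y. EX k. E k & den m q k ~= 0 & (ALL i<m. chp m q k i = y i)) (nbm nb m (chp m q k1))"
  unfolding chp by blast
 let ?\<alpha> = "poly (lpoly m k1) a"
 have dvd_root: "poly (mpoly m y) (poly (lpoly m k) a) = 0" if "den m q k ~= 0" "ALL i<m. chp m q k i = y i" for k y
 proof -
  have "mpoly m (chp m q k) = mpoly m y" using that(2) by (intro poly_eqI) (auto simp: coeff_mpoly)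
  hence "Q dvd pcompose (mpoly m y) (lpoly m k)" using chp_root[OF m that(1)] Qq by simp
  hence "poly (pcompose (mpoly m y) (lpoly m k)) a = 0" using root by (auto simp: dvd_def)
  thus ?thesis by (simp add: poly_pcompose)
 qed
 have h1: "poly (lpoly m (inv_el m q k1)) ?\<alpha> = a"
 proof -
  have "Q dvd pcompose (lpoly m (inv_el m q k1)) (lpoly m k1) - [:0, 1:]" using inv_el[OF m k1] Qq by simp
  then obtain s where e: "pcompose (lpoly m (inv_el m q k1)) (lpoly m k1) - [:0, 1:] = Q * s" by (rule dvdE)
  have "poly (pcompose (lpoly m (inv_el m q k1)) (lpoly m k1) - [:0, 1:]) a = 0" unfolding e using root by simp
  thus ?thesis by (simp add: poly_pcompose)
 qed
 \<comment> \<open>Now the roles change: \<open>k1\<close> is fixed and the modulus varies.\<close>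
 note pf2 = PF_kp[where P = "%p. p" and k = "%_. k1", OF m crd PF.const] PF_den[where P = "%p. p" and k = "%_. k1", OF m crd PF.const]
  PF_num[where P = "%p. p" and k = "%_. k1", OF m crd PF.const] PF_xm[where P = "%p. p" and k = "%_. k1", OF m crd PF.const]
 note lim = tends_PF[OF _ tends_coord]
 have dl: "filterlim (%p. den m p k1) (nb (den m q k1)) (nbm nb m q)" by (rule lim[OF pf2(2)])
 have cl: "filterlim (%p. chp m p k1 i) (nb (chp m q k1 i)) (nbm nb m q)" if "i < m" for i
  unfolding chp_def[OF m] by (intro tends_uminus tends_divide dl k1 lim[OF pf2(3)] pf2(1) that)
 have hl: "filterlim (%p. inv_el m p k1 i) (nb (inv_el m q k1 i)) (nbm nb m q)" if "i < m" for i
  unfolding inv_el_def[OF m] by (intro tends_divide dl k1 lim[OF pf2(3)] pf2(4) that)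
 have "filterlim (%x. poly (lpoly m (inv_el m (fst x) k1)) (snd x)) (nb (poly (lpoly m (inv_el m q k1)) ?\<alpha>)) (nbm nb m q \<times>\<^sub>F nb ?\<alpha>)"
  by (rule tends_poly_lpoly[OF filterlim_compose[OF hl filterlim_fst] filterlim_snd])
 hence "eventually (%x. E (poly (lpoly m (inv_el m (fst x) k1)) (snd x))) (nbm nb m q \<times>\<^sub>F nb ?\<alpha>)"
  using E unfolding h1 filterlim_iff by blast
 then obtain A B where A: "eventually A (nbm nb m q)" and B: "eventually B (nb ?\<alpha>)"
  and AB: "!!p b. A p ==> B b ==> E (poly (lpoly m (inv_el m p k1)) b)"
  unfolding eventually_prod_filter by auto
 have "filterlim (%k. poly (lpoly m k) a) (nb ?\<alpha>) (nbm nb m k1)"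
  by (rule tends_poly_lpoly[OF _ tends_const]) (use tends_coord in \<open>auto simp: coords_def\<close>)
 hence "eventually (%k. B (poly (lpoly m k) a)) (nbm nb m k1)" using B unfolding filterlim_iff by blast
 from op[OF this] have "eventually (%y. EX b. B b & poly (mpoly m y) b = 0) (nbm nb m (chp m q k1))"
  by (rule eventually_mono) (use dvd_root in blast)
 moreover have "filterlim (%p. chp m p k1) (nbm nb m (chp m q k1)) (nbm nb m q)" unfolding filterlim_nbm using cl by blast
 ultimately have ev1: "eventually (%p. EX b. B b & poly (mpoly m (chp m p k1)) b = 0) (nbm nb m q)"
  unfolding filterlim_iff by blast
 have "eventually (%p. EX b. E b & poly (mpoly m p) b = 0) (nbm nb m q)"
  using ev1 A tends_nonzero[OF dl k1]
 proof eventually_elim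
  case (elim p)
  obtain b where b: "B b" "poly (mpoly m (chp m p k1)) b = 0" using elim(1) by blast
  have "mpoly m (chp m p k1) dvd pcompose (mpoly m p) (lpoly m (inv_el m p k1))" by (rule chp_dvd[OF m elim(3)])
  hence "poly (pcompose (mpoly m p) (lpoly m (inv_el m p k1))) b = 0" using b(2) by (auto simp: dvd_def)
  thus ?case using AB[OF elim(2) b(1)] by (auto simp: poly_pcompose)
 qed
 thus ?thesis unfolding q_def .
qed

end

section \<open>Polynomials in two variables and largeness\<close>

definition hv :: "('k::field_gcd poly => 'r::comm_ring_1) => 'r => 'k poly poly => 'r" where
 "hv h v P = poly (map_poly h P) v"

lemma map_poly_pCons0: "f 0 = 0 ==> map_poly f (pCons c p) = pCons (f c) (map_poly f p)"
 by (rule poly_eqI) (simp add: coeff_map_poly coeff_pCons split: nat.split)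

context
 fixes h :: "'k::field_gcd poly => 'r::comm_ring_1" assumes h: "comm_ring_hom h"
begin

interpretation h: map_poly_comm_ring_hom h using h by (intro map_poly_comm_ring_hom.intro)

lemma hv_add: "hv h v (P + Q) = hv h v P + hv h v Q" unfolding hv_def by (simp add: h.hom_add)
lemma hv_mult: "hv h v (P * Q) = hv h v P * hv h v Q" unfolding hv_def by (simp add: h.hom_mult)
lemma hv_diff: "hv h v (P - Q) = hv h v P - hv h v Q" unfolding hv_def by (simp add: h.hom_minus)
lemma hv_one: "hv h v 1 = 1" unfolding hv_def by simp
lemma hv_zero: "hv h v 0 = 0" unfolding hv_def by simp
lemma hv_pCons: "hv h v (pCons q P) = h q + v * hv h v P"
 unfolding hv_def by (simp add: map_poly_pCons0)
lemma hv_const: "hv h v [:q:] = h q" by (simp add: hv_pCons hv_zero)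
lemma hv_dvd: "P dvd Q ==> hv h v P = 0 ==> hv h v Q = 0" by (auto simp: dvd_def hv_mult)
lemma hv_of_nat: "hv h v (of_nat n) = of_nat n" by (induction n) (simp_all add: hv_zero hv_add hv_one)

end

lemma hom_poly: "comm_ring_hom (%q. poly q x)" by unfold_locales auto
lemma hom_pcompose: "comm_ring_hom (%q. pcompose q u)" by unfold_locales (auto simp: pcompose_add pcompose_mult pcompose_1)
lemma hom_ev: "comm_ring_hom (ev r)" by unfold_locales (auto simp: ev_simps)

text \<open>Evaluation at a point, restriction to a parametrized curve (\<open>sb\<close>) and
  evaluation in the algebraic closure are all instances of \<open>hv\<close>, so the ring laws are
  proved once.\<close>

definition p2 :: "'k::field_gcd poly poly => 'k => 'k => 'k" where "p2 P x y = hv (%q. poly q x) y P"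
definition sb :: "'k::field_gcd poly => 'k poly => 'k poly poly => 'k poly" where "sb u v P = hv (%q. pcompose q u) v P"

lemmas p2_simps = hv_add[OF hom_poly, folded p2_def] hv_mult[OF hom_poly, folded p2_def] hv_diff[OF hom_poly, folded p2_def]
 hv_one[OF hom_poly, folded p2_def] hv_zero[OF hom_poly, folded p2_def] hv_pCons[OF hom_poly, folded p2_def]
lemmas sb_pCons = hv_pCons[OF hom_pcompose, folded sb_def] and sb_zero = hv_zero[OF hom_pcompose, folded sb_def]

lemma poly_sb: "poly (sb u v P) s = p2 P (poly u s) (poly v s)"
 by (induction P) (simp_all add: sb_pCons sb_zero p2_simps poly_pcompose)

lemma ev_sb: "ev r (sb u v P) = hv (ev (ev r u)) (ev r v) P"
 by (induction P) (simp_all add: sb_pCons sb_zero hv_zero[OF hom_ev] hv_pCons[OF hom_ev] ev_simps ev_pcompose)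

lemma pderiv_sb: "pderiv (sb u v P) = pderiv u * sb u v (map_poly pderiv P) + pderiv v * sb u v (pderiv P)"
proof (induction P)
 case 0
 thus ?case by (simp add: sb_zero)
next
 case (pCons q P)
 have s: "sb u v (P + Q) = sb u v P + sb u v Q" for P Q unfolding sb_def by (rule hv_add[OF hom_pcompose])
 show ?case
  by (simp add: sb_pCons map_poly_pCons0 pderiv_pCons s pderiv_add pderiv_mult pderiv_pcompose pCons.IH algebra_simps)
qed

lemma ev_pCons: "ev r (pCons c p) = to_ac c + r * ev r p"
 unfolding ev_def by (simp add: map_poly_pCons0)

lemma ev_monom: "ev r (monom c i) = to_ac c * r ^ i"
 by (induction i) (simp_all add: monom_0 monom_Suc ev_pCons ev_simps)

lemma ev_to_ac: "ev (to_ac s) p = to_ac (poly p s)"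
 by (induction p) (simp_all add: ev_pCons ev_simps)

lemma coprimeI_ev:
 fixes f g :: "'k::field_gcd poly"
 assumes "f ~= 0" "!!r. ev r f = 0 ==> ev r g ~= 0" shows "coprime f g"
proof (rule ccontr)
 assume "\<not> coprime f g"
 hence u: "\<not> is_unit (gcd f g)" unfolding is_unit_gcd .
 have "gcd f g ~= 0" using assms(1) by simp
 hence "degree (gcd f g) > 0" using u by (metis gr0I is_unit_iff_degree)
 then obtain r where r: "ev r (gcd f g) = 0" by (rule ev_root)
 hence "ev r f = 0" "ev r g = 0" using ev_dvd[OF gcd_dvd1] ev_dvd[OF gcd_dvd2] by blast+
 thus False using assms(2) by blast
qed

text \<open>The element of least degree of the ideal generated by two polynomials in \<open>y\<close> without common
 prime factor does not involve \<open>y\<close>.\<close>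

lemma eliminate:
 fixes p q :: "'k::field_gcd poly poly"
 assumes p: "prime_elem p" "degree p > 0" and q: "\<not> p dvd q"
 obtains D A B where "D ~= 0" "[:D:] = A * p + B * q"
proof -
 define I where "I g \<longleftrightarrow> g ~= 0 & (EX A B. g = A * p + B * q)" for g
 have p0: "p ~= 0" using p by auto
 have "I p" unfolding I_def using p0 by (metis add.right_neutral mult_1 mult_zero_left)
 then obtain g where g: "I g" "!!g'. I g' ==> degree g \<le> degree g'"
  using ex_has_least_nat[of I p degree] by blast
 obtain A B where AB: "g = A * p + B * q" and g0: "g ~= 0" using g(1) unfolding I_def by blast
 have div: "EX a s. a ~= 0 & smult a f = g * s" if f: "f = C * p + E * q" for f C E
 proof -
  obtain a s where as: "a ~= 0" "smult a f = g * s + pseudo_mod f g" using pseudo_mod(1)[OF g0] by metis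
  have "pseudo_mod f g = (smult a C - s * A) * p + (smult a E - s * B) * q"
  proof -
   have "pseudo_mod f g = smult a f - g * s" using as(2) by simp
   thus ?thesis unfolding f AB by (simp add: algebra_simps smult_add_right)
  qed
  hence "pseudo_mod f g = 0" using g(2)[of "pseudo_mod f g"] pseudo_mod(2)[OF g0, of f] unfolding I_def by fastforce
  thus ?thesis using as by auto
 qed
 have "degree g = 0"
 proof (rule ccontr)
  assume dg: "degree g ~= 0"
  obtain a s where s: "a ~= 0" "smult a p = g * s" using div[of p 1 0] by auto
  obtain a' s' where s': "a' ~= 0" "smult a' q = g * s'" using div[of q 0 1] by auto
  have nd: "\<not> p dvd [:c:]" if "c ~= 0" for c
   using dvd_imp_degree_le[of p "[:c:]"] that p(2) by auto
  have "p dvd g * s" using s(2) by (metis dvd_triv_right mult.left_neutral smult_one mult_smult_left dvd_smult dvd_refl)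
  then consider "p dvd g" | "p dvd s" using p(1) by (metis prime_elem_dvd_mult_iff)
  thus False
  proof cases
   case 1
   hence "p dvd [:a':] * q" using s'(2) by (simp add: dvd_mult2)
   thus False using p(1) q nd[OF s'(1)] by (metis prime_elem_dvd_mult_iff)
  next
   case 2
   then obtain w where w: "s = p * w" by (rule dvdE)
   have "p * [:a:] = p * (g * w)" using s(2) w by (simp add: mult.left_commute)
   hence e: "[:a:] = g * w" by (rule mult_left_cancel[OF p0, THEN iffD1])
   hence "w ~= 0" using s(1) by auto
   hence "degree ([:a:]) = degree g + degree w" unfolding e using g0 by (rule degree_mult_eq[rotated])
   thus False using dg by simp
  qed
 qed
 then obtain D where D: "g = [:D:]" by (rule degree_eq_zeroE)
 show thesis by (rule that[of D A B]) (use D AB g0 in auto)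
qed

text \<open>Otherwise the polynomial \<open>g\<close> of least degree that vanishes at
  \<open>X\<close> would divide every coefficient of \<open>p\<close>. As \<open>p\<close> is prime
  and involves \<open>y\<close>, this makes \<open>g\<close> a unit, although it has a root.\<close>

lemma hv_ev_nonzero:
 fixes p :: "'k::field_gcd poly poly"
 assumes p: "prime_elem p" "degree p > 0" and D: "D ~= 0" "ev X D = 0"
 shows "map_poly (ev X) p ~= 0"
proof
 assume z: "map_poly (ev X) p = 0"
 have c0: "ev X (coeff p i) = 0" for i
  using arg_cong[OF z, of "%q. coeff q i"] by (simp add: coeff_map_poly ev_simps)
 obtain g where g: "g ~= 0 & ev X g = 0" "!!g'. g' ~= 0 & ev X g' = 0 ==> degree g \<le> degree g'"
  using ex_has_least_nat[of "%g. g ~= 0 & ev X g = 0" D degree] D by blast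
 have "g dvd f" if "ev X f = 0" for f
 proof -
  have "ev X (f div g * g + f mod g) = 0" using that by simp
  hence "ev X (f mod g) = 0" using g(1) by (simp only: ev_simps) simp
  hence "f mod g = 0" using g(2)[of "f mod g"] degree_mod_less[of g f] g(1) by fastforce
  thus ?thesis by (rule mod_0_imp_dvd)
 qed
 hence "[:g:] dvd p" using c0 by (simp add: const_poly_dvd_iff)
 then obtain w where w: "p = [:g:] * w" by (rule dvdE)
 have p0: "p ~= 0" using p by auto
 have "p dvd [:g:] \<or> p dvd w" using p(1) w by (metis dvd_refl prime_elem_dvd_mult_iff)
 thus False
 proof
  assume "p dvd [:g:]"
  thus False using dvd_imp_degree_le[of p "[:g:]"] g(1) p(2) by simp
 next
  assume "p dvd w"
  then obtain w' where "w = p * w'" by (rule dvdE)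
  hence "p * 1 = p * ([:g:] * w')" using w by (simp add: mult.left_commute)
  hence "1 = [:g:] * w'" using p0 by (metis mult_cancel_left)
  hence "[:g:] dvd 1" by (metis dvd_triv_left)
  hence "is_unit g" by (simp add: is_unit_const_poly_iff)
  hence "ev X 1 = 0" using ev_dvd[of g 1 X] g(1) by simp
  thus False by (simp add: ev_simps)
 qed
qed

text \<open>Some prime factor vanishes at the point; by the product rule the zero is simple for it
  as well.\<close>

lemma simple_prime_factor:
 fixes P :: "'k::field_gcd poly poly"
 assumes "p2 P a b = 0" "p2 (pderiv P) a b ~= 0"
 obtains p where "prime_elem p" "p dvd P" "p2 p a b = 0" "p2 (pderiv p) a b ~= 0"
proof -
 have P0: "P ~= 0" using assms(2) by (auto simp: p2_simps)
 have "EX p. prime_elem p & p dvd Q & p2 p a b = 0" if "Q ~= 0" "p2 Q a b = 0" for Q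
  using that
 proof (induction Q rule: prime_divisors_induct)
  case (unit Q)
  from unit.hyps obtain Q' where Q': "1 = Q * Q'" by (rule dvdE)
  have "p2 (Q * Q') a b = 1" unfolding Q'[symmetric] by (simp add: p2_simps)
  thus ?case using unit.prems(2) by (simp add: p2_simps)
 next
  case (factor q Q)
  have "p2 q a b = 0 \<or> p2 Q a b = 0" using factor.prems(2) by (simp add: p2_simps)
  thus ?case
  proof
   assume "p2 q a b = 0"
   thus ?thesis using factor.hyps by (auto intro: dvd_triv_left prime_imp_prime_elem)
  next
   assume "p2 Q a b = 0"
   moreover have "Q ~= 0" using factor.prems(1) by auto
   ultimately show ?thesis using factor.IH dvd_mult by blast
  qed
 qed auto
 then obtain p where p: "prime_elem p" "p dvd P" "p2 p a b = 0" using P0 assms(1) by blast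
 obtain r where r: "P = p * r" using p(2) by (rule dvdE)
 have "p2 (pderiv P) a b = p2 (pderiv p) a b * p2 r a b" unfolding r by (simp add: pderiv_mult p2_simps p(3))
 thus thesis using that[OF p] assms(2) by auto
qed

lemma degree_sb_le: "(!!i. i \<le> degree p ==> degree (pcompose (coeff p i) u * v ^ i) \<le> d) ==> degree (sb u v p) \<le> d"
 and coeff_sb: "coeff (sb u v p) d = (\<Sum>i\<le>degree p. coeff (pcompose (coeff p i) u * v ^ i) d)"
proof -
 interpret h: map_poly_comm_ring_hom "%q. pcompose q u" using hom_pcompose by (intro map_poly_comm_ring_hom.intro)
 have "degree (map_poly (%q. pcompose q u) p) \<le> degree p" by (rule degree_map_poly_le)
 moreover have "coeff (map_poly (%q. pcompose q u) p) i = pcompose (coeff p i) u" for i by (simp add: coeff_map_poly)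
 moreover from this have "pcompose (coeff p i) u = 0" if "degree (map_poly (%q. pcompose q u) p) < i" for i
  using coeff_eq_0[OF that] by simp
 ultimately have e: "sb u v p = (\<Sum>i\<le>degree p. pcompose (coeff p i) u * v ^ i)"
  unfolding sb_def hv_def poly_altdef
  by (intro sum.mono_neutral_cong_left) (auto simp: not_le dest: coeff_eq_0)
 show "degree (sb u v p) \<le> d" if "!!i. i \<le> degree p ==> degree (pcompose (coeff p i) u * v ^ i) \<le> d"
  unfolding e by (rule degree_sum_le) (use that in auto)
 show "coeff (sb u v p) d = (\<Sum>i\<le>degree p. coeff (pcompose (coeff p i) u * v ^ i) d)"
  unfolding e by (simp add: coeff_sum)
qed

text \<open>The curve is \<open>x = a + s\<close>, \<open>y = b + c s + l s^M\<close>, and a bad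
  \<open>l\<close> gives a multiple root \<open>s\<close> of the restriction of \<open>p\<close>. It
  is not \<open>0\<close>, where the derivative is \<open>1\<close> by the choice of
  \<open>c\<close>. Eliminating \<open>l\<close> shows that the point is a common zero of
  \<open>p\<close> and \<open>dl M\<close>. If \<open>p\<close> does not divide \<open>dl M\<close>,
  only finitely many \<open>s\<close> occur, for each of them finitely many \<open>y\<close>, and
  these determine \<open>l\<close>.\<close>

lemma large_curve_bad_slopes:
 fixes p :: "'k::field_gcd poly poly"
 assumes p: "prime_elem p" and pab: "p2 p a b = 0" and py: "p2 (pderiv p) a b ~= 0"
  and c: "p2 (map_poly pderiv p) a b + c * p2 (pderiv p) a b = 1"
 shows "EX M:{M0, Suc M0}. M0 \<ge> 2 --> finite {l. \<not> coprime (sb [:a, 1:] ([:b, c:] + monom l M) p) (pderiv (sb [:a, 1:] ([:b, c:] + monom l M) p))}"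
proof -
 define x where "x = [:-a, 1:]"
 \<comment> \<open>On the curve this polynomial takes the value \<open>l s^M\<close>.\<close>
 define ll where "ll = [:- ([:b:] + smult c x), 1:]"
 \<comment> \<open>On the curve this is \<open>s\<close> times the derivative of the restriction of
   \<open>p\<close>, with \<open>l s^M\<close> replaced by \<open>ll\<close>; so it does not depend
   on \<open>l\<close>.\<close>
 define dl where "dl M = [:x:] * map_poly pderiv p + ([:smult c x:] + of_nat M * ll) * pderiv p" for M
 have dp: "degree p > 0"
 proof (rule ccontr)
  assume "\<not> degree p > 0"
  then obtain q where "p = [:q:]" by (auto elim: degree_eq_zeroE)
  hence "pderiv p = 0" by (simp add: pderiv_pCons)
  thus False using py by (simp add: p2_simps)
 qed
 have p0: "p ~= 0" using p by auto
 have "map_poly pderiv (1 :: 'k poly poly) = 0"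
 proof (rule poly_eqI)
  fix i show "coeff (map_poly pderiv (1 :: 'k poly poly)) i = coeff 0 i" by (cases i) (simp_all add: coeff_map_poly)
 qed
 hence llv: "p2 ll a b = 0" "p2 (pderiv ll) a b = 1" "p2 (map_poly pderiv ll) a b = - c"
  unfolding ll_def x_def by (simp_all add: p2_simps pderiv_pCons map_poly_pCons0 one_pCons[symmetric])
 \<comment> \<open>If \<open>p\<close> divided \<open>dl\<close> for both exponents, it would divide
   the difference \<open>ll * pderiv p\<close>, hence \<open>ll\<close>. Then the gradient of
   \<open>ll\<close> at \<open>(a, b)\<close> is a multiple of that of \<open>p\<close>; but the
   former kills the direction \<open>(1, c)\<close> and the latter has value \<open>1\<close> on
   it.\<close>
 have "EX M:{M0, Suc M0}. \<not> p dvd dl M"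
 proof (rule ccontr)
  assume "\<not> ?thesis"
  hence "p dvd dl (Suc M0) - dl M0" by (auto intro: dvd_diff)
  moreover have "dl (Suc M0) - dl M0 = ll * pderiv p" unfolding dl_def by (simp add: algebra_simps)
  ultimately have "p dvd ll \<or> p dvd pderiv p" using p by (metis prime_elem_dvd_mult_iff)
  moreover have "\<not> p dvd pderiv p"
  proof
   assume pd: "p dvd pderiv p"
   have "degree (pderiv p) < degree p"
   by (rule le_less_trans[OF degree_le[of "degree p - 1"]]) (use dp in \<open>auto simp: coeff_pderiv intro: coeff_eq_0\<close>)
   moreover have "degree p \<le> degree (pderiv p)" by (rule dvd_imp_degree_le[OF pd]) (use py in \<open>auto simp: p2_simps\<close>)
   ultimately show False by simp
  qed
  moreover have "\<not> p dvd ll"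
  proof
   assume "p dvd ll"
   then obtain w where w: "ll = p * w" by (rule dvdE)
   have y: "p2 (pderiv p) a b * p2 w a b = 1" using llv(2) unfolding w by (simp add: pderiv_mult p2_simps pab mult.commute)
   have hx: "map_poly pderiv (P * Q) = map_poly pderiv P * Q + P * map_poly pderiv Q" for P Q :: "'k poly poly"
   proof (rule poly_eqI)
   fix n
   have "coeff (map_poly pderiv (P * Q)) n = (\<Sum>i\<le>n. coeff P i * pderiv (coeff Q (n - i)) + coeff Q (n - i) * pderiv (coeff P i))"
   by (simp add: coeff_map_poly coeff_mult pderiv_sum pderiv_mult)
   also have "\<dots> = coeff (map_poly pderiv P * Q + P * map_poly pderiv Q) n"
   unfolding sum.distrib coeff_add coeff_mult by (simp add: coeff_map_poly mult.commute)
   finally show "coeff (map_poly pderiv (P * Q)) n = coeff (map_poly pderiv P * Q + P * map_poly pderiv Q) n" .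
   qed
   have "p2 (map_poly pderiv p) a b * p2 w a b = - c" using llv(3) unfolding w hx by (simp add: p2_simps pab)
   hence "(p2 (map_poly pderiv p) a b + c * p2 (pderiv p) a b) * p2 w a b = - c + c" using y by (simp add: algebra_simps)
   hence "p2 w a b = 0" using c by simp
   thus False using y by simp
  qed
  ultimately show False by blast
 qed
 then obtain M where M: "M : {M0, Suc M0}" "\<not> p dvd dl M" by blast
 have "finite {l. \<not> coprime (sb [:a, 1:] ([:b, c:] + monom l M) p) (pderiv (sb [:a, 1:] ([:b, c:] + monom l M) p))}" if "M0 \<ge> 2"
 proof -
  obtain D A B where D: "D ~= 0" "[:D:] = A * p + B * dl M" by (rule eliminate[OF p dp M(2)])
  let ?X = "%r. to_ac a + r"
  \<comment> \<open>Parameters \<open>s\<close> of possible multiple roots. Zero is left out because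
    \<open>l\<close> is recovered from \<open>y\<close> by dividing by \<open>r ^ M\<close>.\<close>
  define R where "R = {r. r ~= 0 & ev (?X r) D = 0}"
  have "finite ((%r. ?X r) ` R)" by (rule finite_subset[OF _ finite_ev_roots[OF D(1)]]) (auto simp: R_def)
  hence fR: "finite R" by (rule finite_imageD) (auto intro: inj_onI)
  define S where "S r = {l. hv (ev (?X r)) (to_ac b + to_ac c * r + to_ac l * r ^ M) p = 0}" for r
  have fS: "finite (S r)" if r: "r : R" for r
  proof -
   have "map_poly (ev (?X r)) p ~= 0" by (rule hv_ev_nonzero[OF p dp D(1)]) (use r in \<open>simp add: R_def\<close>)
   hence "finite {y. hv (ev (?X r)) y p = 0}" unfolding hv_def by (rule poly_roots_finite)
   moreover have "(%l. to_ac b + to_ac c * r + to_ac l * r ^ M) ` S r <= {y. hv (ev (?X r)) y p = 0}" unfolding S_def by auto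
   ultimately have "finite ((%l. to_ac b + to_ac c * r + to_ac l * r ^ M) ` S r)" by (rule finite_subset[rotated])
   thus ?thesis by (rule finite_imageD) (use r in \<open>auto simp: R_def intro!: inj_onI\<close>)
  qed
  have "l : (\<Union>r\<in>R. S r)" if l: "\<not> coprime (sb [:a, 1:] ([:b, c:] + monom l M) p) (pderiv (sb [:a, 1:] ([:b, c:] + monom l M) p))"
   for l
  proof -
   let ?u = "[:a, 1:]" and ?v = "[:b, c:] + monom l M"
   let ?F = "sb ?u ?v p"
   have M2: "M \<ge> 2" using M(1) that(1) \<open>M0 \<ge> 2\<close> by auto
   have v0: "poly ?v 0 = b" "poly (pderiv ?v) 0 = c" using M2
   by (auto simp: poly_monom pderiv_add pderiv_monom pderiv_pCons)
   have u0: "poly ?u 0 = a" "pderiv ?u = 1" by (simp_all add: pderiv_pCons)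
   have chain: "poly (pderiv (sb u v p)) 0 = poly (pderiv u) 0 * p2 (map_poly pderiv p) (poly u 0) (poly v 0) +
   poly (pderiv v) 0 * p2 (pderiv p) (poly u 0) (poly v 0)" for u v
   by (simp add: pderiv_sb poly_sb)
   have F'0: "poly (pderiv ?F) 0 = 1" unfolding chain v0 u0 using c by simp
   have F0: "?F ~= 0" using F'0 by auto
   have "EX r. ev r ?F = 0 & ev r (pderiv ?F) = 0" using coprimeI_ev[OF F0, of "pderiv ?F"] l by blast
   then obtain r where r: "ev r ?F = 0" "ev r (pderiv ?F) = 0" by blast
   have rn: "r ~= 0"
   proof
   assume "r = 0"
   hence "to_ac (poly (pderiv ?F) 0) = 0" using r(2) ev_to_ac[of 0 "pderiv ?F"] by simp
   thus False unfolding F'0 by simp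
   qed
   have ru: "ev r ?u = ?X r" by (simp add: ev_pCons ev_simps)
   have rv: "ev r ?v = to_ac b + to_ac c * r + to_ac l * r ^ M" by (simp add: ev_simps ev_pCons ev_monom mult.commute)
   let ?Y = "ev r ?v"
   have p1: "hv (ev (?X r)) ?Y p = 0" using r(1) unfolding ev_sb ru .
   have rp: "r * ev r (pderiv ?v) = to_ac c * r + of_nat M * (to_ac l * r ^ M)"
   using M2 by (simp add: pderiv_add pderiv_monom pderiv_pCons ev_simps ev_pCons ev_monom ring_distribs) (simp add: power_eq_if algebra_simps)
   have lv: "hv (ev (?X r)) ?Y ll = to_ac l * r ^ M"
   unfolding ll_def x_def rv by (simp add: hv_pCons[OF hom_ev] hv_zero[OF hom_ev] hv_one[OF hom_ev] ev_simps ev_pCons smult_add_right algebra_simps)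
   have "hv (ev (?X r)) ?Y (dl M) = r * hv (ev (?X r)) ?Y (map_poly pderiv p) + (to_ac c * r + of_nat M * (to_ac l * r ^ M)) * hv (ev (?X r)) ?Y (pderiv p)"
   unfolding dl_def hv_add[OF hom_ev] hv_mult[OF hom_ev] hv_of_nat[OF hom_ev] lv hv_const[OF hom_ev] x_def
   by (simp add: ev_simps ev_pCons) (simp add: algebra_simps)
   also have "\<dots> = r * (ev r (pderiv ?u) * hv (ev (?X r)) ?Y (map_poly pderiv p) + ev r (pderiv ?v) * hv (ev (?X r)) ?Y (pderiv p))"
   unfolding rp[symmetric] u0 by (simp add: ev_simps algebra_simps)
   also have "\<dots> = r * ev r (pderiv ?F)" unfolding pderiv_sb ev_simps ev_sb ru ..
   finally have "hv (ev (?X r)) ?Y (dl M) = 0" using r(2) by simp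
   hence "hv (ev (?X r)) ?Y [:D:] = 0" unfolding D(2) hv_add[OF hom_ev] hv_mult[OF hom_ev] p1 by simp
   hence "r : R" unfolding hv_const[OF hom_ev] R_def using rn by simp
   moreover have "l : S r" using p1 unfolding rv S_def by simp
   ultimately show ?thesis by blast
  qed
  thus ?thesis by (intro finite_subset[OF _ finite_UN_I[OF fR fS]]) auto
 qed
 thus ?thesis using M(1) by blast
qed

context open_field
begin

lemma eventually_infinite: "eventually E (nb a) ==> infinite {x. E x}"
proof
 assume E: "eventually E (nb a)" and fin: "finite {x. E x}"
 have "eventually (%x. ALL y:{x. E x} - {a}. x ~= y) (nb a)"
  using fin by (intro eventually_ball_finite) (auto intro: nb_sep)
 with E have "eventually (%x. E x & (ALL y:{x. E x} - {a}. x ~= y)) (nb a)" by (rule eventually_conj)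
 from nb_nondiscrete[OF this] show False by blast
qed

lemma infinite_UNIV_field: "infinite (UNIV :: 'k set)"
 using eventually_infinite[OF eventually_True] by simp

lemma tends_coeff_mult:
 "(!!i. filterlim (%x. coeff (f x) i) (nb (coeff f0 i)) F) ==> (!!i. filterlim (%x. coeff (g x) i) (nb (coeff g0 i)) F) ==>
  filterlim (%x. coeff (f x * g x) i) (nb (coeff (f0 * g0) i)) F"
 unfolding coeff_mult by (intro tends_sum tends_mult)

lemma tends_coeff_power:
 "(!!i. filterlim (%x. coeff (f x) i) (nb (coeff f0 i)) F) ==>
  filterlim (%x. coeff (f x ^ n) i) (nb (coeff (f0 ^ n) i)) F"
proof (induction n arbitrary: i)
 case (Suc n)
 show ?case unfolding power_Suc by (rule tends_coeff_mult[OF Suc.prems Suc.IH[OF Suc.prems]])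
qed (simp add: tends_const)

text \<open>The curve of \<open>large_curve_bad_slopes\<close> is shifted by \<open>t\<close> in the
  \<open>y\<close>-direction. At \<open>t = 0\<close> the restriction of the prime factor
  \<open>p\<close> is separable with root \<open>0\<close>, so for all \<open>t\<close> near
  \<open>0\<close> it still has a root, and each \<open>t\<close> contributes its own zero.\<close>

theorem infinitely_many_zeros:
 fixes P :: "'k poly poly"
 assumes "p2 P a b = 0" "p2 (pderiv P) a b ~= 0"
 shows "infinite {(x, y). p2 P x y = 0}"
proof -
 obtain p where p: "prime_elem p" "p dvd P" "p2 p a b = 0" "p2 (pderiv p) a b ~= 0" by (rule simple_prime_factor[OF assms])
 have p0: "p ~= 0" using p by auto
 define c where "c = (1 - p2 (map_poly pderiv p) a b) / p2 (pderiv p) a b"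
 have c: "p2 (map_poly pderiv p) a b + c * p2 (pderiv p) a b = 1" unfolding c_def using p(4) by simp
 \<comment> \<open>An exponent above the degrees of all coefficients in \<open>x\<close>: then the
   highest power of \<open>y\<close> alone determines the degree and the leading coefficient of the
   restriction, independently of \<open>t\<close>. The summand \<open>2\<close> keeps value and
   tangent of the curve at \<open>s = 0\<close>.\<close>
 define M0 where "M0 = 2 + (\<Sum>i\<le>degree p. degree (coeff p i))"
 obtain M where M: "M : {M0, Suc M0}"
  and bad: "finite {l. \<not> coprime (sb [:a, 1:] ([:b, c:] + monom l M) p) (pderiv (sb [:a, 1:] ([:b, c:] + monom l M) p))}"
  using large_curve_bad_slopes[OF p(1,3,4) c, of M0] unfolding M0_def by auto
 have M2: "M \<ge> 2" using M unfolding M0_def by auto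
 have Md: "degree (coeff p i) < M" for i
 proof (cases "i \<le> degree p")
  case True
  hence "degree (coeff p i) \<le> (\<Sum>i\<le>degree p. degree (coeff p i))" by (intro member_le_sum) auto
  thus ?thesis using M unfolding M0_def by auto
 next
  case False
  thus ?thesis using M2 by (simp add: coeff_eq_0)
 qed
 have "infinite (UNIV - ({l. \<not> coprime (sb [:a, 1:] ([:b, c:] + monom l M) p) (pderiv (sb [:a, 1:] ([:b, c:] + monom l M) p))} \<union> {0}))"
  using infinite_UNIV_field bad by (intro Diff_infinite_finite) auto
 then obtain l where l: "l ~= 0" "coprime (sb [:a, 1:] ([:b, c:] + monom l M) p) (pderiv (sb [:a, 1:] ([:b, c:] + monom l M) p))"
  using infinite_imp_nonempty by blast
 let ?u = "[:a, 1:]"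
 define v where "v t = [:b + t, c:] + monom l M" for t
 define F where "F t = sb ?u (v t) p" for t
 have vd: "degree (v t) = M" "coeff (v t) M = l" for t
 proof -
  have dm: "degree (monom l M) = M" using l(1) by (rule degree_monom_eq)
  have "degree [:b + t, c:] < degree (monom l M)" unfolding dm using M2 by (simp add: degree_pCons_eq_if)
  thus "degree (v t) = M" unfolding v_def using dm by (simp add: degree_add_eq_right)
  show "coeff (v t) M = l" using M2 unfolding v_def by (simp add: coeff_pCons split: nat.split)
 qed
 define N where "N = degree p"
 define d where "d = degree (coeff p N) + M * N"
 have v0: "v t ~= 0" for t using vd(2)[of t] l(1) by auto
 have du: "degree (pcompose q ?u) = degree q" for q :: "'k poly" by (simp add: degree_pcompose)
 have dt: "degree (pcompose (coeff p i) ?u * v t ^ i) \<le> degree (coeff p i) + M * i" for i t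
  using degree_mult_le[of "pcompose (coeff p i) ?u" "v t ^ i"] degree_power_le[of "v t" i] unfolding du vd(1) by simp
 have lt: "degree (pcompose (coeff p i) ?u * v t ^ i) < d" if "i < N" for i t
 proof -
  have "M * Suc i \<le> M * N" using that by (intro mult_le_mono) auto
  thus ?thesis using dt[of i t] Md[of i] unfolding d_def by simp
 qed
 define \<kappa> where "\<kappa> = lead_coeff (pcompose (coeff p N) ?u) * l ^ N"
 have cN: "coeff p N ~= 0" unfolding N_def using p0 by simp
 have "pcompose (coeff p N) ?u ~= 0" using cN by (simp add: pcompose_eq_0_iff)
 hence k0: "\<kappa> ~= 0" unfolding \<kappa>_def using l(1) leading_coeff_0_iff by (metis mult_eq_0_iff power_not_zero)
 have top: "coeff (pcompose (coeff p N) ?u * v t ^ N) d = \<kappa>" for t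
 proof -
  have "degree (v t ^ N) = M * N" using v0 by (simp add: degree_power_eq vd(1))
  moreover have "coeff (v t ^ N) (M * N) = l ^ N"
   using lead_coeff_power[of "v t" N] \<open>degree (v t ^ N) = M * N\<close> by (simp add: vd)
  ultimately show ?thesis unfolding d_def \<kappa>_def using coeff_mult_degree_sum[of "pcompose (coeff p N) ?u" "v t ^ N"] by (simp add: du)
 qed
 have dF: "degree (F t) \<le> d" for t unfolding F_def
 proof (rule degree_sb_le)
  fix i assume "i \<le> degree p"
  thus "degree (pcompose (coeff p i) ?u * v t ^ i) \<le> d" using lt[of i t] dt[of i t] unfolding d_def N_def by (cases "i = degree p") auto
 qed
 have cF: "coeff (F t) d = \<kappa>" for t
 proof -
  have "coeff (F t) d = (\<Sum>i\<in>{..<N} \<union> {N}. coeff (pcompose (coeff p i) ?u * v t ^ i) d)"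
   unfolding F_def coeff_sb N_def by (rule sum.cong) auto
  also have "\<dots> = (\<Sum>i<N. coeff (pcompose (coeff p i) ?u * v t ^ i) d) + (\<Sum>i\<in>{N}. coeff (pcompose (coeff p i) ?u * v t ^ i) d)"
   by (rule sum.union_disjoint) auto
  also have "(\<Sum>i\<in>{N}. coeff (pcompose (coeff p i) ?u * v t ^ i) d) = \<kappa>" using top[of t] by simp
  also have "(\<Sum>i<N. coeff (pcompose (coeff p i) ?u * v t ^ i) d) = 0" by (rule sum.neutral) (use lt in \<open>auto intro: coeff_eq_0\<close>)
  finally show ?thesis by simp
 qed
 \<comment> \<open>Normalized to a monic polynomial of the fixed degree \<open>d\<close>, as
   required for perturbing coefficients.\<close>
 define Q where "Q t = smult (1 / \<kappa>) (F t)" for t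
 have Q: "degree (Q t) = d" "coeff (Q t) d = 1" for t
 proof -
  show "coeff (Q t) d = 1" unfolding Q_def using cF k0 by simp
  hence "d \<le> degree (Q t)" by (intro le_degree) simp
  moreover have "degree (Q t) \<le> d" unfolding Q_def using dF[of t] degree_smult_le[of "1 / \<kappa>" "F t"] by simp
  ultimately show "degree (Q t) = d" by simp
 qed
 have F0: "F 0 = sb ?u ([:b, c:] + monom l M) p" unfolding F_def v_def by simp
 have u: "is_unit [:1 / \<kappa>:]" using k0 by (simp add: is_unit_const_poly_iff dvd_field_iff)
 have sm: "smult (1 / \<kappa>) f = [:1 / \<kappa>:] * f" for f by simp
 have cop: "coprime (Q 0) (pderiv (Q 0))"
  unfolding Q_def F0 pderiv_smult unfolding sm coprime_mult_left_iff coprime_mult_right_iff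
  using l(2) is_unit_left_imp_coprime[OF u] is_unit_right_imp_coprime[OF u] by blast
 have pF: "poly (F t) s = p2 p (a + s) (b + t + c * s + l * s ^ M)" for t s
  unfolding F_def poly_sb v_def by (simp add: poly_monom algebra_simps)
 have root: "poly (Q 0) 0 = 0" unfolding Q_def using pF[of 0 0] p(3) M2 by (simp add: power_0_left)
 have per: "eventually (%q. EX s. True & poly (mpoly d q) s = 0) (nbm nb d (coeff (Q 0)))"
  by (rule separable_root_persists[OF Q cop root eventually_True])
 have "filterlim (%t. coeff (v t) i) (nb (coeff (v 0) i)) (nb 0)" for i
 proof (cases i)
  case 0
  have "filterlim (%t. b + t + coeff (monom l M) 0) (nb (b + 0 + coeff (monom l M) 0)) (nb 0)"
   by (intro tends_add tends_const filterlim_ident)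
  thus ?thesis unfolding v_def 0 by simp
 qed (simp add: v_def tends_const)
 hence "filterlim (%t. coeff (pcompose (coeff p i) ?u * v t ^ i) j) (nb (coeff (pcompose (coeff p i) ?u * v 0 ^ i) j)) (nb 0)" for i j
  by (intro tends_coeff_mult tends_coeff_power tends_const)
 hence "filterlim (%t. coeff (F t) i) (nb (coeff (F 0) i)) (nb 0)" for i
  unfolding F_def coeff_sb by (intro tends_sum)
 hence "filterlim (%t. coeff (Q t) i) (nb (coeff (Q 0) i)) (nb 0)" for i
  unfolding Q_def coeff_smult by (intro tends_mult tends_const)
 hence fl: "filterlim (%t. coeff (Q t)) (nbm nb d (coeff (Q 0))) (nb 0)" unfolding filterlim_nbm by blast
 from eventually_compose_filterlim[OF per fl] have "eventually (%t. EX s. poly (Q t) s = 0) (nb 0)"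
  unfolding mpoly_coeff[OF Q] by (rule eventually_mono) blast
 hence "infinite {t. EX s. poly (Q t) s = 0}" by (rule eventually_infinite)
 moreover have "poly (Q t) s = 0 \<longleftrightarrow> poly (F t) s = 0" for t s unfolding Q_def using k0 by simp
 ultimately have inf: "infinite {t. EX s. poly (F t) s = 0}" by simp
 define r where "r t = (SOME s. poly (F t) s = 0)" for t
 have r: "poly (F t) (r t) = 0" if "t : {t. EX s. poly (F t) s = 0}" for t unfolding r_def by (rule someI_ex) (use that in blast)
 let ?f = "%t. (a + r t, b + t + c * r t + l * r t ^ M)"
 \<comment> \<open>The first coordinate determines \<open>r t\<close>, and then the second
   determines \<open>t\<close>.\<close>
 have "inj_on ?f {t. EX s. poly (F t) s = 0}" by (rule inj_onI) auto
 hence "infinite (?f ` {t. EX s. poly (F t) s = 0})" using inf finite_imageD by blast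
 moreover have "?f ` {t. EX s. poly (F t) s = 0} <= {(x, y). p2 P x y = 0}"
 proof (rule image_subsetI)
  fix t assume "t : {t. EX s. poly (F t) s = 0}"
  hence "p2 p (a + r t) (b + t + c * r t + l * r t ^ M) = 0" using r pF by simp
  thus "?f t : {(x, y). p2 P x y = 0}" using hv_dvd[OF hom_poly p(2)] unfolding p2_def by simp
 qed
 ultimately show ?thesis by (rule infinite_super[rotated])
qed

end

section \<open>Transfer between type-class polynomials and polynomials over a record ring\<close>

lemma poly_sum_upto: "Polynomial.degree p \<le> n ==> poly p b = (\<Sum>i\<le>n. poly.coeff p i * b ^ i)" for b :: "'r::comm_ring_1"
 unfolding poly_altdef by (rule sum.mono_neutral_left) (auto simp: coeff_eq_0)

lemma UP_add_fun: "p : up R ==> q : up R ==> p \<oplus>\<^bsub>UP R\<^esub> q = (%i. p i \<oplus>\<^bsub>R\<^esub> q i)"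
 unfolding UP_def by simp

lemma UP_mult_fun: "p : up R ==> q : up R ==> p \<otimes>\<^bsub>UP R\<^esub> q = (%l. \<Oplus>\<^bsub>R\<^esub>i\<in>{..l}. p i \<otimes>\<^bsub>R\<^esub> q (l - i))"
 unfolding UP_def by simp

lemma UP_one_fun: "\<one>\<^bsub>UP R\<^esub> = (%i. if i = 0 then \<one>\<^bsub>R\<^esub> else \<zero>\<^bsub>R\<^esub>)"
 unfolding UP_def by simp

text \<open>An isomorphism from a type-class domain onto the carrier of a record ring; through it
  results on the polynomial type reach \<open>UP R\<close>.\<close>

locale rec_iso = cring R for R :: "('b, 'c) ring_scheme" (structure) +
 fixes s :: "'r::idom => 'b"
 assumes bij: "bij_betw s UNIV (carrier R)"
  and s_add: "s (x + y) = s x \<oplus> s y" and s_mult: "s (x * y) = s x \<otimes> s y" and s_one: "s 1 = \<one>"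
begin

lemma s_in [simp, intro]: "s x : carrier R" using bij by (auto simp: bij_betw_def)
lemma s_eq [simp]: "s x = s y \<longleftrightarrow> x = y" using bij by (auto simp: bij_betw_def dest: injD)
lemma s_surj: "y : carrier R ==> EX x. y = s x" using bij by (auto simp: bij_betw_def)

lemma s_zero: "s 0 = \<zero>"
proof -
 have "s 0 \<oplus> s 0 = s 0" using s_add[of 0 0] by simp
 thus ?thesis using add.l_cancel_one'[of "s 0" "s 0"] by simp
qed

lemma s_sum: "s (\<Sum>i\<in>A. f i) = (\<Oplus>i\<in>A. s (f i))" if "finite A"
 using that by (induction A rule: finite_induct) (simp_all add: s_zero s_add Pi_iff)

lemma s_pow: "s (x ^ n) = s x [^] (n::nat)"
 by (induction n) (simp_all add: s_one s_mult m_comm)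

lemma s_nat: "s (of_nat n * x) = [n] \<cdot> s x"
 by (induction n) (simp_all add: s_zero s_add distrib_right a_comm)

definition "sP g = (%i. s (poly.coeff g i))"

lemma sP_up: "sP g : up R"
 unfolding up_def sP_def by (auto intro!: exI[of _ "Polynomial.degree g"] bound.intro simp: s_zero coeff_eq_0)

lemma sP_in [simp, intro]: "sP g : carrier (UP R)" using sP_up by (simp add: UP_def)

lemma coeff_sP [simp]: "up_ring.coeff (UP R) (sP g) i = s (poly.coeff g i)" using sP_up by (simp add: UP_def) (simp add: sP_def)

lemma sP_surj: assumes p: "p : carrier (UP R)" shows "EX g. p = sP g"
proof -
 have p': "p : up R" using p by (simp add: UP_def)
 then obtain n where n: "bound \<zero> n p" and pc: "!!i. p i : carrier R" by (auto simp: up_def)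
 let ?g = "\<Sum>i\<le>n. Polynomial.monom (inv_into UNIV s (p i)) i"
 have "s (poly.coeff ?g i) = p i" for i
 proof (cases "i \<le> n")
  case True
  have "p i : range s" using pc bij by (simp add: bij_betw_def)
  thus ?thesis using True by (simp add: coeff_sum f_inv_into_f)
 next
  case False
  thus ?thesis using n by (simp add: coeff_sum s_zero bound_def)
 qed
 hence "p = sP ?g" unfolding sP_def by (intro ext) simp
 thus ?thesis by blast
qed

sublocale UP_cring R "UP R" by unfold_locales auto

text \<open>As the polynomial ring satisfies the same locale, the construction can be iterated,
  which yields the polynomials in two variables.\<close>

lemma rec_iso_UP: "rec_iso (UP R) sP"
proof (intro rec_iso.intro rec_iso_axioms.intro)
 show "cring (UP R)" by (rule UP_cring)
 show "bij_betw sP UNIV (carrier (UP R))" unfolding bij_betw_def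
 proof
  show "inj sP" by (rule injI) (auto simp: sP_def fun_eq_iff intro: poly_eqI)
  show "range sP = carrier (UP R)" using sP_surj by blast
 qed
 show "sP (g + h) = sP g \<oplus>\<^bsub>UP R\<^esub> sP h" for g h
 proof -
  have "sP g \<oplus>\<^bsub>UP R\<^esub> sP h = (%i. sP g i \<oplus> sP h i)" by (rule UP_add_fun[OF sP_up sP_up])
  thus ?thesis by (simp only:) (simp only: sP_def Polynomial.coeff_add s_add)
 qed
 show "sP (g * h) = sP g \<otimes>\<^bsub>UP R\<^esub> sP h" for g h
 proof -
  have "sP g \<otimes>\<^bsub>UP R\<^esub> sP h = (%l. \<Oplus>i\<in>{..l}. sP g i \<otimes> sP h (l - i))" by (rule UP_mult_fun[OF sP_up sP_up])
  thus ?thesis by (simp only:) (simp only: sP_def Polynomial.coeff_mult s_sum[OF finite_atMost] s_mult)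
 qed
 show "sP 1 = \<one>\<^bsub>UP R\<^esub>" unfolding UP_one_fun sP_def by (rule ext) (simp add: s_zero s_one)
qed

lemma degree_le_deg: "Polynomial.degree g \<le> deg R (sP g)"
proof (rule degree_le, intro allI impI)
 fix i assume "deg R (sP g) < i"
 hence "up_ring.coeff (UP R) (sP g) i = \<zero>" by (rule deg_aboveD) simp
 thus "poly.coeff g i = 0" using s_eq[of "poly.coeff g i" 0] by (simp add: s_zero)
qed

lemma eval_sP:
 assumes S: "rec_iso S s'" and phi: "!!x. phi (s x) = s' (h x)" and h0: "h 0 = 0"
 shows "UnivPoly.eval R S phi (s' b) (sP g) = s' (poly (map_poly h g) b)"
proof -
 interpret S: rec_iso S s' by (rule S)
 have "Polynomial.degree (map_poly h g) \<le> deg R (sP g)" using degree_map_poly_le[of h g] degree_le_deg[of g] by simp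
 hence "poly (map_poly h g) b = (\<Sum>i\<le>deg R (sP g). h (poly.coeff g i) * b ^ i)"
  by (subst poly_sum_upto) (simp_all add: coeff_map_poly h0)
 thus ?thesis unfolding UnivPoly.eval_def by (simp add: phi S.s_sum S.s_mult S.s_pow)
qed

lemma poly_deriv_sP: "poly_deriv R (sP g) = sP (pderiv g)"
 unfolding poly_deriv_def by (simp only: coeff_sP s_nat[symmetric]) (simp add: sP_def coeff_pderiv)

end

inductive PFK :: "('b, 'c) ring_scheme => nat => ((nat => 'b) => 'b) => bool" for K m where
 coord: "i < m ==> PFK K m (%k. k i)"
| const: "c : carrier K ==> PFK K m (%_. c)"
| add: "PFK K m f ==> PFK K m g ==> PFK K m (%x. f x \<oplus>\<^bsub>K\<^esub> g x)"
| mult: "PFK K m f ==> PFK K m g ==> PFK K m (%x. f x \<otimes>\<^bsub>K\<^esub> g x)"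

text \<open>The record counterpart of \<open>gen\<close> in \<open>open_field\<close>, with tuples
  in the extensional function space and products of open sets in place of filters.\<close>

definition generically_open :: "('b, 'c) ring_scheme => 'b topology => bool" where
 "generically_open K \<rho> \<longleftrightarrow> (ALL m N D k0. (ALL i<m. PFK K m (N i)) & PFK K m D & k0 : {..<m} \<rightarrow>\<^sub>E carrier K & D k0 ~= \<zero>\<^bsub>K\<^esub> &
   (ALL y. finite {k : {..<m} \<rightarrow>\<^sub>E carrier K. D k ~= \<zero>\<^bsub>K\<^esub> & (ALL i<m. N i k \<otimes>\<^bsub>K\<^esub> inv\<^bsub>K\<^esub> D k = y i)}) -->
   (EX k1 : {..<m} \<rightarrow>\<^sub>E carrier K. D k1 ~= \<zero>\<^bsub>K\<^esub> &
   (ALL S. (ALL i<m. openin \<rho> (S i) & k1 i : S i) -->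
   (EX T. (ALL i<m. openin \<rho> (T i) & N i k1 \<otimes>\<^bsub>K\<^esub> inv\<^bsub>K\<^esub> D k1 : T i) &
   (ALL y. (ALL i<m. y i : T i) --> (EX k : {..<m} \<rightarrow>\<^sub>E carrier K. (ALL i<m. k i : S i) & D k ~= \<zero>\<^bsub>K\<^esub> &
   (ALL i<m. N i k \<otimes>\<^bsub>K\<^esub> inv\<^bsub>K\<^esub> D k = y i)))))))"

text \<open>All that is passed on about \<open>K\<close> and its topology. It mentions no structure
  and no definability, so it makes sense for arbitrary record fields and can be used to select a
  counterexample.\<close>

definition open_field_top :: "'b ring => 'b topology => bool" where
 "open_field_top K \<rho> \<longleftrightarrow> Ring.field K & field_topology K \<rho> &
   (ALL x:carrier K. ALL y:carrier K. x ~= y --> (EX S. openin \<rho> S & x : S & y \<notin> S)) &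
   (ALL S x. openin \<rho> S & x : S --> (EX y:S. y ~= x)) & generically_open K \<rho>"

locale field_transfer = rec_iso K \<phi> for K :: "'b ring" (structure) and \<phi> :: "'k::field_gcd => 'b" +
 fixes \<rho> :: "'b topology"
 assumes oft: "open_field_top K \<rho>"
begin

lemma fieldK: "Ring.field K" using oft by (simp add: open_field_top_def)

sublocale Ring.field K by (rule fieldK)

lemma top: "topspace \<rho> = carrier K"
 and c_add: "continuous_map (prod_topology \<rho> \<rho>) \<rho> (%(x, y). x \<oplus> y)"
 and c_mult: "continuous_map (prod_topology \<rho> \<rho>) \<rho> (%(x, y). x \<otimes> y)"
 and c_inv: "continuous_map (subtopology \<rho> (carrier K - {\<zero>})) \<rho> (%x. inv x)"
 using oft by (simp_all add: open_field_top_def field_topology_def)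

lemma f_zero_iff: "\<phi> x = \<zero> \<longleftrightarrow> x = 0" using s_eq[of x 0] by (simp add: s_zero del: s_eq)

lemma f_inverse: "x ~= 0 ==> \<phi> (inverse x) = inv \<phi> x"
proof -
 assume "x ~= 0"
 hence "\<phi> x \<otimes> \<phi> (inverse x) = \<one>" using s_mult[of x "inverse x"] s_one by simp
 thus ?thesis
  by (rule comm_monoid.comm_inv_char[OF cring.axioms(2)[OF domain.axioms(1)[OF field.axioms(1)[OF fieldK]]] s_in s_in, symmetric])
qed

lemma f_divide: "y ~= 0 ==> \<phi> (x / y) = \<phi> x \<otimes> inv \<phi> y" by (simp add: divide_inverse s_mult f_inverse)

definition nb :: "'k => 'k filter" where
 "nb a = (INF S\<in>{S. openin \<rho> S & \<phi> a : S}. principal (\<phi> -` S))"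

lemma eventually_nb: "eventually E (nb a) \<longleftrightarrow> (EX S. openin \<rho> S & \<phi> a : S & (ALL x. \<phi> x : S --> E x))"
proof -
 have "openin \<rho> (topspace \<rho>)" by (rule openin_topspace)
 moreover have "\<phi> a : topspace \<rho>" using top by simp
 ultimately have ne: "{S. openin \<rho> S & \<phi> a : S} ~= {}" by blast
 have "eventually E (nb a) \<longleftrightarrow> (EX S:{S. openin \<rho> S & \<phi> a : S}. eventually E (principal (\<phi> -` S)))"
  unfolding nb_def
 proof (rule eventually_INF_base[OF ne])
  fix S T assume "S : {S. openin \<rho> S & \<phi> a : S}" "T : {S. openin \<rho> S & \<phi> a : S}"
  hence "S \<inter> T : {S. openin \<rho> S & \<phi> a : S}" by auto
  moreover have "principal (\<phi> -` (S \<inter> T)) \<le> inf (principal (\<phi> -` S)) (principal (\<phi> -` T))" by simp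
  ultimately show "EX x:{S. openin \<rho> S & \<phi> a : S}. principal (\<phi> -` x) \<le> inf (principal (\<phi> -` S)) (principal (\<phi> -` T))"
   by (rule bexI[rotated])
 qed
 thus ?thesis unfolding eventually_principal by blast
qed

lemma eventually_open: "openin \<rho> S ==> \<phi> a : S ==> eventually (%x. \<phi> x : S) (nb a)"
 unfolding eventually_nb by blast

lemma nb_binary:
 assumes c: "continuous_map (prod_topology \<rho> \<rho>) \<rho> (%(x, y). f x y)" and g: "!!x y. \<phi> (g x y) = f (\<phi> x) (\<phi> y)"
 shows "filterlim (%p. g (fst p) (snd p)) (nb (g a b)) (nb a \<times>\<^sub>F nb b)"
 unfolding filterlim_iff
proof (intro allI impI)
 fix E assume "eventually E (nb (g a b))"
 then obtain S where S: "openin \<rho> S" "f (\<phi> a) (\<phi> b) : S" "!!x. \<phi> x : S ==> E x" unfolding eventually_nb g by blast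
 define Z where "Z = {p : topspace (prod_topology \<rho> \<rho>). (%(x, y). f x y) p : S}"
 have Z: "openin (prod_topology \<rho> \<rho>) Z" unfolding Z_def by (rule openin_continuous_map_preimage[OF c S(1)])
 have "(\<phi> a, \<phi> b) : Z" unfolding Z_def using S(2) top by simp
 from Z[unfolded openin_prod_topology_alt, rule_format, OF this]
 obtain U V where U: "openin \<rho> U" "openin \<rho> V" "\<phi> a : U" "\<phi> b : V" "U \<times> V <= Z" by (elim exE conjE)
 show "eventually (%p. E (g (fst p) (snd p))) (nb a \<times>\<^sub>F nb b)" unfolding eventually_prod_filter
 proof (intro exI conjI allI impI)
  show "eventually (%x. \<phi> x : U) (nb a)" "eventually (%x. \<phi> x : V) (nb b)" by (intro eventually_open U)+
  fix x y assume "\<phi> x : U" "\<phi> y : V"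
  hence "(\<phi> x, \<phi> y) : U \<times> V" by blast
  hence "(\<phi> x, \<phi> y) : Z" using U(5) by (rule rev_subsetD)
  hence "f (\<phi> x) (\<phi> y) : S" unfolding Z_def by simp
  thus "E (g (fst (x, y)) (snd (x, y)))" using S(3) g by simp
 qed
qed

lemma PFK_lift:
 assumes "PF (coords m) f"
 shows "EX f'. PFK K m f' & (ALL k x. (ALL i<m. k i = \<phi> (x i)) --> f' k = \<phi> (f x))"
 using assms
proof induction
 case (base f)
 then obtain i where "i < m" "f = (%k. k i)" by (auto simp: coords_def)
 thus ?case by (intro exI[of _ "%k. k i"]) (auto intro: PFK.coord)
next
 case (const c)
 thus ?case by (intro exI[of _ "%_. \<phi> c"]) (auto intro: PFK.const)
next
 case (add f g)
 then obtain f' g' where f': "PFK K m f'" "ALL k x. (ALL i<m. k i = \<phi> (x i)) --> f' k = \<phi> (f x)"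
  and g': "PFK K m g'" "ALL k x. (ALL i<m. k i = \<phi> (x i)) --> g' k = \<phi> (g x)" by (elim exE conjE)
 have "ALL k x. (ALL i<m. k i = \<phi> (x i)) --> f' k \<oplus> g' k = \<phi> (f x + g x)"
  using f'(2) g'(2) by (simp only: s_add) metis
 with PFK.add[OF f'(1) g'(1)] show ?case by (intro exI[of _ "%x. f' x \<oplus> g' x"] conjI)
next
 case (mult f g)
 then obtain f' g' where f': "PFK K m f'" "ALL k x. (ALL i<m. k i = \<phi> (x i)) --> f' k = \<phi> (f x)"
  and g': "PFK K m g'" "ALL k x. (ALL i<m. k i = \<phi> (x i)) --> g' k = \<phi> (g x)" by (elim exE conjE)
 have "ALL k x. (ALL i<m. k i = \<phi> (x i)) --> f' k \<otimes> g' k = \<phi> (f x * g x)"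
  using f'(2) g'(2) by (simp only: s_mult) metis
 with PFK.mult[OF f'(1) g'(1)] show ?case by (intro exI[of _ "%x. f' x \<otimes> g' x"] conjI)
qed

lemma eventually_nbmI: "(ALL i<m. openin \<rho> (S i) & \<phi> (k i) : S i) ==> (!!x. ALL i<m. \<phi> (x i) : S i ==> E x) ==> eventually E (nbm nb m k)"
 unfolding nbm_def
 by (subst eventually_INF_finite) (auto simp: eventually_filtercomap intro!: exI[of _ "%i x. \<phi> (x i) : S i"] exI[of _ "%x. \<phi> x : S _"] eventually_open)

lemma eventually_nbmD:
 assumes "eventually E (nbm nb m k)"
 shows "EX S. (ALL i<m. openin \<rho> (S i) & \<phi> (k i) : S i) & (ALL x. (ALL i<m. \<phi> (x i) : S i) --> E x)"
proof -
 have "EX Q. (ALL i:{..<m}. eventually (Q i) (filtercomap (%x. x i) (nb (k i)))) & (ALL y. (ALL i:{..<m}. Q i y) --> E y)"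
  using assms unfolding nbm_def by (subst (asm) eventually_INF_finite) simp_all
 then obtain Q where Q: "ALL i:{..<m}. eventually (Q i) (filtercomap (%x. x i) (nb (k i)))" "ALL y. (ALL i:{..<m}. Q i y) --> E y" by blast
 have "EX S. i < m --> openin \<rho> S & \<phi> (k i) : S & (ALL x. \<phi> (x i) : S --> Q i x)" for i
  using Q(1) unfolding eventually_filtercomap eventually_nb by (metis lessThan_iff)
 hence "ALL i. EX S. i < m --> openin \<rho> S & \<phi> (k i) : S & (ALL x. \<phi> (x i) : S --> Q i x)" by blast
 from choice[OF this] obtain S where S: "ALL i. i < m --> openin \<rho> (S i) & \<phi> (k i) : S i & (ALL x. \<phi> (x i) : S i --> Q i x)" by blast
 thus ?thesis using Q(2) by (intro exI[of _ S]) auto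
qed

lemma f_tuple: "k : {..<m::nat} \<rightarrow>\<^sub>E carrier K ==> EX x. (ALL i<m. k i = \<phi> (x i)) & (\<forall>i\<ge>m. x i = 0)"
proof -
 assume k: "k : {..<m::nat} \<rightarrow>\<^sub>E carrier K"
 have "EX x. i < m --> k i = \<phi> x" for i using s_surj[OF PiE_mem[OF k, of i]] by auto
 hence "ALL i. EX x. i < m --> k i = \<phi> x" by blast
 from choice[OF this] obtain x where "ALL i. i < m --> k i = \<phi> (x i)" by blast
 thus ?thesis by (intro exI[of _ "%i. if i < m then x i else 0"]) auto
qed

sublocale open_field nb
proof
 show "filterlim (%p. fst p + snd p) (nb (a + b)) (nb a \<times>\<^sub>F nb b)" for a b by (rule nb_binary[OF c_add s_add])
 show "filterlim (%p. fst p * snd p) (nb (a * b)) (nb a \<times>\<^sub>F nb b)" for a b by (rule nb_binary[OF c_mult s_mult])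
 show "eventually E (nb a) ==> E a" for E a unfolding eventually_nb by blast
 show sep: "eventually (%x. x ~= b) (nb a)" if "a ~= b" for a b
 proof -
  have "\<phi> a ~= \<phi> b" using that by simp
  then obtain S where "openin \<rho> S" "\<phi> a : S" "\<phi> b \<notin> S" using oft unfolding open_field_top_def by (meson s_in)
  thus ?thesis unfolding eventually_nb by blast
 qed
 show "filterlim inverse (nb (inverse a)) (nb a)" if a: "a ~= 0" for a
  unfolding filterlim_iff
 proof (intro allI impI)
  fix E assume "eventually E (nb (inverse a))"
  then obtain S where S: "openin \<rho> S" "inv \<phi> a : S" "!!x. \<phi> x : S ==> E x" unfolding eventually_nb f_inverse[OF a] by blast
  have ts: "topspace (subtopology \<rho> (carrier K - {\<zero>})) = carrier K - {\<zero>}" using top by auto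
  have "openin (subtopology \<rho> (carrier K - {\<zero>})) {x : carrier K - {\<zero>}. inv x : S}"
   using openin_continuous_map_preimage[OF c_inv S(1)] unfolding ts .
  then obtain T where T: "openin \<rho> T" "{x : carrier K - {\<zero>}. inv x : S} = T \<inter> (carrier K - {\<zero>})" unfolding openin_subtopology by blast
  have nz: "\<phi> x : carrier K - {\<zero>}" if "x ~= 0" for x using that by (simp add: f_zero_iff)
  have "\<phi> a : T" using nz[OF a] S(2) T(2) by blast
  from eventually_open[OF T(1) this] sep[OF a] show "eventually (%x. E (inverse x)) (nb a)"
  proof eventually_elim
   case (elim x)
   hence "inv \<phi> x : S" using nz[of x] T(2) by blast
   thus ?case using S(3)[of "inverse x"] f_inverse[of x] elim(2) by simp
  qed
 qed
 show "EX x. x ~= a & E x" if "eventually E (nb a)" for E a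
 proof -
  obtain S where S: "openin \<rho> S" "\<phi> a : S" "!!x. \<phi> x : S ==> E x" using `eventually E (nb a)` unfolding eventually_nb by blast
  obtain y where y: "y : S" "y ~= \<phi> a" using oft S(1,2) unfolding open_field_top_def by blast
  have "y : carrier K" using openin_subset[OF S(1)] top y(1) by blast
  then obtain x where "y = \<phi> x" using s_surj by blast
  thus ?thesis using y S(3) by auto
 qed
 fix m :: nat and N :: "nat => (nat => 'k) => 'k" and D k0
 assume N: "!!i. i < m ==> PF (coords m) (N i)" and D: "PF (coords m) D" and k0: "D k0 ~= 0"
  and fin: "!!y. finite {k. (\<forall>i\<ge>m. k i = 0) & D k ~= 0 & (ALL i<m. N i k / D k = y i)}"
 have "EX N'. i < m --> PFK K m N' & (ALL k x. (ALL i<m. k i = \<phi> (x i)) --> N' k = \<phi> (N i x))" for i using PFK_lift[OF N] by blast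
 hence "ALL i. EX N'. i < m --> PFK K m N' & (ALL k x. (ALL i<m. k i = \<phi> (x i)) --> N' k = \<phi> (N i x))" by blast
 from choice[OF this] obtain N' where N': "!!i. i < m ==> PFK K m (N' i)" "!!i k x. i < m ==> ALL i<m. k i = \<phi> (x i) ==> N' i k = \<phi> (N i x)" by blast
 obtain D' where D': "PFK K m D'" "!!k x. ALL i<m. k i = \<phi> (x i) ==> D' k = \<phi> (D x)" using PFK_lift[OF D] by blast
 have DN: "D' k = \<zero> \<longleftrightarrow> D x = 0" "D x ~= 0 ==> i < m ==> N' i k \<otimes> inv D' k = \<phi> (N i x / D x)" if "ALL i<m. k i = \<phi> (x i)" for k x i
  using D'(2)[OF that] N'(2)[OF _ that] by (simp_all add: f_zero_iff f_divide)
 have go: "generically_open K \<rho>" using oft by (simp add: open_field_top_def)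
 let ?r = "%x. \<lambda>i\<in>{..<m}. \<phi> (x i)"
 have rr: "ALL i<m. ?r x i = \<phi> (x i)" "?r x : {..<m} \<rightarrow>\<^sub>E carrier K" for x by auto
 have "finite {k : {..<m} \<rightarrow>\<^sub>E carrier K. D' k ~= \<zero> & (ALL i<m. N' i k \<otimes> inv D' k = y i)}" (is "finite ?Y") for y
 proof -
  let ?X = "{k. (\<forall>i\<ge>m. k i = 0) & D k ~= 0 & (ALL i<m. N i k / D k = inv_into UNIV \<phi> (y i))}"
  have "?Y <= ?r ` ?X"
  proof
   fix k assume k: "k : ?Y"
   hence kE: "k : {..<m} \<rightarrow>\<^sub>E carrier K" and kD: "D' k ~= \<zero>" and kN: "ALL i<m. N' i k \<otimes> inv D' k = y i" by simp_all
   obtain x where x: "ALL i<m. k i = \<phi> (x i)" "\<forall>i\<ge>m. x i = 0" using f_tuple[OF kE] by (elim exE conjE)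
   have Dx: "D x ~= 0" using DN(1)[OF x(1)] kD by simp
   have "N i x / D x = inv_into UNIV \<phi> (y i)" if "i < m" for i
   proof -
   have "y i = \<phi> (N i x / D x)" using DN(2)[OF x(1) Dx that] kN that by simp
   thus ?thesis using inv_into_f_f[of \<phi> UNIV] bij by (simp add: bij_betw_def)
   qed
   moreover have "k = ?r x" using kE x(1) by (intro ext) (simp add: PiE_iff extensional_def restrict_def)
   ultimately show "k : ?r ` ?X" using x(2) Dx by blast
  qed
  thus ?thesis by (rule finite_subset) (intro finite_imageI fin)
 qed
 moreover have "D' (?r k0) ~= \<zero>" using DN(1)[OF rr(1)] k0 by blast
 ultimately have "EX k1 : {..<m} \<rightarrow>\<^sub>E carrier K. D' k1 ~= \<zero> &
   (ALL S. (ALL i<m. openin \<rho> (S i) & k1 i : S i) -->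
   (EX T. (ALL i<m. openin \<rho> (T i) & N' i k1 \<otimes> inv D' k1 : T i) &
   (ALL y. (ALL i<m. y i : T i) --> (EX k : {..<m} \<rightarrow>\<^sub>E carrier K. (ALL i<m. k i : S i) & D' k ~= \<zero> &
   (ALL i<m. N' i k \<otimes> inv D' k = y i)))))"
  by (intro go[unfolded generically_open_def, rule_format, of m N' D' "?r k0"] conjI allI impI N'(1) D'(1) rr(2)) assumption+
 then obtain k1 where k1: "k1 : {..<m} \<rightarrow>\<^sub>E carrier K" "D' k1 ~= \<zero>"
  "!!S. ALL i<m. openin \<rho> (S i) & k1 i : S i ==>
   (EX T. (ALL i<m. openin \<rho> (T i) & N' i k1 \<otimes> inv D' k1 : T i) &
   (ALL y. (ALL i<m. y i : T i) --> (EX k : {..<m} \<rightarrow>\<^sub>E carrier K. (ALL i<m. k i : S i) & D' k ~= \<zero> &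
   (ALL i<m. N' i k \<otimes> inv D' k = y i))))" by (elim bexE conjE) (rule that, assumption, assumption, erule allE, erule mp, assumption)
 obtain x1 where x1: "ALL i<m. k1 i = \<phi> (x1 i)" using f_tuple[OF k1(1)] by blast
 have Dx1: "D x1 ~= 0" using DN(1)[OF x1] k1(2) by blast
 show "EX k1. D k1 ~= 0 & (ALL E. eventually E (nbm nb m k1) -->
   eventually (%y. EX k. E k & D k ~= 0 & (ALL i<m. N i k / D k = y i)) (nbm nb m (%i. N i k1 / D k1)))"
 proof (intro exI[of _ x1] conjI allI impI Dx1)
  fix E assume "eventually E (nbm nb m x1)"
  from eventually_nbmD[OF this] obtain S where S: "ALL i<m. openin \<rho> (S i) & \<phi> (x1 i) : S i" "ALL x. (ALL i<m. \<phi> (x i) : S i) --> E x" by blast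
  have "ALL i<m. openin \<rho> (S i) & k1 i : S i" using S(1) x1 by simp
  from k1(3)[OF this] obtain T where T: "ALL i<m. openin \<rho> (T i) & N' i k1 \<otimes> inv D' k1 : T i"
   "ALL y. (ALL i<m. y i : T i) --> (EX k : {..<m} \<rightarrow>\<^sub>E carrier K. (ALL i<m. k i : S i) & D' k ~= \<zero> &
   (ALL i<m. N' i k \<otimes> inv D' k = y i))" by blast
  show "eventually (%y. EX k. E k & D k ~= 0 & (ALL i<m. N i k / D k = y i)) (nbm nb m (%i. N i x1 / D x1))"
  proof (rule eventually_nbmI)
   show "ALL i<m. openin \<rho> (T i) & \<phi> (N i x1 / D x1) : T i" using T(1) DN(2)[OF x1 Dx1] by simp
   fix y assume "ALL i<m. \<phi> (y i) : T i"
   then obtain k where k: "k : {..<m} \<rightarrow>\<^sub>E carrier K" "ALL i<m. k i : S i" "D' k ~= \<zero>" "ALL i<m. N' i k \<otimes> inv D' k = \<phi> (y i)"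
   using T(2)[rule_format, of "%i. \<phi> (y i)"] by blast
   obtain x where x: "ALL i<m. k i = \<phi> (x i)" using f_tuple[OF k(1)] by blast
   have Dx: "D x ~= 0" using DN(1)[OF x] k(3) by blast
   moreover have "E x" using S(2) k(2) x by simp
   moreover have "ALL i<m. N i x / D x = y i" using DN(2)[OF x Dx] k(4) by simp
   ultimately show "EX k. E k & D k ~= 0 & (ALL i<m. N i k / D k = y i)" by blast
  qed
 qed
qed

lemma poly_at_sP: "poly_at K (sP g) (\<phi> x) = \<phi> (poly g x)"
proof -
 have "rec_iso K \<phi>" by unfold_locales
 from eval_sP[OF this, of id "%x. x" x g] show ?thesis unfolding poly_at_def by (simp add: map_poly_idI)
qed

lemma coprime_of_separable: assumes "separable_poly K (sP g)" "g ~= 0" shows "coprime g (pderiv g)"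
proof -
 interpret P: rec_iso "UP K" sP by (rule rec_iso_UP)
 let ?d = "gcd g (pderiv g)"
 have "sP ?d divides\<^bsub>UP K\<^esub> sP f" if d: "?d dvd f" for f
 proof -
  obtain h where "f = ?d * h" using d by (rule dvdE)
  thus ?thesis unfolding factor_def using P.s_mult[of ?d h] by (intro bexI[of _ "sP h"]) auto
 qed
 hence "sP ?d : Units (UP K)" using assms(1) unfolding separable_poly_def poly_deriv_sP by simp
 then obtain r where r: "r : carrier (UP K)" "sP ?d \<otimes>\<^bsub>UP K\<^esub> r = \<one>\<^bsub>UP K\<^esub>" unfolding Units_def by blast
 obtain h where "r = sP h" using sP_surj[OF r(1)] by blast
 hence "sP (?d * h) = sP 1" using r(2) by (simp add: P.s_mult P.s_one)
 hence "?d * h = 1" by simp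
 hence "is_unit ?d" by (metis dvd_triv_left)
 thus ?thesis by (simp only: is_unit_gcd)
qed

lemma monic_sP: assumes "sP g : monic_polys K d" shows "Polynomial.degree g = d" "poly.coeff g d = 1"
proof -
 have g: "deg K (sP g) = d" "\<phi> (poly.coeff g d) = \<one>" using assms by (simp_all add: monic_polys_def)
 show "poly.coeff g d = 1" using g(2) s_one s_eq by metis
 hence "d \<le> Polynomial.degree g" by (intro le_degree) simp
 thus "Polynomial.degree g = d" using degree_le_deg[of g] g(1) by simp
qed

lemma st_henselian_transfer: "st_henselian K \<rho>"
 unfolding st_henselian_def
proof (intro conjI allI ballI impI)
 show "field_topology K \<rho>" using oft by (simp add: open_field_top_def)
 fix d Q a U
 assume Q: "Q : monic_polys K d" and a: "a : carrier K" and sr: "separable_poly K Q & poly_at K Q a = \<zero>" and U: "neighborhood \<rho> a U"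
 have "Q : carrier (UP K)" using Q by (simp add: monic_polys_def)
 then obtain g where g: "Q = sP g" using sP_surj by blast
 obtain x where x: "a = \<phi> x" using s_surj[OF a] by blast
 note mg = monic_sP[OF Q[unfolded g]]
 have "g ~= 0" using mg(2) by auto
 hence cop: "coprime g (pderiv g)" using coprime_of_separable sr g by blast
 have root: "poly g x = 0" using sr unfolding g x poly_at_sP f_zero_iff by blast
 obtain W where W: "openin \<rho> W" "a : W" "W <= U" using U unfolding neighborhood_def by blast
 have "eventually (%z. \<phi> z : W) (nb x)" by (rule eventually_open) (use W x in auto)
 from eventually_nbmD[OF separable_root_persists[OF mg cop root this]]
 obtain S where S: "ALL i<d. openin \<rho> (S i) & \<phi> (poly.coeff g i) : S i"
  "ALL p. (ALL i<d. \<phi> (p i) : S i) --> (EX b. \<phi> b : W & poly (mpoly d p) b = 0)" by blast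
 let ?V = "{P : monic_polys K d. ALL i<d. up_ring.coeff (UP K) P i : S i}"
 have "openin (monic_topology K \<rho> d) ?V" unfolding monic_topology_def openin_pullback_topology
 proof (intro exI conjI)
  show "openin (power_top \<rho> d) (Pi\<^sub>E {..<d} S)" unfolding power_top_def using S(1) by (simp add: openin_PiE)
  show "?V = (%p. \<lambda>i\<in>{..<d}. up_ring.coeff (UP K) p i) -` (Pi\<^sub>E {..<d} S) \<inter> monic_polys K d"
   by (intro Set.set_eqI) (simp only: mem_Collect_eq Int_iff vimage_eq restrict_PiE_iff Ball_def lessThan_iff conj_commute)
 qed
 moreover have "Q : ?V" using Q S(1) unfolding g by simp
 ultimately have nV: "neighborhood (monic_topology K \<rho> d) Q ?V" unfolding neighborhood_def using openin_subset by blast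
 moreover have "EX b:U. poly_at K P b = \<zero>" if P: "P : ?V" for P
 proof -
  have "P : carrier (UP K)" using P by (simp add: monic_polys_def)
  then obtain h where h: "P = sP h" using sP_surj by blast
  have mh: "sP h : monic_polys K d" and "ALL i<d. \<phi> (poly.coeff h i) : S i" using P h by simp_all
  then obtain b where b: "\<phi> b : W" "poly (mpoly d (poly.coeff h)) b = 0" using S(2) by blast
  have "poly h b = 0" using b(2) mpoly_coeff[OF monic_sP[OF mh]] by simp
  hence "poly_at K P (\<phi> b) = \<zero>" unfolding h poly_at_sP by (simp add: f_zero_iff)
  thus ?thesis using b(1) W(3) by blast
 qed
 ultimately show "EX V. neighborhood (monic_topology K \<rho> d) Q V & (ALL P:V. EX b:U. poly_at K P b = \<zero>)" by blast
qed

lemma large_transfer: "large_field K"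
 unfolding large_field_def
proof (intro ballI impI)
 fix P a b assume P: "P : carrier (UP (UP K))" and a: "a : carrier K" and b: "b : carrier K"
  and h: "poly2_at K P a b = \<zero> & poly2_at K (poly_deriv (UP K) P) a b ~= \<zero>"
 interpret P: rec_iso "UP K" sP by (rule rec_iso_UP)
 have iso: "rec_iso K \<phi>" by unfold_locales
 have ev: "poly2_at K (P.sP G) (\<phi> x) (\<phi> y) = \<phi> (p2 G x y)" for G x y
  unfolding poly2_at_def p2_def hv_def by (rule P.eval_sP[OF iso]) (simp_all add: poly_at_sP)
 obtain G where G: "P = P.sP G" using P.sP_surj[OF P] by blast
 obtain x where x: "a = \<phi> x" using s_surj[OF a] by blast
 obtain y where y: "b = \<phi> y" using s_surj[OF b] by blast
 have "p2 G x y = 0" "p2 (pderiv G) x y ~= 0" using h unfolding G x y P.poly_deriv_sP ev f_zero_iff by auto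
 from infinitely_many_zeros[OF this] have inf: "infinite {(x, y). p2 G x y = 0}" .
 let ?f = "%(x, y). (\<phi> x, \<phi> y)"
 have "infinite (?f ` {(x, y). p2 G x y = 0})" using inf by (subst finite_image_iff) (auto simp: inj_on_def)
 moreover have "?f ` {(x, y). p2 G x y = 0} <= {(x, y). x : carrier K & y : carrier K & poly2_at K P x y = \<zero>}"
  unfolding G by (auto simp: ev s_zero)
 ultimately show "infinite {(x, y). x : carrier K & y : carrier K & poly2_at K P x y = \<zero>}" by (rule infinite_super[rotated])
qed

end

text \<open>There is no class of fields whose carrier is a given set, so the result for type-class fields
 is applied to a type whose elements are those of a counterexample, if there is one.\<close>

definition counterexample :: "'b ring \<times> 'b topology => bool" where
 "counterexample c \<longleftrightarrow> open_field_top (fst c) (snd c) & \<not> (st_henselian (fst c) (snd c) & large_field (fst c))"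

text \<open>A type definition needs a field unconditionally. The sum type leaves room for the
  two-element field, which is used if there is no counterexample.\<close>

definition test_field :: "('b + bit) ring" where
 "test_field = (if EX c::'b ring \<times> 'b topology. counterexample c then image_ring Inl (fst (SOME c::'b ring \<times> 'b topology. counterexample c))
   else image_ring Inr ring_of_type_algebra)"

lemma field_test_field: "Ring.field (test_field :: ('b + bit) ring)"
proof (cases "EX c::'b ring \<times> 'b topology. counterexample c")
 case True
 let ?c = "SOME c::'b ring \<times> 'b topology. counterexample c"
 have "counterexample ?c" using True by (rule someI_ex)
 hence "Ring.field (fst ?c)" unfolding counterexample_def open_field_top_def by blast
 thus ?thesis unfolding test_field_def using True by (auto intro: field.inj_imp_image_ring_is_field)
next
 case False
 thus ?thesis unfolding test_field_def
  using field.inj_imp_image_ring_is_field[OF field_from_type_algebra, where f = "Inr :: bit => 'b + bit"] by auto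
qed

typedef 'b test = "carrier (test_field :: ('b + bit) ring)"
 using ring.ring_simprules(2)[OF cring.axioms(1)[OF domain.axioms(1)[OF field.axioms(1)[OF field_test_field]]]] by blast

instantiation test :: (type) Fields.field
begin

definition "0 = Abs_test \<zero>\<^bsub>test_field\<^esub>"
definition "1 = Abs_test \<one>\<^bsub>test_field\<^esub>"
definition "x + y = Abs_test (Rep_test x \<oplus>\<^bsub>test_field\<^esub> Rep_test y)"
definition "x * y = Abs_test (Rep_test x \<otimes>\<^bsub>test_field\<^esub> Rep_test y)"
definition "- x = Abs_test (\<ominus>\<^bsub>test_field\<^esub> Rep_test x)"
definition "x - y = x + - (y :: 'a test)"
definition "inverse x = (if x = 0 then 0 else Abs_test (inv\<^bsub>test_field\<^esub> Rep_test x))"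
definition "x div y = x * inverse (y :: 'a test)"

instance
proof
 interpret F: Ring.field "test_field :: ('a + bit) ring" by (rule field_test_field)
 note R [simp] = Rep_test
 have rep: "Rep_test (0 :: 'a test) = \<zero>\<^bsub>test_field\<^esub>" "Rep_test (1 :: 'a test) = \<one>\<^bsub>test_field\<^esub>"
  "Rep_test (x + y) = Rep_test x \<oplus>\<^bsub>test_field\<^esub> Rep_test y" "Rep_test (x * y) = Rep_test x \<otimes>\<^bsub>test_field\<^esub> Rep_test y"
  "Rep_test (- x) = \<ominus>\<^bsub>test_field\<^esub> Rep_test x" for x y :: "'a test"
  by (simp_all add: zero_test_def one_test_def plus_test_def times_test_def uminus_test_def Abs_test_inverse)
 have eq: "x = y \<longleftrightarrow> Rep_test x = Rep_test y" for x y :: "'a test" by (simp add: Rep_test_inject)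
 fix a b c :: "'a test"
 show "a + b + c = a + (b + c)" "a + b = b + a" "0 + a = a" "- a + a = 0" "a * b * c = a * (b * c)" "a * b = b * a" "1 * a = a"
  "(a + b) * c = a * c + b * c" "(0 :: 'a test) ~= 1"
  unfolding eq rep using F.a_assoc[of "Rep_test a" "Rep_test b" "Rep_test c"] F.a_comm[of "Rep_test a" "Rep_test b"]
   F.m_assoc[of "Rep_test a" "Rep_test b" "Rep_test c"] F.m_comm[of "Rep_test a" "Rep_test b"] F.l_neg[of "Rep_test a"]
   F.l_distr[of "Rep_test a" "Rep_test b" "Rep_test c"] by (simp_all del: F.r_neg)
 show "a - b = a + - b" by (rule minus_test_def)
 show "a div b = a * inverse b" by (rule divide_test_def)
 show "inverse (0 :: 'a test) = 0" by (simp add: inverse_test_def)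
 assume a: "a ~= 0"
 hence "Rep_test a : Units test_field" unfolding eq rep F.field_Units by simp
 thus "inverse a * a = 1" unfolding eq rep using a by (simp add: inverse_test_def Abs_test_inverse)
qed

end

text \<open>The trivial Euclidean structure of a field, demanded by the class
  \<open>field_gcd\<close> over which the algebra was done.\<close>

instantiation test :: (type) "{unique_euclidean_ring, normalization_euclidean_semiring, normalization_semidom_multiplicative}"
begin

definition [simp]: "normalize_test = (normalize_field :: 'a test => _)"
definition [simp]: "unit_factor_test = (unit_factor_field :: 'a test => _)"
definition [simp]: "modulo_test = (mod_field :: 'a test => _)"
definition [simp]: "euclidean_size_test = (euclidean_size_field :: 'a test => _)"
definition [simp]: "division_segment (x :: 'a test) = 1"

instance
 by standard (simp_all add: dvd_field_iff field_split_simps split: if_splits)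

end

instantiation test :: (type) euclidean_ring_gcd
begin

definition gcd_test :: "'a test => 'a test => 'a test" where "gcd_test = Euclidean_Algorithm.gcd"
definition lcm_test :: "'a test => 'a test => 'a test" where "lcm_test = Euclidean_Algorithm.lcm"
definition Gcd_test :: "'a test set => 'a test" where "Gcd_test = Euclidean_Algorithm.Gcd"
definition Lcm_test :: "'a test set => 'a test" where "Lcm_test = Euclidean_Algorithm.Lcm"

instance by standard (simp_all add: gcd_test_def lcm_test_def Gcd_test_def Lcm_test_def)

end

instance test :: (type) field_gcd ..

text \<open>If \<open>K\<close> is a counterexample, then some counterexample was selected for
  \<open>test_field\<close>, possibly another one. The type \<open>test\<close> is then isomorphic
  to the selected field, for which the transferred results give a contradiction.\<close>

theorem open_field_top_henselian_large:
 fixes K :: "'b ring"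
 assumes "open_field_top K \<rho>" shows "st_henselian K \<rho> & large_field K"
proof (rule ccontr)
 assume n: "\<not> ?thesis"
 have ex: "EX c::'b ring \<times> 'b topology. counterexample c"
  unfolding counterexample_def using assms n by (intro exI[of _ "(K, \<rho>)"]) simp
 define c where "c = (SOME c::'b ring \<times> 'b topology. counterexample c)"
 have c: "counterexample c" unfolding c_def using ex by (rule someI_ex)
 define R where "R = fst c"
 have oft: "open_field_top R (snd c)" and nc: "\<not> (st_henselian R (snd c) & large_field R)" using c unfolding counterexample_def R_def by blast+
 interpret R: Ring.field R using oft unfolding open_field_top_def by blast
 have tf: "(test_field :: ('b + bit) ring) = image_ring Inl R" unfolding test_field_def R_def c_def using ex by simp
 interpret F: Ring.field "test_field :: ('b + bit) ring" by (rule field_test_field)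
 have car: "carrier (test_field :: ('b + bit) ring) = Inl ` carrier R" unfolding tf by (simp add: image_ring_carrier)
 have iso: "Inl : ring_iso R (test_field :: ('b + bit) ring)" unfolding tf by (rule inj_imp_image_ring_iso) (simp add: inj_on_def)
 define \<phi> where "\<phi> x = projl (Rep_test x)" for x :: "'b test"
 have rp: "Rep_test x = Inl (\<phi> x)" "\<phi> x : carrier R" for x
  using Rep_test[of x] unfolding \<phi>_def car by auto
 have inl: "Inl x = (Inl y :: 'b + bit) ==> x = y" for x y by simp
 have hom: "Inl (x \<oplus>\<^bsub>R\<^esub> y) = (Inl x \<oplus>\<^bsub>test_field\<^esub> Inl y :: 'b + bit)" "Inl (x \<otimes>\<^bsub>R\<^esub> y) = (Inl x \<otimes>\<^bsub>test_field\<^esub> Inl y :: 'b + bit)"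
  "Inl \<one>\<^bsub>R\<^esub> = (\<one>\<^bsub>test_field\<^esub> :: 'b + bit)" if "x : carrier R" "y : carrier R" for x y
  using ring_iso_memE(2-4)[OF iso] that by auto
 have "rec_iso R \<phi>"
 proof (intro rec_iso.intro rec_iso_axioms.intro)
  show "cring R" by unfold_locales
  show "bij_betw \<phi> UNIV (carrier R)" unfolding bij_betw_def
  proof
   show "inj \<phi>" by (rule injI) (metis rp(1) Rep_test_inject)
   show "range \<phi> = carrier R"
   proof (intro equalityI subsetI)
   fix y assume "y : carrier R"
   hence "(Inl y :: 'b + bit) : carrier test_field" unfolding car by blast
   hence "\<phi> (Abs_test (Inl y)) = y" unfolding \<phi>_def by (simp add: Abs_test_inverse)
   thus "y : range \<phi>" by (metis rangeI)
   qed (use rp(2) in auto)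
  qed
  show "\<phi> (x + y) = \<phi> x \<oplus>\<^bsub>R\<^esub> \<phi> y" for x y
   by (rule inl) (simp add: rp(1)[symmetric] hom rp(2) plus_test_def Abs_test_inverse Rep_test)
  show "\<phi> (x * y) = \<phi> x \<otimes>\<^bsub>R\<^esub> \<phi> y" for x y
   by (rule inl) (simp add: rp(1)[symmetric] hom rp(2) times_test_def Abs_test_inverse Rep_test)
  show "\<phi> 1 = \<one>\<^bsub>R\<^esub>"
   by (rule inl) (simp add: rp(1)[symmetric] hom(3)[OF R.zero_closed R.zero_closed] one_test_def Abs_test_inverse)
 qed
 then interpret field_transfer R \<phi> "snd c" by (intro field_transfer.intro field_transfer_axioms.intro oft)
 show False using nc st_henselian_transfer large_transfer by blast
qed

section \<open>The field \<open>K\<close> with \<open>rho\<close> satisfies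
  \<open>open_field_top\<close>\<close>

context dfield
begin

lemma PFK_closed: "PFK K m f ==> ALL i<m. k i : CK ==> f k : CK"
 by (induction rule: PFK.induct) simp_all

lemma PFK_cong: "PFK K m f ==> (!!i. i < m ==> k i = k' i) ==> f k = f k'"
 by (induction rule: PFK.induct) simp_all

definition "KT m = {w : TT (m * n). ALL i:{..<m}. slc n i w : CK}"

lemma KT_slc: "w : KT m ==> i < m ==> slc n i w : CK" unfolding KT_def by blast

lemma KT_all: "w : KT m ==> ALL i<m. slc n i w : CK" unfolding KT_def by blast

lemma dKT: "dfb (m * n) (KT m)"
 unfolding KT_def
 by (rule definableI[OF refl], (rule DT_slc dCK dint | assumption | (simp add: dCK; fail)[1])+)

abbreviation "kk w \<equiv> %i. slc n i w"

lemma PFK_kk: "PFK K m f ==> w : KT m ==> f (kk w) : CK" by (rule PFK_closed[where k = "kk w", OF _ KT_all])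

lemma dfn_PFK: "PFK K m f ==> dfn (m * n) (KT m) n (%w. f (kk w))"
proof (induction rule: PFK.induct)
 case (coord i)
 show ?case by (intro dfnI dKT DT_slc[OF DT_var0[OF dKT] coord]) (simp add: dKT)
next
 case (const c)
 show ?case by (intro dfnI dKT DT_const) (use const dKT in simp_all)
next
 case (add f g)
 show ?case
  by (intro dfnI dKT DT_add) (use add dKT PFK_kk in \<open>simp_all add: dfn_def\<close>)
next
 case (mult f g)
 show ?case
  by (intro dfnI dKT DT_mult) (use mult dKT PFK_kk in \<open>simp_all add: dfn_def\<close>)
qed

lemma rho_binary:
 assumes c: "continuous_map (prod_topology rho rho) rho (%(x, y). h x y)"
  and S: "openin rho S" "h a b : S" and ab: "a : CK" "b : CK"
 shows "EX A B. openin rho A & openin rho B & a : A & b : B & (ALL x:A. ALL y:B. h x y : S)"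
proof -
 define Z where "Z = {p : topspace (prod_topology rho rho). (%(x, y). h x y) p : S}"
 have Z: "openin (prod_topology rho rho) Z" unfolding Z_def by (rule openin_continuous_map_preimage[OF c S(1)])
 have "(a, b) : Z" unfolding Z_def using S(2) ab by simp
 from Z[unfolded openin_prod_topology_alt, rule_format, OF this]
 obtain A B where A: "openin rho A" "openin rho B" "a : A" "b : B" "A \<times> B <= Z" by (elim exE conjE)
 have "h x y : S" if "x : A" "y : B" for x y
 proof -
  have "(x, y) : Z" by (rule subsetD[OF A(5)]) (use that in simp)
  thus ?thesis unfolding Z_def by simp
 qed
 thus ?thesis using A(1-4) by blast
qed

lemma PFK_continuous:
 assumes "PFK K m f" and k: "ALL i<m. k i : CK" and "openin rho S" "f k : S"
 shows "EX U. (ALL i<m. openin rho (U i) & k i : U i) & (ALL x. (ALL i<m. x i : U i) --> f x : S)"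
 using assms(1,3,4)
proof (induction arbitrary: S rule: PFK.induct)
 case (coord j)
 have "openin rho CK" using openin_topspace[of rho] by simp
 thus ?case using coord k by (intro exI[of _ "%i. if i = j then S else CK"]) simp
next
 case (const c)
 have "openin rho CK" using openin_topspace[of rho] by simp
 thus ?case using const k by (intro exI[of _ "%i. CK"]) simp
next
 case (add f g)
 obtain A B where A: "openin rho A" "openin rho B" "f k : A" "g k : B" "ALL x:A. ALL y:B. x \<oplus> y : S"
  using rho_binary[OF continuous_add add.prems PFK_closed[OF add.hyps(1) k] PFK_closed[OF add.hyps(2) k]] by (elim exE conjE)
 obtain U where U: "ALL i<m. openin rho (U i) & k i : U i" "ALL x. (ALL i<m. x i : U i) --> f x : A"
  using add.IH(1)[OF A(1,3)] by (elim exE conjE)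
 obtain V where V: "ALL i<m. openin rho (V i) & k i : V i" "ALL x. (ALL i<m. x i : V i) --> g x : B"
  using add.IH(2)[OF A(2,4)] by (elim exE conjE)
 show ?case using U V A(5) by (intro exI[of _ "%i. U i \<inter> V i"]) (simp add: openin_Int)
next
 case (mult f g)
 obtain A B where A: "openin rho A" "openin rho B" "f k : A" "g k : B" "ALL x:A. ALL y:B. x \<otimes> y : S"
  using rho_binary[OF continuous_mult mult.prems PFK_closed[OF mult.hyps(1) k] PFK_closed[OF mult.hyps(2) k]] by (elim exE conjE)
 obtain U where U: "ALL i<m. openin rho (U i) & k i : U i" "ALL x. (ALL i<m. x i : U i) --> f x : A"
  using mult.IH(1)[OF A(1,3)] by (elim exE conjE)
 obtain V where V: "ALL i<m. openin rho (V i) & k i : V i" "ALL x. (ALL i<m. x i : V i) --> g x : B"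
  using mult.IH(2)[OF A(2,4)] by (elim exE conjE)
 show ?case using U V A(5) by (intro exI[of _ "%i. U i \<inter> V i"]) (simp add: openin_Int)
qed

lemma open_nonzero: "openin rho (CK - {\<zero>})"
proof (subst openin_subopen, intro ballI)
 fix x assume "x : CK - {\<zero>}"
 hence "x : CK" "x ~= \<zero>" by auto
 from rho_separates[OF this(1) zero_closed this(2)] obtain S where S: "openin rho S" "x : S" "\<zero> \<notin> S" by (elim exE conjE)
 have "S <= CK - {\<zero>}" using openin_subset[OF S(1)] S(3) by auto
 thus "EX T. openin rho T & x : T & T <= CK - {\<zero>}" using S(1,2) by (intro exI[of _ S] conjI)
qed

lemma dCK0: "dfb n (CK - {\<zero>})"
proof -
 have "dfb n {x : TT n. x : CK & x ~= \<zero>}"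
  by (rule definableI[OF refl], (rule dCK dint | assumption | (simp add: dCK; fail)[1])+)
 moreover have "{x : TT n. x : CK & x ~= \<zero>} = CK - {\<zero>}" using CK_sub by blast
 ultimately show ?thesis by simp
qed

text \<open>A quotient of polynomial functions with the denominator non-zero is a definable map on
  an open subset of \<open>K^m\<close>; stored in flat tuples, it is an instance of
  \<open>gen_open\<close>.\<close>

theorem generically_open_rho: "generically_open K rho"
 unfolding generically_open_def
proof (intro allI impI, elim conjE)
 fix m N D k0
 assume N: "ALL i<m. PFK K m (N i)" and D: "PFK K m D" and k0: "k0 : {..<m::nat} \<rightarrow>\<^sub>E CK" "D k0 ~= \<zero>"
  and fin: "ALL y. finite {k : {..<m} \<rightarrow>\<^sub>E CK. D k ~= \<zero> & (ALL i<m. N i k \<otimes> inv D k = y i)}"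
 define W where "W = {w : KT m. D (kk w) : CK - {\<zero>}}"
 define F where "F w = flat n m (%i. N i (kk w) \<otimes> inv D (kk w))" for w :: "nat => 'a"
 define R where "R w = restrict (kk w) {..<m}" for w :: "nat => 'a"
 have dW: "dfb (m * n) W" unfolding W_def
  by (rule dfb_vimage[OF dfn_PFK[OF D] dCK0])
 have W_KT: "w : KT m" and W_D: "D (kk w) : CK - {\<zero>}" if "w : W" for w using that unfolding W_def by simp_all
 have KT_TT: "w : TT (m * n)" if "w : KT m" for w using that unfolding KT_def by simp
 have inv_c: "inv (D (kk w)) : CK" if "w : W" for w using W_D[OF that] field_Units by auto
 have Nc: "N i (kk w) \<otimes> inv D (kk w) : CK" if "i < m" "w : W" for i w
  by (intro m_closed inv_c that PFK_kk[of m "N i"] W_KT N[rule_format])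
 have RE: "R w : {..<m} \<rightarrow>\<^sub>E CK" if "w : KT m" for w using KT_slc[OF that] unfolding R_def by auto
 have Rv: "R w i = slc n i w" if "i < m" for w i using that unfolding R_def by simp
 have DR: "D (R w) = D (kk w)" for w by (rule PFK_cong[OF D Rv])
 have NR: "N i (R w) = N i (kk w)" if "i < m" for w i by (rule PFK_cong[OF N[rule_format, OF that] Rv])
 have Fs: "slc n i (F w) = N i (R w) \<otimes> inv D (R w)" if "i < m" "w : W" for i w
  unfolding F_def DR NR[OF that(1)] by (rule slc_flatI[OF CK_in[OF Nc[OF _ that(2)]] that(1)])
 have tuple: "flat n m k : KT m" "!!i. i < m ==> slc n i (flat n m k) = k i" if k: "ALL i<m. k i : CK" for k
 proof -
  show s: "slc n i (flat n m k) = k i" if "i < m" for i by (rule slc_flatI[OF _ that]) (use k in simp)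
  show "flat n m k : KT m" unfolding KT_def using s k by (simp add: flat_in)
 qed
 have WI: "w : W" if "w : KT m" "D (kk w) : CK - {\<zero>}" for w using that unfolding W_def by simp
 have k0c: "ALL i<m. k0 i : CK" using k0(1) by (simp add: PiE_iff)
 have "D (kk (flat n m k0)) = D k0" by (rule PFK_cong[OF D tuple(2)[OF k0c]])
 hence w0: "flat n m k0 : W" using WI[OF tuple(1)[OF k0c]] k0(2) PFK_closed[OF D k0c] by simp
 have dF: "dfn (m * n) W (m * n) F" unfolding F_def
 proof (intro dfn_flat dW dfnI DT_mult)
  fix i assume i: "i < m"
  show "DT (c0 (m * n) W) n (%w. N i (kk w))"
   by (rule DT_app[OF dfn_PFK[OF N[rule_format, OF i]] DT_var0[OF dW]]) (use dW W_KT in simp_all)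
  show "DT (c0 (m * n) W) n (%w. inv D (kk w))"
  proof (rule DT_inv)
   show "DT (c0 (m * n) W) n (%w. D (kk w))"
   by (rule DT_app[OF dfn_PFK[OF D] DT_var0[OF dW]]) (use dW W_KT in simp_all)
  qed (use dW W_D in simp_all)
  show "N i (kk w) : CK" if "w : cset (c0 (m * n) W)" for w
   by (rule PFK_kk[OF N[rule_format, OF i] W_KT]) (use that in simp)
  show "inv D (kk w) : CK" if "w : cset (c0 (m * n) W)" for w using that inv_c by simp
 qed (simp add: dW)
 have open_W: "EX S. (ALL i<m. openin rho (S i) & slc n i w : S i) &
   (ALL w':TT (m * n). (ALL i<m. slc n i w' : S i) --> w' : W)" if w: "w : W" for w
 proof -
  obtain U where U: "ALL i<m. openin rho (U i) & kk w i : U i" "ALL x. (ALL i<m. x i : U i) --> D x : CK - {\<zero>}"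
   using PFK_continuous[OF D KT_all[OF W_KT[OF w]] open_nonzero W_D[OF w]] by (elim exE conjE)
  have "w' : W" if w': "w' : TT (m * n)" "ALL i<m. slc n i w' : U i" for w'
  proof (rule WI)
   have "slc n i w' : CK" if "i < m" for i
   using openin_subset[of rho "U i"] U(1) w'(2) that by (simp add: subset_iff)
   thus "w' : KT m" unfolding KT_def using w'(1) by simp
   show "D (kk w') : CK - {\<zero>}" by (rule U(2)[rule_format, of "kk w'", OF w'(2)[rule_format]])
  qed
  thus ?thesis using U(1) by (intro exI[of _ U] conjI ballI impI)
 qed
 have fib: "finite {w : W. F w = y}" for y
 proof -
  let ?Y = "{k : {..<m} \<rightarrow>\<^sub>E CK. D k ~= \<zero> & (ALL i<m. N i k \<otimes> inv D k = slc n i y)}"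
  have "w : flat n m ` ?Y" if w: "w : W" "F w = y" for w
  proof
   have "D (R w) ~= \<zero>" using W_D[OF w(1)] unfolding DR by simp
   thus "R w : ?Y" using RE[OF W_KT[OF w(1)]] Fs[OF _ w(1)] unfolding w(2) by simp
   have Rc: "ALL i<m. R w i : CK" using Rv KT_all[OF W_KT[OF w(1)]] by simp
   show "w = flat n m (R w)"
   by (rule slc_eqI[OF KT_TT[OF W_KT[OF w(1)]] KT_TT[OF tuple(1)[OF Rc]]])
   (simp_all add: tuple(2)[OF Rc] Rv)
  qed
  hence "{w : W. F w = y} <= flat n m ` ?Y" by blast
  thus ?thesis by (rule finite_subset) (intro finite_imageI fin[rule_format])
 qed
 have Fc: "slc n i (F w) : CK" if "w : W" "i < m" for w i
  unfolding Fs[OF that(2,1)] DR NR[OF that(2)] by (rule Nc[OF that(2,1)])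
 have WK: "slc n i w : CK" if "w : W" "i < m" for w i by (rule KT_slc[OF W_KT[OF that(1)] that(2)])
 have Wne: "W ~= {}" using w0 by blast
 obtain w where w: "w : W" and op: "!!S. (ALL i<m. openin rho (S i) & slc n i w : S i) ==>
   EX T. (ALL i<m. openin rho (T i) & slc n i (F w) : T i) &
   (ALL y:TT (m * n). (ALL i<m. slc n i y : T i) --> (EX w':W. (ALL i<m. slc n i w' : S i) & F w' = y))"
 proof (rule gen_open[OF dW Wne WK open_W dF Fc fib])
  fix w assume "w : W" and op: "!!S. (ALL i<m. openin rho (S i) & slc n i w : S i) ==>
   EX T. (ALL i<m. openin rho (T i) & slc n i (F w) : T i) &
   (ALL y:TT (m * n). (ALL i<m. slc n i y : T i) --> (EX w':W. (ALL i<m. slc n i w' : S i) & F w' = y))"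
  show ?thesis by (rule that[OF `w : W` op])
 qed
 show "EX k1 : {..<m} \<rightarrow>\<^sub>E CK. D k1 ~= \<zero> &
   (ALL S. (ALL i<m. openin rho (S i) & k1 i : S i) -->
   (EX T. (ALL i<m. openin rho (T i) & N i k1 \<otimes> inv D k1 : T i) &
   (ALL y. (ALL i<m. y i : T i) --> (EX k : {..<m} \<rightarrow>\<^sub>E CK. (ALL i<m. k i : S i) & D k ~= \<zero> &
   (ALL i<m. N i k \<otimes> inv D k = y i)))))"
 proof (intro bexI[of _ "R w"] conjI allI impI RE W_KT w)
  show "D (R w) ~= \<zero>" using W_D[OF w] unfolding DR by simp
  fix S assume "ALL i<m. openin rho (S i) & R w i : S i"
  hence "ALL i<m. openin rho (S i) & slc n i w : S i" by (simp add: Rv)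
  from op[OF this] obtain T where T: "ALL i<m. openin rho (T i) & slc n i (F w) : T i"
   "ALL y:TT (m * n). (ALL i<m. slc n i y : T i) --> (EX w':W. (ALL i<m. slc n i w' : S i) & F w' = y)" by (elim exE conjE)
  show "EX T. (ALL i<m. openin rho (T i) & N i (R w) \<otimes> inv D (R w) : T i) &
   (ALL y. (ALL i<m. y i : T i) --> (EX k : {..<m} \<rightarrow>\<^sub>E CK. (ALL i<m. k i : S i) & D k ~= \<zero> &
   (ALL i<m. N i k \<otimes> inv D k = y i)))"
  proof (intro exI[of _ T] conjI allI impI)
   show "openin rho (T i)" if "i < m" for i using T(1) that by blast
   show "N i (R w) \<otimes> inv D (R w) : T i" if "i < m" for i unfolding Fs[OF that w, symmetric] using T(1) that by blast
   fix y assume y: "ALL i<m. y i : T i"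
   have yc: "ALL i<m. y i : CK"
   proof (intro allI impI)
   fix i assume "i < m"
   thus "y i : CK" using openin_subset[of rho "T i"] T(1) y by (simp add: subset_iff)
   qed
   have "ALL i<m. slc n i (flat n m y) : T i" using y tuple(2)[OF yc] by simp
   then obtain w' where w': "w' : W" "ALL i<m. slc n i w' : S i" "F w' = flat n m y"
   using T(2) KT_TT[OF tuple(1)[OF yc]] by blast
   show "EX k : {..<m} \<rightarrow>\<^sub>E CK. (ALL i<m. k i : S i) & D k ~= \<zero> & (ALL i<m. N i k \<otimes> inv D k = y i)"
   proof (intro bexI[of _ "R w'"] conjI allI impI RE W_KT w'(1))
   show "D (R w') ~= \<zero>" using W_D[OF w'(1)] unfolding DR by simp
   fix i assume i: "i < m"
   show "R w' i : S i" using w'(2) i by (simp add: Rv)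
   show "N i (R w') \<otimes> inv D (R w') = y i" using Fs[OF i w'(1)] tuple(2)[OF yc i] unfolding w'(3) by simp
   qed
  qed
 qed
qed

lemma open_field_top_rho: "open_field_top K rho"
 unfolding open_field_top_def
proof (intro conjI ballI allI impI)
 show "Ring.field K" by unfold_locales
qed (use field_topology_rho rho_separates rho_nondiscrete generically_open_rho in blast)+

end

theorem theorem8p3:
  fixes L :: "('f, 'r) fo_lang"
    and T :: "('f, 'r) fo_form set"
    and \<kappa> :: "'k rel"
    and M :: "('a, 'f, 'r) fo_struct"
    and \<tau>\<^sub>M :: "'a topology"
    and n :: nat
    and K :: "(nat \<Rightarrow> 'a) ring"
  assumes "t_minimal_theory TYPE('a) L T"
    and "monster_model \<kappa> L T M"
    and "t_minimal_topology L M \<tau>\<^sub>M"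
    and "nice L M \<tau>\<^sub>M"
    and "definable_field L M n K"
    and "infinite (carrier K)"
  shows "st_henselian K (canonical_topology L M \<tau>\<^sub>M n (add_monoid K)) \<and> large_field K"
proof -
  have M: "is_struct L M" "saturated \<kappa> L M" "natLeq <o \<kappa>"
    using assms(2) by (simp_all add: monster_model_def is_model_def)
  have "Ring.field K" using assms(5) by (simp add: definable_field_def)
  then interpret dfield L M \<tau>\<^sub>M \<kappa> K n
    by (intro dfield.intro tmin.intro fo_structure.intro tmin_axioms.intro dfield_axioms.intro M assms)
  show ?thesis unfolding canonical_topology_rho by (rule open_field_top_henselian_large[OF open_field_top_rho])
qed

end
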